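(* Let $(M,[g],\mathbb{PQ})$ be a paraquaternionic contact (pqc) manifold of dimension $4n+3>7$, with horizontal distribution $H$, and fix a metric $g\in[g]$ on $H$. Then there exist a unique linear connection $\nabla$ on $M$, with torsion $T$, and a unique subbundle $V\subset TM$ supplementary to $H$ ($TM=H\oplus V$), such that: (i) $\nabla$ preserves the decomposition $H\oplus V$ and the $Sp(n,\mathbb R)Sp(1,\mathbb R)$-structure on $H$, i.e. $\nabla g=0$ and $\nabla\sigma\in\Gamma(\mathbb{PQ})$ for every section $\sigma\in\Gamma(\mathbb{PQ})$; (ii) for $X,Y\in H$ one has $T(X,Y)=-[X,Y]_{|V}$; (iii) for $\xi\in V$ the endomorphism $X\mapsto T(\xi,X)_{|H}$ of $H$ lies in $(sp(n,\mathbb R)\oplus sp(1,\mathbb R))^{\perp}\subset gl(4n)=\mathrm{End}(H)$; (iv) the connection on $V$ is induced by the natural identification $\varphi$ of $V$ with the subspace $sp(1,\mathbb R)=\mathbb{PQ}$ of the endomorphisms of $H$, i.e. $\nabla\varphi=0$.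
   Context: Put $\epsilon_1=\epsilon_2=1$, $\epsilon_3=-1$; $(i,j,k)$ denotes any cyclic permutation of $(1,2,3)$ and $s,t\in\{1,2,3\}$. Exterior derivative: $d\eta(A,B)=A\eta(B)-B\eta(A)-\eta([A,B])$. A pqc manifold $(M,[g],\mathbb{PQ})$ is a smooth $(4n+3)$-dimensional manifold $M$ with a codimension-three distribution $H$, a conformal class $[g]$ of metrics of signature $(2n,2n)$ on $H$, and a rank-three bundle $\mathbb{PQ}\subset\mathrm{End}(H)$ locally spanned by $I_1,I_2,I_3$ with $I_s^2=\epsilon_s\,\mathrm{id}_H$, $I_iI_j=-I_jI_i=-\epsilon_kI_k$ (so $I_1^2=I_2^2=\mathrm{id}$, $I_3^2=-\mathrm{id}$, $I_1I_2=I_3$), $g(I_s\cdot,I_s\cdot)=-\epsilon_s g(\cdot,\cdot)$, and such that locally $H=\bigcap_s\ker\eta_s$ for 1-forms $\eta_1,\eta_2,\eta_3$ with $d\eta_s(X,Y)=-2\epsilon_s g(I_sX,Y)$ for $X,Y\in H$. With $g\in[g]$ fixed, $(\eta_s,I_s)$ denotes such local data compatible with $g$; they are determined up to a simultaneous $SO(1,2)$ rotation. For a complement $V$ of $H$, the subscripts $|H$, $|V$ denote the projections of $TM=H\oplus V$. If $\xi_1,\xi_2,\xi_3$ is the local frame of $V$ with $\eta_s(\xi_t)=\delta_{st}$, the natural identification is $\varphi:V\to\mathbb{PQ}$, $\varphi(\xi_s)=I_s$ (independent of the choice of local data). At each point $sp(1,\mathbb R)=\mathrm{span}\{I_1,I_2,I_3\}$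 and $sp(n,\mathbb R)$ is the space of $g$-skew-symmetric endomorphisms of $H$ commuting with all $I_s$. The orthogonal complement is with respect to the inner product $\langle A,B\rangle=\sum_a g(e_a,e_a)\,g(Ae_a,Be_a)$ on $\mathrm{End}(H)$, $\{e_a\}$ a $g$-orthonormal basis of $H$. The torsion is $T(A,B)=\nabla_AB-\nabla_BA-[A,B]$. *)

theory Defs
  imports "HOL-Analysis.Analysis" "HOL-Library.Function_Algebras"
begin

text \<open>Real-valued (more generally, vector-valued) functions form a real vector space under
  pointwise operations. Tangent vectors and endomorphisms of tangent spaces below are functions,
  so this makes the library's \<^const>\<open>span\<close>, \<^const>\<open>dim\<close> etc. available for them.\<close>

instantiation "fun" :: (type, real_vector) real_vector
begin

definition scaleR_fun :: "real \<Rightarrow> ('a \<Rightarrow> 'b) \<Rightarrow> 'a \<Rightarrow> 'b" where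
  "scaleR_fun c f = (\<lambda>x. c *\<^sub>R f x)"

instance
  by standard (auto simp: scaleR_fun_def fun_eq_iff algebra_simps)

end

lemma scaleR_fun_apply [simp]: "(c *\<^sub>R f) x = c *\<^sub>R f x"
  by (simp add: scaleR_fun_def)

definition linear_on :: "'a::real_vector set \<Rightarrow> ('a \<Rightarrow> 'b::real_vector) \<Rightarrow> bool" where
  "linear_on S f \<longleftrightarrow>
     (\<forall>x\<in>S. \<forall>y\<in>S. f (x + y) = f x + f y) \<and> (\<forall>c. \<forall>x\<in>S. f (c *\<^sub>R x) = c *\<^sub>R f x)"

text \<open>The functions \<open>e 0, \<dots>, e (r - 1)\<close> form a basis of \<open>S\<close>.\<close>

definition is_basis :: "nat \<Rightarrow> 'a::real_vector set \<Rightarrow> (nat \<Rightarrow> 'a) \<Rightarrow> bool" where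
  "is_basis r S e \<longleftrightarrow> inj_on e {..<r} \<and> independent (e ` {..<r}) \<and> span (e ` {..<r}) = S"

text \<open>For \<open>S \<oplus> T\<close>: the component in \<open>S\<close>.\<close>

definition proj_along :: "'a::real_vector set \<Rightarrow> 'a set \<Rightarrow> 'a \<Rightarrow> 'a" where
  "proj_along S T v = (THE w. w \<in> S \<and> v - w \<in> T)"

text \<open>The space \<open>End(S)\<close>. Endomorphisms are extended by zero outside \<open>S\<close>, so that they are
  determined as functions by their restriction to \<open>S\<close>.\<close>

definition endos :: "'a::real_vector set \<Rightarrow> ('a \<Rightarrow> 'a) set" where
  "endos S = {B. linear_on S B \<and> B ` S \<subseteq> S \<and> (\<forall>v. v \<notin> S \<longrightarrow> B v = 0)}"


section \<open>Smooth manifolds\<close>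

fun C_k_on :: "nat \<Rightarrow> 'e::euclidean_space set \<Rightarrow> ('e \<Rightarrow> 'f::real_normed_vector) \<Rightarrow> bool" where
  "C_k_on 0 U f \<longleftrightarrow> continuous_on U f"
| "C_k_on (Suc k) U f \<longleftrightarrow>
     (\<forall>x\<in>U. f differentiable at x) \<and> (\<forall>v. C_k_on k U (\<lambda>x. frechet_derivative f (at x) v))"

definition C_inf_on :: "'e::euclidean_space set \<Rightarrow> ('e \<Rightarrow> 'f::real_normed_vector) \<Rightarrow> bool" where
  "C_inf_on U f \<longleftrightarrow> (\<forall>k. C_k_on k U f)"

text \<open>The manifold is the whole topological space \<open>'m\<close>, its dimension is \<open>DIM('e)\<close>. A chart is
  given by its domain and the coordinate map. The atlas need not be maximal.\<close>

type_synonym ('m, 'e) atlas = "('m set \<times> ('m \<Rightarrow> 'e)) set"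

definition smooth_atlas ::
  "('m::{t2_space,second_countable_topology}, 'e::euclidean_space) atlas \<Rightarrow> bool" where
  "smooth_atlas A \<longleftrightarrow>
     (\<forall>(U, x) \<in> A. open U \<and> open (x ` U) \<and> (\<exists>x'. homeomorphism U (x ` U) x x')) \<and>
     (\<Union>(U, x) \<in> A. U) = UNIV \<and>
     (\<forall>(U, x) \<in> A. \<forall>(W, y) \<in> A. C_inf_on (x ` (U \<inter> W)) (y \<circ> inv_into U x))"

definition smooth_fun ::
  "('m::topological_space, 'e::euclidean_space) atlas \<Rightarrow> 'm set \<Rightarrow> ('m \<Rightarrow> real) \<Rightarrow> bool" where
  "smooth_fun A W f \<longleftrightarrow>
     open W \<and> (\<forall>(U, x) \<in> A. C_inf_on (x ` (U \<inter> W)) (f \<circ> inv_into U x))"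

definition smooth_fun_near ::
  "('m::topological_space, 'e::euclidean_space) atlas \<Rightarrow> 'm \<Rightarrow> ('m \<Rightarrow> real) \<Rightarrow> bool" where
  "smooth_fun_near A p f \<longleftrightarrow> (\<exists>W. p \<in> W \<and> smooth_fun A W f)"

text \<open>A tangent vector at \<open>p\<close> is a derivation at \<open>p\<close> on the functions that are smooth near \<open>p\<close>,
  extended by zero to all functions. It automatically depends only on the germ of the function:
  apply the Leibniz rule to \<open>f = h \<cdot> f\<close> where \<open>f = 0\<close> near \<open>p\<close> and \<open>h\<close> is \<open>0\<close> near \<open>p\<close> and \<open>1\<close>
  elsewhere. Working with germs, all objects below can be evaluated on locally defined
  data directly, without cutting off.\<close>

type_synonym 'm tvec = "('m \<Rightarrow> real) \<Rightarrow> real"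

definition tangent_space ::
  "('m::topological_space, 'e::euclidean_space) atlas \<Rightarrow> 'm \<Rightarrow> 'm tvec set" where
  "tangent_space A p = {v.
     (\<forall>f g. smooth_fun_near A p f \<and> smooth_fun_near A p g \<longrightarrow>
        v (f + g) = v f + v g \<and> v (f * g) = v f * g p + f p * v g) \<and>
     (\<forall>c f. smooth_fun_near A p f \<longrightarrow> v (c *\<^sub>R f) = c * v f) \<and>
     (\<forall>f. \<not> smooth_fun_near A p f \<longrightarrow> v f = 0)}"

definition vector_field ::
  "('m::topological_space, 'e::euclidean_space) atlas \<Rightarrow> 'm set \<Rightarrow> ('m \<Rightarrow> 'm tvec) \<Rightarrow> bool" where
  "vector_field A U X \<longleftrightarrow> open U \<and> (\<forall>p\<in>U. X p \<in> tangent_space A p) \<and>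
     (\<forall>W f. W \<subseteq> U \<and> smooth_fun A W f \<longrightarrow> smooth_fun A W (\<lambda>p. X p f))"

definition vector_field_near ::
  "('m::topological_space, 'e::euclidean_space) atlas \<Rightarrow> 'm \<Rightarrow> ('m \<Rightarrow> 'm tvec) \<Rightarrow> bool" where
  "vector_field_near A p X \<longleftrightarrow> (\<exists>U. p \<in> U \<and> vector_field A U X)"

definition lie_bracket ::
  "('m::topological_space, 'e::euclidean_space) atlas \<Rightarrow>
   ('m \<Rightarrow> 'm tvec) \<Rightarrow> ('m \<Rightarrow> 'm tvec) \<Rightarrow> 'm \<Rightarrow> 'm tvec" where
  "lie_bracket A X Y p =
     (\<lambda>f. if smooth_fun_near A p f then X p (\<lambda>q. Y q f) - Y p (\<lambda>q. X q f) else 0)"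

definition one_form ::
  "('m::topological_space, 'e::euclidean_space) atlas \<Rightarrow>
   'm set \<Rightarrow> ('m \<Rightarrow> 'm tvec \<Rightarrow> real) \<Rightarrow> bool" where
  "one_form A U \<eta> \<longleftrightarrow> open U \<and> (\<forall>p\<in>U. linear_on (tangent_space A p) (\<eta> p)) \<and>
     (\<forall>W X. W \<subseteq> U \<and> vector_field A W X \<longrightarrow> smooth_fun A W (\<lambda>p. \<eta> p (X p)))"

definition ext_deriv ::
  "('m::topological_space, 'e::euclidean_space) atlas \<Rightarrow> ('m \<Rightarrow> 'm tvec \<Rightarrow> real) \<Rightarrow>
   ('m \<Rightarrow> 'm tvec) \<Rightarrow> ('m \<Rightarrow> 'm tvec) \<Rightarrow> 'm \<Rightarrow> real" where
  "ext_deriv A \<eta> X Y p =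
     X p (\<lambda>q. \<eta> q (Y q)) - Y p (\<lambda>q. \<eta> q (X q)) - \<eta> p (lie_bracket A X Y p)"


section \<open>Subbundles of the tangent bundle\<close>

definition subbundle ::
  "('m::topological_space, 'e::euclidean_space) atlas \<Rightarrow> nat \<Rightarrow> ('m \<Rightarrow> 'm tvec set) \<Rightarrow> bool" where
  "subbundle A r E \<longleftrightarrow>
     (\<forall>p. \<exists>U X. p \<in> U \<and> (\<forall>i<r. vector_field A U (X i)) \<and>
        (\<forall>q\<in>U. is_basis r (E q) (\<lambda>i. X i q)))"

definition section_on ::
  "('m::topological_space, 'e::euclidean_space) atlas \<Rightarrow> ('m \<Rightarrow> 'm tvec set) \<Rightarrow>
   'm set \<Rightarrow> ('m \<Rightarrow> 'm tvec) \<Rightarrow> bool" where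
  "section_on A E U X \<longleftrightarrow> vector_field A U X \<and> (\<forall>p\<in>U. X p \<in> E p)"

definition section_near ::
  "('m::topological_space, 'e::euclidean_space) atlas \<Rightarrow> ('m \<Rightarrow> 'm tvec set) \<Rightarrow>
   'm \<Rightarrow> ('m \<Rightarrow> 'm tvec) \<Rightarrow> bool" where
  "section_near A E p X \<longleftrightarrow> (\<exists>U. p \<in> U \<and> section_on A E U X)"

definition supplementary ::
  "('m::topological_space, 'e::euclidean_space) atlas \<Rightarrow>
   ('m \<Rightarrow> 'm tvec set) \<Rightarrow> ('m \<Rightarrow> 'm tvec set) \<Rightarrow> bool" where
  "supplementary A H V \<longleftrightarrow>
     (\<forall>p. H p \<inter> V p = {0} \<and> {x + \<xi> | x \<xi>. x \<in> H p \<and> \<xi> \<in> V p} = tangent_space A p)"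

text \<open>Smooth sections of \<open>End(E)\<close> over \<open>U\<close>.\<close>

definition endo_field ::
  "('m::topological_space, 'e::euclidean_space) atlas \<Rightarrow> ('m \<Rightarrow> 'm tvec set) \<Rightarrow>
   'm set \<Rightarrow> ('m \<Rightarrow> 'm tvec \<Rightarrow> 'm tvec) \<Rightarrow> bool" where
  "endo_field A E U \<sigma> \<longleftrightarrow> open U \<and> (\<forall>p\<in>U. \<sigma> p \<in> endos (E p)) \<and>
     (\<forall>W X. W \<subseteq> U \<and> section_on A E W X \<longrightarrow> section_on A E W (\<lambda>p. \<sigma> p (X p)))"

text \<open>\<open>F\<close> is an operator on sections of \<open>E\<close> near \<open>p\<close> with values in the fibre at \<open>p\<close>; it is
  tensorial and as such given by the endomorphism \<open>B\<close> of \<open>E p\<close>.\<close>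

definition represents ::
  "('m::topological_space, 'e::euclidean_space) atlas \<Rightarrow> ('m \<Rightarrow> 'm tvec set) \<Rightarrow> 'm \<Rightarrow>
   (('m \<Rightarrow> 'm tvec) \<Rightarrow> 'm tvec) \<Rightarrow> ('m tvec \<Rightarrow> 'm tvec) \<Rightarrow> bool" where
  "represents A E p F B \<longleftrightarrow>
     B \<in> endos (E p) \<and> (\<forall>X. section_near A E p X \<longrightarrow> F X = B (X p))"


section \<open>Metrics on a distribution\<close>

definition orthonormal_basis ::
  "('a::real_vector \<Rightarrow> 'a \<Rightarrow> real) \<Rightarrow> 'a set \<Rightarrow> (nat \<Rightarrow> 'a) \<Rightarrow> bool" where
  "orthonormal_basis g S e \<longleftrightarrow> is_basis (dim S) S e \<and>
     (\<forall>i<dim S. \<forall>j<dim S. \<bar>g (e i) (e j)\<bar> = (if i = j then 1 else 0))"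

definition has_signature ::
  "('a::real_vector \<Rightarrow> 'a \<Rightarrow> real) \<Rightarrow> 'a set \<Rightarrow> nat \<Rightarrow> nat \<Rightarrow> bool" where
  "has_signature g S a b \<longleftrightarrow> (\<exists>e. orthonormal_basis g S e \<and>
     card {i. i < dim S \<and> g (e i) (e i) = 1} = a \<and> card {i. i < dim S \<and> g (e i) (e i) = -1} = b)"

definition metric_on ::
  "('m::topological_space, 'e::euclidean_space) atlas \<Rightarrow> ('m \<Rightarrow> 'm tvec set) \<Rightarrow> nat \<Rightarrow> nat \<Rightarrow>
   ('m \<Rightarrow> 'm tvec \<Rightarrow> 'm tvec \<Rightarrow> real) \<Rightarrow> bool" where
  "metric_on A H a b g \<longleftrightarrow>
     (\<forall>p. (\<forall>x\<in>H p. linear_on (H p) (g p x)) \<and> (\<forall>x\<in>H p. \<forall>y\<in>H p. g p x y = g p y x) \<and>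
        has_signature (g p) (H p) a b) \<and>
     (\<forall>W X Y. section_on A H W X \<and> section_on A H W Y \<longrightarrow>
        smooth_fun A W (\<lambda>p. g p (X p) (Y p)))"

definition conformal_class ::
  "('m::topological_space, 'e::euclidean_space) atlas \<Rightarrow> ('m \<Rightarrow> 'm tvec set) \<Rightarrow> nat \<Rightarrow> nat \<Rightarrow>
   ('m \<Rightarrow> 'm tvec \<Rightarrow> 'm tvec \<Rightarrow> real) \<Rightarrow> ('m \<Rightarrow> 'm tvec \<Rightarrow> 'm tvec \<Rightarrow> real) set" where
  "conformal_class A H a b g = {g'. metric_on A H a b g' \<and>
     (\<exists>f. smooth_fun A UNIV f \<and> (\<forall>p. f p > 0 \<and> (\<forall>x\<in>H p. \<forall>y\<in>H p. g' p x y = f p * g p x y)))}"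


section \<open>Paraquaternionic contact manifolds\<close>

definition \<epsilon> :: "nat \<Rightarrow> real" where
  "\<epsilon> s = (if s = 3 then -1 else 1)"

text \<open>The relations of the paraquaternions, for \<open>I 1, I 2, I 3\<close> on \<open>S\<close>.\<close>

definition paraquaternionic :: "'a::real_vector set \<Rightarrow> (nat \<Rightarrow> 'a \<Rightarrow> 'a) \<Rightarrow> bool" where
  "paraquaternionic S I \<longleftrightarrow>
     (\<forall>s\<in>{1,2,3}. \<forall>x\<in>S. I s (I s x) = \<epsilon> s *\<^sub>R x) \<and>
     (\<forall>(i, j, k) \<in> {(1,2,3), (2,3,1), (3,1,2)}. \<forall>x\<in>S.
        I i (I j x) = - \<epsilon> k *\<^sub>R I k x \<and> I j (I i x) = \<epsilon> k *\<^sub>R I k x)"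

text \<open>Local data \<open>(\<eta>\<^sub>s, I\<^sub>s)\<close> over \<open>U\<close> compatible with \<open>g\<close>.\<close>

definition local_data ::
  "('m::topological_space, 'e::euclidean_space) atlas \<Rightarrow> ('m \<Rightarrow> 'm tvec set) \<Rightarrow>
   ('m \<Rightarrow> 'm tvec \<Rightarrow> 'm tvec \<Rightarrow> real) \<Rightarrow> ('m \<Rightarrow> ('m tvec \<Rightarrow> 'm tvec) set) \<Rightarrow> 'm set \<Rightarrow>
   (nat \<Rightarrow> 'm \<Rightarrow> 'm tvec \<Rightarrow> real) \<Rightarrow> (nat \<Rightarrow> 'm \<Rightarrow> 'm tvec \<Rightarrow> 'm tvec) \<Rightarrow> bool" where
  "local_data A H g PQ U \<eta> I \<longleftrightarrow>
     (\<forall>s\<in>{1,2,3}. one_form A U (\<eta> s) \<and> endo_field A H U (I s)) \<and>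
     (\<forall>p\<in>U. paraquaternionic (H p) (\<lambda>s. I s p) \<and> PQ p = span {I 1 p, I 2 p, I 3 p} \<and>
        H p = {v \<in> tangent_space A p. \<forall>s\<in>{1,2,3}. \<eta> s p v = 0} \<and>
        (\<forall>s\<in>{1,2,3}. \<forall>x\<in>H p. \<forall>y\<in>H p. g p (I s p x) (I s p y) = - \<epsilon> s * g p x y)) \<and>
     (\<forall>s\<in>{1,2,3}. \<forall>W X Y. W \<subseteq> U \<and> section_on A H W X \<and> section_on A H W Y \<longrightarrow>
        (\<forall>p\<in>W. ext_deriv A (\<eta> s) X Y p = - 2 * \<epsilon> s * g p (I s p (X p)) (Y p)))"

text \<open>\<open>H\<close> is a distribution of codimension three, \<open>C\<close> is the conformal class. It suffices to ask
  for local data compatible with one representative of \<open>C\<close>, as rescaling the representative by a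
  positive function and \<open>\<eta>\<close> by the same function preserves compatibility.\<close>

definition pqc_manifold ::
  "('m::{t2_space,second_countable_topology}, 'e::euclidean_space) atlas \<Rightarrow> nat \<Rightarrow>
   ('m \<Rightarrow> 'm tvec set) \<Rightarrow> ('m \<Rightarrow> 'm tvec \<Rightarrow> 'm tvec \<Rightarrow> real) set \<Rightarrow>
   ('m \<Rightarrow> ('m tvec \<Rightarrow> 'm tvec) set) \<Rightarrow> bool" where
  "pqc_manifold A n H C PQ \<longleftrightarrow>
     smooth_atlas A \<and> DIM('e) = 4 * n + 3 \<and> subbundle A (DIM('e) - 3) H \<and>
     (\<exists>g. metric_on A H (2 * n) (2 * n) g \<and> C = conformal_class A H (2 * n) (2 * n) g \<and>
        (\<forall>p. \<exists>U \<eta> I. p \<in> U \<and> local_data A H g PQ U \<eta> I))"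

text \<open>The map \<open>\<phi>\<close> is, fibrewise, the linear map \<open>V \<rightarrow> PQ\<close> with \<open>\<phi> \<xi>\<^sub>s = I\<^sub>s\<close>, for all local data
  and the frame \<open>\<xi>\<close> of \<open>V\<close> dual to \<open>\<eta>\<close>.\<close>

definition natural_identification ::
  "('m::topological_space, 'e::euclidean_space) atlas \<Rightarrow> ('m \<Rightarrow> 'm tvec set) \<Rightarrow>
   ('m \<Rightarrow> 'm tvec \<Rightarrow> 'm tvec \<Rightarrow> real) \<Rightarrow> ('m \<Rightarrow> ('m tvec \<Rightarrow> 'm tvec) set) \<Rightarrow>
   ('m \<Rightarrow> 'm tvec set) \<Rightarrow> ('m \<Rightarrow> 'm tvec \<Rightarrow> 'm tvec \<Rightarrow> 'm tvec) \<Rightarrow> bool" where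
  "natural_identification A H g PQ V \<phi> \<longleftrightarrow>
     (\<forall>p. linear_on (V p) (\<phi> p)) \<and>
     (\<forall>U \<eta> I. local_data A H g PQ U \<eta> I \<longrightarrow>
        (\<forall>p\<in>U. \<forall>\<xi>. (\<forall>s\<in>{1,2,3}. \<xi> s \<in> V p) \<and>
             (\<forall>s\<in>{1,2,3}. \<forall>t\<in>{1,2,3}. \<eta> s p (\<xi> t) = (if s = t then 1 else 0)) \<longrightarrow>
           (\<forall>s\<in>{1,2,3}. \<phi> p (\<xi> s) = I s p)))"

definition sp_n :: "('a::real_vector \<Rightarrow> 'a \<Rightarrow> real) \<Rightarrow> ('a \<Rightarrow> 'a) set \<Rightarrow> 'a set \<Rightarrow> ('a \<Rightarrow> 'a) set" where
  "sp_n g Q S = {B \<in> endos S. (\<forall>x\<in>S. \<forall>y\<in>S. g (B x) y = - g x (B y)) \<and>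
     (\<forall>J\<in>Q. \<forall>x\<in>S. B (J x) = J (B x))}"

text \<open>The value does not depend on the choice of the orthonormal basis.\<close>

definition endo_inner ::
  "('a::real_vector \<Rightarrow> 'a \<Rightarrow> real) \<Rightarrow> 'a set \<Rightarrow> ('a \<Rightarrow> 'a) \<Rightarrow> ('a \<Rightarrow> 'a) \<Rightarrow> real" where
  "endo_inner g S B B' = (let e = (SOME e. orthonormal_basis g S e) in
     \<Sum>a<dim S. g (e a) (e a) * g (B (e a)) (B' (e a)))"

text \<open>The space \<open>(sp(n,\<real>) \<oplus> sp(1,\<real>))\<^sup>\<bottom>\<close>, with \<open>Q\<close> in the role of \<open>sp(1,\<real>)\<close>.\<close>

definition sp_n_sp_1_perp ::
  "('a::real_vector \<Rightarrow> 'a \<Rightarrow> real) \<Rightarrow> ('a \<Rightarrow> 'a) set \<Rightarrow> 'a set \<Rightarrow> ('a \<Rightarrow> 'a) set" where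
  "sp_n_sp_1_perp g Q S =
     {B \<in> endos S. \<forall>B'\<in>sp_n g Q S. \<forall>J\<in>Q. endo_inner g S B (B' + J) = 0}"


section \<open>Connections\<close>

text \<open>\<open>D p v Y\<close> is the covariant derivative of \<open>Y\<close> in direction \<open>v\<close>, for \<open>v\<close> tangent at \<open>p\<close> and
  \<open>Y\<close> a vector field defined near \<open>p\<close>. As for tangent vectors, it depends only on the germ of \<open>Y\<close>
  by the Leibniz rule, so this is the same as a linear connection acting on global vector
  fields. It is extended by zero to all other arguments, which makes equality of connections the
  equality of functions.\<close>

type_synonym 'm connection = "'m \<Rightarrow> 'm tvec \<Rightarrow> ('m \<Rightarrow> 'm tvec) \<Rightarrow> 'm tvec"

definition linear_connection ::
  "('m::topological_space, 'e::euclidean_space) atlas \<Rightarrow> 'm connection \<Rightarrow> bool" where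
  "linear_connection A D \<longleftrightarrow>
     (\<forall>p Y. vector_field_near A p Y \<longrightarrow> linear_on (tangent_space A p) (\<lambda>v. D p v Y)) \<and>
     (\<forall>p. \<forall>v\<in>tangent_space A p. \<forall>Y Z. vector_field_near A p Y \<and> vector_field_near A p Z \<longrightarrow>
        D p v (Y + Z) = D p v Y + D p v Z) \<and>
     (\<forall>p. \<forall>v\<in>tangent_space A p. \<forall>f Y. smooth_fun_near A p f \<and> vector_field_near A p Y \<longrightarrow>
        D p v (\<lambda>q. f q *\<^sub>R Y q) = v f *\<^sub>R Y p + f p *\<^sub>R D p v Y) \<and>
     (\<forall>U X Y. vector_field A U X \<and> vector_field A U Y \<longrightarrow>
        vector_field A U (\<lambda>p. D p (X p) Y)) \<and>
     (\<forall>p v Y. v \<notin> tangent_space A p \<or> \<not> vector_field_near A p Y \<longrightarrow> D p v Y = 0)"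

definition torsion ::
  "('m::topological_space, 'e::euclidean_space) atlas \<Rightarrow> 'm connection \<Rightarrow>
   ('m \<Rightarrow> 'm tvec) \<Rightarrow> ('m \<Rightarrow> 'm tvec) \<Rightarrow> 'm \<Rightarrow> 'm tvec" where
  "torsion A D X Y p = D p (X p) Y - D p (Y p) X - lie_bracket A X Y p"

definition preserves_subbundle ::
  "('m::topological_space, 'e::euclidean_space) atlas \<Rightarrow> 'm connection \<Rightarrow>
   ('m \<Rightarrow> 'm tvec set) \<Rightarrow> bool" where
  "preserves_subbundle A D E \<longleftrightarrow>
     (\<forall>p. \<forall>v\<in>tangent_space A p. \<forall>Y. section_near A E p Y \<longrightarrow> D p v Y \<in> E p)"

definition preserves_metric ::
  "('m::topological_space, 'e::euclidean_space) atlas \<Rightarrow> 'm connection \<Rightarrow>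
   ('m \<Rightarrow> 'm tvec set) \<Rightarrow> ('m \<Rightarrow> 'm tvec \<Rightarrow> 'm tvec \<Rightarrow> real) \<Rightarrow> bool" where
  "preserves_metric A D H g \<longleftrightarrow>
     (\<forall>p. \<forall>v\<in>tangent_space A p. \<forall>Y Z. section_near A H p Y \<and> section_near A H p Z \<longrightarrow>
        v (\<lambda>q. g q (Y q) (Z q)) = g p (D p v Y) (Z p) + g p (Y p) (D p v Z))"

text \<open>\<open>B\<close> is the covariant derivative of the field of endomorphisms \<open>\<sigma>\<close> of \<open>H\<close> in direction
  \<open>v\<close> at \<open>p\<close>, i.e. \<open>B X = \<nabla>\<^sub>v (\<sigma> X) - \<sigma> (\<nabla>\<^sub>v X)\<close>.\<close>

definition has_endo_deriv ::
  "('m::topological_space, 'e::euclidean_space) atlas \<Rightarrow> 'm connection \<Rightarrow>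
   ('m \<Rightarrow> 'm tvec set) \<Rightarrow> 'm \<Rightarrow> 'm tvec \<Rightarrow> ('m \<Rightarrow> 'm tvec \<Rightarrow> 'm tvec) \<Rightarrow>
   ('m tvec \<Rightarrow> 'm tvec) \<Rightarrow> bool" where
  "has_endo_deriv A D H p v \<sigma> B \<longleftrightarrow>
     represents A H p (\<lambda>X. D p v (\<lambda>q. \<sigma> q (X q)) - \<sigma> p (D p v X)) B"

definition preserves_PQ ::
  "('m::topological_space, 'e::euclidean_space) atlas \<Rightarrow> 'm connection \<Rightarrow>
   ('m \<Rightarrow> 'm tvec set) \<Rightarrow> ('m \<Rightarrow> ('m tvec \<Rightarrow> 'm tvec) set) \<Rightarrow> bool" where
  "preserves_PQ A D H PQ \<longleftrightarrow>
     (\<forall>U \<sigma>. endo_field A H U \<sigma> \<and> (\<forall>p\<in>U. \<sigma> p \<in> PQ p) \<longrightarrow>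
        (\<forall>p\<in>U. \<forall>v\<in>tangent_space A p. \<exists>B\<in>PQ p. has_endo_deriv A D H p v \<sigma> B))"

text \<open>\<open>\<nabla>\<phi> = 0\<close>, i.e. \<open>\<nabla>\<^sub>v (\<phi> \<zeta>) = \<phi> (\<nabla>\<^sub>v \<zeta>)\<close> for all sections \<open>\<zeta>\<close> of \<open>V\<close>.\<close>

definition parallel_identification ::
  "('m::topological_space, 'e::euclidean_space) atlas \<Rightarrow> 'm connection \<Rightarrow>
   ('m \<Rightarrow> 'm tvec set) \<Rightarrow> ('m \<Rightarrow> 'm tvec set) \<Rightarrow> ('m \<Rightarrow> 'm tvec \<Rightarrow> 'm tvec \<Rightarrow> 'm tvec) \<Rightarrow> bool" where
  "parallel_identification A D H V \<phi> \<longleftrightarrow>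
     (\<forall>p. \<forall>v\<in>tangent_space A p. \<forall>\<zeta>. section_near A V p \<zeta> \<longrightarrow>
        has_endo_deriv A D H p v (\<lambda>q. \<phi> q (\<zeta> q)) (\<phi> p (D p v \<zeta>)))"

end

theory Submission
  imports Defs
begin

text \<open>Everything is local, so fix data \<open>(\<eta>\<^sub>s, I\<^sub>s)\<close>, a \<open>g\<close>-orthogonal frame of \<open>H\<close> and a complement \<open>V\<close>
  with the frame \<open>\<xi>\<^sub>s\<close> dual to \<open>\<eta>\<^sub>s\<close>. Metricity and condition (ii) determine \<open>\<nabla>\<^sub>X Y\<close> for horizontal
  \<open>X, Y\<close> by the Koszul formula. Taking the horizontal part of \<open>d(d\<eta>\<^sub>s) = 0\<close> one finds that this partial
  connection preserves \<open>PQ\<close> if and only if \<open>d\<eta>\<^sub>s(\<xi>\<^sub>s, X) = 0\<close> for all \<open>s\<close> and all horizontal \<open>X\<close>; here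
  \<open>n > 1\<close> is needed, as it makes the wedge product with the fundamental 2-forms injective on horizontal
  1-forms. These equations have exactly one solution \<open>V\<close>. For vertical \<open>\<xi>\<close> the operators
  \<open>X \<mapsto> [\<xi>, X]\<^bsub>|H\<^esub> + B X\<close> that are metric and preserve \<open>PQ\<close> form an affine space over
  \<open>sp(n,\<real>) \<oplus> sp(1,\<real>)\<close>, and (iii) selects the one with \<open>B\<close> orthogonal to that space; \<open>\<nabla>\<close> on \<open>V\<close> is
  transported from \<open>PQ\<close> by \<open>\<phi>\<close>. The local solutions agree on overlaps by uniqueness.\<close>

section \<open>Smooth functions\<close>

text \<open>The equation d(d\<eta>_s) = 0 prescribes only an alternation: the cyclic sum of
  g((\<nabla>_x I_s) y, z) equals that of the sum over t of a_st(x) g(I_t y, z), with a_st =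
  \<epsilon>_s \<epsilon>_t \<eta>_s([\<xi>_t, .]). If \<nabla> preserves PQ, then \<nabla>I_s has
  no I_s-component, so a_ss must vanish, and this is what the condition on V says. Off the diagonal
  a_jk = \<epsilon>_i a_kj has to hold; this is not imposed but forced by the algebra of I_1, I_2,
  I_3. Then \<nabla>I_s minus the sum of the a_st I_t is a derivative of the same kind with zero
  alternation, which an algebraic form of Hitchin's lemma removes. As I_1, I_2 are product
  structures and g is neutral, positivity is out of reach: type arguments become real identities
  with signs \<epsilon>_s, and nondegeneracy is shown with rank two test operators. Vertical vectors
  come from brackets: \<eta>_s([X, I_t X]) is -2 g(X, X) for s = t and 0 otherwise, so one
  non-isotropic section X of H yields a dual frame and shows that \<phi> is well defined.\<close>

lemma C_k_on_subset: "C_k_on k U f \<Longrightarrow> W \<subseteq> U \<Longrightarrow> C_k_on k W f"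
  by (induction k arbitrary: f) (auto intro: continuous_on_subset)

text \<open>\<open>frechet_derivative\<close> is defined by choice at each point, so equality on the
  open set has to be turned into equality of the derivatives there before the induction can go
  on.\<close>

lemma C_k_on_cong:
  assumes "open U" "\<And>x. x \<in> U \<Longrightarrow> f x = h x" "C_k_on k U f"
  shows "C_k_on k U h"
  using assms(2,3)
proof (induction k arbitrary: f h)
  case 0
  then show ?case by (simp cong: continuous_on_cong)
next
  case (Suc k)
  have d: "(h has_derivative frechet_derivative f (at x)) (at x)" if "x \<in> U" for x
  proof (rule has_derivative_transform_within_open[OF _ \<open>open U\<close> that])
    show "(f has_derivative frechet_derivative f (at x)) (at x)"
      using Suc.prems(2) that by (simp add: frechet_derivative_works[symmetric])
  qed (use Suc.prems(1) in auto)
  have "frechet_derivative h (at x) = frechet_derivative f (at x)" if "x \<in> U" for x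
    using frechet_derivative_at[OF d[OF that]] by simp
  moreover have "C_k_on k U (\<lambda>x. frechet_derivative f (at x) v)" for v
    using Suc.prems(2) by simp
  ultimately have "C_k_on k U (\<lambda>x. frechet_derivative h (at x) v)" for v
    using Suc.IH[of "\<lambda>x. frechet_derivative f (at x) v" "\<lambda>x. frechet_derivative h (at x) v"] by simp
  then show ?case
    using d by (auto simp: differentiable_def)
qed

lemma C_k_on_local:
  assumes "\<And>x. x \<in> U \<Longrightarrow> \<exists>W. open W \<and> x \<in> W \<and> C_k_on k W f"
  shows "C_k_on k U f"
  using assms
proof (induction k arbitrary: f)
  case 0
  have "isCont f x" if "x \<in> U" for x
    using 0[OF that] by (auto simp: continuous_on_eq_continuous_at)
  then show ?case by (simp add: continuous_at_imp_continuous_on)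
next
  case (Suc k)
  have "C_k_on k U (\<lambda>x. frechet_derivative f (at x) v)" for v
    using Suc.prems by (intro Suc.IH) fastforce
  then show ?case using Suc.prems by fastforce
qed

lemma C_k_on_Suc_imp: "C_k_on (Suc k) U f \<Longrightarrow> C_k_on k U f"
proof (induction k arbitrary: f)
  case 0
  then show ?case
    by (auto intro!: continuous_at_imp_continuous_on differentiable_imp_continuous_within)
next
  case (Suc k)
  then show ?case by (metis C_k_on.simps(2))
qed

lemma C_k_on_const: "C_k_on k U (\<lambda>x. c)"
  by (induction k arbitrary: c) auto

lemma C_k_on_add:
  "open U \<Longrightarrow> C_k_on k U f \<Longrightarrow> C_k_on k U h \<Longrightarrow> C_k_on k U (\<lambda>x. f x + h x)"
proof (induction k arbitrary: f h)
  case 0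
  then show ?case by (auto intro: continuous_intros)
next
  case (Suc k)
  have d: "((\<lambda>x. f x + h x) has_derivative
      (\<lambda>v. frechet_derivative f (at x) v + frechet_derivative h (at x) v)) (at x)" if "x \<in> U" for x
    using Suc.prems that
    by (intro has_derivative_add) (auto simp: frechet_derivative_works[symmetric])
  have "C_k_on k U (\<lambda>x. frechet_derivative (\<lambda>x. f x + h x) (at x) v)" for v
  proof (rule C_k_on_cong[OF Suc.prems(1)])
    show "frechet_derivative f (at x) v + frechet_derivative h (at x) v =
        frechet_derivative (\<lambda>x. f x + h x) (at x) v" if "x \<in> U" for x
      using fun_cong[OF frechet_derivative_at[OF d[OF that]]] by simp
    show "C_k_on k U (\<lambda>x. frechet_derivative f (at x) v + frechet_derivative h (at x) v)"
      using Suc.IH[of "\<lambda>x. frechet_derivative f (at x) v" "\<lambda>x. frechet_derivative h (at x) v"]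
        Suc.prems by simp
  qed
  then show ?case
    using d by (auto simp: differentiable_def)
qed

lemma C_k_on_mult:
  fixes f h :: "'e::euclidean_space \<Rightarrow> real"
  shows "open U \<Longrightarrow> C_k_on k U f \<Longrightarrow> C_k_on k U h \<Longrightarrow> C_k_on k U (\<lambda>x. f x * h x)"
proof (induction k arbitrary: f h)
  case 0
  then show ?case by (auto intro: continuous_intros)
next
  case (Suc k)
  have d: "((\<lambda>x. f x * h x) has_derivative
      (\<lambda>v. f x * frechet_derivative h (at x) v + frechet_derivative f (at x) v * h x)) (at x)"
    if "x \<in> U" for x
    using Suc.prems that
    by (intro has_derivative_mult) (auto simp: frechet_derivative_works[symmetric])
  have "C_k_on k U (\<lambda>x. frechet_derivative (\<lambda>x. f x * h x) (at x) v)" for v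
  proof (rule C_k_on_cong[OF Suc.prems(1)])
    show "f x * frechet_derivative h (at x) v + frechet_derivative f (at x) v * h x =
        frechet_derivative (\<lambda>x. f x * h x) (at x) v" if "x \<in> U" for x
      using fun_cong[OF frechet_derivative_at[OF d[OF that]]] by simp
    show "C_k_on k U (\<lambda>x. f x * frechet_derivative h (at x) v + frechet_derivative f (at x) v * h x)"
      using Suc.prems C_k_on_Suc_imp by (intro C_k_on_add Suc.IH) auto
  qed
  then show ?case
    using d by (auto simp: differentiable_def)
qed

lemma C_k_on_inverse:
  fixes f :: "'e::euclidean_space \<Rightarrow> real"
  assumes "open U" "\<And>x. x \<in> U \<Longrightarrow> f x \<noteq> 0"
  shows "C_k_on k U f \<Longrightarrow> C_k_on k U (\<lambda>x. inverse (f x))"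
proof (induction k)
  case 0
  then show ?case using assms(2) by (simp add: continuous_on_inverse)
next
  case (Suc k)
  have d: "((\<lambda>x. inverse (f x)) has_derivative
      (\<lambda>v. - (inverse (f x) * frechet_derivative f (at x) v * inverse (f x)))) (at x)"
    if "x \<in> U" for x
    using Suc.prems that assms
    by (intro Deriv.has_derivative_inverse) (auto simp: frechet_derivative_works[symmetric])
  have "C_k_on k U (\<lambda>x. frechet_derivative (\<lambda>x. inverse (f x)) (at x) v)" for v
  proof (rule C_k_on_cong[OF assms(1)])
    show "(- 1) * (inverse (f x) * frechet_derivative f (at x) v * inverse (f x)) =
        frechet_derivative (\<lambda>x. inverse (f x)) (at x) v" if "x \<in> U" for x
      using fun_cong[OF frechet_derivative_at[OF d[OF that]]] by simp
    show "C_k_on k U (\<lambda>x. (- 1) * (inverse (f x) * frechet_derivative f (at x) v * inverse (f x)))"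
      using Suc.prems C_k_on_Suc_imp Suc.IH assms by (intro C_k_on_mult C_k_on_const) auto
  qed
  then show ?case
    using d by (auto simp: differentiable_def)
qed

section \<open>Charts and the ring of smooth functions on an open subset of the manifold\<close>

lemma smooth_atlas_chart:
  assumes "smooth_atlas A" "(U, x) \<in> A"
  shows "open U" "open W \<Longrightarrow> open (x ` (U \<inter> W))" "inj_on x U" "continuous_on U x"
proof -
  from assms have "open U \<and> open (x ` U) \<and> (\<exists>x'. homeomorphism U (x ` U) x x')"
    unfolding smooth_atlas_def by fast
  then obtain x' where o: "open U" "open (x ` U)" and h: "homeomorphism U (x ` U) x x'"
    by blast
  show "open U" "continuous_on U x" using o h by (auto simp: homeomorphism_def)
  show "inj_on x U"
    using h by (auto simp: homeomorphism_def intro: inj_on_inverseI)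
  show "open (x ` (U \<inter> W))" if "open W"
  proof -
    have "openin (top_of_set (x ` U)) (x ` (U \<inter> W))"
      by (rule homeomorphism_imp_open_map[OF h]) (use that in auto)
    then show ?thesis using o by (simp add: openin_open_eq)
  qed
qed

lemma smooth_atlas_cover:
  assumes "smooth_atlas A"
  obtains U x where "(U, x) \<in> A" "p \<in> U"
proof -
  have "p \<in> (\<Union>(U, x) \<in> A. U)" using assms unfolding smooth_atlas_def by simp
  then show thesis using that by blast
qed

locale smooth_mfd =
  fixes A :: "('m::{t2_space,second_countable_topology}, 'e::euclidean_space) atlas"
  assumes atlas: "smooth_atlas A"
begin

lemma smooth_fun_open: "smooth_fun A W f \<Longrightarrow> open W"
  by (simp add: smooth_fun_def)

lemma smooth_funI:
  assumes "open W" "\<And>U x k. (U, x) \<in> A \<Longrightarrow> open (x ` (U \<inter> W)) \<Longrightarrow>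
    C_k_on k (x ` (U \<inter> W)) (\<lambda>u. f (inv_into U x u))"
  shows "smooth_fun A W f"
  using assms smooth_atlas_chart(2)[OF atlas] by (auto simp: smooth_fun_def C_inf_on_def o_def)

lemma smooth_funD:
  assumes "smooth_fun A W f" "(U, x) \<in> A"
  shows "C_k_on k (x ` (U \<inter> W)) (\<lambda>u. f (inv_into U x u))"
  using assms by (auto simp: smooth_fun_def C_inf_on_def o_def)

lemma smooth_fun_subset:
  assumes "smooth_fun A W f" "open W'" "W' \<subseteq> W"
  shows "smooth_fun A W' f"
proof (rule smooth_funI[OF assms(2)])
  fix U x k assume *: "(U, x) \<in> A"
  show "C_k_on k (x ` (U \<inter> W')) (\<lambda>u. f (inv_into U x u))"
    by (rule C_k_on_subset[OF smooth_funD[OF assms(1) *]]) (use assms(3) in auto)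
qed

lemma chart_inv:
  assumes "(U, x) \<in> A" "u \<in> x ` (U \<inter> W)"
  shows "inv_into U x u \<in> W" "inv_into U x u \<in> U"
  using assms smooth_atlas_chart(3)[OF atlas] by auto

lemma smooth_fun_cong:
  assumes "smooth_fun A W f" "\<And>q. q \<in> W \<Longrightarrow> f q = h q"
  shows "smooth_fun A W h"
proof (rule smooth_funI)
  show "open W" using assms smooth_fun_open by auto
  fix U x k assume *: "(U, x) \<in> A" and o: "open (x ` (U \<inter> W))"
  show "C_k_on k (x ` (U \<inter> W)) (\<lambda>u. h (inv_into U x u))"
    by (rule C_k_on_cong[OF o _ smooth_funD[OF assms(1) *]]) (use assms(2) chart_inv[OF *] in auto)
qed

lemma smooth_fun_local:
  assumes "open W" "\<And>q. q \<in> W \<Longrightarrow> \<exists>W'. q \<in> W' \<and> smooth_fun A W' f"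
  shows "smooth_fun A W f"
proof (rule smooth_funI[OF assms(1)])
  fix U x k assume *: "(U, x) \<in> A"
  show "C_k_on k (x ` (U \<inter> W)) (\<lambda>u. f (inv_into U x u))"
  proof (rule C_k_on_local)
    fix u assume u: "u \<in> x ` (U \<inter> W)"
    then obtain q where q: "q \<in> U" "q \<in> W" "u = x q" by auto
    then obtain W' where W': "q \<in> W'" "smooth_fun A W' f" using assms(2) by blast
    then show "\<exists>T. open T \<and> u \<in> T \<and> C_k_on k T (\<lambda>u. f (inv_into U x u))"
      using smooth_funD[OF W'(2) *, of k] q smooth_atlas_chart(2)[OF atlas * smooth_fun_open]
      by (intro exI[of _ "x ` (U \<inter> W')"]) auto
  qed
qed

lemma smooth_fun_const: "open W \<Longrightarrow> smooth_fun A W (\<lambda>q. c)"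
  by (intro smooth_funI) (auto intro: C_k_on_const)

lemma smooth_fun_add:
  assumes "smooth_fun A W f" "smooth_fun A W h"
  shows "smooth_fun A W (\<lambda>q. f q + h q)"
  using assms smooth_funD by (intro smooth_funI C_k_on_add) (auto simp: smooth_fun_open)

lemma smooth_fun_mult:
  assumes "smooth_fun A W f" "smooth_fun A W h"
  shows "smooth_fun A W (\<lambda>q. f q * h q)"
  using assms smooth_funD by (intro smooth_funI C_k_on_mult) (auto simp: smooth_fun_open)

lemma smooth_fun_inverse:
  assumes "smooth_fun A W f" "\<And>q. q \<in> W \<Longrightarrow> f q \<noteq> 0"
  shows "smooth_fun A W (\<lambda>q. inverse (f q))"
  using assms smooth_funD chart_inv by (intro smooth_funI C_k_on_inverse) (auto simp: smooth_fun_open)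

lemma smooth_fun_divide:
  assumes "smooth_fun A W f" "smooth_fun A W h" "\<And>q. q \<in> W \<Longrightarrow> h q \<noteq> 0"
  shows "smooth_fun A W (\<lambda>q. f q / h q)"
  using smooth_fun_mult[OF assms(1) smooth_fun_inverse[OF assms(2,3)]] by (simp add: divide_inverse)

lemma smooth_fun_cmult: "smooth_fun A W f \<Longrightarrow> smooth_fun A W (\<lambda>q. c * f q)"
  using smooth_fun_mult smooth_fun_const smooth_fun_open by blast

lemma smooth_fun_minus: "smooth_fun A W f \<Longrightarrow> smooth_fun A W (\<lambda>q. - f q)"
  using smooth_fun_cmult[of W f "-1"] by simp

lemma smooth_fun_diff:
  "smooth_fun A W f \<Longrightarrow> smooth_fun A W h \<Longrightarrow> smooth_fun A W (\<lambda>q. f q - h q)"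
  using smooth_fun_add[OF _ smooth_fun_minus, of W f h] by simp

lemma smooth_fun_sum:
  assumes "open W" "\<And>i. i \<in> J \<Longrightarrow> smooth_fun A W (f i)"
  shows "smooth_fun A W (\<lambda>q. \<Sum>i\<in>J. f i q)"
  using assms(2)
  by (induction J rule: infinite_finite_induct) (auto intro: smooth_fun_const assms smooth_fun_add)

lemma smooth_fun_continuous:
  assumes "smooth_fun A W f"
  shows "continuous_on W f"
proof -
  have "isCont f q" if "q \<in> W" for q
  proof -
    obtain U x where U: "(U, x) \<in> A" "q \<in> U" using smooth_atlas_cover[OF atlas] by metis
    note c = smooth_atlas_chart[OF atlas U(1)]
    have W: "open W" using assms smooth_fun_open by auto
    have "continuous_on (x ` (U \<inter> W)) (\<lambda>u. f (inv_into U x u))"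
      using smooth_funD[OF assms U(1), of 0] by simp
    moreover have "continuous_on (U \<inter> W) x" using c(4) by (rule continuous_on_subset) simp
    ultimately have "continuous_on (U \<inter> W) (\<lambda>q. f (inv_into U x (x q)))"
      using continuous_on_compose2 by blast
    moreover have "f (inv_into U x (x q)) = f q" if "q \<in> U \<inter> W" for q
      using c(3) that by simp
    ultimately have "continuous_on (U \<inter> W) f"
      using continuous_on_eq by blast
    then show ?thesis
      using c(1) W that U(2) continuous_on_eq_continuous_at[of "U \<inter> W" f]
      by (simp add: open_Int)
  qed
  then show ?thesis by (simp add: continuous_at_imp_continuous_on)
qed

text \<open>Supplies the neighbourhood on which a vector produced by the Gram-Schmidt process stays
  non-isotropic.\<close>

lemma smooth_fun_nonzero_open:
  assumes "smooth_fun A W f"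
  shows "open {q \<in> W. f q \<noteq> 0}"
proof -
  have "open (W \<inter> f -` (- {0}))"
    by (rule continuous_open_preimage[OF smooth_fun_continuous[OF assms] smooth_fun_open[OF assms]]) auto
  moreover have "W \<inter> f -` (- {0}) = {q \<in> W. f q \<noteq> 0}" by auto
  ultimately show ?thesis by simp
qed

lemma smooth_fun_nearI: "smooth_fun A W f \<Longrightarrow> p \<in> W \<Longrightarrow> smooth_fun_near A p f"
  by (auto simp: smooth_fun_near_def)

end

section \<open>Tangent vectors and vector fields\<close>

lemma linear_onD:
  assumes "linear_on S f"
  shows "x \<in> S \<Longrightarrow> y \<in> S \<Longrightarrow> f (x + y) = f x + f y" "x \<in> S \<Longrightarrow> f (c *\<^sub>R x) = c *\<^sub>R f x"
  using assms by (auto simp: linear_on_def)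

lemma linear_on_zero: "linear_on S f \<Longrightarrow> subspace S \<Longrightarrow> f 0 = 0"
  using linear_onD(2)[of S f 0 0] by (simp add: subspace_0)

lemma linear_on_minus: "linear_on S f \<Longrightarrow> x \<in> S \<Longrightarrow> f (- x) = - f x"
  using linear_onD(2)[of S f x "-1"] by simp

lemma linear_on_diff:
  assumes "linear_on S f" "subspace S" "x \<in> S" "y \<in> S"
  shows "f (x - y) = f x - f y"
  using linear_onD(1)[OF assms(1,3), of "- y"] linear_on_minus[OF assms(1,4)] assms
  by (simp add: subspace_neg)

lemma linear_on_sum:
  assumes "linear_on S f" "subspace S" "\<And>i. i \<in> J \<Longrightarrow> x i \<in> S"
  shows "f (\<Sum>i\<in>J. x i) = (\<Sum>i\<in>J. f (x i))"
  using assms(3)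
proof (induction J rule: infinite_finite_induct)
  case (insert i J)
  then show ?case
    using linear_onD(1)[OF assms(1), of "x i" "sum x J"] subspace_sum[OF assms(2), of J x] by simp
qed (auto simp: linear_on_zero[OF assms(1,2)])

context smooth_mfd
begin

lemma smooth_fun_near_add:
  assumes "smooth_fun_near A p f" "smooth_fun_near A p h"
  shows "smooth_fun_near A p (\<lambda>q. f q + h q)" "smooth_fun_near A p (\<lambda>q. f q * h q)"
proof -
  obtain W W' where W: "p \<in> W" "smooth_fun A W f" "p \<in> W'" "smooth_fun A W' h"
    using assms by (auto simp: smooth_fun_near_def)
  have o: "open (W \<inter> W')" using W smooth_fun_open by auto
  have "smooth_fun A (W \<inter> W') f" "smooth_fun A (W \<inter> W') h"
    using smooth_fun_subset[OF W(2) o] smooth_fun_subset[OF W(4) o] by auto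
  then show "smooth_fun_near A p (\<lambda>q. f q + h q)" "smooth_fun_near A p (\<lambda>q. f q * h q)"
    using smooth_fun_add smooth_fun_mult W(1,3) by (blast intro: smooth_fun_nearI)+
qed

lemma smooth_fun_near_const: "smooth_fun_near A p (\<lambda>q. c)"
  using smooth_fun_const[of UNIV] smooth_fun_nearI by blast

lemma tangent_subspace: "subspace (tangent_space A p)"
  by (auto simp: subspace_def tangent_space_def algebra_simps)

lemma tangent_add:
  assumes "v \<in> tangent_space A p" "smooth_fun_near A p f" "smooth_fun_near A p h"
  shows "v (\<lambda>q. f q + h q) = v f + v h"
  using assms by (simp add: tangent_space_def plus_fun_def)

lemma tangent_mult:
  assumes "v \<in> tangent_space A p" "smooth_fun_near A p f" "smooth_fun_near A p h"
  shows "v (\<lambda>q. f q * h q) = v f * h p + f p * v h"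
  using assms by (simp add: tangent_space_def times_fun_def)

lemma tangent_cmult:
  assumes "v \<in> tangent_space A p" "smooth_fun_near A p f"
  shows "v (\<lambda>q. c * f q) = c * v f"
proof -
  have "v (c *\<^sub>R f) = c * v f" using assms by (auto simp: tangent_space_def)
  moreover have "c *\<^sub>R f = (\<lambda>q. c * f q)" by (simp add: fun_eq_iff)
  ultimately show ?thesis by metis
qed

lemma tangent_const:
  assumes "v \<in> tangent_space A p"
  shows "v (\<lambda>q. c) = 0"
proof -
  have "v (\<lambda>q. 1 * 1) = v (\<lambda>q. 1) * 1 + 1 * v (\<lambda>q. 1)"
    using tangent_mult[OF assms smooth_fun_near_const smooth_fun_near_const, of 1 1] by simp
  then have "v (\<lambda>q. 1) = 0" by simp
  then show ?thesis
    using tangent_cmult[OF assms smooth_fun_near_const, of c 1] by simp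
qed

lemma tangent_not_smooth: "v \<in> tangent_space A p \<Longrightarrow> \<not> smooth_fun_near A p f \<Longrightarrow> v f = 0"
  by (simp add: tangent_space_def)

lemma smooth_fun_near_cong:
  assumes "open W" "p \<in> W" "\<And>q. q \<in> W \<Longrightarrow> f q = h q" "smooth_fun_near A p f"
  shows "smooth_fun_near A p h"
proof -
  obtain W' where W: "p \<in> W'" "smooth_fun A W' f"
    using assms by (auto simp: smooth_fun_near_def)
  have "smooth_fun A (W \<inter> W') f"
    by (rule smooth_fun_subset[OF W(2)]) (use assms W smooth_fun_open in auto)
  then have "smooth_fun A (W \<inter> W') h" by (rule smooth_fun_cong) (use assms in auto)
  then show ?thesis using assms W by (auto intro: smooth_fun_nearI)
qed

text \<open>The characteristic function of a neighbourhood is smooth near \<open>p\<close>: no bump functions needed.\<close>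

lemma smooth_fun_indicator: "open W \<Longrightarrow> smooth_fun A W (\<lambda>q. if q \<in> W then 1 else 0)"
  by (rule smooth_fun_cong[OF smooth_fun_const[of W 1]]) auto

text \<open>With c the characteristic function of \<open>W\<close>, the identity c = c * c forces v
  c = 0, because c p = 1. The Leibniz rule then gives v f = v (c * f), and c * f and c * h are the
  same function.\<close>

lemma tangent_cong:
  assumes v: "v \<in> tangent_space A p" and W: "open W" "p \<in> W" "\<And>q. q \<in> W \<Longrightarrow> f q = h q"
  shows "v f = v h"
proof (cases "smooth_fun_near A p f")
  case True
  then have h: "smooth_fun_near A p h" using smooth_fun_near_cong W by blast
  define c where "c = (\<lambda>q. if q \<in> W then 1::real else 0)"
  have c: "smooth_fun_near A p c"
    unfolding c_def using smooth_fun_nearI[OF smooth_fun_indicator] W by blast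
  have "v (\<lambda>q. c q) = v (\<lambda>q. c q * c q)" by (rule arg_cong[of _ _ v]) (auto simp: c_def)
  then have "v c = 0" using tangent_mult[OF v c c] W by (simp add: c_def)
  then have "v (\<lambda>q. c q * f q) = v f" "v (\<lambda>q. c q * h q) = v h"
    using tangent_mult[OF v c] True h W by (auto simp: c_def)
  moreover have "(\<lambda>q. c q * f q) = (\<lambda>q. c q * h q)" using W by (auto simp: c_def)
  ultimately show ?thesis by simp
next
  case False
  then have "\<not> smooth_fun_near A p h" using smooth_fun_near_cong[OF W(1,2), of h f] W(3) by auto
  then show ?thesis using False v tangent_not_smooth by metis
qed

lemma tangent_minus:
  assumes "v \<in> tangent_space A p" "smooth_fun_near A p f"
  shows "v (\<lambda>q. - f q) = - v f"
  using tangent_cmult[OF assms, of "-1"] by simp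

lemma tangent_diff:
  assumes "v \<in> tangent_space A p" "smooth_fun_near A p f" "smooth_fun_near A p h"
  shows "v (\<lambda>q. f q - h q) = v f - v h"
  using tangent_add[OF assms(1,2) smooth_fun_near_add(2)[OF smooth_fun_near_const assms(3), of "-1"]]
    tangent_cmult[OF assms(1,3), of "-1"] by simp

lemma vf_open: "vector_field A W X \<Longrightarrow> open W"
  by (simp add: vector_field_def)

lemma vf_tangent: "vector_field A W X \<Longrightarrow> q \<in> W \<Longrightarrow> X q \<in> tangent_space A q"
  by (simp add: vector_field_def)

lemma vf_smooth: "vector_field A U X \<Longrightarrow> W \<subseteq> U \<Longrightarrow> smooth_fun A W f \<Longrightarrow> smooth_fun A W (\<lambda>q. X q f)"
  by (simp add: vector_field_def)

lemma vf_smooth_near: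
  assumes "vector_field A U X" "p \<in> U" "smooth_fun_near A p f"
  shows "smooth_fun_near A p (\<lambda>q. X q f)"
proof -
  obtain W where W: "p \<in> W" "smooth_fun A W f" using assms(3) by (auto simp: smooth_fun_near_def)
  have "smooth_fun A (U \<inter> W) f"
    by (rule smooth_fun_subset[OF W(2)]) (use assms W smooth_fun_open vf_open in auto)
  then have "smooth_fun A (U \<inter> W) (\<lambda>q. X q f)" using vf_smooth[OF assms(1)] by blast
  then show ?thesis using assms W by (auto intro: smooth_fun_nearI)
qed

lemma vf_subset: "vector_field A U X \<Longrightarrow> open W \<Longrightarrow> W \<subseteq> U \<Longrightarrow> vector_field A W X"
  by (auto simp: vector_field_def)

lemma vf_cong:
  assumes "vector_field A W X" "\<And>q. q \<in> W \<Longrightarrow> X q = Y q"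
  shows "vector_field A W Y"
  unfolding vector_field_def
proof (intro conjI allI impI ballI)
  show "open W" using assms vf_open by auto
  show "Y q \<in> tangent_space A q" if "q \<in> W" for q using vf_tangent[OF assms(1) that] assms(2) that by simp
  fix W' f assume *: "W' \<subseteq> W \<and> smooth_fun A W' f"
  show "smooth_fun A W' (\<lambda>q. Y q f)"
    by (rule smooth_fun_cong[OF vf_smooth[OF assms(1)]]) (use * assms(2) in auto)
qed

lemma vf_local:
  assumes "open W" "\<And>q. q \<in> W \<Longrightarrow> \<exists>W'. q \<in> W' \<and> vector_field A W' X"
  shows "vector_field A W X"
  unfolding vector_field_def
proof (intro conjI allI impI ballI)
  show "open W" using assms by auto
  show "X q \<in> tangent_space A q" if "q \<in> W" for q using assms(2)[OF that] vf_tangent by auto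
  fix T f assume *: "T \<subseteq> W \<and> smooth_fun A T f"
  show "smooth_fun A T (\<lambda>q. X q f)"
  proof (rule smooth_fun_local)
    show "open T" using * smooth_fun_open by auto
    fix q assume "q \<in> T"
    then obtain W' where W': "q \<in> W'" "vector_field A W' X" using assms(2) * by blast
    have "smooth_fun A (T \<inter> W') f"
      by (rule smooth_fun_subset[of T]) (use * W' vf_open smooth_fun_open in auto)
    then have "smooth_fun A (T \<inter> W') (\<lambda>q. X q f)" using vf_smooth[OF W'(2)] by blast
    then show "\<exists>W'. q \<in> W' \<and> smooth_fun A W' (\<lambda>q. X q f)" using \<open>q \<in> T\<close> W' by blast
  qed
qed

lemma vf_zero: "open W \<Longrightarrow> vector_field A W (\<lambda>q. 0)"
  using subspace_0[OF tangent_subspace] smooth_fun_const smooth_fun_open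
  by (auto simp: vector_field_def)

lemma vf_add:
  assumes "vector_field A W X" "vector_field A W Y"
  shows "vector_field A W (\<lambda>q. X q + Y q)"
  unfolding vector_field_def
proof (intro conjI allI impI ballI)
  show "open W" using assms vf_open by auto
  show "X q + Y q \<in> tangent_space A q" if "q \<in> W" for q
    using assms that by (intro subspace_add[OF tangent_subspace] vf_tangent)
  fix T f assume *: "T \<subseteq> W \<and> smooth_fun A T f"
  show "smooth_fun A T (\<lambda>q. (X q + Y q) f)"
    using * assms vf_smooth by (simp add: smooth_fun_add)
qed

lemma vf_scale:
  assumes "smooth_fun A W h" "vector_field A W Y"
  shows "vector_field A W (\<lambda>q. h q *\<^sub>R Y q)"
  unfolding vector_field_def
proof (intro conjI allI impI ballI)
  show "open W" using assms vf_open by auto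
  show "h q *\<^sub>R Y q \<in> tangent_space A q" if "q \<in> W" for q
    using assms that by (intro subspace_scale[OF tangent_subspace] vf_tangent)
  fix T f assume *: "T \<subseteq> W \<and> smooth_fun A T f"
  then have "smooth_fun A T h" using assms smooth_fun_subset smooth_fun_open by blast
  then show "smooth_fun A T (\<lambda>q. (h q *\<^sub>R Y q) f)"
    using * assms vf_smooth by (simp add: smooth_fun_mult)
qed

lemma vf_cscale: "vector_field A W Y \<Longrightarrow> vector_field A W (\<lambda>q. c *\<^sub>R Y q)"
  using vf_scale[OF smooth_fun_const] vf_open by blast

lemma vf_minus: "vector_field A W Y \<Longrightarrow> vector_field A W (\<lambda>q. - Y q)"
  using vf_cscale[of W Y "-1"] by simp

lemma vf_diff: "vector_field A W X \<Longrightarrow> vector_field A W Y \<Longrightarrow> vector_field A W (\<lambda>q. X q - Y q)"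
  using vf_add[OF _ vf_minus, of W X Y] by simp

lemma vf_sum:
  assumes "open W" "\<And>i. i \<in> J \<Longrightarrow> vector_field A W (X i)"
  shows "vector_field A W (\<lambda>q. \<Sum>i\<in>J. X i q)"
  using assms(2)
  by (induction J rule: infinite_finite_induct) (auto intro: vf_zero assms vf_add)

section \<open>The Lie bracket\<close>

lemma bracket_apply:
  "smooth_fun_near A p f \<Longrightarrow> lie_bracket A X Y p f = X p (\<lambda>q. Y q f) - Y p (\<lambda>q. X q f)"
  by (simp add: lie_bracket_def)

text \<open>The mixed terms X(f) Y(h) + Y(f) X(h) of the product rule are symmetric in X and Y, so
  they cancel. The inner derivatives are taken at points near \<open>p\<close>, hence the rules for
  sums and products are first recorded on a common neighbourhood.\<close>

lemma bracket_tangent: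
  assumes X: "vector_field A W X" and Y: "vector_field A W Y" and p: "p \<in> W"
  shows "lie_bracket A X Y p \<in> tangent_space A p"
  unfolding tangent_space_def mem_Collect_eq
proof (intro conjI allI impI)
  note Xp = vf_tangent[OF X p] and Yp = vf_tangent[OF Y p]
  fix f h assume *: "smooth_fun_near A p f \<and> smooth_fun_near A p h"
  then obtain T T' where T: "p \<in> T" "smooth_fun A T f" "p \<in> T'" "smooth_fun A T' h"
    by (auto simp: smooth_fun_near_def)
  define V where "V = W \<inter> T \<inter> T'"
  have V: "open V" "p \<in> V" "V \<subseteq> W"
    using T p smooth_fun_open vf_open[OF X] by (auto simp: V_def)
  have f: "smooth_fun_near A q f" "smooth_fun_near A q h" if "q \<in> V" for q
    using T that smooth_fun_nearI by (auto simp: V_def)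
  note n = f[OF V(2)] vf_smooth_near[OF X p] vf_smooth_near[OF Y p] smooth_fun_near_add
  have e: "Z q (f + h) = Z q f + Z q h" "Z q (f * h) = Z q f * h q + f q * Z q h"
    if "q \<in> V" "vector_field A W Z" for q Z
    using tangent_add[OF vf_tangent[OF that(2)] f[OF that(1)]]
      tangent_mult[OF vf_tangent[OF that(2)] f[OF that(1)]] that(1) V(3)
    by (auto simp: plus_fun_def times_fun_def)
  have "X p (\<lambda>q. Y q (f + h)) = X p (\<lambda>q. Y q f + Y q h)"
    "Y p (\<lambda>q. X q (f + h)) = Y p (\<lambda>q. X q f + X q h)"
    using e X Y by (auto intro: tangent_cong[OF Xp V(1,2)] tangent_cong[OF Yp V(1,2)])
  then show "lie_bracket A X Y p (f + h) = lie_bracket A X Y p f + lie_bracket A X Y p h"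
    using n Xp Yp 
    by (simp add: bracket_apply plus_fun_def tangent_add[OF Xp] tangent_add[OF Yp])
  have "X p (\<lambda>q. Y q (f * h)) = X p (\<lambda>q. Y q f * h q + f q * Y q h)"
    "Y p (\<lambda>q. X q (f * h)) = Y p (\<lambda>q. X q f * h q + f q * X q h)"
    using e X Y by (auto intro: tangent_cong[OF Xp V(1,2)] tangent_cong[OF Yp V(1,2)])
  then show "lie_bracket A X Y p (f * h) = lie_bracket A X Y p f * h p + f p * lie_bracket A X Y p h"
    using n Xp Yp by (simp add: bracket_apply times_fun_def tangent_add[OF Xp] tangent_add[OF Yp]
      tangent_mult[OF Xp] tangent_mult[OF Yp] algebra_simps)
next
  note Xp = vf_tangent[OF X p] and Yp = vf_tangent[OF Y p]
  fix c f assume f: "smooth_fun_near A p f"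
  then obtain T where T: "p \<in> T" "smooth_fun A T f" by (auto simp: smooth_fun_near_def)
  have V: "open (W \<inter> T)" "p \<in> W \<inter> T" using T p smooth_fun_open vf_open[OF X] by auto
  have c: "c *\<^sub>R f = (\<lambda>q. c * f q)" by (simp add: fun_eq_iff)
  have e: "Z q (c *\<^sub>R f) = c * Z q f" if "q \<in> W \<inter> T" "vector_field A W Z" for q Z
    unfolding c using tangent_cmult[OF vf_tangent[OF that(2)] smooth_fun_nearI[OF T(2)]] that by auto
  have "X p (\<lambda>q. Y q (c *\<^sub>R f)) = X p (\<lambda>q. c * Y q f)"
    "Y p (\<lambda>q. X q (c *\<^sub>R f)) = Y p (\<lambda>q. c * X q f)"
    using e X Y by (auto intro!: tangent_cong[OF Xp V] tangent_cong[OF Yp V])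
  moreover have "smooth_fun_near A p (c *\<^sub>R f)"
    unfolding c using smooth_fun_near_add(2)[OF smooth_fun_near_const f] .
  ultimately show "lie_bracket A X Y p (c *\<^sub>R f) = c * lie_bracket A X Y p f"
    using f vf_smooth_near[OF X p f] vf_smooth_near[OF Y p f] Xp Yp
    by (simp add: bracket_apply tangent_cmult[OF Xp] tangent_cmult[OF Yp] algebra_simps)
qed (simp add: lie_bracket_def)

lemma vf_bracket:
  assumes X: "vector_field A W X" and Y: "vector_field A W Y"
  shows "vector_field A W (lie_bracket A X Y)"
  unfolding vector_field_def
proof (intro conjI allI impI ballI)
  show "open W" using vf_open[OF X] .
  show "lie_bracket A X Y q \<in> tangent_space A q" if "q \<in> W" for q
    using bracket_tangent[OF X Y that] .
  fix T f assume *: "T \<subseteq> W \<and> smooth_fun A T f"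
  show "smooth_fun A T (\<lambda>q. lie_bracket A X Y q f)"
  proof (rule smooth_fun_cong)
    show "smooth_fun A T (\<lambda>q. X q (\<lambda>q. Y q f) - Y q (\<lambda>q. X q f))"
      using * X Y vf_smooth by (intro smooth_fun_diff) blast+
    show "X q (\<lambda>q. Y q f) - Y q (\<lambda>q. X q f) = lie_bracket A X Y q f" if "q \<in> T" for q
      using * that smooth_fun_nearI by (subst bracket_apply) auto
  qed
qed

lemma bracket_cong:
  assumes "vector_field A W X" "vector_field A W Y" "p \<in> W"
    and "\<And>q. q \<in> W \<Longrightarrow> X q = X' q" "\<And>q. q \<in> W \<Longrightarrow> Y q = Y' q"
  shows "lie_bracket A X Y p = lie_bracket A X' Y' p"
proof
  note o = vf_open[OF assms(1)]
  fix f
  have "X p (\<lambda>q. Y q f) = X p (\<lambda>q. Y' q f)" "Y p (\<lambda>q. X q f) = Y p (\<lambda>q. X' q f)"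
    using assms(4,5)
    by (auto intro!: tangent_cong[OF vf_tangent[OF assms(1,3)] o assms(3)]
        tangent_cong[OF vf_tangent[OF assms(2,3)] o assms(3)])
  then show "lie_bracket A X Y p f = lie_bracket A X' Y' p f"
    using assms(3-5) by (simp add: lie_bracket_def)
qed

lemma bracket_swap: "lie_bracket A Y X p = - lie_bracket A X Y p"
  by (simp add: lie_bracket_def fun_eq_iff)

lemma tangent_eqI:
  assumes "v \<in> tangent_space A p" "w \<in> tangent_space A p"
    and "\<And>f. smooth_fun_near A p f \<Longrightarrow> v f = w f"
  shows "v = w"
proof
  fix f show "v f = w f"
    using assms tangent_not_smooth by (cases "smooth_fun_near A p f") metis+
qed

lemma bracket_add:
  assumes X: "vector_field A W X" and Y: "vector_field A W Y" and Z: "vector_field A W Z" and p: "p \<in> W"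
  shows "lie_bracket A X (\<lambda>q. Y q + Z q) p = lie_bracket A X Y p + lie_bracket A X Z p"
proof (rule tangent_eqI)
  show "lie_bracket A X (\<lambda>q. Y q + Z q) p \<in> tangent_space A p"
    using bracket_tangent[OF X vf_add[OF Y Z] p] .
  show "lie_bracket A X Y p + lie_bracket A X Z p \<in> tangent_space A p"
    using bracket_tangent[OF X _ p] Y Z by (intro subspace_add[OF tangent_subspace])
  fix f assume f: "smooth_fun_near A p f"
  show "lie_bracket A X (\<lambda>q. Y q + Z q) p f = (lie_bracket A X Y p + lie_bracket A X Z p) f"
    using f vf_smooth_near[OF _ p f] Y Z by (simp add: bracket_apply tangent_add[OF vf_tangent[OF X p]])
qed

lemma bracket_scale:
  assumes X: "vector_field A W X" and Y: "vector_field A W Y" and h: "smooth_fun A W h" and p: "p \<in> W"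
  shows "lie_bracket A X (\<lambda>q. h q *\<^sub>R Y q) p = X p h *\<^sub>R Y p + h p *\<^sub>R lie_bracket A X Y p"
proof (rule tangent_eqI)
  show "lie_bracket A X (\<lambda>q. h q *\<^sub>R Y q) p \<in> tangent_space A p"
    using bracket_tangent[OF X vf_scale[OF h Y] p] .
  show "X p h *\<^sub>R Y p + h p *\<^sub>R lie_bracket A X Y p \<in> tangent_space A p"
    using bracket_tangent[OF X Y p] vf_tangent[OF Y p]
    by (intro subspace_add[OF tangent_subspace] subspace_scale[OF tangent_subspace])
  fix f assume f: "smooth_fun_near A p f"
  show "lie_bracket A X (\<lambda>q. h q *\<^sub>R Y q) p f = (X p h *\<^sub>R Y p + h p *\<^sub>R lie_bracket A X Y p) f"
    using f vf_smooth_near[OF Y p f] smooth_fun_nearI[OF h p]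
    by (simp add: bracket_apply tangent_mult[OF vf_tangent[OF X p]] algebra_simps)
qed

lemma bracket_add_left:
  assumes "vector_field A W X" "vector_field A W Y" "vector_field A W Z" "p \<in> W"
  shows "lie_bracket A (\<lambda>q. X q + Y q) Z p = lie_bracket A X Z p + lie_bracket A Y Z p"
  unfolding bracket_swap[of "\<lambda>q. X q + Y q" Z p] bracket_add[OF assms(3,1,2,4)]
    bracket_swap[of Z X p] bracket_swap[of Z Y p]
  by simp

lemma bracket_scale_left:
  assumes "vector_field A W X" "vector_field A W Y" "smooth_fun A W h" "p \<in> W"
  shows "lie_bracket A (\<lambda>q. h q *\<^sub>R X q) Y p = h p *\<^sub>R lie_bracket A X Y p - Y p h *\<^sub>R X p"
  unfolding bracket_swap[of "\<lambda>q. h q *\<^sub>R X q" Y p] bracket_scale[OF assms(2,1,3,4)] bracket_swap[of Y X p]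
  by simp

lemma bracket_sum:
  assumes X: "vector_field A W X" and "\<And>i. i \<in> J \<Longrightarrow> vector_field A W (Y i)" and p: "p \<in> W"
  shows "lie_bracket A X (\<lambda>q. \<Sum>i\<in>J. Y i q) p = (\<Sum>i\<in>J. lie_bracket A X (Y i) p)"
  using assms(2)
proof (induction J rule: infinite_finite_induct)
  case (insert i J)
  have "lie_bracket A X (\<lambda>q. \<Sum>i\<in>insert i J. Y i q) p = lie_bracket A X (\<lambda>q. Y i q + (\<Sum>i\<in>J. Y i q)) p"
    using insert.hyps by simp
  also have "\<dots> = lie_bracket A X (Y i) p + lie_bracket A X (\<lambda>q. \<Sum>i\<in>J. Y i q) p"
    using insert.prems by (intro bracket_add[OF X _ vf_sum[OF vf_open[OF X]] p]) auto
  also have "lie_bracket A X (\<lambda>q. \<Sum>i\<in>J. Y i q) p = (\<Sum>i\<in>J. lie_bracket A X (Y i) p)"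
    using insert by blast
  finally show ?case by (simp only: sum.insert[OF insert.hyps])
qed (use vf_tangent[OF X p] tangent_const in
    \<open>auto simp: lie_bracket_def fun_eq_iff\<close>)

text \<open>Each double bracket contributes four third order terms, and the twelve terms cancel in
  pairs. Expanding the inner bracket is legitimate because \<open>f\<close> is smooth near every
  point of a neighbourhood of \<open>p\<close>, not only near \<open>p\<close>.\<close>

lemma jacobi:
  assumes X: "vector_field A W X" and Y: "vector_field A W Y" and Z: "vector_field A W Z" and p: "p \<in> W"
  shows "lie_bracket A (lie_bracket A X Y) Z p + lie_bracket A (lie_bracket A Y Z) X p
    + lie_bracket A (lie_bracket A Z X) Y p = 0"
proof (rule tangent_eqI)
  note b = bracket_tangent[OF vf_bracket _ p]
  show "lie_bracket A (lie_bracket A X Y) Z p + lie_bracket A (lie_bracket A Y Z) X p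
      + lie_bracket A (lie_bracket A Z X) Y p \<in> tangent_space A p"
    using b X Y Z by (intro subspace_add[OF tangent_subspace])
  show "0 \<in> tangent_space A p" using subspace_0[OF tangent_subspace] .
  fix f assume f: "smooth_fun_near A p f"
  then obtain T where T: "p \<in> T" "smooth_fun A T f" by (auto simp: smooth_fun_near_def)
  have V: "open (W \<inter> T)" "p \<in> W \<inter> T" using T p smooth_fun_open vf_open[OF X] by auto
  have n: "smooth_fun_near A q f" if "q \<in> W \<inter> T" for q using T that smooth_fun_nearI by auto
  have e: "lie_bracket A (lie_bracket A X Y) Z p f = X p (\<lambda>q. Y q (\<lambda>q. Z q f)) - Y p (\<lambda>q. X q (\<lambda>q. Z q f))
      - Z p (\<lambda>q. X q (\<lambda>q. Y q f)) + Z p (\<lambda>q. Y q (\<lambda>q. X q f))"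
    if X: "vector_field A W X" and Y: "vector_field A W Y" and Z: "vector_field A W Z" for X Y Z
  proof -
    have "Z p (\<lambda>q. lie_bracket A X Y q f) = Z p (\<lambda>q. X q (\<lambda>q. Y q f) - Y q (\<lambda>q. X q f))"
      by (rule tangent_cong[OF vf_tangent[OF Z p] V]) (use n in \<open>simp add: bracket_apply\<close>)
    also have "\<dots> = Z p (\<lambda>q. X q (\<lambda>q. Y q f)) - Z p (\<lambda>q. Y q (\<lambda>q. X q f))"
      using f vf_smooth_near[OF X p] vf_smooth_near[OF Y p]
      by (intro tangent_diff[OF vf_tangent[OF Z p]]) auto
    finally show ?thesis
      using f vf_smooth_near[OF Z p] by (simp add: bracket_apply)
  qed
  show "(lie_bracket A (lie_bracket A X Y) Z p + lie_bracket A (lie_bracket A Y Z) X p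
      + lie_bracket A (lie_bracket A Z X) Y p) f = 0 f"
    using e[OF X Y Z] e[OF Y Z X] e[OF Z X Y] by simp
qed

end

section \<open>Paraquaternionic linear algebra\<close>

lemma eps_simps [simp]: "\<epsilon> (Suc 0) = 1" "\<epsilon> 1 = 1" "\<epsilon> 2 = 1" "\<epsilon> 3 = -1"
  by (auto simp: \<epsilon>_def)

lemma eps_sq [simp]: "\<epsilon> s * \<epsilon> s = 1" "\<epsilon> s * (\<epsilon> s * x) = x"
  by (auto simp: \<epsilon>_def)

lemma eps_nz [simp]: "\<epsilon> s \<noteq> 0"
  by (simp add: \<epsilon>_def)

lemma eps_cancel: "\<epsilon> s * a = \<epsilon> s * b \<Longrightarrow> a = b"
  by (auto simp: \<epsilon>_def split: if_splits)

lemma eps_cases: "\<epsilon> s = 1 \<or> \<epsilon> s = -1"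
  by (auto simp: \<epsilon>_def)

definition Idx :: "nat set" where
  "Idx = {1, 2, 3}"

lemma Idx_mem [simp]: "1 \<in> Idx" "Suc 0 \<in> Idx" "2 \<in> Idx" "3 \<in> Idx" "finite Idx"
  by (auto simp: Idx_def)

lemma sum_123: "(\<Sum>t\<in>Idx. f t) = f 1 + f 2 + (f 3 :: 'a::comm_monoid_add)"
  by (simp add: Idx_def add.assoc)

definition cyc :: "nat \<Rightarrow> nat \<Rightarrow> nat \<Rightarrow> bool" where
  "cyc i j k \<longleftrightarrow> (i, j, k) \<in> {(1,2,3), (2,3,1), (3,1,2)}"

lemma cyc_mem: "cyc i j k \<Longrightarrow> i \<in> Idx \<and> j \<in> Idx \<and> k \<in> Idx"
  by (auto simp: cyc_def Idx_def)

lemma cyc_distinct: "cyc i j k \<Longrightarrow> i \<noteq> j \<and> i \<noteq> k \<and> j \<noteq> k"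
  by (auto simp: cyc_def)

lemma cyc_rot: "cyc i j k \<Longrightarrow> cyc j k i"
  by (auto simp: cyc_def)

text \<open>The product of the three signs is -1.\<close>

lemma cyc_eps: "cyc i j k \<Longrightarrow> \<epsilon> j = - \<epsilon> i * \<epsilon> k"
  by (auto simp: cyc_def)

lemma cyc_cases: "s \<in> Idx \<Longrightarrow> \<exists>j k. cyc s j k"
  by (auto simp: Idx_def cyc_def)

lemma cyc_pair: "s \<in> Idx \<Longrightarrow> t \<in> Idx \<Longrightarrow> s \<noteq> t \<Longrightarrow> \<exists>k. cyc s t k \<or> cyc t s k"
  by (auto simp: Idx_def cyc_def)

section \<open>Symmetric forms in an orthogonal basis: expansion, contraction, trace\<close>

locale orth_space =
  fixes S :: "'a::real_vector set" and g :: "'a \<Rightarrow> 'a \<Rightarrow> real" and N :: nat and E :: "nat \<Rightarrow> 'a"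
  assumes S: "subspace S"
    and g_lin: "x \<in> S \<Longrightarrow> linear_on S (g x)"
    and g_sym: "x \<in> S \<Longrightarrow> y \<in> S \<Longrightarrow> g x y = g y x"
    and E: "a < N \<Longrightarrow> E a \<in> S"
    and E_span: "span (E ` {..<N}) = S"
    and E_orth: "a < N \<Longrightarrow> b < N \<Longrightarrow> a \<noteq> b \<Longrightarrow> g (E a) (E b) = 0"
    and E_nz: "a < N \<Longrightarrow> g (E a) (E a) \<noteq> 0"
begin

lemma S_closed [simp, intro]: "0 \<in> S" "x \<in> S \<Longrightarrow> y \<in> S \<Longrightarrow> x + y \<in> S" "x \<in> S \<Longrightarrow> c *\<^sub>R x \<in> S"
  "x \<in> S \<Longrightarrow> - x \<in> S" "x \<in> S \<Longrightarrow> y \<in> S \<Longrightarrow> x - y \<in> S"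
  using S by (auto intro: subspace_0 subspace_add subspace_scale subspace_neg subspace_diff)

lemma S_sum: "(\<And>i. i \<in> J \<Longrightarrow> x i \<in> S) \<Longrightarrow> (\<Sum>i\<in>J. x i) \<in> S"
  using subspace_sum[OF S] by blast

lemma g_right [simp]:
  "x \<in> S \<Longrightarrow> y \<in> S \<Longrightarrow> z \<in> S \<Longrightarrow> g x (y + z) = g x y + g x z"
  "x \<in> S \<Longrightarrow> y \<in> S \<Longrightarrow> g x (c *\<^sub>R y) = c * g x y"
  "x \<in> S \<Longrightarrow> y \<in> S \<Longrightarrow> g x (- y) = - g x y"
  "x \<in> S \<Longrightarrow> y \<in> S \<Longrightarrow> z \<in> S \<Longrightarrow> g x (y - z) = g x y - g x z"
  "x \<in> S \<Longrightarrow> g x 0 = 0"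
  using linear_onD[OF g_lin] linear_on_minus[OF g_lin] linear_on_diff[OF g_lin S]
    linear_on_zero[OF g_lin S] by auto

lemma g_left [simp]:
  "x \<in> S \<Longrightarrow> y \<in> S \<Longrightarrow> z \<in> S \<Longrightarrow> g (y + z) x = g y x + g z x"
  "x \<in> S \<Longrightarrow> y \<in> S \<Longrightarrow> g (c *\<^sub>R y) x = c * g y x"
  "x \<in> S \<Longrightarrow> y \<in> S \<Longrightarrow> g (- y) x = - g y x"
  "x \<in> S \<Longrightarrow> y \<in> S \<Longrightarrow> z \<in> S \<Longrightarrow> g (y - z) x = g y x - g z x"
  "x \<in> S \<Longrightarrow> g 0 x = 0"
  by (simp_all add: g_sym[of _ x])

lemma g_lin_left: "z \<in> S \<Longrightarrow> linear_on S (\<lambda>x. g x z)"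
  by (simp add: linear_on_def)

lemma g_sum_right:
  "x \<in> S \<Longrightarrow> (\<And>i. i \<in> J \<Longrightarrow> y i \<in> S) \<Longrightarrow> g x (\<Sum>i\<in>J. y i) = (\<Sum>i\<in>J. g x (y i))"
  using linear_on_sum[OF g_lin S] by blast

lemma g_sum_left:
  "x \<in> S \<Longrightarrow> (\<And>i. i \<in> J \<Longrightarrow> y i \<in> S) \<Longrightarrow> g (\<Sum>i\<in>J. y i) x = (\<Sum>i\<in>J. g (y i) x)"
  by (rule linear_on_sum[OF g_lin_left S])

text \<open>The vectors with this expansion form a subspace, and orthogonality puts every
  \<open>E b\<close> into it. The basis is orthogonal rather than orthonormal so that smooth frames
  arise by divisions alone; the weights \<open>g (E a) (E a)\<close> are carried along.\<close>

lemma expand: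
  assumes "x \<in> S"
  shows "x = (\<Sum>a<N. (g x (E a) / g (E a) (E a)) *\<^sub>R E a)"
proof -
  define T where "T = {x \<in> S. x = (\<Sum>a<N. (g x (E a) / g (E a) (E a)) *\<^sub>R E a)}"
  have "subspace T"
    unfolding subspace_def
  proof (intro conjI ballI allI)
    show "0 \<in> T" using E by (auto simp: T_def)
    show "x + y \<in> T" if "x \<in> T" "y \<in> T" for x y
    proof -
      have "(\<Sum>a<N. (g (x + y) (E a) / g (E a) (E a)) *\<^sub>R E a) =
        (\<Sum>a<N. (g x (E a) / g (E a) (E a)) *\<^sub>R E a) + (\<Sum>a<N. (g y (E a) / g (E a) (E a)) *\<^sub>R E a)"
        using that E unfolding sum.distrib[symmetric]
        by (intro sum.cong) (auto simp: T_def add_divide_distrib scaleR_left_distrib)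
      also have "\<dots> = x + y" using that by (auto simp: T_def)
      finally show ?thesis using that by (simp add: T_def)
    qed
    show "c *\<^sub>R x \<in> T" if "x \<in> T" for c x
    proof -
      have "(\<Sum>a<N. (g (c *\<^sub>R x) (E a) / g (E a) (E a)) *\<^sub>R E a) =
        c *\<^sub>R (\<Sum>a<N. (g x (E a) / g (E a) (E a)) *\<^sub>R E a)"
        using that E unfolding scaleR_sum_right by (intro sum.cong) (auto simp: T_def)
      also have "\<dots> = c *\<^sub>R x" using that by (auto simp: T_def)
      finally show ?thesis using that by (simp add: T_def)
    qed
  qed
  moreover have "E b \<in> T" if "b < N" for b
  proof -
    have "(\<Sum>a<N. (g (E b) (E a) / g (E a) (E a)) *\<^sub>R E a) = (\<Sum>a<N. if a = b then E a else 0)"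
      using that E_orth E_nz by (intro sum.cong) auto
    then show ?thesis using that E by (simp add: T_def)
  qed
  ultimately have "span (E ` {..<N}) \<subseteq> T" by (intro span_minimal) auto
  then have "x \<in> T" using assms E_span by auto
  then show ?thesis by (simp add: T_def)
qed

text \<open>The form in which all traces below are evaluated: a sum over the basis into which
  \<open>x\<close> enters through \<open>g\<close> collapses to a single value of
  \<open>f\<close>.\<close>

lemma contract:
  assumes "x \<in> S" "linear_on S f"
  shows "(\<Sum>a<N. (g x (E a) / g (E a) (E a)) *\<^sub>R f (E a)) = f x"
proof -
  have "f x = f (\<Sum>a<N. (g x (E a) / g (E a) (E a)) *\<^sub>R E a)" using expand[OF assms(1)] by simp
  also have "\<dots> = (\<Sum>a<N. f ((g x (E a) / g (E a) (E a)) *\<^sub>R E a))"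
    using E by (intro linear_on_sum[OF assms(2) S]) auto
  also have "\<dots> = (\<Sum>a<N. (g x (E a) / g (E a) (E a)) *\<^sub>R f (E a))"
    using E linear_onD(2)[OF assms(2)] by (intro sum.cong) auto
  finally show ?thesis by simp
qed

lemma nondeg:
  assumes "x \<in> S" "\<And>a. a < N \<Longrightarrow> g x (E a) = 0"
  shows "x = 0"
  using expand[OF assms(1)] assms(2) by simp

lemma nondeg2:
  assumes "x \<in> S" "y \<in> S" "\<And>z. z \<in> S \<Longrightarrow> g x z = g y z"
  shows "x = y"
  using nondeg[of "x - y"] assms E by simp

text \<open>Expand \<open>F b\<close> in the basis \<open>E\<close> in the first argument, exchange
  the two sums, and contract the second argument over the basis \<open>F\<close>.\<close>

lemma trace_indep:
  assumes "orth_space S g M F"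
    and "\<And>x. x \<in> S \<Longrightarrow> linear_on S (\<beta> x)" "\<And>y. y \<in> S \<Longrightarrow> linear_on S (\<lambda>x. \<beta> x y)"
  shows "(\<Sum>b<M. \<beta> (F b) (F b) / g (F b) (F b)) = (\<Sum>a<N. \<beta> (E a) (E a) / g (E a) (E a))"
proof -
  interpret F: orth_space S g M F by fact
  have "(\<Sum>b<M. \<beta> (F b) (F b) / g (F b) (F b)) =
    (\<Sum>b<M. (\<Sum>a<N. (g (F b) (E a) / g (E a) (E a)) *\<^sub>R \<beta> (E a) (F b)) / g (F b) (F b))"
    using F.E contract[OF _ assms(3)] by (intro sum.cong) auto
  also have "\<dots> = (\<Sum>b<M. \<Sum>a<N. (g (E a) (F b) / g (F b) (F b)) *\<^sub>R \<beta> (E a) (F b) / g (E a) (E a))"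
    unfolding sum_divide_distrib using E F.E g_sym by (intro sum.cong) auto
  also have "\<dots> = (\<Sum>a<N. (\<Sum>b<M. (g (E a) (F b) / g (F b) (F b)) *\<^sub>R \<beta> (E a) (F b)) / g (E a) (E a))"
    unfolding sum_divide_distrib by (rule sum.swap)
  also have "\<dots> = (\<Sum>a<N. \<beta> (E a) (E a) / g (E a) (E a))"
    using E F.contract[OF _ assms(2)] by (intro sum.cong) auto
  finally show ?thesis .
qed

definition tr :: "('a \<Rightarrow> 'a) \<Rightarrow> ('a \<Rightarrow> 'a) \<Rightarrow> real" where
  "tr B C = (\<Sum>a<N. g (B (E a)) (C (E a)) / g (E a) (E a))"

text \<open>\<open>endo_inner\<close> uses an orthonormal basis picked by \<open>SOME\<close>, about
  which nothing else is known; independence of the basis moves the computation to \<open>E\<close>.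
  For a unit vector, multiplying by \<open>g (e b) (e b)\<close>, which is 1 or -1, is the same as
  dividing by it.\<close>

lemma endo_inner_tr:
  assumes "orthonormal_basis g S e0"
    and "linear_on S B" "B ` S \<subseteq> S" "linear_on S C" "C ` S \<subseteq> S"
  shows "endo_inner g S B C = tr B C"
proof -
  define e where "e = (SOME e. orthonormal_basis g S e)"
  have e: "orthonormal_basis g S e" unfolding e_def by (rule someI[of "orthonormal_basis g S", OF assms(1)])
  have "orth_space S g (dim S) e"
  proof
    show "subspace S" "x \<in> S \<Longrightarrow> linear_on S (g x)" "x \<in> S \<Longrightarrow> y \<in> S \<Longrightarrow> g x y = g y x" for x y
      using S g_lin g_sym by auto
    show sp: "span (e ` {..<dim S}) = S" using e by (simp add: orthonormal_basis_def is_basis_def)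
    then show "a < dim S \<Longrightarrow> e a \<in> S" for a using span_base[of "e a" "e ` {..<dim S}"] by auto
    have "\<bar>g (e a) (e b)\<bar> = (if a = b then 1 else 0)" if "a < dim S" "b < dim S" for a b
      using e that by (simp add: orthonormal_basis_def)
    then show "a < dim S \<Longrightarrow> b < dim S \<Longrightarrow> a \<noteq> b \<Longrightarrow> g (e a) (e b) = 0"
      "a < dim S \<Longrightarrow> g (e a) (e a) \<noteq> 0" for a b
      by (metis abs_eq_0, metis abs_zero zero_neq_one)
  qed
  moreover have "linear_on S (\<lambda>y. g (B x) (C y))" "linear_on S (\<lambda>y. g (B y) (C x))" if "x \<in> S" for x
    using that assms(3,5) linear_onD[OF assms(2)] linear_onD[OF assms(4)]
    by (auto simp: linear_on_def image_subset_iff)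
  ultimately have "(\<Sum>b<dim S. g (B (e b)) (C (e b)) / g (e b) (e b)) = tr B C"
    unfolding tr_def by (intro trace_indep[where \<beta> = "\<lambda>x y. g (B x) (C y)"])
  moreover have "g (e b) (e b) * g (B (e b)) (C (e b)) = g (B (e b)) (C (e b)) / g (e b) (e b)"
    if "b < dim S" for b
  proof -
    have "\<bar>g (e b) (e b)\<bar> = 1" using e that by (auto simp: orthonormal_basis_def)
    then have "g (e b) (e b) = 1 \<or> g (e b) (e b) = -1" by linarith
    then show ?thesis by auto
  qed
  ultimately show ?thesis by (simp add: endo_inner_def e_def)
qed

end

section \<open>Paraquaternionic structures compatible with the form, and their fundamental
  2-forms\<close>

locale pq_space = orth_space +
  fixes I :: "nat \<Rightarrow> 'a \<Rightarrow> 'a"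
  assumes I_lin: "s \<in> Idx \<Longrightarrow> linear_on S (I s)"
    and I_in: "s \<in> Idx \<Longrightarrow> x \<in> S \<Longrightarrow> I s x \<in> S"
    and pq: "paraquaternionic S I"
    and I_g: "s \<in> Idx \<Longrightarrow> x \<in> S \<Longrightarrow> y \<in> S \<Longrightarrow> g (I s x) (I s y) = - \<epsilon> s * g x y"
begin

lemma I_closed [simp, intro]: "x \<in> S \<Longrightarrow> I 1 x \<in> S" "x \<in> S \<Longrightarrow> I (Suc 0) x \<in> S"
  "x \<in> S \<Longrightarrow> I 2 x \<in> S" "x \<in> S \<Longrightarrow> I 3 x \<in> S"
  by (simp_all add: I_in)

lemma I_linear:
  assumes "s \<in> Idx" "x \<in> S"
  shows "y \<in> S \<Longrightarrow> I s (x + y) = I s x + I s y" "I s (c *\<^sub>R x) = c *\<^sub>R I s x" "I s (- x) = - I s x"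
    "y \<in> S \<Longrightarrow> I s (x - y) = I s x - I s y"
  using linear_onD(1)[OF I_lin[OF assms(1)] assms(2)] linear_onD(2)[OF I_lin[OF assms(1)] assms(2)]
    linear_on_minus[OF I_lin[OF assms(1)] assms(2)] linear_on_diff[OF I_lin[OF assms(1)] S assms(2)]
  by simp_all

lemma I_sq: "s \<in> Idx \<Longrightarrow> x \<in> S \<Longrightarrow> I s (I s x) = \<epsilon> s *\<^sub>R x"
  using pq by (auto simp: paraquaternionic_def Idx_def)

lemma I_cyc:
  assumes "cyc i j k" "x \<in> S"
  shows "I i (I j x) = - \<epsilon> k *\<^sub>R I k x" "I j (I i x) = \<epsilon> k *\<^sub>R I k x"
  using pq assms unfolding paraquaternionic_def cyc_def by blast+

lemma I_anti:
  assumes "s \<in> Idx" "t \<in> Idx" "s \<noteq> t" "x \<in> S"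
  shows "I s (I t x) = - I t (I s x)"
proof -
  obtain k where "cyc s t k \<or> cyc t s k" using cyc_pair assms by blast
  then show ?thesis using I_cyc assms(4) by (metis minus_minus scaleR_minus_left)
qed

lemma I_skew:
  assumes "s \<in> Idx" "x \<in> S" "y \<in> S"
  shows "g (I s x) y = - g x (I s y)"
proof -
  have "g (I s x) (I s (I s y)) = - \<epsilon> s * g x (I s y)" using I_g[OF assms(1,2) I_in[OF assms(1,3)]] .
  then have "\<epsilon> s * g (I s x) y = \<epsilon> s * (- g x (I s y))" using I_sq[of s y] I_in[of s] assms by simp
  then show ?thesis by (rule eps_cancel)
qed

lemma I_orth: "s \<in> Idx \<Longrightarrow> x \<in> S \<Longrightarrow> g x (I s x) = 0"
  using I_skew[of s x x] g_sym[of x "I s x"] I_in by auto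

text \<open>For distinct indices I_s I_t is a multiple of the third structure, which is skew, so its
  quadratic form vanishes.\<close>

lemma I_inner:
  assumes "s \<in> Idx" "t \<in> Idx" "x \<in> S"
  shows "g (I s x) (I t x) = (if s = t then - \<epsilon> s * g x x else 0)"
proof (cases "s = t")
  case False
  then obtain k where k: "cyc s t k \<or> cyc t s k" using cyc_pair assms by blast
  then have "k \<in> Idx" using cyc_mem by blast
  have "g (I s x) (I t x) = - g x (I s (I t x))" using I_skew assms I_in by blast
  also have "\<dots> = 0"
  proof -
    obtain c where "I s (I t x) = c *\<^sub>R I k x" using k I_cyc assms(3) by metis
    then show ?thesis using I_orth[OF \<open>k \<in> Idx\<close>] I_in[OF \<open>k \<in> Idx\<close>] assms(3) by simp
  qed
  finally show ?thesis using False by simp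
qed (use I_g assms in simp)

text \<open>The fundamental 2-form of I_s. On horizontal vectors d\<eta>_s equals -2 \<epsilon>_s
  times it.\<close>

definition w :: "nat \<Rightarrow> 'a \<Rightarrow> 'a \<Rightarrow> real" where
  "w s x y = g (I s x) y"

lemma w_swap: "s \<in> Idx \<Longrightarrow> x \<in> S \<Longrightarrow> y \<in> S \<Longrightarrow> w s x y = - w s y x"
  using I_skew[of s x y] g_sym[of x "I s y"] I_in by (simp add: w_def)

text \<open>In rank greater than four, contracting a relation \<open>\<Sum>\<^sub>t b\<^sub>t \<and> w\<^sub>t = 0\<close> with the inverse of \<open>w\<^sub>j\<close>
  shows that all \<open>b\<^sub>t\<close> vanish.\<close>

lemma wedge_w_injective:
  assumes N: "N > 4" and b: "\<And>t. t \<in> Idx \<Longrightarrow> linear_on S (b t)"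
    and cyc0: "\<And>x y z. x \<in> S \<Longrightarrow> y \<in> S \<Longrightarrow> z \<in> S \<Longrightarrow>
      (\<Sum>t\<in>Idx. b t x * w t y z + b t y * w t z x + b t z * w t x y) = (0::real)"
    and t: "t \<in> Idx" "x \<in> S"
  shows "b t x = 0"
proof -
  \<comment> \<open>The relation is contracted at (x, E a, I_j (E a)). In the first of its three
    terms only t = j survives and gives the trace, hence the factor N; each of the other two
    collapses to b_t(I_j I_t x).\<close>
  have contr: "- real N * \<epsilon> j * b j x + 2 * (\<Sum>t\<in>Idx. b t (I j (I t x))) = 0"
    if j: "j \<in> Idx" and x: "x \<in> S" for j x
  proof -
    define G where "G a = g (E a) (E a)" for a
    have 1: "(\<Sum>a<N. b t x * w t (E a) (I j (E a)) / G a) = (if t = j then - real N * \<epsilon> j * b j x else 0)"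
      if t: "t \<in> Idx" for t
    proof -
      have "(\<Sum>a<N. b t x * w t (E a) (I j (E a)) / G a) = (\<Sum>a<N. if t = j then - \<epsilon> j * b j x else 0)"
      proof (rule sum.cong[OF refl])
        fix a assume "a \<in> {..<N}"
        then have a: "a < N" by simp
        show "b t x * w t (E a) (I j (E a)) / G a = (if t = j then - \<epsilon> j * b j x else 0)"
          using I_inner[OF t j E[OF a]] E_nz[OF a] by (simp add: w_def G_def)
      qed
      then show ?thesis by simp
    qed
    have 2: "(\<Sum>a<N. b t (E a) * w t (I j (E a)) x / G a) = b t (I j (I t x))" if t: "t \<in> Idx" for t
    proof -
      have "w t (I j (E a)) x = g (I j (I t x)) (E a)" if "a < N" for a
      proof -
        note E' = E[OF that] and x' = I_in[OF t x]
        have "w t (I j (E a)) x = - g (I j (E a)) (I t x)"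
          unfolding w_def by (rule I_skew[OF t I_in[OF j E'] x])
        also have "\<dots> = g (E a) (I j (I t x))" using I_skew[OF j E' x'] by linarith
        finally show ?thesis using g_sym[OF E' I_in[OF j x']] by linarith
      qed
      then have "(\<Sum>a<N. b t (E a) * w t (I j (E a)) x / G a) =
          (\<Sum>a<N. (g (I j (I t x)) (E a) / g (E a) (E a)) *\<^sub>R b t (E a))"
        by (intro sum.cong) (auto simp: G_def)
      then show ?thesis using contract[OF I_in[OF j I_in[OF t x]] b[OF t]] by linarith
    qed
    have 3: "(\<Sum>a<N. b t (I j (E a)) * w t x (E a) / G a) = b t (I j (I t x))" if t: "t \<in> Idx" for t
    proof -
      have "linear_on S (\<lambda>y. b t (I j y))"
        unfolding linear_on_def
        using linear_onD[OF b[OF t]] I_linear[OF j] I_in[OF j] by presburger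
      from contract[OF I_in[OF t x] this] show ?thesis
        by (simp add: G_def w_def mult.commute)
    qed
    have "0 = (\<Sum>a<N. (\<Sum>t\<in>Idx. b t x * w t (E a) (I j (E a)) + b t (E a) * w t (I j (E a)) x
        + b t (I j (E a)) * w t x (E a)) / G a)"
      using cyc0[OF x E I_in[OF j E]] by simp
    also have "\<dots> = (\<Sum>t\<in>Idx. (\<Sum>a<N. b t x * w t (E a) (I j (E a)) / G a)
        + (\<Sum>a<N. b t (E a) * w t (I j (E a)) x / G a) + (\<Sum>a<N. b t (I j (E a)) * w t x (E a) / G a))"
      unfolding sum_divide_distrib add_divide_distrib sum.distrib[symmetric]
      by (rule sum.swap)
    also have "\<dots> = (\<Sum>t\<in>Idx. (if t = j then - real N * \<epsilon> j * b j x else 0) + b t (I j (I t x)) + b t (I j (I t x)))"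
      by (rule sum.cong[OF refl]) (simp only: 1 2 3)
    also have "\<dots> = (\<Sum>t\<in>Idx. if t = j then - real N * \<epsilon> j * b j x else 0) + 2 * (\<Sum>t\<in>Idx. b t (I j (I t x)))"
      by (simp only: sum.distrib)
    also have "(\<Sum>t\<in>Idx. if t = j then - real N * \<epsilon> j * b j x else 0) = - real N * \<epsilon> j * b j x"
      using j by simp
    finally show ?thesis by simp
  qed
  \<comment> \<open>Evaluated at I_j x, the contraction becomes a linear system for the three
    numbers c_t = b_t(I_t x): (N - 4) c_j = -2 (c_1 + c_2 + c_3). Adding the three equations gives
    (N + 2) (c_1 + c_2 + c_3) = 0, and then N > 4 leaves only zero.\<close>
  have c: "b t (I t x) = 0" if t: "t \<in> Idx" and x: "x \<in> S" for t x
  proof -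
    define c where "c t = b t (I t x)" for t
    have "(real N - 4) * c j = - 2 * (c 1 + c 2 + c 3)" if j: "j \<in> Idx" for j
    proof -
      have e: "b t (I j (I t (I j x))) = (if t = j then \<epsilon> j else - \<epsilon> j) * c t" if t: "t \<in> Idx" for t
      proof (cases "t = j")
        case True
        then show ?thesis
          using I_sq[OF j x] I_linear(2)[OF j x] linear_onD(2)[OF b[OF j] I_in[OF j x]]
          by (simp add: c_def)
      next
        case False
        have "I j (I t (I j x)) = - I t (I j (I j x))"
          using I_anti[OF j t _ I_in[OF j x]] False by simp
        also have "\<dots> = (- \<epsilon> j) *\<^sub>R I t x" using I_sq[OF j x] I_linear(2)[OF t x] by simp
        finally show ?thesis
          using False linear_onD(2)[OF b[OF t] I_in[OF t x], of "- \<epsilon> j"] by (simp add: c_def)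
      qed
      have "- real N * \<epsilon> j * c j + 2 * (\<Sum>t\<in>Idx. (if t = j then \<epsilon> j else - \<epsilon> j) * c t) = 0"
        using contr[OF j I_in[OF j x]] sum.cong[OF refl e, of Idx] by (simp add: c_def)
      moreover have "(\<Sum>t\<in>Idx. (if t = j then \<epsilon> j else - \<epsilon> j) * c t) = \<epsilon> j * (2 * c j - (c 1 + c 2 + c 3))"
        using j unfolding sum_123 Idx_def by (elim insertE emptyE) simp_all
      ultimately have "\<epsilon> j * ((real N - 4) * c j) = \<epsilon> j * (- 2 * (c 1 + c 2 + c 3))"
        by (simp add: algebra_simps)
      then show ?thesis by (rule eps_cancel)
    qed
    note cs = this
    have "(real N - 4) * (c 1 + c 2 + c 3) = - 6 * (c 1 + c 2 + c 3)"
      using cs[of 1] cs[of 2] cs[of 3] by (simp add: algebra_simps)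
    then have "(real N + 2) * (c 1 + c 2 + c 3) = 0" by (simp add: algebra_simps)
    then have "c 1 + c 2 + c 3 = 0" by (simp only: mult_eq_0_iff) linarith
    then have "(real N - 4) * c t = 0" using cs[OF t] by simp
    then show ?thesis using N by (simp add: c_def)
  qed
  have "b t (I t (I t x)) = 0" using c[OF t(1) I_in[OF t]] .
  then show ?thesis using I_sq[OF t] linear_onD(2)[OF b[OF t(1)] t(2)] by simp
qed

end

text \<open>The algebraic properties of the covariant derivatives of \<open>I\<^sub>1, I\<^sub>2, I\<^sub>3\<close>: \<open>T s x\<close> stands for
  \<open>\<nabla>\<^sub>x I\<^sub>s\<close> of a metric connection.\<close>

locale derivation_tensor = pq_space +
  fixes T :: "nat \<Rightarrow> 'a \<Rightarrow> 'a \<Rightarrow> 'a"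
  assumes T_lin: "s \<in> Idx \<Longrightarrow> x \<in> S \<Longrightarrow> linear_on S (T s x)"
    and T_lin_left: "s \<in> Idx \<Longrightarrow> y \<in> S \<Longrightarrow> linear_on S (\<lambda>x. T s x y)"
    and T_in: "s \<in> Idx \<Longrightarrow> x \<in> S \<Longrightarrow> y \<in> S \<Longrightarrow> T s x y \<in> S"
    and T_anti: "s \<in> Idx \<Longrightarrow> x \<in> S \<Longrightarrow> y \<in> S \<Longrightarrow> T s x (I s y) = - I s (T s x y)"
    and T_skew: "s \<in> Idx \<Longrightarrow> x \<in> S \<Longrightarrow> y \<in> S \<Longrightarrow> z \<in> S \<Longrightarrow> g (T s x y) z = - g y (T s x z)"
    and T_cyc: "cyc i j k \<Longrightarrow> x \<in> S \<Longrightarrow> y \<in> S \<Longrightarrow> T j x (I i y) + I j (T i x y) = \<epsilon> k *\<^sub>R T k x y"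
begin

text \<open>For a metric connection this is the covariant derivative (\<nabla>_x w_s)(y, z).\<close>

definition "m s x y z = g (T s x y) z"

lemma m_swap:
  assumes "s \<in> Idx" "x \<in> S" "y \<in> S" "z \<in> S"
  shows "m s x y z = - m s x z y"
  unfolding m_def T_skew[OF assms] g_sym[OF assms(3) T_in[OF assms(1,2,4)]] ..

lemma m_scale:
  assumes "s \<in> Idx" "x \<in> S" "y \<in> S" "z \<in> S"
  shows "m s (c *\<^sub>R x) y z = c * m s x y z" "m s x (c *\<^sub>R y) z = c * m s x y z"
    "m s x y (c *\<^sub>R z) = c * m s x y z"
  unfolding m_def linear_onD(2)[OF T_lin_left[OF assms(1,3)] assms(2)]
    linear_onD(2)[OF T_lin[OF assms(1,2)] assms(3)]
  using T_in[OF assms(1-3)] assms(4) by simp_all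

lemma m_sq:
  assumes "s \<in> Idx" "i \<in> Idx" "x \<in> S" "y \<in> S" "z \<in> S"
  shows "m s (I i (I i x)) y z = \<epsilon> i * m s x y z" "m s x (I i (I i y)) z = \<epsilon> i * m s x y z"
    "m s x y (I i (I i z)) = \<epsilon> i * m s x y z"
  unfolding I_sq[OF assms(2,3)] I_sq[OF assms(2,4)] I_sq[OF assms(2,5)]
  by (rule m_scale[OF assms(1,3-5)])+

lemma m_move:
  assumes "i \<in> Idx" "x \<in> S" "y \<in> S" "z \<in> S"
  shows "m i x (I i y) z = m i x y (I i z)"
  unfolding m_def T_anti[OF assms(1-3)]
  using I_skew[OF assms(1) T_in[OF assms(1-3)] assms(4)] T_in[OF assms(1-3)] I_in[OF assms(1)] assms(4)
  by simp

text \<open>The derivative of I_j I_i = \<epsilon>_k I_k, paired with \<open>z\<close>; skewness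
  moves I_j to the last argument.\<close>

lemma m_cyc:
  assumes c: "cyc i j k" and S: "x \<in> S" "y \<in> S" "z \<in> S"
  shows "m i x y (I j z) = m j x (I i y) z - \<epsilon> k * m k x y z"
proof -
  have mem: "i \<in> Idx" "j \<in> Idx" "k \<in> Idx" using cyc_mem[OF c] by auto
  have "g (T j x (I i y) + I j (T i x y)) z = \<epsilon> k * g (T k x y) z"
    unfolding T_cyc[OF c S(1,2)] using T_in[OF mem(3) S(1,2)] S(3) by simp
  then have "g (T j x (I i y)) z + g (I j (T i x y)) z = \<epsilon> k * g (T k x y) z"
    using S(3) T_in[OF mem(2) S(1) I_in[OF mem(1) S(2)]] I_in[OF mem(2) T_in[OF mem(1) S(1,2)]] by simp
  moreover have "g (I j (T i x y)) z = - g (T i x y) (I j z)"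
    by (rule I_skew[OF mem(2) T_in[OF mem(1) S(1,2)] S(3)])
  ultimately show ?thesis by (simp add: m_def)
qed

text \<open>For a positive definite \<open>g\<close> and \<open>I\<^sub>i\<close> a complex structure: the form \<open>w\<^sub>j + \<i> w\<^sub>k\<close> is of type
  (2,0), so its derivatives have no (0,2)-part.\<close>

lemma m_type:
  assumes c: "cyc i j k" and S: "x \<in> S" "y \<in> S" "z \<in> S"
  shows "\<epsilon> i * m j x y z + m j x (I i y) (I i z) = \<epsilon> k * (m k x y (I i z) + m k x (I i y) z)"
proof -
  have mem: "i \<in> Idx" "j \<in> Idx" "k \<in> Idx" "i \<noteq> j" using cyc_mem[OF c] cyc_distinct[OF c] by auto
  note S' = S I_in[OF mem(1) S(2)] I_in[OF mem(1) S(3)] I_in[OF mem(2) S(3)]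
  have "m i x (I i y) (I j z) = \<epsilon> i * m j x y z - \<epsilon> k * m k x (I i y) z"
    using m_cyc[OF c S(1) S'(4) S(3)] m_sq(2)[OF mem(2,1) S] by simp
  moreover have "m i x (I i y) (I j z) = m i x y (I i (I j z))" using m_move S' mem by blast
  moreover have "I i (I j z) = (- 1) *\<^sub>R I j (I i z)" using I_anti[OF mem(1,2,4) S(3)] by simp
  moreover have "m i x y ((- 1) *\<^sub>R I j (I i z)) = - m i x y (I j (I i z))"
    using m_scale(3)[OF mem(1) S(1,2) I_in[OF mem(2) S'(5)], of "-1"] by simp
  moreover have "m i x y (I j (I i z)) = m j x (I i y) (I i z) - \<epsilon> k * m k x y (I i z)"
    using m_cyc[OF c S(1,2) S'(5)] .
  ultimately show ?thesis by (simp add: algebra_simps)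
qed

text \<open>The alternation of \<nabla>w_s; for a torsion-free connection it is dw_s(x, y,
  z).\<close>

definition "cycsum s x y z = m s x y z + m s y z x + m s z x y"

text \<open>Sum of \<open>m_type\<close> over the cyclic permutations of (x; y, z) and of (J x; J y,
  z), after which all values of \<open>m\<close> regroup into cyclic sums. In the model case of
  \<open>m_type\<close> this is the fact that the derivative of a (2,0)-form has no
  (0,3)-part.\<close>

lemma cycsum_type:
  assumes c: "cyc i j k" and S: "x \<in> S" "y \<in> S" "z \<in> S"
  defines "J \<equiv> I i"
  shows "\<epsilon> i * cycsum j x y z + cycsum j x (J y) (J z) + cycsum j (J x) y (J z) + cycsum j (J x) (J y) z =
    \<epsilon> k * (cycsum k (J x) y z + cycsum k x (J y) z + cycsum k x y (J z) + \<epsilon> i * cycsum k (J x) (J y) (J z))"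
proof -
  have mem: "i \<in> Idx" "j \<in> Idx" "k \<in> Idx" using cyc_mem[OF c] by auto
  have JS: "J x \<in> S" "J y \<in> S" "J z \<in> S" using I_in mem S by (auto simp: J_def)
  note t = m_type[OF c, folded J_def] and q = m_sq[OF _ mem(1), folded J_def]
  note e1 = t[OF S] t[OF S(2,3,1)] t[OF S(3,1,2)]
  note e2 = t[OF JS(1,2) S(3)] t[OF JS(2,3) S(1)] t[OF JS(3,1) S(2)]
  have q': "m j (J x) (J (J y)) (J z) = \<epsilon> i * m j (J x) y (J z)" "m j (J y) (J (J z)) (J x) = \<epsilon> i * m j (J y) z (J x)"
    "m j (J z) (J (J x)) (J y) = \<epsilon> i * m j (J z) x (J y)"
    "m k (J x) (J (J y)) z = \<epsilon> i * m k (J x) y z" "m k (J y) (J (J z)) x = \<epsilon> i * m k (J y) z x"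
    "m k (J z) (J (J x)) y = \<epsilon> i * m k (J z) x y"
    using q(2) mem S JS by blast+
  have e3: "a + b = \<epsilon> k * (\<epsilon> i * c + d)" if "\<epsilon> i * a + \<epsilon> i * b = \<epsilon> k * (c + \<epsilon> i * d)" for a b c d
    by (rule eps_cancel[of i]) (use that in \<open>simp add: algebra_simps\<close>)
  note e2' = e2[unfolded q', THEN e3]
  show ?thesis
    unfolding cycsum_def using e1 e2' by (simp only: distrib_left mult.assoc)
qed

text \<open>Hitchin's lemma (closed \<open>w\<^sub>1, w\<^sub>2, w\<^sub>3\<close> are parallel) in algebraic form.\<close>

lemma hitchin:
  assumes z: "\<And>s x y z. s \<in> Idx \<Longrightarrow> x \<in> S \<Longrightarrow> y \<in> S \<Longrightarrow> z \<in> S \<Longrightarrow> cycsum s x y z = 0"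
    and "s \<in> Idx" "x \<in> S" "y \<in> S"
  shows "T s x y = 0"
proof -
  \<comment> \<open>A combination of four vanishing cyclic sums, in which J may be moved between the
    last two arguments. For a Hermitian structure this is the fact that almost Kaehler manifolds are
    quasi-Kaehler.\<close>
  have ty: "m i (I i x) (I i y) z = \<epsilon> i * m i x y z"
    if i: "i \<in> Idx" and S: "x \<in> S" "y \<in> S" "z \<in> S" for i x y z
  proof -
    define J where "J = I i"
    have JS: "J x \<in> S" "J y \<in> S" "J z \<in> S" using I_in i S by (auto simp: J_def)
    have mv: "m i u (J v) v' = m i u v (J v')" if "u \<in> S" "v \<in> S" "v' \<in> S" for u v v'
      using m_move[OF i that] by (simp add: J_def)
    have q: "m i u (J v) (J v') = \<epsilon> i * m i u v v'" if "u \<in> S" "v \<in> S" "v' \<in> S" for u v v'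
      using mv[OF that(1,2) I_in[OF i that(3)]] m_sq(3)[OF i i that] by (simp add: J_def)
    have "cycsum i x y z = 0" "cycsum i x (J y) (J z) = 0" "cycsum i (J x) y (J z) = 0" "cycsum i (J x) (J y) z = 0"
      using z i S JS by auto
    moreover from this(1) have "\<epsilon> i * m i x y z + \<epsilon> i * m i y z x + \<epsilon> i * m i z x y = 0"
      by (simp add: cycsum_def flip: distrib_left)
    ultimately show ?thesis
      unfolding cycsum_def J_def[symmetric]
      using q[OF S] q[OF S(2,3,1)] q[OF S(3,1,2)]
        mv[OF JS(1) S(2,3)] mv[OF JS(2) S(3,1)] mv[OF JS(3) S(1,2)]
      by linarith
  qed
  \<comment> \<open>With h(x, y) = m_i(x, y, I_j z), the skew part of h is computed in two ways at
    (J x, J y). By \<open>ty\<close> it is \<epsilon>_i times the skew part at (x, y); by the cyclic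
    sums for j and k it is minus that. Hence it vanishes.\<close>
  have sym: "m i x y (I j z) = m i y x (I j z)" if c: "cyc i j k" and S: "x \<in> S" "y \<in> S" "z \<in> S" for i j k x y z
  proof -
    have mem: "i \<in> Idx" "j \<in> Idx" "k \<in> Idx" using cyc_mem[OF c] by auto
    define J where "J = I i"
    have JS: "J x \<in> S" "J y \<in> S" "J z \<in> S" using I_in mem S by (auto simp: J_def)
    have zS: "I j z \<in> S" using I_in mem S by auto
    define h where "h x y = m i x y (I j z)" for x y
    have h: "h u v = m j u (J v) z - \<epsilon> k * m k u v z" if "u \<in> S" "v \<in> S" for u v
      using m_cyc[OF c that S(3)] by (simp add: h_def J_def)
    have H: "h u v - h v u = - \<epsilon> i * \<epsilon> k * m k z (J u) (J v) + m j (J u) z v - m j (J v) z u"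
      if uv: "u \<in> S" "v \<in> S" for u v
    proof -
      have J: "J u \<in> S" "J v \<in> S" using I_in mem uv by (auto simp: J_def)
      have 1: "m j z (J u) v + m j z u (J v) = \<epsilon> k * m k z u v + \<epsilon> i * \<epsilon> k * m k z (J u) (J v)"
        by (rule eps_cancel[of i])
          (use m_type[OF c S(3) J(1) uv(2)] m_sq(2)[OF mem(2,1) S(3) uv(1) J(2)]
            m_sq(2)[OF mem(3,1) S(3) uv] in \<open>simp add: J_def algebra_simps\<close>)
      have 2: "m j z v (J u) = - m j z (J u) v" "m k z u v = - m k z v u"
        "m k v u z = - m k v z u"
        using m_swap mem S uv J by blast+
      have "cycsum j u (J v) z = 0" "cycsum j v (J u) z = 0" "cycsum k u v z = 0"
        using z mem S uv J by auto
      then have 3: "m j u (J v) z + m j (J v) z u + m j z u (J v) = 0" "m j v (J u) z + m j (J u) z v + m j z v (J u) = 0"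
        "m k u v z + m k v z u + m k z u v = 0" by (auto simp: cycsum_def)
      have "h u v - h v u = m j u (J v) z - m j v (J u) z - \<epsilon> k * (m k u v z - m k v u z)"
        using h[OF uv] h[OF uv(2,1)] by (simp add: algebra_simps)
      also have "m k u v z - m k v u z = - m k z u v" using 2 3 by linarith
      also have "m j u (J v) z - m j v (J u) z = m j (J u) z v - m j (J v) z u - (m j z (J u) v + m j z u (J v))"
        using 2 3 by linarith
      finally show ?thesis using 1 by simp
    qed
    have D: "h x y - h y x = m j x (J y) z - m j y (J x) z + \<epsilon> k * m k z x y"
    proof -
      have "m k x y z - m k y x z = - m k z x y"
        using z[OF mem(3) S] m_swap[OF mem(3) S(2,3,1)] by (simp add: cycsum_def)
      then have "\<epsilon> k * m k x y z - \<epsilon> k * m k y x z = - \<epsilon> k * m k z x y"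
        by (simp flip: right_diff_distrib)
      then show ?thesis using h[OF S(1,2)] h[OF S(2,1)] by linarith
    qed
    have "h (J x) (J y) - h (J y) (J x) = \<epsilon> i * (h x y - h y x)"
      using ty[OF mem(1) S(1,2) zS] ty[OF mem(1) S(2,1) zS] unfolding h_def J_def
      by (simp add: right_diff_distrib)
    moreover have "h (J x) (J y) - h (J y) (J x) = \<epsilon> i * (- (\<epsilon> k * m k z x y) + m j x z (J y) - m j y z (J x))"
    proof -
      have "m k z (J (J x)) (J (J y)) = m k z x y"
        using m_sq(2)[OF mem(3,1) S(3,1), of "J (J y)"] m_sq(3)[OF mem(3,1) S(3,1,2)] JS I_in[OF mem(1)]
        by (simp add: J_def)
      moreover have "m j (J (J x)) z (J y) = \<epsilon> i * m j x z (J y)" "m j (J (J y)) z (J x) = \<epsilon> i * m j y z (J x)"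
        using m_sq(1)[OF mem(2,1)] S JS unfolding J_def by blast+
      ultimately show ?thesis using H[OF JS(1,2)] by (simp add: algebra_simps)
    qed
    moreover have "m j x z (J y) = - m j x (J y) z" "m j y z (J x) = - m j y (J x) z"
      using m_swap mem S JS by blast+
    ultimately have "\<epsilon> i * (h x y - h y x) = \<epsilon> i * (- (h x y - h y x))"
      unfolding D by (simp add: algebra_simps)
    then have "h x y - h y x = - (h x y - h y x)" by (rule eps_cancel)
    then have "h x y = h y x" by linarith
    then show ?thesis by (simp add: h_def)
  qed
  \<comment> \<open>Every vector is of the form I_j z up to sign, so the symmetry holds for an
    arbitrary last argument.\<close>
  have sym': "m s x y z = m s y x z" if s: "s \<in> Idx" and S: "x \<in> S" "y \<in> S" "z \<in> S" for s x y z
  proof -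
    obtain j k where c: "cyc s j k" using cyc_cases[OF s] by blast
    have j: "j \<in> Idx" using cyc_mem[OF c] by auto
    have "m s x y (I j (I j z)) = m s y x (I j (I j z))" using sym[OF c S(1,2) I_in[OF j S(3)]] .
    then have "\<epsilon> j * m s x y z = \<epsilon> j * m s y x z"
      unfolding m_sq(3)[OF s j S] m_sq(3)[OF s j S(2,1,3)] .
    then show ?thesis by (rule eps_cancel)
  qed
  have "g (T s x y) z = g 0 z" if S: "z \<in> S" for z
  proof -
    note X = assms(3) and Y = assms(4) and sI = assms(2)
    \<comment> \<open>A trilinear form that is symmetric in the first two arguments and skew in the
      last two is zero: six alternating exchanges return to the start with the opposite sign. The
      uniqueness of the Levi-Civita connection rests on the same fact.\<close>
    have "m s x y z = 0"
      using m_swap[OF sI X Y S] sym'[OF sI X S Y] m_swap[OF sI S X Y] sym'[OF sI S Y X]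
        m_swap[OF sI Y S X] sym'[OF sI X Y S] by linarith
    then show ?thesis using S by (simp add: m_def)
  qed
  then show ?thesis using nondeg2[OF T_in[OF assms(2-4)], of 0] by simp
qed

end

declare One_nat_def [simp del]

lemma linear_on_scaleR_fun: "linear_on S f \<Longrightarrow> linear_on S (\<lambda>x. c *\<^sub>R f x)"
  by (simp add: linear_on_def scaleR_add_right mult.commute)

lemma linear_on_scaleR_vec: "linear_on S f \<Longrightarrow> linear_on S (\<lambda>x. f x *\<^sub>R v)"
  by (simp add: linear_on_def scaleR_add_left)

lemma linear_on_add_fun: "linear_on S f \<Longrightarrow> linear_on S h \<Longrightarrow> linear_on S (\<lambda>x. f x + h x)"
  by (simp add: linear_on_def scaleR_add_right)

lemma linear_on_diff_fun: "linear_on S f \<Longrightarrow> linear_on S h \<Longrightarrow> linear_on S (\<lambda>x. f x - h x)"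
  by (simp add: linear_on_def scaleR_diff_right)

lemma linear_on_sum_fun:
  "(\<And>i. i \<in> J \<Longrightarrow> linear_on S (f i)) \<Longrightarrow> linear_on S (\<lambda>x. \<Sum>i\<in>J. f i x)"
  unfolding linear_on_def by (simp add: sum.distrib scaleR_sum_right)

lemma sum_cyc: "cyc i j k \<Longrightarrow> (\<Sum>t\<in>Idx. f t) = f i + f j + (f k :: 'a::comm_monoid_add)"
  by (auto simp: cyc_def sum_123 add_ac)

section \<open>Derivatives of the structure whose alternation is given by 1-forms\<close>

context derivation_tensor
begin

context
  fixes a :: "nat \<Rightarrow> nat \<Rightarrow> 'a \<Rightarrow> real"
  assumes N: "N > 4"
    and a_lin: "s \<in> Idx \<Longrightarrow> t \<in> Idx \<Longrightarrow> linear_on S (a s t)"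
    and a0: "s \<in> Idx \<Longrightarrow> x \<in> S \<Longrightarrow> a s s x = 0"
    and F: "s \<in> Idx \<Longrightarrow> x \<in> S \<Longrightarrow> y \<in> S \<Longrightarrow> z \<in> S \<Longrightarrow>
      cycsum s x y z = (\<Sum>t\<in>Idx. a s t x * w t y z + a s t y * w t z x + a s t z * w t x y)"
begin

text \<open>With \<gamma> = a_jk - \<epsilon>_i a_kj, inserting the prescribed cyclic sums into
  \<open>cycsum_type\<close> cancels the terms with a_ji and a_ki and leaves, up to the factor 2
  \<epsilon>_i, the relation that \<gamma> wedge w_k plus \<epsilon>_k (\<gamma> o J) wedge w_j is
  zero. Injectivity of the wedge product gives \<gamma> = 0, and this is where N > 4 enters.\<close>

lemma structure_forms_antisym:
  assumes c: "cyc i j k" and x: "x \<in> S"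
  shows "a j k x = \<epsilon> i * a k j x"
proof -
  have mem: "i \<in> Idx" "j \<in> Idx" "k \<in> Idx" and ne: "i \<noteq> j" "i \<noteq> k" "j \<noteq> k"
    using cyc_mem[OF c] cyc_distinct[OF c] by auto
  define J where "J = I i"
  have JS: "J y \<in> S" if "y \<in> S" for y using I_in[OF mem(1) that] by (simp add: J_def)
  define \<gamma> where "\<gamma> x = a j k x - \<epsilon> i * a k j x" for x
  have w1: "w i (J y) z = \<epsilon> i * g y z" "w i y (J z) = - \<epsilon> i * g y z"
    "w j (J y) z = \<epsilon> k * w k y z" "w j y (J z) = \<epsilon> k * w k y z"
    "w k (J y) z = \<epsilon> i * \<epsilon> k * w j y z" "w k y (J z) = \<epsilon> i * \<epsilon> k * w j y z"
    if y: "y \<in> S" and z: "z \<in> S" for y z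
  proof -
    have j: "w j (J u) v = \<epsilon> k * w k u v" if "u \<in> S" "v \<in> S" for u v
      unfolding w_def J_def I_cyc(2)[OF c that(1)] using I_in[OF mem(3) that(1)] that by simp
    have k: "w k (J u) v = \<epsilon> i * \<epsilon> k * w j u v" if "u \<in> S" "v \<in> S" for u v
      unfolding w_def J_def I_cyc(1)[OF cyc_rot[OF cyc_rot[OF c]] that(1)] cyc_eps[OF c]
      using I_in[OF mem(2) that(1)] that by simp
    show "w i (J y) z = \<epsilon> i * g y z" using y z by (simp add: w_def J_def I_sq[OF mem(1)])
    show "w i y (J z) = - \<epsilon> i * g y z" using I_g[OF mem(1) y z] by (simp add: w_def J_def)
    show "w j (J y) z = \<epsilon> k * w k y z" "w k (J y) z = \<epsilon> i * \<epsilon> k * w j y z"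
      using j[OF y z] k[OF y z] .
    show "w j y (J z) = \<epsilon> k * w k y z"
      using w_swap[OF mem(2) y JS[OF z]] j[OF z y] w_swap[OF mem(3) z y] by simp
    show "w k y (J z) = \<epsilon> i * \<epsilon> k * w j y z"
      using w_swap[OF mem(3) y JS[OF z]] k[OF z y] w_swap[OF mem(2) z y] by simp
  qed
  have gJ: "g y (J z) = - w i y z" if y: "y \<in> S" and z: "z \<in> S" for y z
    using I_skew[OF mem(1) y z] by (simp add: J_def w_def)
  have Fj: "cycsum j x y z = a j i x * w i y z + a j i y * w i z x + a j i z * w i x y
      + (a j k x * w k y z + a j k y * w k z x + a j k z * w k x y)"
    and Fk: "cycsum k x y z = a k i x * w i y z + a k i y * w i z x + a k i z * w i x y
      + (a k j x * w j y z + a k j y * w j z x + a k j z * w j x y)"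
    if "x \<in> S" "y \<in> S" "z \<in> S" for x y z
    using F[OF mem(2) that] F[OF mem(3) that] a0[OF mem(2)] a0[OF mem(3)] that
    unfolding sum_cyc[OF c] by simp_all
  \<comment> \<open>The coefficients of the remaining wedge relation: \<gamma> at w_k, \<epsilon>_k
    (\<gamma> o J) at w_j, and nothing at w_i.\<close>
  define b where "b t = (\<lambda>x. if t = k then \<gamma> x else if t = j then \<epsilon> k * \<gamma> (J x) else 0)" for t
  have "b k x = 0"
  proof (rule wedge_w_injective[OF N _ _ mem(3) x])
    have l: "linear_on S \<gamma>"
      unfolding linear_on_def \<gamma>_def
      using linear_onD[OF a_lin[OF mem(2,3)]] linear_onD[OF a_lin[OF mem(3,2)]]
      by (simp add: algebra_simps)
    have "linear_on S (\<lambda>x. \<epsilon> k * \<gamma> (J x))"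
      unfolding linear_on_def J_def
      using linear_onD[OF l I_in[OF mem(1)]] I_in[OF mem(1)] I_linear(1,2)[OF mem(1)]
      by (simp add: algebra_simps)
    with l show "linear_on S (b t)" if "t \<in> Idx" for t
      by (auto simp: b_def linear_on_def)
    fix x y z assume S: "x \<in> S" "y \<in> S" "z \<in> S"
    note J3 = JS[OF S(1)] JS[OF S(2)] JS[OF S(3)]
    define e f where "e = \<epsilon> i" and "f = \<epsilon> k"
    have ef: "e = 1 \<or> e = -1" "f = 1 \<or> f = -1" using eps_cases by (auto simp: e_def f_def)
    have ax: "g y x = g x y" "g z y = g y z" "g x z = g z x"
      using g_sym S by auto
    note main = cycsum_type[OF c S, folded J_def e_def f_def,
        unfolded Fj[OF S] Fj[OF S(1) J3(2,3)] Fj[OF J3(1) S(2) J3(3)] Fj[OF J3(1,2) S(3)]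
          Fk[OF J3(1) S(2,3)] Fk[OF S(1) J3(2) S(3)] Fk[OF S(1,2) J3(3)] Fk[OF J3]
          w1[OF S(1,2), folded e_def f_def] w1[OF S(2,1), folded e_def f_def]
          w1[OF S(2,3), folded e_def f_def] w1[OF S(3,2), folded e_def f_def]
          w1[OF S(3,1), folded e_def f_def] w1[OF S(1,3), folded e_def f_def]
          w1[OF S(1) J3(2), folded e_def f_def] w1[OF S(2) J3(3), folded e_def f_def] 
          w1[OF S(3) J3(1), folded e_def f_def] w1[OF J3(1) S(2), folded e_def f_def]
          w1[OF J3(2) S(3), folded e_def f_def] w1[OF J3(3) S(1), folded e_def f_def]
          gJ[OF S(1,2)] gJ[OF S(2,3)] gJ[OF S(3,1)] ax]
    have "\<gamma> x * w k y z + f * \<gamma> (J x) * w j y z + (\<gamma> y * w k z x + f * \<gamma> (J y) * w j z x)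
        + (\<gamma> z * w k x y + f * \<gamma> (J z) * w j x y) = 0" (is "?L = 0")
    proof -
      have "2 * e * ?L = 0"
        using main ef unfolding \<gamma>_def e_def[symmetric] f_def[symmetric]
        by (elim disjE) (simp_all only: mult_1 mult_1_right mult_minus1 minus_minus mult_minus_left
              mult_minus_right, (simp_all add: ring_distribs)?, (linarith+)?)
      then show ?thesis using ef by auto
    qed
    then show "(\<Sum>t\<in>Idx. b t x * w t y z + b t y * w t z x + b t z * w t x y) = 0"
      unfolding sum_cyc[OF c] b_def using ne by (simp add: f_def algebra_simps)
  qed
  then show ?thesis by (simp add: b_def \<gamma>_def)
qed

text \<open>The candidate U = sum of the a_st I_t is itself a derivative of the structure: it
  anticommutes with I_s because a_ss = 0, and it respects the products because of
  \<open>structure_forms_antisym\<close>. So T - U satisfies the same axioms, has zero cyclic sums,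
  and vanishes by \<open>hitchin\<close>.\<close>

theorem parallel_up_to_structure_forms:
  assumes "s \<in> Idx" "x \<in> S" "y \<in> S"
  shows "T s x y = (\<Sum>t\<in>Idx. a s t x *\<^sub>R I t y)"
proof -
  define U where "U s x y = (\<Sum>t\<in>Idx. a s t x *\<^sub>R I t y)" for s x y
  have U: "U i x y = a i j x *\<^sub>R I j y + a i k x *\<^sub>R I k y" if "cyc i j k" "x \<in> S" for i j k x y
    unfolding U_def sum_cyc[OF that(1)] using a0[of i x] cyc_mem[OF that(1)] that(2) by simp
  have U_in: "U s x y \<in> S" if "y \<in> S" for s x y
    unfolding U_def using that I_in by (intro S_sum) simp
  have U_w: "g (U s x y) z = (\<Sum>t\<in>Idx. a s t x * w t y z)" if "y \<in> S" "z \<in> S" for s x y z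
    unfolding U_def using that I_in by (subst g_sum_left) (simp_all add: w_def)
  interpret M: derivation_tensor S g N E I "\<lambda>s x y. T s x y - U s x y"
  proof
    fix s x assume s: "s \<in> Idx" and x: "x \<in> S"
    have "linear_on S (U s x)"
      unfolding U_def by (intro linear_on_sum_fun linear_on_scaleR_fun I_lin)
    then show "linear_on S (\<lambda>y. T s x y - U s x y)"
      using T_lin[OF s x] by (rule linear_on_diff_fun[rotated])
    have "linear_on S (\<lambda>y. U s y x)"
      unfolding U_def by (intro linear_on_sum_fun linear_on_scaleR_vec a_lin s)
    then show "linear_on S (\<lambda>y. T s y x - U s y x)"
      using T_lin_left[OF s x] by (rule linear_on_diff_fun[rotated])
    fix y assume y: "y \<in> S"
    note Txy = T_in[OF s x y] and Uxy = U_in[OF y, of s x]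
    show "T s x y - U s x y \<in> S" using Txy Uxy by simp
    obtain j k where c: "cyc s j k" using cyc_cases[OF s] by auto
    have jk: "j \<in> Idx" "k \<in> Idx" "s \<noteq> j" "s \<noteq> k" using cyc_mem[OF c] cyc_distinct[OF c] by auto
    have "U s x (I s y) = - I s (U s x y)"
      unfolding U[OF c x] using I_anti[OF jk(1) s _ y] I_anti[OF jk(2) s _ y] jk
        I_linear(1,2)[OF s] I_in[OF jk(1) y] I_in[OF jk(2) y] by simp
    then show "T s x (I s y) - U s x (I s y) = - I s (T s x y - U s x y)"
      using T_anti[OF s x y] I_linear(4)[OF s Txy Uxy] by simp
    fix z assume z: "z \<in> S"
    have "g (U s x y) z = - g y (U s x z)"
      unfolding U[OF c x] using I_skew[OF jk(1) y z] I_skew[OF jk(2) y z] I_in[OF jk(1)] I_in[OF jk(2)] y z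
      by simp
    then show "g (T s x y - U s x y) z = - g y (T s x z - U s x z)"
      using T_skew[OF s x y z] Txy Uxy T_in[OF s x z] U_in[OF z, of s x] y z by simp
  next
    fix i j k x y assume c: "cyc i j k" and x: "x \<in> S" and y: "y \<in> S"
    have mem: "i \<in> Idx" "j \<in> Idx" "k \<in> Idx" using cyc_mem[OF c] by auto
    note c' = cyc_rot[OF c] cyc_rot[OF cyc_rot[OF c]]
    note Iy = I_in[OF mem(1) y] I_in[OF mem(2) y] I_in[OF mem(3) y]
    \<comment> \<open>In the derivative of I_j I_i the coefficients of I_j and I_i have to match
      those of \<epsilon>_k U_k, and the multiple of the identity has to vanish; these are the three
      instances of antisymmetry.\<close>
    have r: "- \<epsilon> j * a j k x = \<epsilon> k * a k j x" "- \<epsilon> i * a i k x = \<epsilon> k * a k i x"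
      "\<epsilon> i * a j i x = - \<epsilon> j * a i j x"
      using structure_forms_antisym[OF c x] structure_forms_antisym[OF c'(1) x]
        structure_forms_antisym[OF c'(2) x] cyc_eps[OF c]
      by (simp_all add: algebra_simps)
    have "U j x (I i y) + I j (U i x y) =
        (- \<epsilon> j * a j k x) *\<^sub>R I j y + (\<epsilon> i * a j i x + \<epsilon> j * a i j x) *\<^sub>R y + (- \<epsilon> i * a i k x) *\<^sub>R I i y"
      unfolding U[OF c x] U[OF c'(1) x]
      using I_linear(1,2)[OF mem(2)] Iy I_cyc(1)[OF c'(2) y] I_cyc(1)[OF c'(1) y] I_sq[OF mem(1) y]
        I_sq[OF mem(2) y] by (simp add: scaleR_add_left mult.commute)
    also have "\<dots> = \<epsilon> k *\<^sub>R U k x y"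
      unfolding U[OF c'(2) x] r by (simp add: scaleR_add_right)
    finally have "U j x (I i y) + I j (U i x y) = \<epsilon> k *\<^sub>R U k x y" .
    from this[symmetric] show "T j x (I i y) - U j x (I i y) + I j (T i x y - U i x y) = \<epsilon> k *\<^sub>R (T k x y - U k x y)"
      unfolding T_cyc[OF c x y, symmetric] I_linear(4)[OF mem(2) T_in[OF mem(1) x y] U_in[OF y, of i x]]
        scaleR_diff_right by simp
  qed
  have "M.cycsum s x y z = 0" if s: "s \<in> Idx" and S: "x \<in> S" "y \<in> S" "z \<in> S" for s x y z
  proof -
    have d: "g (T s u v - U s u v) v' = m s u v v' - (\<Sum>t\<in>Idx. a s t u * w t v v')"
      if "u \<in> S" "v \<in> S" "v' \<in> S" for u v v'
      using T_in[OF s that(1,2)] U_in[OF that(2)] U_w[OF that(2,3)] that by (simp add: m_def)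
    show ?thesis
      unfolding M.cycsum_def M.m_def d[OF S] d[OF S(2,3,1)] d[OF S(3,1,2)]
      using F[OF s S] by (simp add: cycsum_def sum.distrib)
  qed
  then have "T s x y - U s x y = 0" by (rule M.hitchin) (use assms in auto)
  then show ?thesis by (simp add: U_def)
qed

end

end

section \<open>The orthogonal complement of sp(n,R) + sp(1,R)\<close>

lemma span_3: "J \<in> span {a, b, c} \<longleftrightarrow> (\<exists>x y z. J = x *\<^sub>R a + y *\<^sub>R b + z *\<^sub>R (c :: 'a::real_vector))"
proof
  assume "J \<in> span {a, b, c}"
  then obtain x y z where "J - x *\<^sub>R a - y *\<^sub>R b - z *\<^sub>R c = 0"
    by (auto simp: span_breakdown_eq)
  then have "J = x *\<^sub>R a + y *\<^sub>R b + z *\<^sub>R c" by (simp add: algebra_simps)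
  then show "\<exists>x y z. J = x *\<^sub>R a + y *\<^sub>R b + z *\<^sub>R c" by blast
next
  assume "\<exists>x y z. J = x *\<^sub>R a + y *\<^sub>R b + z *\<^sub>R c"
  then obtain x y z where J: "J = x *\<^sub>R a + y *\<^sub>R b + z *\<^sub>R c" by blast
  show "J \<in> span {a, b, c}" unfolding J by (intro span_add span_scale) (simp_all add: span_base)
qed

text \<open>The structures vanish outside \<open>S\<close>, so that they are elements of
  \<open>endos S\<close>. The basis \<open>e0\<close> certifies that the choice made in
  \<open>endo_inner\<close> succeeds; computations use \<open>E\<close>.\<close>

locale pq_endo = pq_space +
  fixes Q :: "('a \<Rightarrow> 'a) set" and e0 :: "nat \<Rightarrow> 'a"
  assumes I_off: "s \<in> Idx \<Longrightarrow> x \<notin> S \<Longrightarrow> I s x = 0"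
    and Q: "Q = span {I 1, I 2, I 3}"
    and onb: "orthonormal_basis g S e0"
    and N: "N > 0"
begin

lemma I_endos: "s \<in> Idx \<Longrightarrow> I s \<in> endos S"
  using I_lin[of s] I_in[of s] I_off[of s] by (simp add: endos_def image_subset_iff)

lemma Q_sum: "J \<in> Q \<longleftrightarrow> (\<exists>c. J = (\<Sum>t\<in>Idx. c t *\<^sub>R I t))"
proof
  assume "J \<in> Q"
  then obtain x y z where *: "J = x *\<^sub>R I 1 + y *\<^sub>R I 2 + z *\<^sub>R I 3" unfolding Q span_3 by blast
  have "J = (\<Sum>t\<in>Idx. (if t = 1 then x else if t = 2 then y else z) *\<^sub>R I t)"
    unfolding sum_123 * by simp
  then show "\<exists>c. J = (\<Sum>t\<in>Idx. c t *\<^sub>R I t)" by fast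
next
  assume "\<exists>c. J = (\<Sum>t\<in>Idx. c t *\<^sub>R I t)"
  then show "J \<in> Q" unfolding Q span_3 sum_123 by blast
qed

lemma Q_apply:
  assumes "J \<in> Q" obtains c where "\<And>x. J x = (\<Sum>t\<in>Idx. c t *\<^sub>R I t x)"
proof -
  obtain c where *: "J = (\<Sum>t\<in>Idx. c t *\<^sub>R I t)" using assms Q_sum by blast
  have "J x = (\<Sum>t\<in>Idx. c t *\<^sub>R I t x)" for x unfolding * sum_123 by simp
  then show thesis using that by blast
qed

text \<open>Says nothing about values outside \<open>S\<close>, unlike \<open>endos\<close>, so that
  terms such as compositions written with \<lambda> qualify directly; \<open>tr\<close> sees only
  the values on \<open>S\<close>.\<close>

definition lin_endo :: "('a \<Rightarrow> 'a) \<Rightarrow> bool" where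
  "lin_endo B \<longleftrightarrow> linear_on S B \<and> B ` S \<subseteq> S"

lemma lin_endoD:
  assumes "lin_endo B"
  shows "x \<in> S \<Longrightarrow> B x \<in> S" "x \<in> S \<Longrightarrow> y \<in> S \<Longrightarrow> B (x + y) = B x + B y"
    "x \<in> S \<Longrightarrow> B (c *\<^sub>R x) = c *\<^sub>R B x"
  using assms linear_onD[of S B] by (auto simp: lin_endo_def)

lemma lin_endoI:
  assumes "\<And>x. x \<in> S \<Longrightarrow> B x \<in> S" "\<And>x y. x \<in> S \<Longrightarrow> y \<in> S \<Longrightarrow> B (x + y) = B x + B y"
    "\<And>c x. x \<in> S \<Longrightarrow> B (c *\<^sub>R x) = c *\<^sub>R B x"
  shows "lin_endo B"
  using assms by (auto simp: lin_endo_def linear_on_def)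

lemma lin_endo_I: "s \<in> Idx \<Longrightarrow> lin_endo (I s)"
  using I_lin[of s] I_in[of s] by (simp add: lin_endo_def image_subset_iff)

lemma lin_endo_comp: "lin_endo B \<Longrightarrow> lin_endo C \<Longrightarrow> lin_endo (\<lambda>x. B (C x))"
  by (rule lin_endoI) (simp_all add: lin_endoD)

lemma lin_endo_lin_comb:
  "lin_endo B \<Longrightarrow> lin_endo C \<Longrightarrow> lin_endo (\<lambda>x. B x + C x)" "lin_endo B \<Longrightarrow> lin_endo (\<lambda>x. c *\<^sub>R B x)"
  by (rule lin_endoI; simp add: lin_endoD algebra_simps)+

lemma lin_endo_sum:
  assumes "\<And>i. i \<in> J \<Longrightarrow> lin_endo (B i)"
  shows "lin_endo (\<lambda>x. \<Sum>i\<in>J. B i x)"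
proof (rule lin_endoI)
  show "(\<Sum>i\<in>J. B i x) \<in> S" if "x \<in> S" for x
    by (rule S_sum) (rule lin_endoD(1)[OF assms that])
  show "(\<Sum>i\<in>J. B i (x + y)) = (\<Sum>i\<in>J. B i x) + (\<Sum>i\<in>J. B i y)" if "x \<in> S" "y \<in> S" for x y
    unfolding sum.distrib[symmetric] by (rule sum.cong[OF refl]) (rule lin_endoD(2)[OF assms that])
  show "(\<Sum>i\<in>J. B i (c *\<^sub>R x)) = c *\<^sub>R (\<Sum>i\<in>J. B i x)" if "x \<in> S" for c x
    unfolding scaleR_sum_right by (rule sum.cong[OF refl]) (rule lin_endoD(3)[OF assms that])
qed

lemma lin_endo_endos: "B \<in> endos S \<Longrightarrow> lin_endo B"
  by (simp add: endos_def lin_endo_def)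

section \<open>The trace form on endomorphisms and its behaviour under conjugation by I_s\<close>

lemma tr_cong: "(\<And>x. x \<in> S \<Longrightarrow> B x = B' x) \<Longrightarrow> (\<And>x. x \<in> S \<Longrightarrow> C x = C' x) \<Longrightarrow> tr B C = tr B' C'"
  unfolding tr_def using E by (intro sum.cong) auto

lemma tr_sym: "lin_endo B \<Longrightarrow> lin_endo C \<Longrightarrow> tr B C = tr C B"
  unfolding tr_def using E g_sym[OF lin_endoD(1) lin_endoD(1)] by (intro sum.cong) auto

lemma tr_add: "lin_endo B \<Longrightarrow> lin_endo C \<Longrightarrow> lin_endo D \<Longrightarrow> tr B (\<lambda>x. C x + D x) = tr B C + tr B D"
  unfolding tr_def using E by (simp add: lin_endoD(1) add_divide_distrib sum.distrib)

lemma tr_scale: "lin_endo B \<Longrightarrow> lin_endo C \<Longrightarrow> tr B (\<lambda>x. c *\<^sub>R C x) = c * tr B C"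
  unfolding tr_def using E by (simp add: lin_endoD(1) sum_distrib_left)

lemma tr_sum:
  assumes "lin_endo B" "\<And>i. i \<in> J \<Longrightarrow> lin_endo (C i)"
  shows "tr B (\<lambda>x. \<Sum>i\<in>J. C i x) = (\<Sum>i\<in>J. tr B (C i))"
proof -
  have "g (B (E a)) (\<Sum>i\<in>J. C i (E a)) / g (E a) (E a) = (\<Sum>i\<in>J. g (B (E a)) (C i (E a)) / g (E a) (E a))"
    if "a < N" for a
    unfolding sum_divide_distrib[symmetric]
    by (subst g_sum_right) (use lin_endoD(1)[OF assms(1) E[OF that]] lin_endoD(1)[OF assms(2) E[OF that]] in auto)
  then show ?thesis
    unfolding tr_def by (subst sum.swap) simp
qed

text \<open>I_s carries \<open>E\<close> to another orthogonal basis whose square lengths are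
  multiplied by -\<epsilon>_s. Applying I_s to the values produces the same sign in the numerators,
  and the trace does not depend on the basis.\<close>

lemma tr_conj:
  assumes "s \<in> Idx" "lin_endo B" "lin_endo C"
  shows "tr (\<lambda>x. I s (B (I s x))) (\<lambda>x. I s (C (I s x))) = tr B C"
proof -
  define F where "F a = I s (E a)" for a
  have FE: "g (F a) (F b) = - \<epsilon> s * g (E a) (E b)" if "a < N" "b < N" for a b
    unfolding F_def using I_g[OF assms(1) E E] that by blast
  have F_in: "F a \<in> S" if "a < N" for a unfolding F_def using I_in[OF assms(1) E[OF that]] .
  interpret F: orth_space S g N F
  proof
    show "subspace S" by (rule S)
    show "x \<in> S \<Longrightarrow> linear_on S (g x)" "x \<in> S \<Longrightarrow> y \<in> S \<Longrightarrow> g x y = g y x" for x y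
      using g_lin g_sym by blast+
    show "F a \<in> S" if "a < N" for a using F_in[OF that] .
    show "g (F a) (F b) = 0" if "a < N" "b < N" "a \<noteq> b" for a b using FE E_orth that by simp
    show "g (F a) (F a) \<noteq> 0" if "a < N" for a using FE E_nz that by simp
    show "span (F ` {..<N}) = S"
    proof
      show "span (F ` {..<N}) \<subseteq> S" using F_in S by (intro span_minimal) auto
      show "S \<subseteq> span (F ` {..<N})"
      proof
        fix x assume x: "x \<in> S"
        define y where "y = \<epsilon> s *\<^sub>R I s x"
        have y: "y \<in> S" using I_in[OF assms(1) x] by (simp add: y_def)
        have "x = I s y" using I_linear(2)[OF assms(1) I_in[OF assms(1) x]] I_sq[OF assms(1) x] by (simp add: y_def)
        also have "\<dots> = (\<Sum>a<N. (g y (E a) / g (E a) (E a)) *\<^sub>R I s (E a))"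
          using contract[OF y I_lin[OF assms(1)]] by simp
        also have "\<dots> \<in> span (F ` {..<N})"
          unfolding F_def by (intro span_sum span_scale span_base) auto
        finally show "x \<in> span (F ` {..<N})" .
      qed
    qed
  qed
  have "linear_on S (\<lambda>y. g (B x) (C y))" "linear_on S (\<lambda>y. g (B y) (C x))" if "x \<in> S" for x
    using lin_endoD[OF assms(2)] lin_endoD[OF assms(3)] that by (simp_all add: linear_on_def)
  then have "(\<Sum>b<N. g (B (F b)) (C (F b)) / g (F b) (F b)) = tr B C"
    unfolding tr_def by (intro trace_indep[OF F.orth_space_axioms])
  moreover have "g (B (F b)) (C (F b)) / g (F b) (F b) = g (I s (B (F b))) (I s (C (F b))) / g (E b) (E b)"
    if b: "b < N" for b
    unfolding FE[OF b b] I_g[OF assms(1) lin_endoD(1)[OF assms(2) F_in[OF b]] lin_endoD(1)[OF assms(3) F_in[OF b]]]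
    using eps_cases[of s] by auto
  ultimately show ?thesis by (simp add: tr_def F_def)
qed

text \<open>Conjugation by I_s preserves the trace form but multiplies \<open>B\<close> by
  \<epsilon>_s and \<open>R\<close> by -\<epsilon>_s.\<close>

lemma tr_commuting_zero:
  assumes s: "s \<in> Idx" and B: "lin_endo B" "\<And>x. x \<in> S \<Longrightarrow> B (I s x) = I s (B x)"
    and R: "lin_endo R" "\<And>x. x \<in> S \<Longrightarrow> R (I s x) = - I s (R x)"
  shows "tr R B = 0"
proof -
  have "tr R B = tr (\<lambda>x. I s (R (I s x))) (\<lambda>x. I s (B (I s x)))"
    by (rule tr_conj[OF s R(1) B(1), symmetric])
  also have "\<dots> = tr (\<lambda>x. - \<epsilon> s *\<^sub>R R x) (\<lambda>x. \<epsilon> s *\<^sub>R B x)"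
    using R(2) B(2) lin_endoD(1)[OF R(1)] lin_endoD(1)[OF B(1)] I_linear(3)[OF s I_in[OF s]] I_sq[OF s]
    by (intro tr_cong) simp_all
  also have "\<dots> = - tr R B"
    unfolding tr_def using E lin_endoD(1)[OF R(1)] lin_endoD(1)[OF B(1)]
    by (simp add: sum_negf)
  finally show ?thesis by simp
qed

lemma tr_I: "s \<in> Idx \<Longrightarrow> t \<in> Idx \<Longrightarrow> tr (I s) (I t) = (if s = t then - \<epsilon> s * N else 0)"
proof -
  assume s: "s \<in> Idx" and t: "t \<in> Idx"
  have "g (I s (E a)) (I t (E a)) / g (E a) (E a) = (if s = t then - \<epsilon> s else 0)" if "a < N" for a
    using I_inner[OF s t E[OF that]] E_nz[OF that] by simp
  then show ?thesis by (simp add: tr_def)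
qed

text \<open>Expanded in the basis, the trace is a double sum whose terms change sign when the two
  indices are exchanged.\<close>

lemma tr_symmetric_skew:
  assumes Y: "lin_endo Y" "\<And>x y. x \<in> S \<Longrightarrow> y \<in> S \<Longrightarrow> g (Y x) y = g x (Y y)"
    and B: "lin_endo B" "\<And>x y. x \<in> S \<Longrightarrow> y \<in> S \<Longrightarrow> g (B x) y = - g x (B y)"
  shows "tr Y B = 0"
proof -
  define G where "G a b = g (Y (E a)) (E b) * g (B (E a)) (E b) / (g (E a) (E a) * g (E b) (E b))" for a b
  have "g (Y (E a)) (B (E a)) / g (E a) (E a) = (\<Sum>b<N. G a b)" if a: "a < N" for a
  proof -
    note Ea = E[OF a] and YE = lin_endoD(1)[OF Y(1) E[OF a]] and BE = lin_endoD(1)[OF B(1) E[OF a]]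
    have "g (Y (E a)) (B (E a)) = (\<Sum>b<N. (g (Y (E a)) (E b) / g (E b) (E b)) *\<^sub>R g (B (E a)) (E b))"
      using contract[OF YE g_lin[OF BE]] g_sym[OF YE BE] by simp
    then show ?thesis unfolding G_def by (simp add: sum_divide_distrib mult.commute)
  qed
  then have t: "tr Y B = (\<Sum>a<N. \<Sum>b<N. G a b)" by (simp add: tr_def)
  have neg: "G a b = - G b a" if "a < N" "b < N" for a b
    using Y(2)[OF E E, of a b] B(2)[OF E E, of a b] that E
      g_sym[OF E lin_endoD(1)[OF Y(1) E], of a b] g_sym[OF E lin_endoD(1)[OF B(1) E], of a b]
    by (simp add: G_def mult.commute)
  have "(\<Sum>a<N. \<Sum>b<N. G a b) = (\<Sum>a<N. \<Sum>b<N. - G b a)"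
    by (intro sum.cong refl neg) (simp_all only: lessThan_iff)
  also have "\<dots> = - (\<Sum>a<N. \<Sum>b<N. G a b)" by (subst sum.swap) (simp add: sum_negf)
  finally show ?thesis using t by simp
qed

lemma inner_tr: "B \<in> endos S \<Longrightarrow> C \<in> endos S \<Longrightarrow> endo_inner g S B C = tr B C"
  by (rule endo_inner_tr[OF onb]) (auto simp: endos_def)

lemma sp_nD:
  assumes "B \<in> sp_n g Q S"
  shows "B \<in> endos S" "x \<in> S \<Longrightarrow> y \<in> S \<Longrightarrow> g (B x) y = - g x (B y)"
    "s \<in> Idx \<Longrightarrow> x \<in> S \<Longrightarrow> B (I s x) = I s (B x)"
proof -
  show "B \<in> endos S" "x \<in> S \<Longrightarrow> y \<in> S \<Longrightarrow> g (B x) y = - g x (B y)"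
    using assms by (auto simp: sp_n_def)
  have "I s \<in> Q" if "s \<in> Idx" for s
    unfolding Q using that by (auto simp: Idx_def intro: span_base)
  then show "s \<in> Idx \<Longrightarrow> x \<in> S \<Longrightarrow> B (I s x) = I s (B x)"
    using assms by (auto simp: sp_n_def)
qed

lemma endos_lin_comb: "B \<in> endos S \<Longrightarrow> C \<in> endos S \<Longrightarrow> B + C \<in> endos S"
  "B \<in> endos S \<Longrightarrow> c *\<^sub>R B \<in> endos S" "0 \<in> endos S"
  by (auto simp: endos_def linear_on_def image_subset_iff algebra_simps)

lemma Q_endos: "J \<in> Q \<Longrightarrow> J \<in> endos S"
proof -
  assume "J \<in> Q"
  then obtain c where *: "J = (\<Sum>t\<in>Idx. c t *\<^sub>R I t)" using Q_sum by blast
  show ?thesis unfolding * sum_123 by (intro endos_lin_comb I_endos) auto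
qed

lemma perpI:
  assumes B: "B \<in> endos S"
    and 1: "\<And>s. s \<in> Idx \<Longrightarrow> tr B (I s) = 0"
    and 2: "\<And>C. C \<in> sp_n g Q S \<Longrightarrow> tr B C = 0"
  shows "B \<in> sp_n_sp_1_perp g Q S"
  unfolding sp_n_sp_1_perp_def
proof (intro CollectI conjI ballI B)
  fix C J assume C: "C \<in> sp_n g Q S" and J: "J \<in> Q"
  obtain c where c: "\<And>x. J x = (\<Sum>t\<in>Idx. c t *\<^sub>R I t x)" using Q_apply[OF J] by blast
  note lB = lin_endo_endos[OF B] and lC = lin_endo_endos[OF sp_nD(1)[OF C]]
  have "endo_inner g S B (C + J) = tr B (\<lambda>x. C x + J x)"
    using inner_tr[OF B endos_lin_comb(1)[OF sp_nD(1)[OF C] Q_endos[OF J]]] by (simp add: plus_fun_def)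
  also have "\<dots> = tr B C + tr B J" by (rule tr_add[OF lB lC lin_endo_endos[OF Q_endos[OF J]]])
  also have "tr B J = tr B (\<lambda>x. \<Sum>t\<in>Idx. c t *\<^sub>R I t x)" by (rule tr_cong) (simp_all add: c)
  also have "\<dots> = (\<Sum>t\<in>Idx. tr B (\<lambda>x. c t *\<^sub>R I t x))"
    by (rule tr_sum[OF lB]) (rule lin_endo_lin_comb(2)[OF lin_endo_I])
  also have "\<dots> = 0"
    by (rule sum.neutral) (simp add: tr_scale[OF lB lin_endo_I] 1)
  finally show "endo_inner g S B (C + J) = 0" using 2[OF C] by (simp add: plus_fun_def)
qed

lemma sp_n_zero: "0 \<in> sp_n g Q S"
proof -
  have "J 0 = 0" if "J \<in> Q" for J
    using lin_endoD(3)[OF lin_endo_endos[OF Q_endos[OF that]], of 0 0] by simp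
  then show ?thesis by (simp add: sp_n_def endos_lin_comb)
qed

lemma perpD:
  assumes "B \<in> sp_n_sp_1_perp g Q S"
  shows "B \<in> endos S" "s \<in> Idx \<Longrightarrow> tr B (I s) = 0" "C \<in> sp_n g Q S \<Longrightarrow> tr B C = 0"
proof -
  show B: "B \<in> endos S" using assms by (simp add: sp_n_sp_1_perp_def)
  have *: "endo_inner g S B (C + J) = 0" if "C \<in> sp_n g Q S" "J \<in> Q" for C J
    using assms that by (simp add: sp_n_sp_1_perp_def)
  show "tr B (I s) = 0" if s: "s \<in> Idx"
  proof -
    have "I s \<in> Q" unfolding Q using s by (auto simp: Idx_def intro: span_base)
    from *[OF sp_n_zero this] show ?thesis using inner_tr[OF B I_endos[OF s]] by simp
  qed
  show "tr B C = 0" if C: "C \<in> sp_n g Q S"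
    using *[OF C, of 0] inner_tr[OF B sp_nD(1)[OF C]] by (simp add: Q span_zero)
qed

text \<open>Since \<epsilon>_s I_s is the inverse of I_s, this is a mean over the four conjugations
  by 1, I_1, I_2, I_3. The values \<open>b s\<close> are free arguments because the formula also has
  to serve for differential operators, where they are derivatives of the sections I_s Y.\<close>

definition avg :: "'a \<Rightarrow> (nat \<Rightarrow> 'a) \<Rightarrow> 'a" where
  "avg a b = (1/4) *\<^sub>R (a + (\<Sum>s\<in>Idx. \<epsilon> s *\<^sub>R I s (b s)))"

text \<open>For \<open>a = B x\<close> and \<open>b s = B (I s x)\<close> this says that averaging an operator \<open>B\<close> over the
  conjugations by the group generated by \<open>I\<^sub>1, I\<^sub>2, I\<^sub>3\<close> yields an operator that commutes with it.\<close>

lemma avg_commute: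
  assumes c: "cyc t j k" and a: "a \<in> S" and b: "\<And>s. s \<in> Idx \<Longrightarrow> b s \<in> S"
  shows "avg (b t) (\<lambda>s. if s = t then \<epsilon> t *\<^sub>R a else if s = j then \<epsilon> k *\<^sub>R b k else - \<epsilon> j *\<^sub>R b j)
    = I t (avg a b)"
proof -
  have mem: "t \<in> Idx" "j \<in> Idx" "k \<in> Idx" and ne: "t \<noteq> j" "t \<noteq> k" "j \<noteq> k"
    using cyc_mem[OF c] cyc_distinct[OF c] by auto
  note c2 = cyc_rot[OF cyc_rot[OF c]]
  note bb = b[OF mem(1)] b[OF mem(2)] b[OF mem(3)]
  have Ib: "I t (b t) \<in> S" "I j (b j) \<in> S" "I k (b k) \<in> S" using I_in mem bb by auto
  have 1: "I t (I t (b t)) = \<epsilon> t *\<^sub>R b t" "I t (I j (b j)) = - \<epsilon> k *\<^sub>R I k (b j)"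
    "I t (I k (b k)) = \<epsilon> j *\<^sub>R I j (b k)"
    using I_sq[OF mem(1) bb(1)] I_cyc(1)[OF c bb(2)] I_cyc(2)[OF c2 bb(3)] by auto
  have "I t (avg a b) = (1/4) *\<^sub>R (I t a + (\<epsilon> t *\<^sub>R I t (I t (b t)) + \<epsilon> j *\<^sub>R I t (I j (b j)) + \<epsilon> k *\<^sub>R I t (I k (b k))))"
    unfolding avg_def sum_cyc[OF c]
    using I_linear(1,2)[OF mem(1)] a Ib by simp
  also have "\<dots> = (1/4) *\<^sub>R (I t a + (b t - (\<epsilon> j * \<epsilon> k) *\<^sub>R I k (b j) + (\<epsilon> k * \<epsilon> j) *\<^sub>R I j (b k)))"
    unfolding 1 by simp
  finally have lhs: "I t (avg a b) = \<dots>" .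
  have "I k (- (\<epsilon> j *\<^sub>R b j)) = - (\<epsilon> j *\<^sub>R I k (b j))"
    using I_linear(2,3)[OF mem(3) bb(2)] I_linear(3)[OF mem(3), of "\<epsilon> j *\<^sub>R b j"] bb(2) by simp
  then show ?thesis
    unfolding lhs unfolding avg_def sum_cyc[OF c]
    using ne I_linear(2)[OF mem(1) a] I_linear(2)[OF mem(2) bb(3)] by (simp add: algebra_simps)
qed

definition AV :: "('a \<Rightarrow> 'a) \<Rightarrow> 'a \<Rightarrow> 'a" where
  "AV B x = (if x \<in> S then avg (B x) (\<lambda>s. B (I s x)) else 0)"

lemma AV_endo:
  assumes B: "lin_endo B" shows "lin_endo (AV B)" "AV B \<in> endos S"
proof -
  have "lin_endo (\<lambda>x. avg (B x) (\<lambda>s. B (I s x)))"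
    unfolding avg_def by (intro lin_endo_lin_comb lin_endo_sum lin_endo_comp[OF lin_endo_I]
      lin_endo_comp[OF B lin_endo_I] B)
  then show l: "lin_endo (AV B)"
    unfolding lin_endo_def linear_on_def AV_def by (simp add: image_subset_iff)
  then show "AV B \<in> endos S" by (simp add: endos_def lin_endo_def AV_def)
qed

lemma AV_commute:
  assumes B: "lin_endo B" and s: "s \<in> Idx" and x: "x \<in> S"
  shows "AV B (I s x) = I s (AV B x)"
proof -
  obtain j k where c: "cyc s j k" using cyc_cases[OF s] by blast
  have mem: "j \<in> Idx" "k \<in> Idx" and ne: "s \<noteq> j" "s \<noteq> k" "j \<noteq> k"
    using cyc_mem[OF c] cyc_distinct[OF c] by auto
  note c2 = cyc_rot[OF cyc_rot[OF c]]
  have "AV B (I s x) = avg (B (I s x)) (\<lambda>r. if r = s then \<epsilon> s *\<^sub>R B x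
      else if r = j then \<epsilon> k *\<^sub>R B (I k x) else - \<epsilon> j *\<^sub>R B (I j x))"
    unfolding AV_def avg_def sum_cyc[OF c] I_sq[OF s x] I_cyc(2)[OF c x] I_cyc(1)[OF c2 x]
    using I_in[OF s x] lin_endoD(3)[OF B x] lin_endoD(3)[OF B I_in[OF mem(1) x], of "- \<epsilon> j"]
      lin_endoD(3)[OF B I_in[OF mem(2) x]] ne by simp
  also have "\<dots> = I s (avg (B x) (\<lambda>s. B (I s x)))"
    by (rule avg_commute[OF c lin_endoD(1)[OF B x]]) (rule lin_endoD(1)[OF B I_in[OF _ x]])
  finally show ?thesis using x by (simp add: AV_def)
qed

lemma AV_sp_n:
  assumes B: "lin_endo B" and skew: "\<And>x y. x \<in> S \<Longrightarrow> y \<in> S \<Longrightarrow> g (B x) y = - g x (B y)"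
  shows "AV B \<in> sp_n g Q S"
  unfolding sp_n_def
proof (intro CollectI conjI ballI AV_endo[OF B])
  fix x y assume x: "x \<in> S" and y: "y \<in> S"
  note Bx = lin_endoD(1)[OF B x] and By = lin_endoD(1)[OF B y]
  have IBI: "I s (B (I s u)) \<in> S" if "s \<in> Idx" "u \<in> S" for s u
    using I_in[OF that(1) lin_endoD(1)[OF B I_in[OF that]]] .
  have s: "g (I s (B (I s x))) y = - g x (I s (B (I s y)))" if s: "s \<in> Idx" for s
    using I_skew[OF s lin_endoD(1)[OF B I_in[OF s x]] y] skew[OF I_in[OF s x] I_in[OF s y]]
      I_skew[OF s x lin_endoD(1)[OF B I_in[OF s y]]] by simp
  show "g (AV B x) y = - g x (AV B y)"
    unfolding AV_def avg_def sum_123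
    using x y Bx By IBI[of 1] IBI[of 2] IBI[of 3] s[of 1] s[of 2] s[of 3] skew[OF x y]
    by (simp add: add_divide_distrib diff_divide_distrib)
next
  fix J x assume J: "J \<in> Q" and x: "x \<in> S"
  obtain c where c: "\<And>x. J x = (\<Sum>t\<in>Idx. c t *\<^sub>R I t x)" using Q_apply[OF J] by blast
  show "AV B (J x) = J (AV B x)"
    unfolding c sum_123
    using AV_commute[OF B _ x] x I_in[OF _ x] lin_endoD(2,3)[OF AV_endo(1)[OF B]] by simp
qed

text \<open>Averaging is self-adjoint for the trace form: against an operator that commutes with the
  structures, each of the four conjugates contributes the same amount.\<close>

lemma tr_AV:
  assumes B: "lin_endo B" "\<And>s x. s \<in> Idx \<Longrightarrow> x \<in> S \<Longrightarrow> B (I s x) = I s (B x)" and K: "lin_endo K"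
  shows "tr B (AV K) = tr B K"
proof -
  have IKI: "lin_endo (\<lambda>x. I s (K (I s x)))" if "s \<in> Idx" for s
    by (intro lin_endo_comp[OF lin_endo_I[OF that]] lin_endo_comp[OF K] lin_endo_I[OF that])
  have s: "tr B (\<lambda>x. \<epsilon> s *\<^sub>R I s (K (I s x))) = tr B K" if s: "s \<in> Idx" for s
  proof -
    have "tr B (\<lambda>x. I s (K (I s x))) = tr (\<lambda>x. I s (B (I s x))) (\<lambda>x. I s (I s (K (I s (I s x)))))"
      by (rule tr_conj[OF s B(1) IKI[OF s], symmetric])
    also have "\<dots> = tr (\<lambda>x. \<epsilon> s *\<^sub>R B x) K"
      using B(2)[OF s] I_sq[OF s] lin_endoD(1)[OF B(1)] lin_endoD(1,3)[OF K]
      by (intro tr_cong) simp_all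
    also have "\<dots> = \<epsilon> s * tr B K"
      unfolding tr_def using E lin_endoD(1)[OF B(1)] lin_endoD(1)[OF K] by (simp add: sum_distrib_left)
    finally show ?thesis by (simp add: tr_scale[OF B(1) IKI[OF s]])
  qed
  have IKI': "lin_endo (\<lambda>x. \<epsilon> s *\<^sub>R I s (K (I s x)))" if "s \<in> Idx" for s
    by (rule lin_endo_lin_comb(2)[OF IKI[OF that]])
  have "tr B (AV K) = tr B (\<lambda>x. (1/4) *\<^sub>R (K x + (\<Sum>s\<in>Idx. \<epsilon> s *\<^sub>R I s (K (I s x)))))"
    by (rule tr_cong) (simp_all add: AV_def avg_def)
  also have "\<dots> = (1/4) * tr B (\<lambda>x. K x + (\<Sum>s\<in>Idx. \<epsilon> s *\<^sub>R I s (K (I s x))))"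
    by (rule tr_scale[OF B(1)]) (intro lin_endo_lin_comb(1) K lin_endo_sum IKI')
  also have "tr B (\<lambda>x. K x + (\<Sum>s\<in>Idx. \<epsilon> s *\<^sub>R I s (K (I s x)))) =
      tr B K + tr B (\<lambda>x. \<Sum>s\<in>Idx. \<epsilon> s *\<^sub>R I s (K (I s x)))"
    by (rule tr_add[OF B(1) K]) (intro lin_endo_sum IKI')
  also have "tr B (\<lambda>x. \<Sum>s\<in>Idx. \<epsilon> s *\<^sub>R I s (K (I s x))) = (\<Sum>s\<in>Idx. tr B (\<lambda>x. \<epsilon> s *\<^sub>R I s (K (I s x))))"
    by (rule tr_sum[OF B(1) IKI'])
  also have "\<dots> = 3 * tr B K" unfolding sum_123 s[OF Idx_mem(1)] s[OF Idx_mem(3)] s[OF Idx_mem(4)] by simp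
  finally show ?thesis by simp
qed

text \<open>The trace form is indefinite on sp(n,R), so \<open>B\<close> cannot be tested against
  itself. The test element is the average of the skew rank two operator K z = g(x, z) y - g(y, z) x;
  its trace with \<open>B\<close> is that of K, namely 2 g(B x, y).\<close>

lemma sp_n_perp_zero:
  assumes B: "B \<in> sp_n g Q S" and perp: "\<And>C. C \<in> sp_n g Q S \<Longrightarrow> tr B C = 0" and x: "x \<in> S"
  shows "B x = 0"
proof (rule nondeg2[OF _ S_closed(1)])
  note lB = lin_endo_endos[OF sp_nD(1)[OF B]]
  show "B x \<in> S" using lin_endoD(1)[OF lB x] .
  fix y assume y: "y \<in> S"
  define K where "K z = g x z *\<^sub>R y - g y z *\<^sub>R x" for z
  have K: "lin_endo K"
    unfolding K_def using x y by (intro lin_endoI) (simp_all add: algebra_simps)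
  have "g (K u) v = - g u (K v)" if "u \<in> S" "v \<in> S" for u v
    unfolding K_def using x y that g_sym[of u x] g_sym[of u y] by simp
  then have "tr B (AV K) = 0" by (intro perp AV_sp_n K)
  then have "tr B K = 0" using tr_AV[OF lB sp_nD(3)[OF B] K] by simp
  moreover have "tr B K = g (B x) y - g (B y) x"
  proof -
    have l: "linear_on S (\<lambda>z. g (B z) u)" if "u \<in> S" for u
      using lin_endoD[OF lB] that by (simp add: linear_on_def)
    have "tr B K = (\<Sum>a<N. (g x (E a) / g (E a) (E a)) *\<^sub>R g (B (E a)) y - (g y (E a) / g (E a) (E a)) *\<^sub>R g (B (E a)) x)"
      unfolding tr_def K_def using E x y lin_endoD(1)[OF lB] by (intro sum.cong) (simp_all add: diff_divide_distrib)
    then show ?thesis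
      unfolding sum_subtractf contract[OF x l[OF y]] contract[OF y l[OF x]] .
  qed
  moreover have "g (B y) x = - g (B x) y"
    using sp_nD(2)[OF B y x] g_sym[OF y lin_endoD(1)[OF lB x]] by simp
  ultimately show "g (B x) y = g 0 y" using y by simp
qed

text \<open>The normalizer of \<open>Q\<close> among the skew endomorphisms is sp(n,R) + sp(1,R), on which the
  inner product is nondegenerate.\<close>

lemma perp_normalizer_zero:
  assumes D: "D \<in> sp_n_sp_1_perp g Q S"
    and skew: "\<And>x y. x \<in> S \<Longrightarrow> y \<in> S \<Longrightarrow> g (D x) y = - g x (D y)"
    and norm: "\<And>s x. s \<in> Idx \<Longrightarrow> x \<in> S \<Longrightarrow> D (I s x) - I s (D x) = (\<Sum>t\<in>Idx. A s t *\<^sub>R I t x)"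
    and x: "x \<in> S"
  shows "D x = 0"
proof -
  note D' = perpD[OF D] and lD = lin_endo_endos[OF perpD(1)[OF D]]
  have DI: "D (I s x) = I s (D x) + (\<Sum>t\<in>Idx. A s t *\<^sub>R I t x)" if "s \<in> Idx" "x \<in> S" for s x
    using norm[OF that] by (simp add: algebra_simps)
  \<comment> \<open>Commuting D past I_s twice must give the same as commuting it past the scalar
    \<epsilon>_s. The off-diagonal terms cancel by anticommutation, and 2 A_ss \<epsilon>_s
    remains.\<close>
  have A0: "A s s = 0" if s: "s \<in> Idx" for s
  proof -
    define e where "e = E 0"
    have e: "e \<in> S" "e \<noteq> 0" using E[of 0] E_nz[of 0] N by (auto simp: e_def)
    obtain j k where c: "cyc s j k" using cyc_cases[OF s] by blast
    have mem: "j \<in> Idx" "k \<in> Idx" "s \<noteq> j" "s \<noteq> k" using cyc_mem[OF c] cyc_distinct[OF c] by auto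
    note Ie = I_in[OF s e(1)] I_in[OF mem(1) e(1)] I_in[OF mem(2) e(1)] and De = lin_endoD(1)[OF lD e(1)]
    have "D (I s (I s e)) = I s (D (I s e)) + (\<Sum>t\<in>Idx. A s t *\<^sub>R I t (I s e))"
      by (rule DI[OF s Ie(1)])
    also have "D (I s e) = I s (D e) + (A s s *\<^sub>R I s e + A s j *\<^sub>R I j e + A s k *\<^sub>R I k e)"
      using DI[OF s e(1)] unfolding sum_cyc[OF c] .
    finally have "\<epsilon> s *\<^sub>R D e = \<epsilon> s *\<^sub>R D e + (A s s *\<^sub>R I s (I s e) + A s j *\<^sub>R I s (I j e) + A s k *\<^sub>R I s (I k e))
        + (A s s *\<^sub>R I s (I s e) + A s j *\<^sub>R I j (I s e) + A s k *\<^sub>R I k (I s e))"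
      unfolding sum_cyc[OF c] using I_linear(1,2)[OF s] Ie De I_in[OF s De] I_sq[OF s De]
        I_sq[OF s e(1)] lin_endoD(3)[OF lD e(1)] by simp
    then have "(2 * A s s * \<epsilon> s) *\<^sub>R e = 0"
      unfolding I_anti[OF mem(1) s mem(3)[symmetric] e(1)] I_anti[OF mem(2) s mem(4)[symmetric] e(1)]
        I_sq[OF s e(1)]
      by (simp add: algebra_simps flip: scaleR_2)
    then show ?thesis using e(2) by simp
  qed
  \<comment> \<open>The coefficients of AV D - D. For each t the average collects the two
    off-diagonal entries of A whose products I_s I_u are multiples of I_t, with the signs of the
    multiplication table \<open>tab\<close>.\<close>
  define c :: "nat \<Rightarrow> real" where "c t = (if t = 1 then - A 2 3 - A 3 2 else if t = 2 then A 1 3 + A 3 1 else A 1 2 - A 2 1) / 4" for t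
  have AVD: "AV D x = D x + (\<Sum>t\<in>Idx. c t *\<^sub>R I t x)" if x: "x \<in> S" for x
  proof -
    note Ix = I_in[of 1, OF _ x, simplified] I_in[of 2, OF _ x, simplified] I_in[of 3, OF _ x, simplified]
    note Dx = lin_endoD(1)[OF lD x]
    have tab: "I 1 (I 2 x) = I 3 x" "I 2 (I 1 x) = - I 3 x" "I 2 (I 3 x) = - I 1 x" "I 3 (I 2 x) = I 1 x"
      "I 3 (I 1 x) = - I 2 x" "I 1 (I 3 x) = I 2 x"
      using I_cyc[of 1 2 3, OF _ x] I_cyc[of 2 3 1, OF _ x] I_cyc[of 3 1 2, OF _ x] by (simp_all add: cyc_def)
    have s: "I s (D (I s x)) = \<epsilon> s *\<^sub>R D x + (A s 1 *\<^sub>R I s (I 1 x) + A s 2 *\<^sub>R I s (I 2 x) + A s 3 *\<^sub>R I s (I 3 x))"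
      if s: "s \<in> Idx" for s
      unfolding DI[OF s x] sum_123 using I_linear(1,2)[OF s] Ix I_in[OF s Dx] I_sq[OF s Dx] by simp
    have q: "(1/4) *\<^sub>R D x + ((1/4) *\<^sub>R D x + ((1/4) *\<^sub>R D x + ((1/4) *\<^sub>R D x + z))) = D x + z" for z
      by (simp flip: add.assoc scaleR_add_left)
    show ?thesis
      unfolding AV_def avg_def sum_123 s[OF Idx_mem(1)] s[OF Idx_mem(3)] s[OF Idx_mem(4)] tab c_def
      using x A0[of 1] A0[of 2] A0[of 3]
      by (simp add: algebra_simps add_divide_distrib diff_divide_distrib q)
  qed
  \<comment> \<open>D is orthogonal to sp(n,R) by assumption, and so is each I_t, since it
    anticommutes with some I_j. Hence the average, an element of sp(n,R), is zero, and D is a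
    combination of the I_t; pairing with each I_u then removes its coefficients.\<close>
  have AV_perp: "tr (AV D) C = 0" if C: "C \<in> sp_n g Q S" for C
  proof -
    note lC = lin_endo_endos[OF sp_nD(1)[OF C]]
    have It: "tr (I t) C = 0" if t: "t \<in> Idx" for t
    proof -
      obtain j k where "cyc t j k" using cyc_cases[OF t] by blast
      then have j: "j \<in> Idx" "t \<noteq> j" using cyc_mem cyc_distinct by blast+
      show ?thesis
        by (rule tr_commuting_zero[OF j(1) lC sp_nD(3)[OF C j(1)] lin_endo_I[OF t]])
          (use I_anti[OF t j(1,2)] in auto)
    qed
    have lcI: "lin_endo (\<lambda>x. c t *\<^sub>R I t x)" if "t \<in> Idx" for t
      by (rule lin_endo_lin_comb(2)[OF lin_endo_I[OF that]])
    have lsum: "lin_endo (\<lambda>x. \<Sum>t\<in>Idx. c t *\<^sub>R I t x)" by (rule lin_endo_sum[OF lcI])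
    have "tr (AV D) C = tr C (AV D)" by (rule tr_sym[OF AV_endo(1)[OF lD] lC])
    also have "\<dots> = tr C (\<lambda>x. D x + (\<Sum>t\<in>Idx. c t *\<^sub>R I t x))"
      by (rule tr_cong) (simp_all add: AVD)
    also have "\<dots> = tr C D + (\<Sum>t\<in>Idx. c t * tr C (I t))"
      by (simp add: tr_add[OF lC lD lsum] tr_sum[OF lC lcI] tr_scale[OF lC lin_endo_I])
    also have "\<dots> = 0"
      using D'(3)[OF C] tr_sym[OF lC lD] It tr_sym[OF lC lin_endo_I] by simp
    finally show ?thesis .
  qed
  have "AV D y = 0" if "y \<in> S" for y
    by (rule sp_n_perp_zero[OF AV_sp_n[OF lD skew] AV_perp that])
  then have Dc: "D y = (\<Sum>t\<in>Idx. - c t *\<^sub>R I t y)" if "y \<in> S" for y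
    using AVD[OF that] that by (simp add: sum_negf eq_neg_iff_add_eq_0)
  have "c u = 0" if u: "u \<in> Idx" for u
  proof -
    have lcI: "lin_endo (\<lambda>x. - c t *\<^sub>R I t x)" if "t \<in> Idx" for t
      by (rule lin_endo_lin_comb(2)[OF lin_endo_I[OF that]])
    have "0 = tr (I u) D" using D'(2)[OF u] tr_sym[OF lD lin_endo_I[OF u]] by simp
    also have "\<dots> = tr (I u) (\<lambda>y. \<Sum>t\<in>Idx. - c t *\<^sub>R I t y)" by (rule tr_cong) (simp_all add: Dc)
    also have "\<dots> = (\<Sum>t\<in>Idx. tr (I u) (\<lambda>y. - c t *\<^sub>R I t y))"
      by (rule tr_sum[OF lin_endo_I[OF u] lcI])
    also have "\<dots> = (\<Sum>t\<in>Idx. - c t * tr (I u) (I t))"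
      by (rule sum.cong[OF refl]) (rule tr_scale[OF lin_endo_I[OF u] lin_endo_I])
    also have "\<dots> = (\<Sum>t\<in>Idx. if t = u then c u * (\<epsilon> u * N) else 0)"
      by (rule sum.cong[OF refl]) (simp add: tr_I[OF u])
    also have "\<dots> = c u * (\<epsilon> u * N)" using u by simp
    finally show ?thesis using N by simp
  qed
  then show ?thesis using Dc[OF x] by simp
qed

text \<open>The three summands take care of the three requirements. Each I_s R_s anticommutes with
  I_s and is therefore orthogonal to sp(n,R); the symmetric \<open>Y\<close> is orthogonal to every
  skew operator; and as tr(I_u, I_u) = -\<epsilon>_u N, the constants \<open>c u\<close> are those
  that make the sum orthogonal to I_u.\<close>

lemma perp_construction:
  fixes R :: "nat \<Rightarrow> 'a \<Rightarrow> 'a"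
  assumes Y: "lin_endo Y" "\<And>x y. x \<in> S \<Longrightarrow> y \<in> S \<Longrightarrow> g (Y x) y = g x (Y y)"
    and R: "\<And>s. s \<in> Idx \<Longrightarrow> lin_endo (R s)"
      "\<And>s x. s \<in> Idx \<Longrightarrow> x \<in> S \<Longrightarrow> R s (I s x) = - I s (R s x)"
    and P: "\<And>x. x \<in> S \<Longrightarrow> P x = (\<Sum>s\<in>Idx. (\<epsilon> s / 4) *\<^sub>R I s (R s x))"
    and c: "\<And>u. u \<in> Idx \<Longrightarrow> c u = \<epsilon> u * tr P (I u) / N"
    and B: "B \<in> endos S" "\<And>x. x \<in> S \<Longrightarrow> B x = P x + Y x + (\<Sum>u\<in>Idx. c u *\<^sub>R I u x)"
  shows "B \<in> sp_n_sp_1_perp g Q S"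
proof (rule perpI[OF B(1)])
  have lIR: "lin_endo (\<lambda>x. (\<epsilon> s / 4) *\<^sub>R I s (R s x))" if "s \<in> Idx" for s
    by (rule lin_endo_lin_comb(2)[OF lin_endo_comp[OF lin_endo_I[OF that] R(1)[OF that]]])
  have lP': "lin_endo (\<lambda>x. \<Sum>s\<in>Idx. (\<epsilon> s / 4) *\<^sub>R I s (R s x))" by (rule lin_endo_sum[OF lIR])
  then have lP: "lin_endo P" using P unfolding lin_endo_def linear_on_def by (simp add: image_subset_iff)
  have lcI: "lin_endo (\<lambda>x. c t *\<^sub>R I t x)" if "t \<in> Idx" for t
    by (rule lin_endo_lin_comb(2)[OF lin_endo_I[OF that]])
  have lsum: "lin_endo (\<lambda>x. \<Sum>t\<in>Idx. c t *\<^sub>R I t x)" by (rule lin_endo_sum[OF lcI])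
  note lB = lin_endo_endos[OF B(1)]
  have trB: "tr C B = tr C P + tr C Y + (\<Sum>t\<in>Idx. c t * tr C (I t))" if C: "lin_endo C" for C
  proof -
    have "tr C B = tr C (\<lambda>x. (P x + Y x) + (\<Sum>u\<in>Idx. c u *\<^sub>R I u x))"
      by (rule tr_cong) (simp_all add: B(2))
    also have "\<dots> = tr C P + tr C Y + (\<Sum>t\<in>Idx. tr C (\<lambda>x. c t *\<^sub>R I t x))"
      by (simp add: tr_add[OF C lin_endo_lin_comb(1)[OF lP Y(1)] lsum] tr_add[OF C lP Y(1)] tr_sum[OF C lcI])
    also have "(\<Sum>t\<in>Idx. tr C (\<lambda>x. c t *\<^sub>R I t x)) = (\<Sum>t\<in>Idx. c t * tr C (I t))"
      by (rule sum.cong[OF refl]) (rule tr_scale[OF C lin_endo_I])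
    finally show ?thesis .
  qed
  have YC: "tr C Y = 0" if "lin_endo C" "\<And>x y. x \<in> S \<Longrightarrow> y \<in> S \<Longrightarrow> g (C x) y = - g x (C y)" for C
    using tr_symmetric_skew[OF Y that] tr_sym[OF Y(1) that(1)] by simp
  show "tr B (I s) = 0" if s: "s \<in> Idx" for s
  proof -
    have "(\<Sum>t\<in>Idx. c t * tr (I s) (I t)) = (\<Sum>t\<in>Idx. if t = s then - (c s * \<epsilon> s * N) else 0)"
      by (rule sum.cong[OF refl]) (simp add: tr_I[OF s])
    also have "\<dots> = - tr (I s) P" using s N c[OF s] tr_sym[OF lP lin_endo_I[OF s]] by simp
    finally show ?thesis
      using trB[OF lin_endo_I[OF s]] YC[OF lin_endo_I[OF s] I_skew[OF s]] tr_sym[OF lB lin_endo_I[OF s]]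
      by simp
  qed
  show "tr B C = 0" if C: "C \<in> sp_n g Q S" for C
  proof -
    note lC = lin_endo_endos[OF sp_nD(1)[OF C]]
    have anti: "tr C D = 0" if s: "s \<in> Idx" and D: "lin_endo D" "\<And>x. x \<in> S \<Longrightarrow> D (I s x) = - I s (D x)" for D s
      using tr_commuting_zero[OF s lC sp_nD(3)[OF C s] D] tr_sym[OF lC D(1)] by simp
    have "tr C (I t) = 0" if t: "t \<in> Idx" for t
    proof -
      obtain j k where "cyc t j k" using cyc_cases[OF t] by blast
      then have j: "j \<in> Idx" "t \<noteq> j" using cyc_mem cyc_distinct by blast+
      show ?thesis by (rule anti[OF j(1) lin_endo_I[OF t]]) (use I_anti[OF t j(1,2)] in auto)
    qed
    moreover have "tr C P = 0"
    proof -
      have "tr C P = tr C (\<lambda>x. \<Sum>s\<in>Idx. (\<epsilon> s / 4) *\<^sub>R I s (R s x))" by (rule tr_cong) (simp_all add: P)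
      also have "\<dots> = (\<Sum>s\<in>Idx. tr C (\<lambda>x. (\<epsilon> s / 4) *\<^sub>R I s (R s x)))" by (rule tr_sum[OF lC lIR])
      also have "\<dots> = 0"
      proof (rule sum.neutral, rule ballI)
        fix s assume s: "s \<in> Idx"
        have RI: "lin_endo (\<lambda>x. I s (R s x))" by (rule lin_endo_comp[OF lin_endo_I[OF s] R(1)[OF s]])
        have "I s (R s (I s x)) = - I s (I s (R s x))" if "x \<in> S" for x
          unfolding R(2)[OF s that] by (rule I_linear(3)[OF s I_in[OF s lin_endoD(1)[OF R(1)[OF s] that]]])
        then show "tr C (\<lambda>x. (\<epsilon> s / 4) *\<^sub>R I s (R s x)) = 0"
          using anti[OF s RI] tr_scale[OF lC RI] by simp
      qed
      finally show ?thesis .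
    qed
    ultimately show ?thesis using trB[OF lC] YC[OF lC sp_nD(2)[OF C]] tr_sym[OF lB lC] by simp
  qed
qed

end

section \<open>Local frames\<close>

lemma ball_Idx: "(\<forall>s\<in>{1,2,3}. P s) \<longleftrightarrow> (\<forall>s\<in>Idx. P s)"
  by (simp add: Idx_def)

lemma section_onD:
  "section_on A E W X \<Longrightarrow> vector_field A W X" "section_on A E W X \<Longrightarrow> q \<in> W \<Longrightarrow> X q \<in> E q"
  by (simp_all add: section_on_def)

lemma section_onI: "vector_field A W X \<Longrightarrow> (\<And>q. q \<in> W \<Longrightarrow> X q \<in> E q) \<Longrightarrow> section_on A E W X"
  by (simp add: section_on_def)

lemma (in smooth_mfd) section_subset:
  "section_on A E U X \<Longrightarrow> open W \<Longrightarrow> W \<subseteq> U \<Longrightarrow> section_on A E W X"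
  using vf_subset by (auto simp: section_on_def)

lemma local_dataD:
  assumes "local_data A H g PQ U \<eta> I"
  shows "s \<in> Idx \<Longrightarrow> one_form A U (\<eta> s)" "s \<in> Idx \<Longrightarrow> endo_field A H U (I s)"
    "q \<in> U \<Longrightarrow> paraquaternionic (H q) (\<lambda>s. I s q)" "q \<in> U \<Longrightarrow> PQ q = span {I 1 q, I 2 q, I 3 q}"
    "q \<in> U \<Longrightarrow> H q = {v \<in> tangent_space A q. \<forall>s\<in>Idx. \<eta> s q v = 0}"
    "q \<in> U \<Longrightarrow> s \<in> Idx \<Longrightarrow> x \<in> H q \<Longrightarrow> y \<in> H q \<Longrightarrow> g q (I s q x) (I s q y) = - \<epsilon> s * g q x y"
    "s \<in> Idx \<Longrightarrow> W \<subseteq> U \<Longrightarrow> section_on A H W X \<Longrightarrow> section_on A H W Y \<Longrightarrow> q \<in> W \<Longrightarrow>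
      ext_deriv A (\<eta> s) X Y q = - 2 * \<epsilon> s * g q (I s q (X q)) (Y q)"
  using assms unfolding local_data_def ball_Idx by blast+

lemma local_dataI:
  assumes "\<And>s. s \<in> Idx \<Longrightarrow> one_form A U (\<eta> s)" "\<And>s. s \<in> Idx \<Longrightarrow> endo_field A H U (I s)"
    "\<And>q. q \<in> U \<Longrightarrow> paraquaternionic (H q) (\<lambda>s. I s q)"
    "\<And>q. q \<in> U \<Longrightarrow> PQ q = span {I 1 q, I 2 q, I 3 q}"
    "\<And>q. q \<in> U \<Longrightarrow> H q = {v \<in> tangent_space A q. \<forall>s\<in>Idx. \<eta> s q v = 0}"
    "\<And>q s x y. q \<in> U \<Longrightarrow> s \<in> Idx \<Longrightarrow> x \<in> H q \<Longrightarrow> y \<in> H q \<Longrightarrow>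
      g q (I s q x) (I s q y) = - \<epsilon> s * g q x y"
    "\<And>s W X Y q. s \<in> Idx \<Longrightarrow> W \<subseteq> U \<Longrightarrow> section_on A H W X \<Longrightarrow> section_on A H W Y \<Longrightarrow> q \<in> W \<Longrightarrow>
      ext_deriv A (\<eta> s) X Y q = - 2 * \<epsilon> s * g q (I s q (X q)) (Y q)"
  shows "local_data A H g PQ U \<eta> I"
  unfolding local_data_def ball_Idx
  by (intro conjI ballI allI impI; (elim conjE)?; rule assms; assumption)

lemma local_data_subset:
  assumes data: "local_data A H g PQ U \<eta> I" and W: "open W" "W \<subseteq> U"
  shows "local_data A H g PQ W \<eta> I"
proof (rule local_dataI)
  note d = local_dataD[OF data]
  show "one_form A W (\<eta> s)" if "s \<in> Idx" for s using d(1)[OF that] W unfolding one_form_def by blast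
  show "endo_field A H W (I s)" if "s \<in> Idx" for s using d(2)[OF that] W unfolding endo_field_def by blast
  show "ext_deriv A (\<eta> s) X Y q = - 2 * \<epsilon> s * g q (I s q (X q)) (Y q)"
    if "s \<in> Idx" "T \<subseteq> W" "section_on A H T X" "section_on A H T Y" "q \<in> T" for s T X Y q
    by (rule d(7)[OF that(1) subset_trans[OF that(2) W(2)] that(3-5)])
  fix q assume "q \<in> W"
  then have q: "q \<in> U" using W by blast
  show "paraquaternionic (H q) (\<lambda>s. I s q)" "PQ q = span {I 1 q, I 2 q, I 3 q}"
    "H q = {v \<in> tangent_space A q. \<forall>s\<in>Idx. \<eta> s q v = 0}"
    using d(3-5)[OF q] by blast+
  show "g q (I s q x) (I s q y) = - \<epsilon> s * g q x y" if "s \<in> Idx" "x \<in> H q" "y \<in> H q" for s x y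
    by (rule d(6)[OF q that])
qed

section \<open>Local data together with an orthogonal frame of H\<close>

locale pqc_frame = smooth_mfd A
  for A :: "('m::{t2_space,second_countable_topology}, 'e::euclidean_space) atlas" +
  fixes H :: "'m \<Rightarrow> 'm tvec set" and g :: "'m \<Rightarrow> 'm tvec \<Rightarrow> 'm tvec \<Rightarrow> real"
    and PQ :: "'m \<Rightarrow> ('m tvec \<Rightarrow> 'm tvec) set" and n :: nat and U :: "'m set"
    and \<eta> :: "nat \<Rightarrow> 'm \<Rightarrow> 'm tvec \<Rightarrow> real" and I :: "nat \<Rightarrow> 'm \<Rightarrow> 'm tvec \<Rightarrow> 'm tvec"
    and e :: "nat \<Rightarrow> 'm \<Rightarrow> 'm tvec"
  assumes n: "n \<ge> 2" and metric: "metric_on A H (2 * n) (2 * n) g"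
    and data: "local_data A H g PQ U \<eta> I"
    and e_sec: "a < 4 * n \<Longrightarrow> section_on A H U (e a)"
    and e_orth: "q \<in> U \<Longrightarrow> a < 4 * n \<Longrightarrow> b < 4 * n \<Longrightarrow> a \<noteq> b \<Longrightarrow> g q (e a q) (e b q) = 0"
    and e_nz: "q \<in> U \<Longrightarrow> a < 4 * n \<Longrightarrow> g q (e a q) (e a q) \<noteq> 0"
    and e_span: "q \<in> U \<Longrightarrow> span ((\<lambda>a. e a q) ` {..<4 * n}) = H q"
begin

lemma one_form_eta: "s \<in> Idx \<Longrightarrow> one_form A U (\<eta> s)"
  and endo_I: "s \<in> Idx \<Longrightarrow> endo_field A H U (I s)"
  using data unfolding local_data_def ball_Idx by blast+

lemma data_pointwise:
  assumes "q \<in> U"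
  shows "paraquaternionic (H q) (\<lambda>s. I s q)" "PQ q = span {I 1 q, I 2 q, I 3 q}"
    "H q = {v \<in> tangent_space A q. \<forall>s\<in>Idx. \<eta> s q v = 0}"
    "s \<in> Idx \<Longrightarrow> x \<in> H q \<Longrightarrow> y \<in> H q \<Longrightarrow> g q (I s q x) (I s q y) = - \<epsilon> s * g q x y"
  using data assms unfolding local_data_def ball_Idx by blast+

lemma data_ext_deriv:
  assumes "s \<in> Idx" "W \<subseteq> U" "section_on A H W X" "section_on A H W Y" "q \<in> W"
  shows "ext_deriv A (\<eta> s) X Y q = - 2 * \<epsilon> s * g q (I s q (X q)) (Y q)"
  using data assms unfolding local_data_def ball_Idx by blast

lemma openU: "open U"
  using one_form_eta[of 1] by (simp add: one_form_def)

text \<open>Not the frame field \<open>e 0\<close>: a basis chosen separately at each point,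
  orthonormal at that point, which serves to instantiate \<open>pq_endo\<close>.\<close>

definition e0 :: "'m \<Rightarrow> nat \<Rightarrow> 'm tvec" where
  "e0 q = (SOME e. orthonormal_basis (g q) (H q) e)"

lemma pointwise:
  assumes q: "q \<in> U"
  shows "pq_endo (H q) (g q) (4 * n) (\<lambda>a. e a q) (\<lambda>s. I s q) (PQ q) (e0 q)"
proof
  have m: "\<forall>x\<in>H q. linear_on (H q) (g q x)" "\<forall>x\<in>H q. \<forall>y\<in>H q. g q x y = g q y x"
    "has_signature (g q) (H q) (2 * n) (2 * n)"
    using metric unfolding metric_on_def by blast+
  show "subspace (H q)" using e_span[OF q] subspace_span by metis
  show "linear_on (H q) (g q x)" if "x \<in> H q" for x using m that by blast
  show "g q x y = g q y x" if "x \<in> H q" "y \<in> H q" for x y using m that by blast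
  show "e a q \<in> H q" if "a < 4 * n" for a using section_onD(2)[OF e_sec[OF that] q] .
  show "span ((\<lambda>a. e a q) ` {..<4 * n}) = H q" by (rule e_span[OF q])
  show "g q (e a q) (e b q) = 0" if "a < 4 * n" "b < 4 * n" "a \<noteq> b" for a b using e_orth[OF q that] .
  show "g q (e a q) (e a q) \<noteq> 0" if "a < 4 * n" for a using e_nz[OF q that] .
  have I: "I s q \<in> endos (H q)" if "s \<in> Idx" for s
    using endo_I[OF that] q unfolding endo_field_def by blast
  show "linear_on (H q) (I s q)" "x \<in> H q \<Longrightarrow> I s q x \<in> H q" "x \<notin> H q \<Longrightarrow> I s q x = 0" if "s \<in> Idx" for s x
    using I[OF that] by (simp_all add: endos_def image_subset_iff)
  show "paraquaternionic (H q) (\<lambda>s. I s q)" by (rule data_pointwise(1)[OF q])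
  show "g q (I s q x) (I s q y) = - \<epsilon> s * g q x y" if "s \<in> Idx" "x \<in> H q" "y \<in> H q" for s x y
    by (rule data_pointwise(4)[OF q that])
  show "PQ q = span {I 1 q, I 2 q, I 3 q}" by (rule data_pointwise(2)[OF q])
  show "orthonormal_basis (g q) (H q) (e0 q)"
    unfolding e0_def using m(3) someI_ex[of "orthonormal_basis (g q) (H q)"] unfolding has_signature_def by blast
  show "0 < 4 * n" using n by simp
qed

lemma H_subspace: "q \<in> U \<Longrightarrow> subspace (H q)"
  using e_span[of q] subspace_span[of "(\<lambda>a. e a q) ` {..<4 * n}"] by simp

lemma H_tangent: "q \<in> U \<Longrightarrow> x \<in> H q \<Longrightarrow> x \<in> tangent_space A q"
  using data_pointwise(3)[of q] by blast

lemma eta_H: "q \<in> U \<Longrightarrow> s \<in> Idx \<Longrightarrow> x \<in> H q \<Longrightarrow> \<eta> s q x = 0"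
  using data_pointwise(3)[of q] by blast

lemma H_iff: "q \<in> U \<Longrightarrow> x \<in> tangent_space A q \<Longrightarrow> (x \<in> H q) = (\<forall>s\<in>Idx. \<eta> s q x = 0)"
  using data_pointwise(3)[of q] by blast

lemma eta_linear: "q \<in> U \<Longrightarrow> s \<in> Idx \<Longrightarrow> linear_on (tangent_space A q) (\<eta> s q)"
  using one_form_eta[of s] unfolding one_form_def by blast

lemma eta_smooth: "s \<in> Idx \<Longrightarrow> W \<subseteq> U \<Longrightarrow> vector_field A W X \<Longrightarrow> smooth_fun A W (\<lambda>q. \<eta> s q (X q))"
  using one_form_eta[of s] unfolding one_form_def by blast

lemma sec_zero: "open W \<Longrightarrow> W \<subseteq> U \<Longrightarrow> section_on A H W (\<lambda>q. 0)"
  by (rule section_onI[OF vf_zero]) (use subspace_0[OF H_subspace] in auto)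

lemma sec_add:
  assumes "W \<subseteq> U" "section_on A H W X" "section_on A H W Y"
  shows "section_on A H W (\<lambda>q. X q + Y q)"
  by (rule section_onI[OF vf_add[OF section_onD(1)[OF assms(2)] section_onD(1)[OF assms(3)]]])
    (use subspace_add[OF H_subspace section_onD(2)[OF assms(2)] section_onD(2)[OF assms(3)]] assms(1) in blast)

lemma sec_scale:
  assumes "W \<subseteq> U" "smooth_fun A W f" "section_on A H W X"
  shows "section_on A H W (\<lambda>q. f q *\<^sub>R X q)"
  by (rule section_onI[OF vf_scale[OF assms(2) section_onD(1)[OF assms(3)]]])
    (use subspace_scale[OF H_subspace section_onD(2)[OF assms(3)]] assms(1) in blast)

lemma sec_cscale: "W \<subseteq> U \<Longrightarrow> section_on A H W X \<Longrightarrow> section_on A H W (\<lambda>q. c *\<^sub>R X q)"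
  using sec_scale[OF _ smooth_fun_const] vf_open section_onD(1) by blast

lemma sec_diff:
  assumes "W \<subseteq> U" "section_on A H W X" "section_on A H W Y"
  shows "section_on A H W (\<lambda>q. X q - Y q)"
  using sec_add[OF assms(1,2) sec_cscale[OF assms(1,3), of "-1"]] by simp

lemma sec_sum:
  assumes "W \<subseteq> U" "open W" "\<And>i. i \<in> J \<Longrightarrow> section_on A H W (X i)"
  shows "section_on A H W (\<lambda>q. \<Sum>i\<in>J. X i q)"
  using assms(3)
proof (induction J rule: infinite_finite_induct)
  case (insert i J)
  then have "section_on A H W (\<lambda>q. X i q + (\<Sum>i\<in>J. X i q))" by (intro sec_add[OF assms(1)]) blast+
  then show ?case by (simp only: sum.insert[OF insert.hyps])
qed (use sec_zero[OF assms(2,1)] in \<open>simp_all only: sum.infinite sum.empty not_False_eq_True\<close>)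

lemma sec_cong:
  assumes "section_on A H W X" "\<And>q. q \<in> W \<Longrightarrow> X q = Y q"
  shows "section_on A H W Y"
  by (rule section_onI[OF vf_cong[OF section_onD(1)[OF assms(1)] assms(2)]])
    (use section_onD(2)[OF assms(1)] assms(2) in auto)

lemma sec_I: "s \<in> Idx \<Longrightarrow> W \<subseteq> U \<Longrightarrow> section_on A H W X \<Longrightarrow> section_on A H W (\<lambda>q. I s q (X q))"
  using endo_I[of s] unfolding endo_field_def by blast

lemma e_sec': "W \<subseteq> U \<Longrightarrow> open W \<Longrightarrow> a < 4 * n \<Longrightarrow> section_on A H W (e a)"
  using section_subset[OF e_sec] by blast

lemma g_smooth: "section_on A H W X \<Longrightarrow> section_on A H W Y \<Longrightarrow> smooth_fun A W (\<lambda>q. g q (X q) (Y q))"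
  using metric unfolding metric_on_def by blast

definition co :: "nat \<Rightarrow> 'm \<Rightarrow> 'm tvec \<Rightarrow> real" where
  "co a q x = g q x (e a q) / g q (e a q) (e a q)"

lemma co_smooth:
  assumes "W \<subseteq> U" "section_on A H W X" "a < 4 * n"
  shows "smooth_fun A W (\<lambda>q. co a q (X q))"
proof -
  have "section_on A H W (e a)" using e_sec'[OF assms(1) _ assms(3)] vf_open section_onD(1)[OF assms(2)] by blast
  then show ?thesis
    unfolding co_def using e_nz[OF _ assms(3)] assms(1)
    by (intro smooth_fun_divide g_smooth assms) auto
qed

lemma frame_expand: "q \<in> U \<Longrightarrow> x \<in> H q \<Longrightarrow> x = (\<Sum>a<4*n. co a q x *\<^sub>R e a q)"
proof -
  assume q: "q \<in> U" and x: "x \<in> H q"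
  interpret P: pq_endo "H q" "g q" "4 * n" "\<lambda>a. e a q" "\<lambda>s. I s q" "PQ q" "e0 q" by (rule pointwise[OF q])
  show ?thesis unfolding co_def by (rule P.expand[OF x])
qed

lemma co_linear: "q \<in> U \<Longrightarrow> a < 4 * n \<Longrightarrow> linear_on (H q) (co a q)"
proof -
  assume q: "q \<in> U" and a: "a < 4 * n"
  interpret P: pq_endo "H q" "g q" "4 * n" "\<lambda>a. e a q" "\<lambda>s. I s q" "PQ q" "e0 q" by (rule pointwise[OF q])
  show ?thesis
    unfolding linear_on_def co_def using P.E[OF a] by (simp add: add_divide_distrib)
qed

text \<open>The sections that are given by the frame with constant coefficients; they realise any
  given vector at \<open>p\<close>.\<close>

definition ext :: "'m \<Rightarrow> 'm tvec \<Rightarrow> 'm \<Rightarrow> 'm tvec" where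
  "ext p x = (\<lambda>q. \<Sum>a<4*n. co a p x *\<^sub>R e a q)"

lemma ext_sec: "section_on A H U (ext p x)"
  unfolding ext_def using openU by (intro sec_sum sec_cscale e_sec) auto

lemma ext_eq: "p \<in> U \<Longrightarrow> x \<in> H p \<Longrightarrow> ext p x p = x"
  unfolding ext_def by (rule frame_expand[symmetric])

text \<open>Over the frame, \<open>X\<close> is a combination with smooth coefficients, so
  additivity and homogeneity over functions leave only the values of the coefficients at
  \<open>p\<close>.\<close>

lemma tensorial:
  fixes F :: "('m \<Rightarrow> 'm tvec) \<Rightarrow> 'b::real_vector"
  assumes W: "W \<subseteq> U" "p \<in> W" and X: "section_on A H W X"
    and add: "\<And>X Y. section_on A H W X \<Longrightarrow> section_on A H W Y \<Longrightarrow> F (\<lambda>q. X q + Y q) = F X + F Y"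
    and scale: "\<And>f X. smooth_fun A W f \<Longrightarrow> section_on A H W X \<Longrightarrow> F (\<lambda>q. f q *\<^sub>R X q) = f p *\<^sub>R F X"
  shows "F X = (\<Sum>a<4*n. co a p (X p) *\<^sub>R F (e a))"
proof -
  have o: "open W" using vf_open section_onD(1)[OF X] by blast
  \<comment> \<open>The operator receives \<open>X\<close> as a function on the whole manifold,
    while the frame expansion holds on \<open>W\<close> only. Scaling by the characteristic function
    of \<open>W\<close> removes the difference.\<close>
  have cong: "F X = F Y" if "section_on A H W X" "section_on A H W Y" "\<And>q. q \<in> W \<Longrightarrow> X q = Y q" for X Y
  proof -
    define c where "c = (\<lambda>q. if q \<in> W then 1::real else 0)"
    have c: "smooth_fun A W c" unfolding c_def by (rule smooth_fun_indicator[OF o])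
    have "(\<lambda>q. c q *\<^sub>R X q) = (\<lambda>q. c q *\<^sub>R Y q)" using that(3) by (auto simp: c_def)
    then have "c p *\<^sub>R F X = c p *\<^sub>R F Y" using scale[OF c that(1)] scale[OF c that(2)] by metis
    then show ?thesis using W by (simp add: c_def)
  qed
  have ea: "section_on A H W (e a)" if "a < 4 * n" for a using e_sec'[OF W(1) o that] .
  have sum: "F (\<lambda>q. \<Sum>a\<in>J. X a q) = (\<Sum>a\<in>J. F (X a))"
    if "finite J" "\<And>a. a \<in> J \<Longrightarrow> section_on A H W (X a)" for J and X :: "nat \<Rightarrow> 'm \<Rightarrow> 'm tvec"
    using that
  proof (induction J rule: finite_induct)
    case empty
    have "F (\<lambda>q. 0 *\<^sub>R (0 :: 'm tvec)) = 0 *\<^sub>R F (\<lambda>q. 0)"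
      by (rule scale[OF smooth_fun_const[OF o] sec_zero[OF o W(1)]])
    then show ?case by (simp only: sum.empty scaleR_zero_left)
  next
    case (insert a J)
    have "F (\<lambda>q. X a q + (\<Sum>a\<in>J. X a q)) = F (X a) + F (\<lambda>q. \<Sum>a\<in>J. X a q)"
      using insert.prems by (intro add sec_sum[OF W(1) o]) simp_all
    also have "F (\<lambda>q. \<Sum>a\<in>J. X a q) = (\<Sum>a\<in>J. F (X a))" using insert.IH insert.prems by blast
    finally show ?case by (simp only: sum.insert[OF insert.hyps])
  qed
  have "F X = F (\<lambda>q. \<Sum>a<4*n. co a q (X q) *\<^sub>R e a q)"
  proof (rule cong[OF X])
    show "section_on A H W (\<lambda>q. \<Sum>a<4*n. co a q (X q) *\<^sub>R e a q)"
      using co_smooth[OF W(1) X] ea by (intro sec_sum[OF W(1) o] sec_scale[OF W(1)]) auto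
    show "X q = (\<Sum>a<4*n. co a q (X q) *\<^sub>R e a q)" if "q \<in> W" for q
      using frame_expand section_onD(2)[OF X that] that W(1) by blast
  qed
  also have "\<dots> = (\<Sum>a<4*n. F (\<lambda>q. co a q (X q) *\<^sub>R e a q))"
    using co_smooth[OF W(1) X] ea by (intro sum sec_scale[OF W(1)]) auto
  also have "\<dots> = (\<Sum>a<4*n. co a p (X p) *\<^sub>R F (e a))"
    using co_smooth[OF W(1) X] ea by (intro sum.cong refl scale) auto
  finally show ?thesis .
qed

text \<open>\<eta>_s vanishes on sections of H, so only the bracket term of d\<eta>_s
  survives.\<close>

lemma eta_bracket:
  assumes "s \<in> Idx" "W \<subseteq> U" "section_on A H W X" "section_on A H W Y" "q \<in> W"
  shows "\<eta> s q (lie_bracket A X Y q) = 2 * \<epsilon> s * g q (I s q (X q)) (Y q)"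
proof -
  note o = vf_open[OF section_onD(1)[OF assms(3)]]
  have z: "Z q (\<lambda>r. \<eta> s r (Z' r)) = 0" if "section_on A H W Z" "section_on A H W Z'" for Z Z'
  proof -
    have t: "Z q \<in> tangent_space A q" using vf_tangent[OF section_onD(1)[OF that(1)] assms(5)] .
    have "Z q (\<lambda>r. \<eta> s r (Z' r)) = Z q (\<lambda>r. 0)"
      by (rule tangent_cong[OF t o assms(5)])
        (use eta_H[OF _ assms(1)] section_onD(2)[OF that(2)] assms(2) in blast)
    then show ?thesis using tangent_const[OF t] by simp
  qed
  show ?thesis
    using data_ext_deriv[OF assms] z[OF assms(3,4)] z[OF assms(4,3)]
    by (simp add: ext_deriv_def)
qed

lemma restrict:
  assumes "open W" "W \<subseteq> U"
  shows "pqc_frame A H g PQ n W \<eta> I e"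
proof
  show "2 \<le> n" "metric_on A H (2 * n) (2 * n) g" by (rule n, rule metric)
  show "local_data A H g PQ W \<eta> I" by (rule local_data_subset[OF data assms])
  show "section_on A H W (e a)" if "a < 4 * n" for a using e_sec'[OF assms(2,1) that] .
  show "g q (e a q) (e b q) = 0" if "q \<in> W" "a < 4 * n" "b < 4 * n" "a \<noteq> b" for q a b
    using e_orth that assms by blast
  show "g q (e a q) (e a q) \<noteq> 0" if "q \<in> W" "a < 4 * n" for q a
    using e_nz that assms by blast
  show "span ((\<lambda>a. e a q) ` {..<4 * n}) = H q" if "q \<in> W" for q
    using e_span that assms by blast
qed

end

section \<open>A complement of H, presented by a frame dual to the contact forms\<close>

locale pqc_dual = pqc_frame +
  fixes \<xi> :: "nat \<Rightarrow> 'a \<Rightarrow> 'a tvec"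
  assumes xi: "s \<in> Idx \<Longrightarrow> vector_field A U (\<xi> s)"
    and dual: "q \<in> U \<Longrightarrow> s \<in> Idx \<Longrightarrow> t \<in> Idx \<Longrightarrow> \<eta> s q (\<xi> t q) = (if s = t then 1 else 0)"
begin

lemma xi_tangent: "q \<in> U \<Longrightarrow> s \<in> Idx \<Longrightarrow> \<xi> s q \<in> tangent_space A q"
  using vf_tangent[OF xi] by blast

definition prV :: "'a \<Rightarrow> 'a tvec \<Rightarrow> 'a tvec" where
  "prV q v = (\<Sum>s\<in>Idx. \<eta> s q v *\<^sub>R \<xi> s q)"

definition prH :: "'a \<Rightarrow> 'a tvec \<Rightarrow> 'a tvec" where
  "prH q v = v - prV q v"

lemma prV_tangent: "q \<in> U \<Longrightarrow> prV q v \<in> tangent_space A q"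
  unfolding prV_def by (intro subspace_sum[OF tangent_subspace] subspace_scale[OF tangent_subspace] xi_tangent)

lemma eta_prV:
  assumes "q \<in> U" "s \<in> Idx"
  shows "\<eta> s q (prV q v) = \<eta> s q v"
proof -
  have "\<eta> s q (prV q v) = (\<Sum>t\<in>Idx. \<eta> s q (\<eta> t q v *\<^sub>R \<xi> t q))"
    unfolding prV_def using xi_tangent[OF assms(1)]
    by (intro linear_on_sum[OF eta_linear[OF assms] tangent_subspace] subspace_scale[OF tangent_subspace])
  also have "\<dots> = (\<Sum>t\<in>Idx. if t = s then \<eta> s q v else 0)"
    using dual[OF assms] linear_onD(2)[OF eta_linear[OF assms] xi_tangent[OF assms(1)]]
    by (intro sum.cong) simp_all
  finally show ?thesis using assms by simp
qed

lemma prH_in: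
  assumes q: "q \<in> U" and v: "v \<in> tangent_space A q"
  shows "prH q v \<in> H q"
proof -
  note t = prV_tangent[OF q, of v]
  have "\<eta> s q (v - prV q v) = 0" if s: "s \<in> Idx" for s
    using linear_on_diff[OF eta_linear[OF q s] tangent_subspace v t] eta_prV[OF q s] by simp
  then show ?thesis
    unfolding prH_def H_iff[OF q subspace_diff[OF tangent_subspace v t]] by blast
qed

lemma prH_id: "q \<in> U \<Longrightarrow> v \<in> H q \<Longrightarrow> prH q v = v"
  by (simp add: prH_def prV_def eta_H)

lemma prV_vf:
  assumes "W \<subseteq> U" "vector_field A W X"
  shows "vector_field A W (\<lambda>q. prV q (X q))"
  unfolding prV_def using vf_open[OF assms(2)] eta_smooth[OF _ assms] vf_subset[OF xi vf_open[OF assms(2)] assms(1)]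
  by (intro vf_sum vf_scale)

lemma prH_sec:
  assumes "W \<subseteq> U" "vector_field A W X"
  shows "section_on A H W (\<lambda>q. prH q (X q))"
  by (rule section_onI)
    (use vf_diff[OF assms(2) prV_vf[OF assms]] prH_in vf_tangent[OF assms(2)] assms(1) in \<open>auto simp: prH_def\<close>)

lemma prH_linear: "q \<in> U \<Longrightarrow> linear_on (tangent_space A q) (prH q)"
proof -
  assume q: "q \<in> U"
  have "linear_on (tangent_space A q) (prV q)"
    unfolding prV_def by (intro linear_on_sum_fun linear_on_scaleR_vec eta_linear q)
  then show ?thesis
    unfolding linear_on_def prH_def by (simp add: scaleR_diff_right)
qed

text \<open>The structure form a_st on H. Up to the factor -\<epsilon>_s \<epsilon>_t it is
  d\<eta>_s(\<xi>_t, .), so the Reeb condition d\<eta>_s(\<xi>_s, .) = 0 on H reads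
  \<open>af s s\<close> = 0. It is written in frame components to be a linear form at each point,
  independently of any extension of the vector.\<close>

definition af :: "nat \<Rightarrow> nat \<Rightarrow> 'a \<Rightarrow> 'a tvec \<Rightarrow> real" where
  "af s t q z = (\<Sum>a<4*n. co a q z * (\<epsilon> s * \<epsilon> t * \<eta> s q (lie_bracket A (\<xi> t) (e a) q)))"

text \<open>Tensorial in \<open>Z\<close>, since a derivative of the coefficient multiplies a
  horizontal vector, on which \<eta>_s vanishes.\<close>

lemma af_eq:
  assumes "W \<subseteq> U" "section_on A H W Z" "q \<in> W" "s \<in> Idx" "t \<in> Idx"
  shows "af s t q (Z q) = \<epsilon> s * \<epsilon> t * \<eta> s q (lie_bracket A (\<xi> t) Z q)"
proof -
  have o: "open W" and q: "q \<in> U" using assms vf_open section_onD(1) by blast+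
  have x: "vector_field A W (\<xi> t)" using vf_subset[OF xi[OF assms(5)] o assms(1)] .
  note lin = eta_linear[OF q assms(4)]
  define F where "F Z = \<epsilon> s * \<epsilon> t * \<eta> s q (lie_bracket A (\<xi> t) Z q)" for Z
  have "F Z = (\<Sum>a<4*n. co a q (Z q) *\<^sub>R F (e a))"
  proof (rule tensorial[OF assms(1,3,2)])
    fix X Y assume XY: "section_on A H W X" "section_on A H W Y"
    show "F (\<lambda>q. X q + Y q) = F X + F Y"
      unfolding F_def bracket_add[OF x section_onD(1)[OF XY(1)] section_onD(1)[OF XY(2)] assms(3)]
        linear_onD(1)[OF lin bracket_tangent[OF x section_onD(1)[OF XY(1)] assms(3)]
          bracket_tangent[OF x section_onD(1)[OF XY(2)] assms(3)]]
      by (simp add: algebra_simps)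
  next
    fix f X assume f: "smooth_fun A W f" and X: "section_on A H W X"
    note b = bracket_tangent[OF x section_onD(1)[OF X] assms(3)] and Xt = vf_tangent[OF section_onD(1)[OF X] assms(3)]
    have "\<eta> s q (\<xi> t q f *\<^sub>R X q + f q *\<^sub>R lie_bracket A (\<xi> t) X q) =
      \<xi> t q f * \<eta> s q (X q) + f q * \<eta> s q (lie_bracket A (\<xi> t) X q)"
      using linear_onD[OF lin] b Xt subspace_scale[OF tangent_subspace b] subspace_scale[OF tangent_subspace Xt] by simp
    then show "F (\<lambda>q. f q *\<^sub>R X q) = f q *\<^sub>R F X"
      unfolding F_def bracket_scale[OF x section_onD(1)[OF X] f assms(3)]
      using eta_H[OF q assms(4) section_onD(2)[OF X assms(3)]] by simp
  qed
  then show ?thesis by (simp add: af_def F_def)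
qed

lemma af_linear: "q \<in> U \<Longrightarrow> linear_on (H q) (af s t q)"
proof -
  assume q: "q \<in> U"
  have "linear_on (H q) (\<lambda>z. \<Sum>a<4*n. co a q z *\<^sub>R (\<epsilon> s * \<epsilon> t * \<eta> s q (lie_bracket A (\<xi> t) (e a) q)))"
    by (intro linear_on_sum_fun linear_on_scaleR_vec co_linear[OF q]) simp
  then show ?thesis by (simp add: af_def[abs_def])
qed

end

section \<open>Horizontal connections\<close>

text \<open>A metric partial connection: derivatives of sections of H in directions of H, with
  horizontal torsion zero. There are two instances, the Koszul connection for existence and the
  restriction of an adapted connection for uniqueness.\<close>

locale hconn = pqc_dual +
  fixes D :: "('a \<Rightarrow> 'a tvec) \<Rightarrow> ('a \<Rightarrow> 'a tvec) \<Rightarrow> 'a \<Rightarrow> 'a tvec"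
  assumes D_sec: "section_on A H U X \<Longrightarrow> section_on A H U Y \<Longrightarrow> section_on A H U (D X Y)"
    and D_add1: "section_on A H U X \<Longrightarrow> section_on A H U X' \<Longrightarrow> section_on A H U Y \<Longrightarrow> q \<in> U \<Longrightarrow>
      D (\<lambda>q. X q + X' q) Y q = D X Y q + D X' Y q"
    and D_scale1: "smooth_fun A U f \<Longrightarrow> section_on A H U X \<Longrightarrow> section_on A H U Y \<Longrightarrow> q \<in> U \<Longrightarrow>
      D (\<lambda>q. f q *\<^sub>R X q) Y q = f q *\<^sub>R D X Y q"
    and D_add2: "section_on A H U X \<Longrightarrow> section_on A H U Y \<Longrightarrow> section_on A H U Y' \<Longrightarrow> q \<in> U \<Longrightarrow>
      D X (\<lambda>q. Y q + Y' q) q = D X Y q + D X Y' q"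
    and D_leib: "smooth_fun A U f \<Longrightarrow> section_on A H U X \<Longrightarrow> section_on A H U Y \<Longrightarrow> q \<in> U \<Longrightarrow>
      D X (\<lambda>q. f q *\<^sub>R Y q) q = X q f *\<^sub>R Y q + f q *\<^sub>R D X Y q"
    and D_tors: "section_on A H U X \<Longrightarrow> section_on A H U Y \<Longrightarrow> q \<in> U \<Longrightarrow>
      D X Y q - D Y X q = prH q (lie_bracket A X Y q)"
    and D_metric: "section_on A H U X \<Longrightarrow> section_on A H U Y \<Longrightarrow> section_on A H U Z \<Longrightarrow> q \<in> U \<Longrightarrow>
      X q (\<lambda>r. g r (Y r) (Z r)) = g q (D X Y q) (Z q) + g q (Y q) (D X Z q)"
begin

lemma D_in: "section_on A H U X \<Longrightarrow> section_on A H U Y \<Longrightarrow> q \<in> U \<Longrightarrow> D X Y q \<in> H q"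
  using section_onD(2)[OF D_sec] by blast

lemma sec_tangent: "section_on A H U X \<Longrightarrow> q \<in> U \<Longrightarrow> X q \<in> tangent_space A q"
  using vf_tangent[OF section_onD(1)] by blast

lemma D_cong2:
  assumes X: "section_on A H U X" and Y: "section_on A H U Y" and Y': "section_on A H U Y'"
    and q: "q \<in> U" and eq: "\<And>r. r \<in> U \<Longrightarrow> Y r = Y' r"
  shows "D X Y q = D X Y' q"
proof -
  define c where "c = (\<lambda>q. if q \<in> U then 1::real else 0)"
  have c: "smooth_fun A U c" unfolding c_def by (rule smooth_fun_indicator[OF openU])
  have "X q c = X q (\<lambda>r. 1)"
    by (rule tangent_cong[OF sec_tangent[OF X q] openU q]) (simp add: c_def)
  then have Xc: "X q c = 0" using tangent_const[OF sec_tangent[OF X q]] by simp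
  have "(\<lambda>r. c r *\<^sub>R Y r) = (\<lambda>r. c r *\<^sub>R Y' r)" using eq by (auto simp: c_def)
  then have "D X (\<lambda>r. c r *\<^sub>R Y r) q = D X (\<lambda>r. c r *\<^sub>R Y' r) q" by metis
  then show ?thesis
    unfolding D_leib[OF c X Y q] D_leib[OF c X Y' q] Xc using q by (simp add: c_def)
qed

lemma D_cscale2:
  assumes X: "section_on A H U X" and Y: "section_on A H U Y" and q: "q \<in> U"
  shows "D X (\<lambda>r. c *\<^sub>R Y r) q = c *\<^sub>R D X Y q"
  using D_leib[OF smooth_fun_const[OF openU] X Y q, of c] tangent_const[OF sec_tangent[OF X q]] by simp

text \<open>(\<nabla>_X I_s) Y on sections. It is tensorial in both arguments; \<open>T\<close> is
  the resulting map on vectors, evaluated through the extensions \<open>ext\<close>.\<close>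

definition Nt :: "nat \<Rightarrow> ('a \<Rightarrow> 'a tvec) \<Rightarrow> ('a \<Rightarrow> 'a tvec) \<Rightarrow> 'a \<Rightarrow> 'a tvec" where
  "Nt s X Y q = D X (\<lambda>r. I s r (Y r)) q - I s q (D X Y q)"

definition T :: "'a \<Rightarrow> nat \<Rightarrow> 'a tvec \<Rightarrow> 'a tvec \<Rightarrow> 'a tvec" where
  "T q s x y = Nt s (ext q x) (ext q y) q"

lemma sec_IU: "s \<in> Idx \<Longrightarrow> section_on A H U X \<Longrightarrow> section_on A H U (\<lambda>q. I s q (X q))"
  by (rule sec_I[OF _ subset_refl])

context
  fixes q assumes q: "q \<in> U"
begin

interpretation P: pq_endo "H q" "g q" "4 * n" "\<lambda>a. e a q" "\<lambda>s. I s q" "PQ q" "e0 q"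
  by (rule pointwise[OF q])

lemma ext_sec_q: "section_on A H U (ext q x)"
  by (rule ext_sec)

lemma I_add: "s \<in> Idx \<Longrightarrow> r \<in> U \<Longrightarrow> x \<in> H r \<Longrightarrow> y \<in> H r \<Longrightarrow> I s r (x + y) = I s r x + I s r y"
  and I_scale: "s \<in> Idx \<Longrightarrow> r \<in> U \<Longrightarrow> x \<in> H r \<Longrightarrow> I s r (c *\<^sub>R x) = c *\<^sub>R I s r x"
proof -
  assume s: "s \<in> Idx" and r: "r \<in> U" and x: "x \<in> H r"
  interpret R: pq_endo "H r" "g r" "4 * n" "\<lambda>a. e a r" "\<lambda>s. I s r" "PQ r" "e0 r"
    by (rule pointwise[OF r])
  show "y \<in> H r \<Longrightarrow> I s r (x + y) = I s r x + I s r y" "I s r (c *\<^sub>R x) = c *\<^sub>R I s r x"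
    using R.I_linear(1,2)[OF s x] by auto
qed

lemma Nt_in:
  assumes "s \<in> Idx" "section_on A H U X" "section_on A H U Y"
  shows "Nt s X Y q \<in> H q"
  unfolding Nt_def using D_in[OF assms(2) sec_IU[OF assms(1,3)] q] P.I_in[OF assms(1) D_in[OF assms(2,3) q]]
  by simp

lemma Nt_add1:
  assumes s: "s \<in> Idx" and X: "section_on A H U X" "section_on A H U X'" and Y: "section_on A H U Y"
  shows "Nt s (\<lambda>q. X q + X' q) Y q = Nt s X Y q + Nt s X' Y q"
  unfolding Nt_def D_add1[OF X Y q] D_add1[OF X sec_IU[OF s Y] q]
    P.I_linear(1)[OF s D_in[OF X(1) Y q] D_in[OF X(2) Y q]] by simp

lemma Nt_scale1:
  assumes s: "s \<in> Idx" and f: "smooth_fun A U f" and X: "section_on A H U X" and Y: "section_on A H U Y"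
  shows "Nt s (\<lambda>q. f q *\<^sub>R X q) Y q = f q *\<^sub>R Nt s X Y q"
  unfolding Nt_def D_scale1[OF f X Y q] D_scale1[OF f X sec_IU[OF s Y] q]
    P.I_linear(2)[OF s D_in[OF X Y q]] by (simp add: scaleR_diff_right)

lemma Nt_add2:
  assumes s: "s \<in> Idx" and X: "section_on A H U X" and Y: "section_on A H U Y" "section_on A H U Y'"
  shows "Nt s X (\<lambda>q. Y q + Y' q) q = Nt s X Y q + Nt s X Y' q"
proof -
  have "D X (\<lambda>r. I s r (Y r + Y' r)) q = D X (\<lambda>r. I s r (Y r) + I s r (Y' r)) q"
    using I_add[OF s _ section_onD(2)[OF Y(1)] section_onD(2)[OF Y(2)]]
    by (intro D_cong2 X sec_IU s sec_add Y subset_refl q) blast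
  then show ?thesis
    unfolding Nt_def D_add2[OF X Y q] D_add2[OF X sec_IU[OF s Y(1)] sec_IU[OF s Y(2)] q]
      P.I_linear(1)[OF s D_in[OF X Y(1) q] D_in[OF X Y(2) q]] by simp
qed

lemma Nt_scale2:
  assumes s: "s \<in> Idx" and f: "smooth_fun A U f" and X: "section_on A H U X" and Y: "section_on A H U Y"
  shows "Nt s X (\<lambda>q. f q *\<^sub>R Y q) q = f q *\<^sub>R Nt s X Y q"
proof -
  note Yq = section_onD(2)[OF Y q]
  have "D X (\<lambda>r. I s r (f r *\<^sub>R Y r)) q = D X (\<lambda>r. f r *\<^sub>R I s r (Y r)) q"
    using I_scale[OF s _ section_onD(2)[OF Y]]
    by (intro D_cong2 X sec_IU s sec_scale f Y subset_refl q) blast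
  moreover have "I s q (X q f *\<^sub>R Y q + f q *\<^sub>R D X Y q) = X q f *\<^sub>R I s q (Y q) + f q *\<^sub>R I s q (D X Y q)"
    using P.I_linear(1)[OF s, of "X q f *\<^sub>R Y q" "f q *\<^sub>R D X Y q"] P.I_linear(2)[OF s Yq]
      P.I_linear(2)[OF s D_in[OF X Y q]] Yq D_in[OF X Y q] by simp
  ultimately show ?thesis
    unfolding Nt_def D_leib[OF f X Y q] D_leib[OF f X sec_IU[OF s Y] q]
    by (simp add: scaleR_diff_right)
qed

lemma T_eq:
  assumes s: "s \<in> Idx" and X: "section_on A H U X" and Y: "section_on A H U Y"
  shows "Nt s X Y q = T q s (X q) (Y q)"
proof -
  have 1: "Nt s X Y q = Nt s X Y' q" if Y: "section_on A H U Y" "section_on A H U Y'" "Y q = Y' q"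
    and X: "section_on A H U X" for X Y Y'
    using tensorial[of U q Y "\<lambda>Y. Nt s X Y q"] tensorial[of U q Y' "\<lambda>Y. Nt s X Y q"]
      Nt_add2[OF s X] Nt_scale2[OF s _ X] q Y by simp
  have 2: "Nt s X Y q = Nt s X' Y q" if X: "section_on A H U X" "section_on A H U X'" "X q = X' q"
    and Y: "section_on A H U Y" for X X' Y
    using tensorial[of U q X "\<lambda>X. Nt s X Y q"] tensorial[of U q X' "\<lambda>X. Nt s X Y q"]
      Nt_add1[OF s _ _ Y] Nt_scale1[OF s _ _ Y] q X by simp
  have "Nt s X Y q = Nt s X (ext q (Y q)) q"
    by (rule 1[OF Y ext_sec_q _ X]) (rule ext_eq[OF q section_onD(2)[OF Y q], symmetric])
  also have "\<dots> = Nt s (ext q (X q)) (ext q (Y q)) q"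
    by (rule 2[OF X ext_sec_q _ ext_sec_q]) (rule ext_eq[OF q section_onD(2)[OF X q], symmetric])
  finally show ?thesis by (simp add: T_def)
qed

lemma ext_at: "x \<in> H q \<Longrightarrow> ext q x q = x"
  by (rule ext_eq[OF q])

lemma g_metric_skew:
  assumes s: "s \<in> Idx" and X: "section_on A H U X" and Y: "section_on A H U Y" and Z: "section_on A H U Z"
  shows "g q (Nt s X Y q) (Z q) = - g q (Y q) (Nt s X Z q)"
proof -
  note IY = sec_IU[OF s Y] and IZ = sec_IU[OF s Z]
  note in1 = D_in[OF X IY q] D_in[OF X IZ q] D_in[OF X Y q] D_in[OF X Z q] section_onD(2)[OF Y q]
    section_onD(2)[OF Z q]
  have "X q (\<lambda>r. g r (I s r (Y r)) (Z r)) = X q (\<lambda>r. - g r (Y r) (I s r (Z r)))"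
  proof (rule tangent_cong[OF sec_tangent[OF X q] openU q])
    fix r assume r: "r \<in> U"
    interpret R: pq_endo "H r" "g r" "4 * n" "\<lambda>a. e a r" "\<lambda>s. I s r" "PQ r" "e0 r"
      by (rule pointwise[OF r])
    show "g r (I s r (Y r)) (Z r) = - g r (Y r) (I s r (Z r))"
      by (rule R.I_skew[OF s section_onD(2)[OF Y r] section_onD(2)[OF Z r]])
  qed
  also have "\<dots> = - X q (\<lambda>r. g r (Y r) (I s r (Z r)))"
    by (rule tangent_minus[OF sec_tangent[OF X q] smooth_fun_nearI[OF g_smooth[OF Y IZ] q]])
  finally have "g q (D X (\<lambda>r. I s r (Y r)) q) (Z q) + g q (I s q (Y q)) (D X Z q) =
      - (g q (D X Y q) (I s q (Z q)) + g q (Y q) (D X (\<lambda>r. I s r (Z r)) q))"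
    unfolding D_metric[OF X IY Z q] D_metric[OF X Y IZ q] .
  moreover have "g q (I s q (Y q)) (D X Z q) = - g q (Y q) (I s q (D X Z q))"
    "g q (I s q (D X Y q)) (Z q) = - g q (D X Y q) (I s q (Z q))"
    using P.I_skew[OF s in1(5,4)] P.I_skew[OF s in1(3,6)] by auto
  ultimately show ?thesis
    unfolding Nt_def using in1 P.I_in[OF s in1(3)] P.I_in[OF s in1(4)] by simp
qed

text \<open>The axioms are the derivatives of the relations I_s I_s = \<epsilon>_s and I_j I_i =
  \<epsilon>_k I_k and of the skewness of I_s. The relations hold on all of \<open>U\<close>, so
  they may be used under the derivative.\<close>

lemma T_tensor: "derivation_tensor (H q) (g q) (4 * n) (\<lambda>a. e a q) (\<lambda>s. I s q) (T q)"
proof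
  fix s x y assume s: "s \<in> Idx" and x: "x \<in> H q" and y: "y \<in> H q"
  show "T q s x y \<in> H q" unfolding T_def by (rule Nt_in[OF s ext_sec_q ext_sec_q])
  have "T q s x (I s q y) = Nt s (ext q x) (\<lambda>r. I s r (ext q y r)) q"
    using T_eq[OF s ext_sec_q[of x] sec_IU[OF s ext_sec_q[of y]]] ext_at x y by simp
  also have "\<dots> = D (ext q x) (\<lambda>r. I s r (I s r (ext q y r))) q - I s q (D (ext q x) (\<lambda>r. I s r (ext q y r)) q)"
    by (simp add: Nt_def)
  also have "D (ext q x) (\<lambda>r. I s r (I s r (ext q y r))) q = D (ext q x) (\<lambda>r. \<epsilon> s *\<^sub>R ext q y r) q"
  proof (intro D_cong2 sec_IU s sec_cscale ext_sec_q subset_refl q)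
    fix r assume r: "r \<in> U"
    interpret R: pq_endo "H r" "g r" "4 * n" "\<lambda>a. e a r" "\<lambda>s. I s r" "PQ r" "e0 r"
      by (rule pointwise[OF r])
    show "I s r (I s r (ext q y r)) = \<epsilon> s *\<^sub>R ext q y r"
      by (rule R.I_sq[OF s section_onD(2)[OF ext_sec_q r]])
  qed
  also have "\<dots> = I s q (I s q (D (ext q x) (ext q y) q))"
    using D_cscale2[OF ext_sec_q ext_sec_q q] P.I_sq[OF s D_in[OF ext_sec_q ext_sec_q q]] by simp
  finally show "T q s x (I s q y) = - I s q (T q s x y)"
    unfolding T_def[of q s x y] Nt_def
      P.I_linear(4)[OF s D_in[OF ext_sec_q sec_IU[OF s ext_sec_q] q] P.I_in[OF s D_in[OF ext_sec_q ext_sec_q q]]]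
    by (simp add: fun_eq_iff)
  fix z assume z: "z \<in> H q"
  show "g q (T q s x y) z = - g q y (T q s x z)"
    using g_metric_skew[OF s ext_sec_q ext_sec_q ext_sec_q, of x y z] ext_at[OF y] ext_at[OF z]
    by (simp add: T_def)
next
  fix s x assume s: "s \<in> Idx" and x: "x \<in> H q"
  show "linear_on (H q) (T q s x)"
    unfolding linear_on_def
  proof (intro conjI ballI allI)
    fix y z assume y: "y \<in> H q" and z: "z \<in> H q"
    show "T q s x (y + z) = T q s x y + T q s x z"
      using T_eq[OF s ext_sec_q[of x] sec_add[OF subset_refl ext_sec_q[of y] ext_sec_q[of z]]]
        Nt_add2[OF s ext_sec_q[of x] ext_sec_q[of y] ext_sec_q[of z]] ext_at x y z
      by (simp add: T_def[of q s x y] T_def[of q s x z])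
  next
    fix c y assume y: "y \<in> H q"
    show "T q s x (c *\<^sub>R y) = c *\<^sub>R T q s x y"
      using T_eq[OF s ext_sec_q[of x] sec_cscale[OF subset_refl ext_sec_q[of y], of c]]
        Nt_scale2[OF s smooth_fun_const[OF openU, of c] ext_sec_q[of x] ext_sec_q[of y]] ext_at x y
      by (simp add: T_def[of q s x y])
  qed
  show "linear_on (H q) (\<lambda>y. T q s y x)"
    unfolding linear_on_def
  proof (intro conjI ballI allI)
    fix y z assume y: "y \<in> H q" and z: "z \<in> H q"
    show "T q s (y + z) x = T q s y x + T q s z x"
      using T_eq[OF s sec_add[OF subset_refl ext_sec_q[of y] ext_sec_q[of z]] ext_sec_q[of x]]
        Nt_add1[OF s ext_sec_q[of y] ext_sec_q[of z] ext_sec_q[of x]] ext_at x y z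
      by (simp add: T_def[of q s y x] T_def[of q s z x])
  next
    fix c y assume y: "y \<in> H q"
    show "T q s (c *\<^sub>R y) x = c *\<^sub>R T q s y x"
      using T_eq[OF s sec_cscale[OF subset_refl ext_sec_q[of y], of c] ext_sec_q[of x]]
        Nt_scale1[OF s smooth_fun_const[OF openU, of c] ext_sec_q[of y] ext_sec_q[of x]] ext_at x y
      by (simp add: T_def[of q s y x])
  qed
next
  fix i j k x y assume c: "cyc i j k" and x: "x \<in> H q" and y: "y \<in> H q"
  have mem: "i \<in> Idx" "j \<in> Idx" "k \<in> Idx" using cyc_mem[OF c] by auto
  define X Y where "X = ext q x" and "Y = ext q y"
  have XY: "section_on A H U X" "section_on A H U Y" unfolding X_def Y_def by (rule ext_sec_q)+
  note d = D_in[OF XY q] and d2 = D_in[OF XY(1) sec_IU[OF mem(1) XY(2)] q]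
  have "T q j x (I i q y) = Nt j X (\<lambda>r. I i r (Y r)) q"
    using T_eq[OF mem(2) XY(1) sec_IU[OF mem(1) XY(2)]] ext_at x y by (simp add: X_def Y_def)
  moreover have "D X (\<lambda>r. I j r (I i r (Y r))) q = D X (\<lambda>r. \<epsilon> k *\<^sub>R I k r (Y r)) q"
  proof (intro D_cong2 sec_IU mem sec_cscale XY subset_refl q)
    fix r assume r: "r \<in> U"
    interpret R: pq_endo "H r" "g r" "4 * n" "\<lambda>a. e a r" "\<lambda>s. I s r" "PQ r" "e0 r"
      by (rule pointwise[OF r])
    show "I j r (I i r (Y r)) = \<epsilon> k *\<^sub>R I k r (Y r)"
      by (rule R.I_cyc(2)[OF c section_onD(2)[OF XY(2) r]])
  qed
  moreover have "I j q (I i q (D X Y q)) = \<epsilon> k *\<^sub>R I k q (D X Y q)" by (rule P.I_cyc(2)[OF c d])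
  moreover have "I j q (T q i x y) = I j q (D X (\<lambda>r. I i r (Y r)) q) - I j q (I i q (D X Y q))"
    unfolding T_def Nt_def X_def[symmetric] Y_def[symmetric]
    by (rule P.I_linear(4)[OF mem(2) d2 P.I_in[OF mem(1) d]])
  ultimately show "T q j x (I i q y) + I j q (T q i x y) = \<epsilon> k *\<^sub>R T q k x y"
    using D_cscale2[OF XY(1) sec_IU[OF mem(3) XY(2)] q, of "\<epsilon> k"]
    by (simp add: Nt_def T_def[of q k x y] scaleR_diff_right flip: X_def Y_def)
qed

text \<open>This is \<open>d(d\<eta>\<^sub>s) = 0\<close> restricted to \<open>H\<close>.\<close>

lemma structure_equation:
  assumes s: "s \<in> Idx" and X: "section_on A H U X" and Y: "section_on A H U Y" and Z: "section_on A H U Z"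
  defines "w \<equiv> \<lambda>t x y. g q (I t q x) y"
  shows "g q (Nt s X Y q) (Z q) + g q (Nt s Y Z q) (X q) + g q (Nt s Z X q) (Y q) =
    (\<Sum>t\<in>Idx. af s t q (X q) * w t (Y q) (Z q) + af s t q (Y q) * w t (Z q) (X q)
      + af s t q (Z q) * w t (X q) (Y q))"
proof -
  have w_skew: "w t x y = - w t y x" if "t \<in> Idx" "x \<in> H q" "y \<in> H q" for t x y
    using P.w_swap[OF that] by (simp add: w_def P.w_def)
  \<comment> \<open>One double bracket is computed by splitting [X, Y]. The horizontal part is D_X Y
    - D_Y X by the torsion condition; the vertical part is the sum of h_t \<xi>_t with h_t = 2
    \<epsilon>_t w_t(X, Y). Its terms [\<xi>_t, Z] give the structure forms, and Z(h_s) brings in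
    \<nabla>_Z I_s.\<close>
  have main: "\<eta> s q (lie_bracket A (lie_bracket A X Y) Z q) =
      2 * \<epsilon> s * (w s (D X Y q) (Z q) - w s (D Y X q) (Z q) + (\<Sum>t\<in>Idx. af s t q (Z q) * w t (X q) (Y q))
        - (g q (Nt s Z X q) (Y q) + w s (D Z X q) (Y q) + w s (X q) (D Z Y q)))"
    if X: "section_on A H U X" and Y: "section_on A H U Y" and Z: "section_on A H U Z" for X Y Z
  proof -
    note vX = section_onD(1)[OF X] and vY = section_onD(1)[OF Y] and vZ = section_onD(1)[OF Z]
    note inq = section_onD(2)[OF X q] section_onD(2)[OF Y q] section_onD(2)[OF Z q]
    note b = vf_bracket[OF vX vY] and Zt = sec_tangent[OF Z q]
    define p where "p = (\<lambda>r. prH r (lie_bracket A X Y r))"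
    define h where "h t r = \<eta> t r (lie_bracket A X Y r)" for t r
    have p: "section_on A H U p" unfolding p_def by (rule prH_sec[OF subset_refl b])
    have h: "smooth_fun A U (h t)" if "t \<in> Idx" for t
      unfolding h_def[abs_def] by (rule eta_smooth[OF that subset_refl b])
    have hv: "vector_field A U (\<lambda>r. h t r *\<^sub>R \<xi> t r)" if "t \<in> Idx" for t by (rule vf_scale[OF h xi]) fact+
    have sv: "vector_field A U (\<lambda>r. \<Sum>t\<in>Idx. h t r *\<^sub>R \<xi> t r)" by (rule vf_sum[OF openU hv])
    have hw: "h t r = 2 * \<epsilon> t * g r (I t r (X r)) (Y r)" if "t \<in> Idx" "r \<in> U" for t r
      unfolding h_def by (rule eta_bracket[OF that(1) subset_refl X Y that(2)])
    have "lie_bracket A (lie_bracket A X Y) Z q = lie_bracket A (\<lambda>r. p r + (\<Sum>t\<in>Idx. h t r *\<^sub>R \<xi> t r)) Z q"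
      by (rule bracket_cong[OF b vZ q]) (simp_all add: p_def h_def prH_def prV_def)
    also have "\<dots> = lie_bracket A p Z q + lie_bracket A (\<lambda>r. \<Sum>t\<in>Idx. h t r *\<^sub>R \<xi> t r) Z q"
      by (rule bracket_add_left[OF section_onD(1)[OF p] sv vZ q])
    also have "lie_bracket A (\<lambda>r. \<Sum>t\<in>Idx. h t r *\<^sub>R \<xi> t r) Z q = (\<Sum>t\<in>Idx. lie_bracket A (\<lambda>r. h t r *\<^sub>R \<xi> t r) Z q)"
    proof -
      have "lie_bracket A Z (\<lambda>r. \<Sum>t\<in>Idx. h t r *\<^sub>R \<xi> t r) q = (\<Sum>t\<in>Idx. lie_bracket A Z (\<lambda>r. h t r *\<^sub>R \<xi> t r) q)"
        by (rule bracket_sum[OF vZ hv q])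
      then show ?thesis unfolding bracket_swap[of _ Z q] by (simp only: sum_negf)
    qed
    finally have br: "lie_bracket A (lie_bracket A X Y) Z q =
      lie_bracket A p Z q + (\<Sum>t\<in>Idx. lie_bracket A (\<lambda>r. h t r *\<^sub>R \<xi> t r) Z q)" .
    note lin = eta_linear[OF q s]
    have bt: "lie_bracket A (\<lambda>r. h t r *\<^sub>R \<xi> t r) Z q \<in> tangent_space A q" if "t \<in> Idx" for t
      by (rule bracket_tangent[OF hv[OF that] vZ q])
    have "\<eta> s q (lie_bracket A (lie_bracket A X Y) Z q) =
      \<eta> s q (lie_bracket A p Z q) + (\<Sum>t\<in>Idx. \<eta> s q (lie_bracket A (\<lambda>r. h t r *\<^sub>R \<xi> t r) Z q))"
    proof -
      have sum_in: "(\<Sum>t\<in>Idx. lie_bracket A (\<lambda>r. h t r *\<^sub>R \<xi> t r) Z q) \<in> tangent_space A q"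
        by (rule subspace_sum[OF tangent_subspace bt])
      have "\<eta> s q (\<Sum>t\<in>Idx. lie_bracket A (\<lambda>r. h t r *\<^sub>R \<xi> t r) Z q) =
          (\<Sum>t\<in>Idx. \<eta> s q (lie_bracket A (\<lambda>r. h t r *\<^sub>R \<xi> t r) Z q))"
        by (rule linear_on_sum[OF lin tangent_subspace bt])
      with linear_onD(1)[OF lin bracket_tangent[OF section_onD(1)[OF p] vZ q] sum_in]
      show ?thesis by (simp only: br)
    qed
    moreover have "\<eta> s q (lie_bracket A p Z q) = 2 * \<epsilon> s * (w s (D X Y q) (Z q) - w s (D Y X q) (Z q))"
    proof -
      have "\<eta> s q (lie_bracket A p Z q) = 2 * \<epsilon> s * w s (p q) (Z q)"
        unfolding w_def by (rule eta_bracket[OF s subset_refl p Z q])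
      also have "p q = D X Y q - D Y X q" unfolding p_def by (rule D_tors[OF X Y q, symmetric])
      also have "w s (D X Y q - D Y X q) (Z q) = w s (D X Y q) (Z q) - w s (D Y X q) (Z q)"
        unfolding w_def
        using P.I_linear(4)[OF s D_in[OF X Y q] D_in[OF Y X q]] P.I_in[OF s D_in[OF X Y q]]
          P.I_in[OF s D_in[OF Y X q]] inq(3) by simp
      finally show ?thesis .
    qed
    moreover have "\<eta> s q (lie_bracket A (\<lambda>r. h t r *\<^sub>R \<xi> t r) Z q) =
        2 * \<epsilon> s * (af s t q (Z q) * w t (X q) (Y q)) - (if t = s then Z q (h s) else 0)" if t: "t \<in> Idx" for t
    proof -
      note xt = bracket_tangent[OF xi[OF t] vZ q] and xt' = xi_tangent[OF q t]
      have "\<eta> s q (lie_bracket A (\<lambda>r. h t r *\<^sub>R \<xi> t r) Z q) =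
          \<eta> s q (h t q *\<^sub>R lie_bracket A (\<xi> t) Z q - Z q (h t) *\<^sub>R \<xi> t q)"
        unfolding bracket_scale_left[OF xi[OF t] vZ h[OF t] q] ..
      also have "\<dots> = h t q * \<eta> s q (lie_bracket A (\<xi> t) Z q) - Z q (h t) * \<eta> s q (\<xi> t q)"
        using linear_on_diff[OF lin tangent_subspace subspace_scale[OF tangent_subspace xt]
            subspace_scale[OF tangent_subspace xt']] linear_onD(2)[OF lin xt] linear_onD(2)[OF lin xt'] by simp
      also have "h t q * \<eta> s q (lie_bracket A (\<xi> t) Z q) = 2 * \<epsilon> s * (af s t q (Z q) * w t (X q) (Y q))"
        unfolding hw[OF t q] af_eq[OF subset_refl Z q s t] w_def by (simp add: algebra_simps)
      finally have "\<eta> s q (lie_bracket A (\<lambda>r. h t r *\<^sub>R \<xi> t r) Z q) =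
          2 * \<epsilon> s * (af s t q (Z q) * w t (X q) (Y q)) - Z q (h t) * \<eta> s q (\<xi> t q)" .
      then show ?thesis using dual[OF q s t] by auto
    qed
    moreover have "Z q (h s) = 2 * \<epsilon> s * (g q (Nt s Z X q) (Y q) + w s (D Z X q) (Y q) + w s (X q) (D Z Y q))"
    proof -
      note IX = sec_IU[OF s X]
      have "Z q (h s) = Z q (\<lambda>r. (2 * \<epsilon> s) * g r (I s r (X r)) (Y r))"
        by (rule tangent_cong[OF Zt openU q]) (simp add: hw[OF s])
      also have "\<dots> = 2 * \<epsilon> s * Z q (\<lambda>r. g r (I s r (X r)) (Y r))"
        by (rule tangent_cmult[OF Zt smooth_fun_nearI[OF g_smooth[OF IX Y] q]])
      also have "Z q (\<lambda>r. g r (I s r (X r)) (Y r)) = g q (D Z (\<lambda>r. I s r (X r)) q) (Y q) + w s (X q) (D Z Y q)"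
        unfolding D_metric[OF Z IX Y q] w_def ..
      also have "g q (D Z (\<lambda>r. I s r (X r)) q) (Y q) = g q (Nt s Z X q) (Y q) + w s (D Z X q) (Y q)"
        unfolding Nt_def w_def using D_in[OF Z IX q] P.I_in[OF s D_in[OF Z X q]] inq(2) by simp
      finally show ?thesis by simp
    qed
    ultimately show ?thesis
      using s by (simp add: sum_subtractf algebra_simps sum_distrib_left)
  qed
  note d = D_in[OF _ _ q] and inq = section_onD(2)[OF _ q]
  note v = section_onD(1)
  note lin = eta_linear[OF q s] and bt = bracket_tangent[OF vf_bracket[OF v v] v q]
  \<comment> \<open>The vanishing of d(d\<eta>_s) enters as the Jacobi identity, to which \<eta>_s
    is applied. In the cyclic sum the terms with derivatives of X, Y, Z themselves cancel by
    skewness of w_s.\<close>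
  have "0 = \<eta> s q (lie_bracket A (lie_bracket A X Y) Z q + lie_bracket A (lie_bracket A Y Z) X q
    + lie_bracket A (lie_bracket A Z X) Y q)"
    unfolding jacobi[OF v[OF X] v[OF Y] v[OF Z] q] using linear_on_zero[OF lin tangent_subspace] by simp
  also have "\<dots> = \<eta> s q (lie_bracket A (lie_bracket A X Y) Z q) + \<eta> s q (lie_bracket A (lie_bracket A Y Z) X q)
    + \<eta> s q (lie_bracket A (lie_bracket A Z X) Y q)"
    using linear_onD(1)[OF lin subspace_add[OF tangent_subspace bt[OF X Y Z] bt[OF Y Z X]] bt[OF Z X Y]]
      linear_onD(1)[OF lin bt[OF X Y Z] bt[OF Y Z X]] by simp
  also have "\<dots> = 2 * \<epsilon> s * ((\<Sum>t\<in>Idx. af s t q (X q) * w t (Y q) (Z q) + af s t q (Y q) * w t (Z q) (X q)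
      + af s t q (Z q) * w t (X q) (Y q))
      - (g q (Nt s X Y q) (Z q) + g q (Nt s Y Z q) (X q) + g q (Nt s Z X q) (Y q)))"
    unfolding main[OF X Y Z] main[OF Y Z X] main[OF Z X Y]
      w_skew[OF s inq[OF X] d[OF Z Y]] w_skew[OF s inq[OF Y] d[OF X Z]] w_skew[OF s inq[OF Z] d[OF Y X]]
    by (simp add: sum.distrib algebra_simps)
  finally show ?thesis by simp
qed

lemma T_cycsum:
  assumes "s \<in> Idx" "x \<in> H q" "y \<in> H q" "z \<in> H q"
  shows "derivation_tensor.cycsum (g q) (T q) s x y z =
    (\<Sum>t\<in>Idx. af s t q x * P.w t y z + af s t q y * P.w t z x + af s t q z * P.w t x y)"
proof -
  interpret T: derivation_tensor "H q" "g q" "4 * n" "\<lambda>a. e a q" "\<lambda>s. I s q" "T q" by (rule T_tensor)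
  show ?thesis
    using structure_equation[OF assms(1) ext_sec_q ext_sec_q ext_sec_q, of x y z] ext_at[OF assms(2)]
      ext_at[OF assms(3)] ext_at[OF assms(4)]
    by (simp add: T.cycsum_def T.m_def T_def P.w_def)
qed

end

end

section \<open>Preservation of PQ in horizontal directions against the Reeb condition\<close>

context hconn
begin

context
  fixes q assumes q: "q \<in> U"
begin

interpretation P: pq_endo "H q" "g q" "4 * n" "\<lambda>a. e a q" "\<lambda>s. I s q" "PQ q" "e0 q"
  by (rule pointwise[OF q])

interpretation T: derivation_tensor "H q" "g q" "4 * n" "\<lambda>a. e a q" "\<lambda>s. I s q" "T q"
  by (rule T_tensor[OF q])

text \<open>If \<nabla>_x I_s is the sum of the a_t(x) I_t, the structure equation says that the
  forms a_t - a_st have vanishing total wedge product with the w_t, so a_t = a_st by injectivity.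
  But a_s = 0, because \<nabla>_x I_s is skew and anticommutes with I_s.\<close>

lemma preserving_imp_reeb:
  assumes PQ: "\<And>s x. s \<in> Idx \<Longrightarrow> x \<in> H q \<Longrightarrow>
      \<exists>c. \<forall>y\<in>H q. T q s x y = (\<Sum>t\<in>Idx. c t *\<^sub>R I t q y)"
    and s: "s \<in> Idx" and x: "x \<in> H q"
  shows "af s s q x = 0"
proof -
  define y0 where "y0 = e 0 q"
  have y0: "y0 \<in> H q" and G: "g q y0 y0 \<noteq> 0"
    using P.E[of 0] P.E_nz[of 0] n by (auto simp: y0_def)
  \<comment> \<open>The coefficients are read off by pairing with I_t y0 for a non-isotropic y0,
    because the coefficients supplied by the hypothesis are chosen separately for each
    \<open>x\<close> and carry no linearity.\<close>
  define a where "a t x = (- \<epsilon> t / g q y0 y0) * g q (T q s x y0) (I t q y0)" for t x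
  have Ta: "T q s x y = (\<Sum>t\<in>Idx. a t x *\<^sub>R I t q y)" if x: "x \<in> H q" and y: "y \<in> H q" for x y
  proof -
    obtain c where c: "\<And>y. y \<in> H q \<Longrightarrow> T q s x y = (\<Sum>t\<in>Idx. c t *\<^sub>R I t q y)" using PQ[OF s x] by blast
    have "a t x = c t" if t: "t \<in> Idx" for t
    proof -
      have "g q (T q s x y0) (I t q y0) = (\<Sum>u\<in>Idx. g q (c u *\<^sub>R I u q y0) (I t q y0))"
        unfolding c[OF y0] by (rule P.g_sum_left[OF P.I_in[OF t y0]]) (use P.I_in[OF _ y0] in auto)
      also have "\<dots> = (\<Sum>u\<in>Idx. if u = t then - c t * \<epsilon> t * g q y0 y0 else 0)"
        by (rule sum.cong[OF refl]) (use P.I_inner[OF _ t y0] P.I_in[OF _ y0] t in \<open>simp split del: if_split\<close>, auto)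
      finally have "g q (T q s x y0) (I t q y0) = - c t * \<epsilon> t * g q y0 y0" using t by simp
      then show ?thesis using G by (simp add: a_def)
    qed
    then show ?thesis using c[OF y] by simp
  qed
  have lin: "linear_on (H q) (a t)" if t: "t \<in> Idx" for t
    unfolding linear_on_def a_def
    using linear_onD[OF T.T_lin_left[OF s y0]] T.T_in[OF s _ y0] P.I_in[OF t y0]
    by (simp add: algebra_simps)
  have a0: "a s x = 0" if x: "x \<in> H q" for x
  proof -
    have "T.m s x (I s q y0) y0 = T.m s x y0 (I s q y0)" by (rule T.m_move[OF s x y0 y0])
    moreover have "T.m s x (I s q y0) y0 = - T.m s x y0 (I s q y0)"
      by (rule T.m_swap[OF s x P.I_in[OF s y0] y0])
    ultimately show ?thesis by (simp add: a_def T.m_def)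
  qed
  have "a s x - af s s q x = 0"
  proof (rule P.wedge_w_injective[where b = "\<lambda>t x. a t x - af s t q x", OF _ _ _ s x])
    show "4 < 4 * n" using n by simp
    show "linear_on (H q) (\<lambda>x. a t x - af s t q x)" if "t \<in> Idx" for t
      by (rule linear_on_diff_fun[OF lin[OF that] af_linear[OF q]])
    fix x y z assume X: "x \<in> H q" "y \<in> H q" "z \<in> H q"
    have m: "T.m s u v v' = (\<Sum>t\<in>Idx. a t u * P.w t v v')" if "u \<in> H q" "v \<in> H q" "v' \<in> H q" for u v v'
      unfolding T.m_def Ta[OF that(1,2)] P.w_def
      by (subst P.g_sum_left) (use that P.I_in[OF _ that(2)] in auto)
    show "(\<Sum>t\<in>Idx. (a t x - af s t q x) * P.w t y z + (a t y - af s t q y) * P.w t z x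
        + (a t z - af s t q z) * P.w t x y) = 0"
      using T_cycsum[OF q s X] unfolding T.cycsum_def m[OF X] m[OF X(2,3,1)] m[OF X(3,1,2)]
      by (simp add: sum.distrib sum_subtractf algebra_simps)
  qed
  then show ?thesis using a0[OF x] by simp
qed

lemma reeb_imp_preserving:
  assumes reeb: "\<And>s x. s \<in> Idx \<Longrightarrow> x \<in> H q \<Longrightarrow> af s s q x = 0"
    and s: "s \<in> Idx" and X: "section_on A H U X" and Y: "section_on A H U Y"
  shows "Nt s X Y q = (\<Sum>t\<in>Idx. af s t q (X q) *\<^sub>R I t q (Y q))"
  unfolding T_eq[OF q s X Y]
  by (rule T.parallel_up_to_structure_forms[OF _ af_linear[OF q] reeb T_cycsum[OF q] s
        section_onD(2)[OF X q] section_onD(2)[OF Y q]]) (use n in simp)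

end

end

section \<open>The Reeb frame\<close>

context pqc_frame
begin

text \<open>The bracket of \<open>e 0\<close> with I_t (e 0) has \<eta>_s-value -2 g(e 0, e 0) for s
  = t and 0 otherwise, which explains the factor in the definition of \<zeta>.\<close>

lemma dual_frame_exists: "\<exists>\<zeta>. pqc_dual A H g PQ n U \<eta> I e \<zeta>"
proof -
  define G where "G q = g q (e 0 q) (e 0 q)" for q
  define \<zeta> where "\<zeta> t q = (- 1 / (2 * G q)) *\<^sub>R lie_bracket A (e 0) (\<lambda>q. I t q (e 0 q)) q" for t q
  have e: "section_on A H U (e 0)" and G: "G q \<noteq> 0" if "q \<in> U" for q
    using e_sec[of 0] e_nz[OF that, of 0] n by (auto simp: G_def)
  have e: "section_on A H U (e 0)" using e_sec[of 0] n by simp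
  have Gs: "smooth_fun A U G" unfolding G_def[abs_def] by (rule g_smooth[OF e e])
  have "pqc_dual A H g PQ n U \<eta> I e \<zeta>"
  proof
    fix t assume t: "t \<in> Idx"
    have It: "section_on A H U (\<lambda>q. I t q (e 0 q))" by (rule sec_I[OF t subset_refl e])
    have b: "vector_field A U (lie_bracket A (e 0) (\<lambda>q. I t q (e 0 q)))"
      by (rule vf_bracket[OF section_onD(1)[OF e] section_onD(1)[OF It]])
    have "smooth_fun A U (\<lambda>q. - 1 / (2 * G q))"
      by (intro smooth_fun_divide smooth_fun_const openU smooth_fun_cmult Gs) (use G in simp)
    then show "vector_field A U (\<zeta> t)" unfolding \<zeta>_def[abs_def] by (rule vf_scale[OF _ b])
    fix q s assume q: "q \<in> U" and s: "s \<in> Idx"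
    interpret P: pq_endo "H q" "g q" "4 * n" "\<lambda>a. e a q" "\<lambda>s. I s q" "PQ q" "e0 q"
      by (rule pointwise[OF q])
    have "\<eta> s q (\<zeta> t q) = (- 1 / (2 * G q)) * \<eta> s q (lie_bracket A (e 0) (\<lambda>q. I t q (e 0 q)) q)"
      unfolding \<zeta>_def by (simp only: linear_onD(2)[OF eta_linear[OF q s] vf_tangent[OF b q]] real_scaleR_def)
    also have "\<dots> = (- 1 / (2 * G q)) * (2 * \<epsilon> s * g q (I s q (e 0 q)) (I t q (e 0 q)))"
      unfolding eta_bracket[OF s subset_refl e It q] ..
    also have "\<dots> = (if s = t then 1 else 0)"
      unfolding P.I_inner[OF s t section_onD(2)[OF e q]] using G[OF q] by (simp add: G_def)
    finally show "\<eta> s q (\<zeta> t q) = (if s = t then 1 else 0)" .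
  qed
  then show ?thesis by blast
qed

end

context pqc_dual
begin

text \<open>Adding a horizontal r_t to \<xi>_t adds 2 \<epsilon>_t g(I_t r_t, Z) to
  \<eta>_t([\<xi>_t, Z]). With c_t the metric dual of \<eta>_t([\<xi>_t, .]) on H, the required r_t
  is -1/2 I_t c_t, as I_t I_t = \<epsilon>_t.\<close>

lemma reeb_frame_exists:
  "\<exists>\<xi>'. pqc_dual A H g PQ n U \<eta> I e \<xi>' \<and>
    (\<forall>q\<in>U. \<forall>s\<in>Idx. \<forall>x\<in>H q. pqc_dual.af A g n \<eta> e \<xi>' s s q x = 0)"
proof -
  define C where "C t a q = \<eta> t q (lie_bracket A (\<xi> t) (e a) q) / g q (e a q) (e a q)" for t a q
  define c where "c t q = (\<Sum>a<4*n. C t a q *\<^sub>R e a q)" for t q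
  define r where "r t q = (- 1 / 2) *\<^sub>R I t q (c t q)" for t q
  define \<xi>' where "\<xi>' t q = \<xi> t q + r t q" for t q
  have c: "section_on A H U (c t)" if t: "t \<in> Idx" for t
    unfolding c_def[abs_def]
  proof (intro sec_sum sec_scale subset_refl openU)
    fix a assume "a \<in> {..<4*n}"
    then have a: "a < 4 * n" by simp
    show "section_on A H U (e a)" by (rule e_sec[OF a])
    show "smooth_fun A U (C t a)"
      unfolding C_def[abs_def]
      by (intro smooth_fun_divide eta_smooth[OF t subset_refl] vf_bracket xi[OF t]
          section_onD(1)[OF e_sec[OF a]] g_smooth e_sec[OF a] e_nz[OF _ a])
  qed
  have r: "section_on A H U (r t)" if t: "t \<in> Idx" for t
    unfolding r_def[abs_def] by (rule sec_cscale[OF subset_refl sec_I[OF t subset_refl c[OF t]]])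
  have d: "pqc_dual A H g PQ n U \<eta> I e \<xi>'"
  proof
    fix t assume t: "t \<in> Idx"
    show "vector_field A U (\<xi>' t)" unfolding \<xi>'_def[abs_def] by (rule vf_add[OF xi[OF t] section_onD(1)[OF r[OF t]]])
    fix q s assume q: "q \<in> U" and s: "s \<in> Idx"
    show "\<eta> s q (\<xi>' t q) = (if s = t then 1 else 0)"
      unfolding \<xi>'_def using linear_onD(1)[OF eta_linear[OF q s] xi_tangent[OF q t] H_tangent[OF q section_onD(2)[OF r[OF t] q]]]
        dual[OF q s t] eta_H[OF q s section_onD(2)[OF r[OF t] q]] by simp
  qed
  then interpret X: pqc_dual A H g PQ n U \<eta> I e \<xi>' .
  have "X.af t t q x = 0" if q: "q \<in> U" and t: "t \<in> Idx" and x: "x \<in> H q" for q t x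
  proof -
    interpret P: pq_endo "H q" "g q" "4 * n" "\<lambda>a. e a q" "\<lambda>s. I s q" "PQ q" "e0 q"
      by (rule pointwise[OF q])
    define Z where "Z = ext q x"
    have Z: "section_on A H U Z" and Zq: "Z q = x" unfolding Z_def by (rule ext_sec) (rule ext_eq[OF q x])
    note cq = section_onD(2)[OF c[OF t] q]
    have "X.af t t q x = \<eta> t q (lie_bracket A (\<xi>' t) Z q)"
      using X.af_eq[OF subset_refl Z q t t] Zq by simp
    also have "\<dots> = \<eta> t q (lie_bracket A (\<xi> t) Z q + lie_bracket A (r t) Z q)"
      unfolding \<xi>'_def[abs_def] bracket_add_left[OF xi[OF t] section_onD(1)[OF r[OF t]] section_onD(1)[OF Z] q] ..
    also have "\<dots> = \<eta> t q (lie_bracket A (\<xi> t) Z q) + \<eta> t q (lie_bracket A (r t) Z q)"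
      by (rule linear_onD(1)[OF eta_linear[OF q t] bracket_tangent[OF xi[OF t] section_onD(1)[OF Z] q]
            bracket_tangent[OF section_onD(1)[OF r[OF t]] section_onD(1)[OF Z] q]])
    also have "\<eta> t q (lie_bracket A (r t) Z q) = 2 * \<epsilon> t * g q (I t q (r t q)) (Z q)"
      by (rule eta_bracket[OF t subset_refl r[OF t] Z q])
    also have "I t q (r t q) = (- \<epsilon> t / 2) *\<^sub>R c t q"
      unfolding r_def P.I_linear(2)[OF t P.I_in[OF t cq]] P.I_sq[OF t cq] by simp
    also have "2 * \<epsilon> t * g q ((- \<epsilon> t / 2) *\<^sub>R c t q) (Z q) = - g q (c t q) (Z q)"
      using P.g_left(2)[OF section_onD(2)[OF Z q] cq, of "- \<epsilon> t / 2"] by simp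
    also have "g q (c t q) (Z q) = (\<Sum>a<4*n. g q (C t a q *\<^sub>R e a q) (Z q))"
      unfolding c_def by (rule P.g_sum_left[OF section_onD(2)[OF Z q]]) (use P.E in simp)
    also have "\<dots> = (\<Sum>a<4*n. co a q x * (\<epsilon> t * \<epsilon> t * \<eta> t q (lie_bracket A (\<xi> t) (e a) q)))"
      using P.E x P.g_sym[OF P.E x] by (intro sum.cong) (simp_all add: Zq C_def co_def)
    also have "\<dots> = \<eta> t q (lie_bracket A (\<xi> t) Z q)"
      using af_eq[OF subset_refl Z q t t] Zq by (simp add: af_def)
    finally show ?thesis by simp
  qed
  then show ?thesis using d by blast
qed

section \<open>The Koszul formula\<close>

text \<open>The Koszul expression with brackets replaced by their horizontal parts; it is 2
  g(\<nabla>_X Y, Z) for the connection sought. The denominators in \<open>K\<close> turn it into a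
  vector by means of the orthogonal frame.\<close>

definition Kz :: "('a \<Rightarrow> 'a tvec) \<Rightarrow> ('a \<Rightarrow> 'a tvec) \<Rightarrow> ('a \<Rightarrow> 'a tvec) \<Rightarrow> 'a \<Rightarrow> real" where
  "Kz X Y Z q = X q (\<lambda>r. g r (Y r) (Z r)) + Y q (\<lambda>r. g r (X r) (Z r)) - Z q (\<lambda>r. g r (X r) (Y r))
    + g q (prH q (lie_bracket A X Y q)) (Z q) - g q (prH q (lie_bracket A X Z q)) (Y q)
    - g q (prH q (lie_bracket A Y Z q)) (X q)"

definition K :: "('a \<Rightarrow> 'a tvec) \<Rightarrow> ('a \<Rightarrow> 'a tvec) \<Rightarrow> 'a \<Rightarrow> 'a tvec" where
  "K X Y q = (\<Sum>a<4*n. (Kz X Y (e a) q / (2 * g q (e a q) (e a q))) *\<^sub>R e a q)"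

definition bH :: "('a \<Rightarrow> 'a tvec) \<Rightarrow> ('a \<Rightarrow> 'a tvec) \<Rightarrow> 'a \<Rightarrow> 'a tvec" where
  "bH X Y q = prH q (lie_bracket A X Y q)"

context
  fixes q assumes q: "q \<in> U"
begin

interpretation P: pq_endo "H q" "g q" "4 * n" "\<lambda>a. e a q" "\<lambda>s. I s q" "PQ q" "e0 q"
  by (rule pointwise[OF q])

lemma sec_tg: "section_on A H U X \<Longrightarrow> X q \<in> tangent_space A q"
  using vf_tangent[OF section_onD(1) q] by blast

lemma bH_in: "vector_field A U X \<Longrightarrow> vector_field A U Y \<Longrightarrow> bH X Y q \<in> H q"
  unfolding bH_def by (rule prH_in[OF q bracket_tangent[OF _ _ q]])

lemma bH_add:
  assumes "vector_field A U X" "vector_field A U Y" "vector_field A U Z"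
  shows "bH X (\<lambda>q. Y q + Z q) q = bH X Y q + bH X Z q"
    "bH (\<lambda>q. Y q + Z q) X q = bH Y X q + bH Z X q"
  unfolding bH_def bracket_add[OF assms q] bracket_add_left[OF assms(2,3,1) q]
  by (rule linear_onD(1)[OF prH_linear[OF q] bracket_tangent[OF _ _ q] bracket_tangent[OF _ _ q]]; fact)+

lemma bH_scale:
  assumes X: "vector_field A U X" and Y: "section_on A H U Y" and f: "smooth_fun A U f"
  shows "bH X (\<lambda>q. f q *\<^sub>R Y q) q = X q f *\<^sub>R Y q + f q *\<^sub>R bH X Y q"
    "bH (\<lambda>q. f q *\<^sub>R Y q) X q = f q *\<^sub>R bH Y X q - X q f *\<^sub>R Y q"
proof -
  note vY = section_onD(1)[OF Y] and Yq = sec_tg[OF Y]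
  note b = bracket_tangent[OF X vY q] and b' = bracket_tangent[OF vY X q] and sc = subspace_scale[OF tangent_subspace]
  have p: "prH q (Y q) = Y q" by (rule prH_id[OF q section_onD(2)[OF Y q]])
  note L = prH_linear[OF q]
  show "bH X (\<lambda>q. f q *\<^sub>R Y q) q = X q f *\<^sub>R Y q + f q *\<^sub>R bH X Y q"
    unfolding bH_def bracket_scale[OF X vY f q] linear_onD(1)[OF L sc[OF Yq] sc[OF b]]
      linear_onD(2)[OF L Yq] linear_onD(2)[OF L b] p ..
  show "bH (\<lambda>q. f q *\<^sub>R Y q) X q = f q *\<^sub>R bH Y X q - X q f *\<^sub>R Y q"
    unfolding bH_def bracket_scale_left[OF vY X f q] linear_on_diff[OF L tangent_subspace sc[OF b'] sc[OF Yq]]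
      linear_onD(2)[OF L Yq] linear_onD(2)[OF L b'] p ..
qed

lemma bH_swap: "vector_field A U X \<Longrightarrow> vector_field A U Y \<Longrightarrow> bH Y X q = - bH X Y q"
  unfolding bH_def bracket_swap[of Y X q]
  by (rule linear_on_minus[OF prH_linear[OF q] bracket_tangent[OF _ _ q]])

lemma dg_cong:
  assumes "section_on A H U Z" "\<And>r. r \<in> U \<Longrightarrow> f r = h r"
  shows "Z q f = Z q h"
  by (rule tangent_cong[OF sec_tg[OF assms(1)] openU q assms(2)])

lemma g_add_fun:
  assumes "section_on A H U X" "section_on A H U Y" "section_on A H U Z" "r \<in> U"
  shows "g r (X r + Y r) (Z r) = g r (X r) (Z r) + g r (Y r) (Z r)"
    "g r (Z r) (X r + Y r) = g r (Z r) (X r) + g r (Z r) (Y r)"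
proof -
  interpret R: pq_endo "H r" "g r" "4 * n" "\<lambda>a. e a r" "\<lambda>s. I s r" "PQ r" "e0 r"
    by (rule pointwise) fact
  show "g r (X r + Y r) (Z r) = g r (X r) (Z r) + g r (Y r) (Z r)"
    "g r (Z r) (X r + Y r) = g r (Z r) (X r) + g r (Z r) (Y r)"
    using section_onD(2)[OF assms(1,4)] section_onD(2)[OF assms(2,4)] section_onD(2)[OF assms(3,4)] by simp_all
qed

lemma g_scale_fun:
  assumes "section_on A H U X" "section_on A H U Z" "r \<in> U"
  shows "g r (c *\<^sub>R X r) (Z r) = c * g r (X r) (Z r)" "g r (Z r) (c *\<^sub>R X r) = c * g r (Z r) (X r)"
    "g r (X r) (Z r) = g r (Z r) (X r)"
proof -
  interpret R: pq_endo "H r" "g r" "4 * n" "\<lambda>a. e a r" "\<lambda>s. I s r" "PQ r" "e0 r"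
    by (rule pointwise) fact
  note x = section_onD(2)[OF assms(1,3)] section_onD(2)[OF assms(2,3)]
  show "g r (c *\<^sub>R X r) (Z r) = c * g r (X r) (Z r)" "g r (Z r) (c *\<^sub>R X r) = c * g r (Z r) (X r)"
    using x by simp_all
  show "g r (X r) (Z r) = g r (Z r) (X r)" by (rule R.g_sym[OF x])
qed

lemma dg_add:
  assumes "section_on A H U X" "section_on A H U Y" "section_on A H U Z" "section_on A H U W"
  shows "W q (\<lambda>r. g r (X r + Y r) (Z r)) = W q (\<lambda>r. g r (X r) (Z r)) + W q (\<lambda>r. g r (Y r) (Z r))"
    "W q (\<lambda>r. g r (Z r) (X r + Y r)) = W q (\<lambda>r. g r (Z r) (X r)) + W q (\<lambda>r. g r (Z r) (Y r))"
  using dg_cong[OF assms(4) g_add_fun(1)[OF assms(1-3)]] dg_cong[OF assms(4) g_add_fun(2)[OF assms(1-3)]]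
    tangent_add[OF sec_tg[OF assms(4)] smooth_fun_nearI[OF g_smooth q] smooth_fun_nearI[OF g_smooth q]] assms(1-3)
  by simp_all

lemma dg_scale:
  assumes X: "section_on A H U X" and Z: "section_on A H U Z" and W: "section_on A H U W" and f: "smooth_fun A U f"
  shows "W q (\<lambda>r. g r (f r *\<^sub>R X r) (Z r)) = W q f * g q (X q) (Z q) + f q * W q (\<lambda>r. g r (X r) (Z r))"
    "W q (\<lambda>r. g r (Z r) (f r *\<^sub>R X r)) = W q f * g q (Z q) (X q) + f q * W q (\<lambda>r. g r (Z r) (X r))"
  using dg_cong[OF W g_scale_fun(1)[OF X Z, of _ "f _"]] dg_cong[OF W g_scale_fun(2)[OF X Z, of _ "f _"]]
    tangent_mult[OF sec_tg[OF W] smooth_fun_nearI[OF f q] smooth_fun_nearI[OF g_smooth[OF X Z] q]]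
    tangent_mult[OF sec_tg[OF W] smooth_fun_nearI[OF f q] smooth_fun_nearI[OF g_smooth[OF Z X] q]]
  by simp_all

lemma dg_sym:
  assumes X: "section_on A H U X" and Z: "section_on A H U Z" and W: "section_on A H U W"
  shows "W q (\<lambda>r. g r (X r) (Z r)) = W q (\<lambda>r. g r (Z r) (X r))"
  by (rule dg_cong[OF W g_scale_fun(3)[OF X Z]])

lemma Kz_bH: "Kz X Y Z q = X q (\<lambda>r. g r (Y r) (Z r)) + Y q (\<lambda>r. g r (X r) (Z r)) - Z q (\<lambda>r. g r (X r) (Y r))
    + g q (bH X Y q) (Z q) - g q (bH X Z q) (Y q) - g q (bH Y Z q) (X q)"
  by (simp add: Kz_def bH_def)

context
  fixes X Y Z assumes X: "section_on A H U X" and Y: "section_on A H U Y" and Z: "section_on A H U Z"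
begin

lemmas Kz_mem = section_onD(2)[OF X q] section_onD(2)[OF Y q] section_onD(2)[OF Z q]
  bH_in[OF section_onD(1)[OF X] section_onD(1)[OF Y]] bH_in[OF section_onD(1)[OF X] section_onD(1)[OF Z]]
  bH_in[OF section_onD(1)[OF Y] section_onD(1)[OF Z]]

lemmas Kz_vf = section_onD(1)[OF X] section_onD(1)[OF Y] section_onD(1)[OF Z]

lemma Kz_scale1: "smooth_fun A U f \<Longrightarrow> Kz (\<lambda>q. f q *\<^sub>R X q) Y Z q = f q * Kz X Y Z q"
  unfolding Kz_bH by (simp add: dg_scale[OF X] X Y Z bH_scale[OF _ X] Kz_vf Kz_mem)
    (simp add: P.g_sym[OF Kz_mem(2,1)] P.g_sym[OF Kz_mem(3,1)] algebra_simps)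

lemma Kz_scale2: "smooth_fun A U f \<Longrightarrow>
    Kz X (\<lambda>q. f q *\<^sub>R Y q) Z q = f q * Kz X Y Z q + 2 * X q f * g q (Y q) (Z q)"
  unfolding Kz_bH by (simp add: dg_scale[OF Y] X Y Z bH_scale[OF _ Y] Kz_vf Kz_mem)
    (simp add: P.g_sym[OF Kz_mem(2,1)] P.g_sym[OF Kz_mem(3,1)] algebra_simps)

lemma Kz_scale3: "smooth_fun A U f \<Longrightarrow> Kz X Y (\<lambda>q. f q *\<^sub>R Z q) q = f q * Kz X Y Z q"
  unfolding Kz_bH by (simp add: dg_scale[OF Z] X Y Z bH_scale[OF _ Z] Kz_vf Kz_mem)
    (simp add: P.g_sym[OF Kz_mem(2,3)] P.g_sym[OF Kz_mem(1,3)] algebra_simps)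

lemma Kz_tors: "Kz X Y Z q - Kz Y X Z q = 2 * g q (bH X Y q) (Z q)"
  unfolding Kz_bH bH_swap[OF Kz_vf(1,2)] dg_sym[OF Y X Z] using Kz_mem by simp

lemma Kz_metric: "Kz X Y Z q + Kz X Z Y q = 2 * X q (\<lambda>r. g r (Y r) (Z r))"
  unfolding Kz_bH bH_swap[OF Kz_vf(2,3)] dg_sym[OF Z Y X] using Kz_mem by simp

context
  fixes W assumes W: "section_on A H U W"
begin

lemmas KzW_mem = section_onD(2)[OF W q]
  bH_in[OF section_onD(1)[OF X] section_onD(1)[OF W]] bH_in[OF section_onD(1)[OF Y] section_onD(1)[OF W]]
  bH_in[OF section_onD(1)[OF W] section_onD(1)[OF Y]] bH_in[OF section_onD(1)[OF W] section_onD(1)[OF Z]]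

lemma Kz_add1: "Kz (\<lambda>q. X q + W q) Y Z q = Kz X Y Z q + Kz W Y Z q"
  unfolding Kz_bH by (simp add: dg_add[OF X W] X Y Z W bH_add[OF _ Kz_vf(1) section_onD(1)[OF W]] Kz_vf Kz_mem KzW_mem)

lemma Kz_add2: "Kz X (\<lambda>q. Y q + W q) Z q = Kz X Y Z q + Kz X W Z q"
  unfolding Kz_bH by (simp add: dg_add[OF Y W] X Y Z W bH_add[OF _ Kz_vf(2) section_onD(1)[OF W]] Kz_vf Kz_mem KzW_mem)

lemma Kz_add3: "Kz X Y (\<lambda>q. Z q + W q) q = Kz X Y Z q + Kz X Y W q"
  unfolding Kz_bH by (simp add: dg_add[OF Z W] X Y Z W bH_add[OF _ Kz_vf(3) section_onD(1)[OF W]] Kz_vf Kz_mem KzW_mem)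

end

end

lemma K_in: "K X Y q \<in> H q"
  unfolding K_def by (intro P.S_sum P.S_closed(3) P.E) simp

lemma g_K:
  assumes X: "section_on A H U X" and Y: "section_on A H U Y" and Z: "section_on A H U Z"
  shows "g q (K X Y q) (Z q) = Kz X Y Z q / 2"
proof -
  have "Kz X Y Z q = (\<Sum>a<4*n. co a q (Z q) *\<^sub>R Kz X Y (e a) q)"
    by (rule tensorial[OF subset_refl q Z]) (rule Kz_add3[OF X Y], assumption+,
        unfold real_scaleR_def, rule Kz_scale3[OF X Y], assumption+)
  moreover have "g q (K X Y q) (Z q) =
      (\<Sum>a<4*n. g q ((Kz X Y (e a) q / (2 * g q (e a q) (e a q))) *\<^sub>R e a q) (Z q))"
    unfolding K_def by (rule P.g_sum_left[OF section_onD(2)[OF Z q]]) (use P.E in simp)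
  moreover have "\<dots> = (\<Sum>a<4*n. co a q (Z q) * Kz X Y (e a) q / 2)"
    using P.E section_onD(2)[OF Z q] P.g_sym[OF P.E section_onD(2)[OF Z q]]
    by (intro sum.cong) (simp_all add: co_def ac_simps)
  ultimately show ?thesis by (simp add: sum_divide_distrib)
qed

lemma sec_nondeg:
  assumes "x \<in> H q" "y \<in> H q" "\<And>Z. section_on A H U Z \<Longrightarrow> g q x (Z q) = g q y (Z q)"
  shows "x = y"
proof (rule P.nondeg2[OF assms(1,2)])
  fix z assume "z \<in> H q"
  then show "g q x z = g q y z" using assms(3)[OF ext_sec[of q z]] ext_eq[OF q] by simp
qed

end

text \<open>Every axiom is a property of \<open>Kz\<close>, carried over by pairing with sections
  (\<open>g_K\<close>) and by nondegeneracy (\<open>sec_nondeg\<close>).\<close>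

lemma Koszul_hconn: "hconn A H g PQ n U \<eta> I e \<xi> K"
proof
  fix X Y assume X: "section_on A H U X" and Y: "section_on A H U Y"
  show "section_on A H U (K X Y)"
    unfolding K_def[abs_def]
  proof (intro sec_sum sec_scale subset_refl openU)
    fix a assume "a \<in> {..<4*n}"
    then have a: "a < 4 * n" by simp
    note ea = e_sec[OF a]
    show "section_on A H U (e a)" by (rule ea)
    note v = section_onD(1)[OF X] section_onD(1)[OF Y] section_onD(1)[OF ea]
    show "smooth_fun A U (\<lambda>q. Kz X Y (e a) q / (2 * g q (e a q) (e a q)))"
    proof (rule smooth_fun_divide[OF _ smooth_fun_cmult[OF g_smooth[OF ea ea]]])
      note b = prH_sec[OF subset_refl vf_bracket[OF v(1,2)]] prH_sec[OF subset_refl vf_bracket[OF v(1,3)]]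
        prH_sec[OF subset_refl vf_bracket[OF v(2,3)]]
      show "smooth_fun A U (Kz X Y (e a))"
        unfolding Kz_def[abs_def]
        by (rule smooth_fun_diff[OF smooth_fun_diff[OF smooth_fun_add[OF smooth_fun_diff[OF smooth_fun_add[OF
            vf_smooth[OF v(1) subset_refl g_smooth[OF Y ea]] vf_smooth[OF v(2) subset_refl g_smooth[OF X ea]]]
            vf_smooth[OF v(3) subset_refl g_smooth[OF X Y]]] g_smooth[OF b(1) ea]] g_smooth[OF b(2) Y]]
            g_smooth[OF b(3) X]])
      show "2 * g q (e a q) (e a q) \<noteq> 0" if "q \<in> U" for q using e_nz[OF that a] by simp
    qed
  qed
next
  fix X X' Y q assume *: "section_on A H U X" "section_on A H U X'" "section_on A H U Y" "q \<in> U"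
  interpret P: pq_endo "H q" "g q" "4 * n" "\<lambda>a. e a q" "\<lambda>s. I s q" "PQ q" "e0 q" by (rule pointwise) fact
  note K = K_in[OF *(4)] and XX = sec_add[OF subset_refl *(1,2)]
  show "K (\<lambda>q. X q + X' q) Y q = K X Y q + K X' Y q"
    by (rule sec_nondeg[OF *(4) K P.S_closed(2)[OF K K]])
      (simp add: K section_onD(2)[OF _ *(4)] g_K[OF *(4)] XX * Kz_add1[OF *(4)] add_divide_distrib)
next
  fix X Y Y' q assume *: "section_on A H U X" "section_on A H U Y" "section_on A H U Y'" "q \<in> U"
  interpret P: pq_endo "H q" "g q" "4 * n" "\<lambda>a. e a q" "\<lambda>s. I s q" "PQ q" "e0 q" by (rule pointwise) fact
  note K = K_in[OF *(4)] and XX = sec_add[OF subset_refl *(2,3)]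
  show "K X (\<lambda>q. Y q + Y' q) q = K X Y q + K X Y' q"
    by (rule sec_nondeg[OF *(4) K P.S_closed(2)[OF K K]])
      (simp add: K section_onD(2)[OF _ *(4)] g_K[OF *(4)] XX * Kz_add2[OF *(4)] add_divide_distrib)
next
  fix f X Y q assume *: "smooth_fun A U f" "section_on A H U X" "section_on A H U Y" "q \<in> U"
  interpret P: pq_endo "H q" "g q" "4 * n" "\<lambda>a. e a q" "\<lambda>s. I s q" "PQ q" "e0 q" by (rule pointwise) fact
  note K = K_in[OF *(4)] and XX = sec_scale[OF subset_refl *(1,2)] and YY = sec_scale[OF subset_refl *(1,3)]
  note Yq = section_onD(2)[OF *(3,4)]
  show "K (\<lambda>q. f q *\<^sub>R X q) Y q = f q *\<^sub>R K X Y q"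
    by (rule sec_nondeg[OF *(4) K P.S_closed(3)[OF K]])
      (simp add: K section_onD(2)[OF _ *(4)] g_K[OF *(4)] XX * Kz_scale1[OF *(4)])
  show "K X (\<lambda>q. f q *\<^sub>R Y q) q = X q f *\<^sub>R Y q + f q *\<^sub>R K X Y q"
    by (rule sec_nondeg[OF *(4) K P.S_closed(2)[OF P.S_closed(3)[OF Yq] P.S_closed(3)[OF K]]])
      (simp add: K Yq section_onD(2)[OF _ *(4)] g_K[OF *(4)] YY * Kz_scale2[OF *(4)] add_divide_distrib)
next
  fix X Y q assume *: "section_on A H U X" "section_on A H U Y" "q \<in> U"
  interpret P: pq_endo "H q" "g q" "4 * n" "\<lambda>a. e a q" "\<lambda>s. I s q" "PQ q" "e0 q" by (rule pointwise) fact
  note K = K_in[OF *(3)] and b = bH_in[OF *(3) section_onD(1)[OF *(1)] section_onD(1)[OF *(2)]]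
  have "K X Y q - K Y X q = bH X Y q"
  proof (rule sec_nondeg[OF *(3) P.S_closed(5)[OF K K] b])
    fix Z assume Z: "section_on A H U Z"
    show "g q (K X Y q - K Y X q) (Z q) = g q (bH X Y q) (Z q)"
      using Kz_tors[OF *(3,1,2) Z] g_K[OF *(3,1,2) Z] g_K[OF *(3,2,1) Z] K section_onD(2)[OF Z *(3)]
      by simp
  qed
  then show "K X Y q - K Y X q = prH q (lie_bracket A X Y q)" by (simp add: bH_def)
next
  fix X Y Z q assume *: "section_on A H U X" "section_on A H U Y" "section_on A H U Z" "q \<in> U"
  interpret P: pq_endo "H q" "g q" "4 * n" "\<lambda>a. e a q" "\<lambda>s. I s q" "PQ q" "e0 q" by (rule pointwise) fact
  show "X q (\<lambda>r. g r (Y r) (Z r)) = g q (K X Y q) (Z q) + g q (Y q) (K X Z q)"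
    using Kz_metric[OF *(4,1-3)] g_K[OF *(4,1-3)] g_K[OF *(4,1,3,2)]
      P.g_sym[OF section_onD(2)[OF *(2,4)] K_in[OF *(4)]] by simp
qed

end

section \<open>The canonical identification\<close>

text \<open>Both triples are bases of Q, orthogonal for the trace form with the same square lengths
  -\<epsilon>_s N. The sum of \<epsilon>_s I_s tensor I_s is, up to a factor, the inverse of that
  form and hence independent of the basis; here it is applied to (x, y) in one factor.\<close>

lemma (in pq_endo) quadratic_independent:
  assumes "pq_endo S g N E I' Q e0'" and x: "x \<in> S" and y: "y \<in> S"
  shows "(\<Sum>s\<in>Idx. (\<epsilon> s * g (I s x) y) *\<^sub>R I s) = (\<Sum>s\<in>Idx. (\<epsilon> s * g (I' s x) y) *\<^sub>R I' s)"
proof -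
  interpret J: pq_endo S g N E I' Q e0' by fact
  have I_Q: "I s \<in> Q" if "s \<in> Idx" for s
    using that unfolding Q Idx_def by (auto intro: span_base)
  have J_Q: "I' s \<in> Q" if "s \<in> Idx" for s
    using that unfolding J.Q Idx_def by (auto intro: span_base)
  have "\<forall>t\<in>Idx. \<exists>c. I t = (\<Sum>s\<in>Idx. c s *\<^sub>R I' s)" using J.Q_sum I_Q by blast
  then obtain c where c: "\<And>t. t \<in> Idx \<Longrightarrow> I t = (\<Sum>s\<in>Idx. c t s *\<^sub>R I' s)" by metis
  have "\<forall>t\<in>Idx. \<exists>c. I' t = (\<Sum>s\<in>Idx. c s *\<^sub>R I s)" using Q_sum J_Q by blast
  then obtain d where d: "\<And>t. t \<in> Idx \<Longrightarrow> I' t = (\<Sum>s\<in>Idx. d t s *\<^sub>R I s)" by metis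
  have cx: "I t z = (\<Sum>s\<in>Idx. c t s *\<^sub>R I' s z)" if "t \<in> Idx" for t z
    unfolding c[OF that] sum_123 by simp
  have dx: "I' t z = (\<Sum>s\<in>Idx. d t s *\<^sub>R I s z)" if "t \<in> Idx" for t z
    unfolding d[OF that] sum_123 by simp
  \<comment> \<open>The trace of I'_s against I_t is computed by expanding either factor. This makes
    the two transition matrices transposes of each other up to signs, that is, elements of
    O(1,2).\<close>
  have rel: "\<epsilon> s * d s t = \<epsilon> t * c t s" if s: "s \<in> Idx" and t: "t \<in> Idx" for s t
  proof -
    have 1: "tr (I' s) (I t) = - (c t s * \<epsilon> s * N)"
    proof -
      have "tr (I' s) (I t) = tr (I' s) (\<lambda>z. \<Sum>u\<in>Idx. c t u *\<^sub>R I' u z)"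
        by (rule tr_cong) (simp_all only: cx[OF t])
      also have "\<dots> = (\<Sum>u\<in>Idx. tr (I' s) (\<lambda>z. c t u *\<^sub>R I' u z))"
        by (rule tr_sum[OF J.lin_endo_I[OF s] lin_endo_lin_comb(2)[OF J.lin_endo_I]])
      also have "\<dots> = (\<Sum>u\<in>Idx. if u = s then - (c t s * \<epsilon> s * N) else 0)"
        by (rule sum.cong[OF refl]) (simp add: tr_scale[OF J.lin_endo_I[OF s] J.lin_endo_I] J.tr_I[OF s])
      finally show ?thesis using s by simp
    qed
    have 2: "tr (I t) (I' s) = - (d s t * \<epsilon> t * N)"
    proof -
      have "tr (I t) (I' s) = tr (I t) (\<lambda>z. \<Sum>u\<in>Idx. d s u *\<^sub>R I u z)"
        by (rule tr_cong) (simp_all only: dx[OF s])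
      also have "\<dots> = (\<Sum>u\<in>Idx. tr (I t) (\<lambda>z. d s u *\<^sub>R I u z))"
        by (rule tr_sum[OF lin_endo_I[OF t] lin_endo_lin_comb(2)[OF lin_endo_I]])
      also have "\<dots> = (\<Sum>u\<in>Idx. if u = t then - (d s t * \<epsilon> t * N) else 0)"
        by (rule sum.cong[OF refl]) (simp add: tr_scale[OF lin_endo_I[OF t] lin_endo_I] tr_I[OF t])
      finally show ?thesis using t by simp
    qed
    have "c t s * \<epsilon> s * N = d s t * \<epsilon> t * N"
      using 1 2 tr_sym[OF J.lin_endo_I[OF s] lin_endo_I[OF t]] by linarith
    then have "c t s * \<epsilon> s = d s t * \<epsilon> t" using N by simp
    then show ?thesis using eps_cases[of s] eps_cases[of t] by auto
  qed
  have "(\<Sum>s\<in>Idx. (\<epsilon> s * g (I' s x) y) *\<^sub>R I' s) = (\<Sum>s\<in>Idx. \<Sum>t\<in>Idx. (\<epsilon> t * g (I t x) y * c t s) *\<^sub>R I' s)"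
  proof (rule sum.cong[OF refl])
    fix s assume s: "s \<in> Idx"
    have "g (I' s x) y = (\<Sum>t\<in>Idx. g (d s t *\<^sub>R I t x) y)"
      unfolding dx[OF s] by (rule g_sum_left[OF y]) (use I_in[OF _ x] in simp)
    also have "\<dots> = (\<Sum>t\<in>Idx. d s t * g (I t x) y)"
      by (rule sum.cong[OF refl]) (use I_in[OF _ x] y in simp)
    finally have "\<epsilon> s * g (I' s x) y = (\<Sum>t\<in>Idx. (\<epsilon> s * d s t) * g (I t x) y)"
      by (simp add: sum_distrib_left mult.assoc)
    also have "\<dots> = (\<Sum>t\<in>Idx. \<epsilon> t * g (I t x) y * c t s)"
      by (rule sum.cong[OF refl]) (simp add: rel[OF s])
    finally show "(\<epsilon> s * g (I' s x) y) *\<^sub>R I' s = (\<Sum>t\<in>Idx. (\<epsilon> t * g (I t x) y * c t s) *\<^sub>R I' s)"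
      by (simp only: scaleR_sum_left)
  qed
  also have "\<dots> = (\<Sum>t\<in>Idx. (\<epsilon> t * g (I t x) y) *\<^sub>R I t)"
  proof (subst sum.swap, rule sum.cong[OF refl])
    fix t assume t: "t \<in> Idx"
    show "(\<Sum>s\<in>Idx. (\<epsilon> t * g (I t x) y * c t s) *\<^sub>R I' s) = (\<epsilon> t * g (I t x) y) *\<^sub>R I t"
      unfolding c[OF t] scaleR_sum_right by (simp only: scaleR_scaleR)
  qed
  finally show ?thesis by simp
qed

text \<open>The identification \<open>\<phi>\<close> is induced by a map on the whole tangent space that does not
  depend on \<open>V\<close>.\<close>

definition phi0 ::
  "('m::topological_space, 'e::euclidean_space) atlas \<Rightarrow> ('m \<Rightarrow> 'm tvec set) \<Rightarrow>
   ('m \<Rightarrow> 'm tvec \<Rightarrow> 'm tvec \<Rightarrow> real) \<Rightarrow> ('m \<Rightarrow> ('m tvec \<Rightarrow> 'm tvec) set) \<Rightarrow>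
   'm \<Rightarrow> 'm tvec \<Rightarrow> 'm tvec \<Rightarrow> 'm tvec" where
  "phi0 A H g PQ p v = (SOME J. \<exists>U \<eta> I. p \<in> U \<and> local_data A H g PQ U \<eta> I \<and>
     J = (\<Sum>s\<in>Idx. \<eta> s p v *\<^sub>R I s p))"

context pqc_frame
begin

text \<open>Both sides are linear in \<open>v\<close> and vanish on H. On the brackets of
  \<open>e 0\<close> with I_t (e 0) they agree by \<open>quadratic_independent\<close>, because
  \<eta>_s([X, Y]) = 2 \<epsilon>_s g(I_s X, Y) for either choice of data; together with H these
  brackets span the tangent space. The rotation relating the two choices never has to be
  exhibited.\<close>

lemma identification_independent:
  assumes "pqc_frame A H g PQ n U \<eta>' I' e" and q: "q \<in> U" and v: "v \<in> tangent_space A q"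
  shows "(\<Sum>s\<in>Idx. \<eta> s q v *\<^sub>R I s q) = (\<Sum>s\<in>Idx. \<eta>' s q v *\<^sub>R I' s q)"
proof -
  interpret J: pqc_frame A H g PQ n U \<eta>' I' e by fact
  interpret P: pq_endo "H q" "g q" "4 * n" "\<lambda>a. e a q" "\<lambda>s. I s q" "PQ q" "e0 q"
    by (rule pointwise[OF q])
  have e: "section_on A H U (e 0)" using e_sec[of 0] n by simp
  define G where "G = g q (e 0 q) (e 0 q)"
  have G: "G \<noteq> 0" using e_nz[OF q, of 0] n by (simp add: G_def)
  define b where "b t = lie_bracket A (e 0) (\<lambda>q. I t q (e 0 q)) q" for t
  have It: "section_on A H U (\<lambda>q. I t q (e 0 q))" if "t \<in> Idx" for t by (rule sec_I[OF that subset_refl e])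
  have bt: "b t \<in> tangent_space A q" if "t \<in> Idx" for t
    unfolding b_def by (rule bracket_tangent[OF section_onD(1)[OF e] section_onD(1)[OF It[OF that]] q])
  define \<phi> \<phi>' where "\<phi> v = (\<Sum>s\<in>Idx. \<eta> s q v *\<^sub>R I s q)" and "\<phi>' v = (\<Sum>s\<in>Idx. \<eta>' s q v *\<^sub>R I' s q)" for v
  have lin: "linear_on (tangent_space A q) \<phi>" "linear_on (tangent_space A q) \<phi>'"
    unfolding \<phi>_def \<phi>'_def
    by (intro linear_on_sum_fun linear_on_scaleR_vec eta_linear[OF q] J.eta_linear[OF q]; assumption)+
  have H0: "\<phi> h = 0" "\<phi>' h = 0" if "h \<in> H q" for h
    unfolding \<phi>_def \<phi>'_def using eta_H[OF q _ that] J.eta_H[OF q _ that] by simp_all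
  have br: "\<phi> (b t) = \<phi>' (b t)" if t: "t \<in> Idx" for t
  proof -
    define x y where "x = e 0 q" and "y = I t q (e 0 q)"
    have "\<phi> (b t) = (\<Sum>s\<in>Idx. (2 * \<epsilon> s * g q (I s q x) y) *\<^sub>R I s q)"
      unfolding \<phi>_def b_def x_def y_def by (rule sum.cong[OF refl]) (simp only: eta_bracket[OF _ subset_refl e It[OF t] q])
    also have "\<dots> = 2 *\<^sub>R (\<Sum>s\<in>Idx. (\<epsilon> s * g q (I s q x) y) *\<^sub>R I s q)"
      unfolding scaleR_sum_right by (simp only: scaleR_scaleR mult.assoc)
    also have "(\<Sum>s\<in>Idx. (\<epsilon> s * g q (I s q x) y) *\<^sub>R I s q) = (\<Sum>s\<in>Idx. (\<epsilon> s * g q (I' s q x) y) *\<^sub>R I' s q)"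
      by (rule P.quadratic_independent[OF J.pointwise[OF q]])
        (simp_all add: x_def y_def section_onD(2)[OF e q] section_onD(2)[OF It[OF t] q])
    also have "2 *\<^sub>R \<dots> = (\<Sum>s\<in>Idx. (2 * \<epsilon> s * g q (I' s q x) y) *\<^sub>R I' s q)"
      unfolding scaleR_sum_right by (simp only: scaleR_scaleR mult.assoc)
    also have "\<dots> = \<phi>' (b t)"
      unfolding \<phi>'_def b_def x_def y_def by (rule sum.cong[OF refl]) (simp only: J.eta_bracket[OF _ subset_refl e It[OF t] q])
    finally show ?thesis .
  qed
  \<comment> \<open>As \<eta>_s(b_t) is -2 G for s = t and 0 otherwise, these coefficients make v +
    u horizontal.\<close>
  define u where "u = (\<Sum>t\<in>Idx. (\<eta> t q v / (2 * G)) *\<^sub>R b t)"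
  have ub: "(\<eta> t q v / (2 * G)) *\<^sub>R b t \<in> tangent_space A q" if "t \<in> Idx" for t
    by (rule subspace_scale[OF tangent_subspace bt[OF that]])
  have u: "u \<in> tangent_space A q" unfolding u_def by (rule subspace_sum[OF tangent_subspace ub])
  have "\<eta> s q (v + u) = 0" if s: "s \<in> Idx" for s
  proof -
    have "\<eta> s q u = (\<Sum>t\<in>Idx. \<eta> s q ((\<eta> t q v / (2 * G)) *\<^sub>R b t))"
      unfolding u_def by (rule linear_on_sum[OF eta_linear[OF q s] tangent_subspace ub])
    also have "\<dots> = (\<Sum>t\<in>Idx. if t = s then - \<eta> s q v else 0)"
    proof (rule sum.cong[OF refl])
      fix t assume t: "t \<in> Idx"
      have "\<eta> s q (b t) = (if s = t then - 2 * G else 0)"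
        unfolding b_def eta_bracket[OF s subset_refl e It[OF t] q] P.I_inner[OF s t section_onD(2)[OF e q]]
        by (simp add: G_def)
      then show "\<eta> s q ((\<eta> t q v / (2 * G)) *\<^sub>R b t) = (if t = s then - \<eta> s q v else 0)"
        unfolding linear_onD(2)[OF eta_linear[OF q s] bt[OF t]] using G by simp
    qed
    finally show ?thesis using linear_onD(1)[OF eta_linear[OF q s] v u] s by simp
  qed
  then have vu: "v + u \<in> H q" using H_iff[OF q subspace_add[OF tangent_subspace v u]] by blast
  have "\<phi> u = (\<Sum>t\<in>Idx. \<phi> ((\<eta> t q v / (2 * G)) *\<^sub>R b t))"
    unfolding u_def by (rule linear_on_sum[OF lin(1) tangent_subspace ub])
  also have "\<dots> = (\<Sum>t\<in>Idx. \<phi>' ((\<eta> t q v / (2 * G)) *\<^sub>R b t))"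
    by (rule sum.cong[OF refl]) (simp only: linear_onD(2)[OF lin(1) bt] linear_onD(2)[OF lin(2) bt] br)
  also have "\<dots> = \<phi>' u"
    unfolding u_def by (rule linear_on_sum[OF lin(2) tangent_subspace ub, symmetric])
  finally have uu: "\<phi> u = \<phi>' u" .
  have "\<phi> v + \<phi> u = \<phi>' v + \<phi>' u"
    using H0[OF vu] linear_onD(1)[OF lin(1) v u] linear_onD(1)[OF lin(2) v u] by metis
  then have "\<phi> v = \<phi>' v" unfolding uu by (rule add_right_imp_eq)
  then show ?thesis by (simp only: \<phi>_def \<phi>'_def)
qed

text \<open>The data chosen inside \<open>phi0\<close> may live on a different neighbourhood. On the
  intersection the frame \<open>e\<close> serves both choices, since it depends only on H and
  g.\<close>

lemma phi0_eq:
  assumes q: "q \<in> U" and v: "v \<in> tangent_space A q"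
  shows "phi0 A H g PQ q v = (\<Sum>s\<in>Idx. \<eta> s q v *\<^sub>R I s q)"
proof -
  have "\<exists>J U' \<eta>' I'. q \<in> U' \<and> local_data A H g PQ U' \<eta>' I' \<and> J = (\<Sum>s\<in>Idx. \<eta>' s q v *\<^sub>R I' s q)"
    using data q by blast
  from someI_ex[OF this] obtain U' \<eta>' I' where U': "q \<in> U'" "local_data A H g PQ U' \<eta>' I'"
    and J: "phi0 A H g PQ q v = (\<Sum>s\<in>Idx. \<eta>' s q v *\<^sub>R I' s q)"
    unfolding phi0_def by blast
  have oU': "open U'" using U'(2) unfolding local_data_def one_form_def by blast
  define W where "W = U \<inter> U'"
  have W: "open W" "W \<subseteq> U" "W \<subseteq> U'" "q \<in> W" using openU oU' q U' by (auto simp: W_def)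
  interpret F: pqc_frame A H g PQ n W \<eta> I e by (rule restrict[OF W(1,2)])
  have "pqc_frame A H g PQ n W \<eta>' I' e"
    by standard (rule F.n F.metric local_data_subset[OF U'(2) W(1,3)] F.e_sec F.e_orth F.e_nz F.e_span; assumption)+
  from F.identification_independent[OF this W(4) v] show ?thesis
    unfolding J by (rule sym)
qed

end

section \<open>The defining conditions at a point\<close>

lemma proj_along_eq:
  assumes "subspace S" "subspace T" "S \<inter> T = {0}" "w \<in> S" "v - w \<in> T"
  shows "proj_along S T v = w"
  unfolding proj_along_def
proof (rule the_equality)
  show "w \<in> S \<and> v - w \<in> T" using assms by blast
  fix w' assume "w' \<in> S \<and> v - w' \<in> T"
  then have "w' - w \<in> S" "(v - w) - (v - w') \<in> T"
    using assms subspace_diff by blast+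
  moreover have "(v - w) - (v - w') = w' - w" by (simp add: algebra_simps)
  ultimately have "w' - w \<in> S \<inter> T" by simp
  then show "w' = w" using assms(3) by simp
qed

text \<open>The conditions of the theorem at the single point \<open>p\<close>, with the
  identification replaced by the canonical \<open>phi0\<close>. Only the smoothness of \<nabla>
  cannot be stated pointwise; it is kept apart in \<open>smooth_conn_on\<close>. In this form
  restriction to open subsets and glueing are immediate.\<close>

definition adapted_at ::
  "('m::topological_space, 'e::euclidean_space) atlas \<Rightarrow> ('m \<Rightarrow> 'm tvec set) \<Rightarrow>
   ('m \<Rightarrow> 'm tvec \<Rightarrow> 'm tvec \<Rightarrow> real) \<Rightarrow> ('m \<Rightarrow> ('m tvec \<Rightarrow> 'm tvec) set) \<Rightarrow>
   'm connection \<Rightarrow> ('m \<Rightarrow> 'm tvec set) \<Rightarrow> 'm \<Rightarrow> bool" where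
  "adapted_at A H g PQ D V p \<longleftrightarrow>
     (\<forall>Y. vector_field_near A p Y \<longrightarrow> linear_on (tangent_space A p) (\<lambda>v. D p v Y)) \<and>
     (\<forall>v\<in>tangent_space A p. \<forall>Y Z. vector_field_near A p Y \<and> vector_field_near A p Z \<longrightarrow>
        D p v (Y + Z) = D p v Y + D p v Z) \<and>
     (\<forall>v\<in>tangent_space A p. \<forall>f Y. smooth_fun_near A p f \<and> vector_field_near A p Y \<longrightarrow>
        D p v (\<lambda>q. f q *\<^sub>R Y q) = v f *\<^sub>R Y p + f p *\<^sub>R D p v Y) \<and>
     (\<forall>v Y. v \<notin> tangent_space A p \<or> \<not> vector_field_near A p Y \<longrightarrow> D p v Y = 0) \<and>
     (\<exists>U X. p \<in> U \<and> (\<forall>i<3. vector_field A U (X i)) \<and> (\<forall>q\<in>U. is_basis 3 (V q) (\<lambda>i. X i q))) \<and>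
     H p \<inter> V p = {0} \<and> {x + \<xi> | x \<xi>. x \<in> H p \<and> \<xi> \<in> V p} = tangent_space A p \<and>
     (\<forall>v\<in>tangent_space A p. \<forall>Y. section_near A H p Y \<longrightarrow> D p v Y \<in> H p) \<and>
     (\<forall>v\<in>tangent_space A p. \<forall>Y. section_near A V p Y \<longrightarrow> D p v Y \<in> V p) \<and>
     (\<forall>v\<in>tangent_space A p. \<forall>Y Z. section_near A H p Y \<and> section_near A H p Z \<longrightarrow>
        v (\<lambda>q. g q (Y q) (Z q)) = g p (D p v Y) (Z p) + g p (Y p) (D p v Z)) \<and>
     (\<forall>U \<sigma>. p \<in> U \<and> endo_field A H U \<sigma> \<and> (\<forall>q\<in>U. \<sigma> q \<in> PQ q) \<longrightarrow>
        (\<forall>v\<in>tangent_space A p. \<exists>B\<in>PQ p. has_endo_deriv A D H p v \<sigma> B)) \<and>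
     (\<forall>X Y. section_near A H p X \<and> section_near A H p Y \<longrightarrow>
        torsion A D X Y p = - proj_along (V p) (H p) (lie_bracket A X Y p)) \<and>
     (\<forall>\<xi>. section_near A V p \<xi> \<longrightarrow>
        (\<exists>B \<in> sp_n_sp_1_perp (g p) (PQ p) (H p).
           represents A H p (\<lambda>X. proj_along (H p) (V p) (torsion A D \<xi> X p)) B)) \<and>
     (\<forall>v\<in>tangent_space A p. \<forall>\<zeta>. section_near A V p \<zeta> \<longrightarrow>
        has_endo_deriv A D H p v (\<lambda>q. phi0 A H g PQ q (\<zeta> q)) (phi0 A H g PQ p (D p v \<zeta>)))"

definition smooth_conn_on ::
  "('m::topological_space, 'e::euclidean_space) atlas \<Rightarrow> 'm set \<Rightarrow> 'm connection \<Rightarrow> bool" where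
  "smooth_conn_on A U D \<longleftrightarrow> (\<forall>W X Y. W \<subseteq> U \<and> vector_field A W X \<and> vector_field A W Y \<longrightarrow>
     vector_field A W (\<lambda>p. D p (X p) Y))"

lemma adapted_atD:
  assumes "adapted_at A H g PQ D V p"
  shows "vector_field_near A p Y \<Longrightarrow> linear_on (tangent_space A p) (\<lambda>v. D p v Y)"
    "v \<in> tangent_space A p \<Longrightarrow> vector_field_near A p Y \<Longrightarrow> vector_field_near A p Z \<Longrightarrow>
      D p v (Y + Z) = D p v Y + D p v Z"
    "v \<in> tangent_space A p \<Longrightarrow> smooth_fun_near A p f \<Longrightarrow> vector_field_near A p Y \<Longrightarrow>
      D p v (\<lambda>q. f q *\<^sub>R Y q) = v f *\<^sub>R Y p + f p *\<^sub>R D p v Y"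
    "v \<notin> tangent_space A p \<or> \<not> vector_field_near A p Y \<Longrightarrow> D p v Y = 0"
    "\<exists>U X. p \<in> U \<and> (\<forall>i<3. vector_field A U (X i)) \<and> (\<forall>q\<in>U. is_basis 3 (V q) (\<lambda>i. X i q))"
    "H p \<inter> V p = {0}" "{x + \<xi> | x \<xi>. x \<in> H p \<and> \<xi> \<in> V p} = tangent_space A p"
    "v \<in> tangent_space A p \<Longrightarrow> section_near A H p Y \<Longrightarrow> D p v Y \<in> H p"
    "v \<in> tangent_space A p \<Longrightarrow> section_near A V p Y \<Longrightarrow> D p v Y \<in> V p"
    "v \<in> tangent_space A p \<Longrightarrow> section_near A H p Y \<Longrightarrow> section_near A H p Z \<Longrightarrow>
      v (\<lambda>q. g q (Y q) (Z q)) = g p (D p v Y) (Z p) + g p (Y p) (D p v Z)"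
    "p \<in> U \<Longrightarrow> endo_field A H U \<sigma> \<Longrightarrow> \<forall>q\<in>U. \<sigma> q \<in> PQ q \<Longrightarrow> v \<in> tangent_space A p \<Longrightarrow>
      \<exists>B\<in>PQ p. has_endo_deriv A D H p v \<sigma> B"
    "section_near A H p X \<Longrightarrow> section_near A H p Y \<Longrightarrow>
      torsion A D X Y p = - proj_along (V p) (H p) (lie_bracket A X Y p)"
    "section_near A V p \<xi> \<Longrightarrow> \<exists>B \<in> sp_n_sp_1_perp (g p) (PQ p) (H p).
      represents A H p (\<lambda>X. proj_along (H p) (V p) (torsion A D \<xi> X p)) B"
    "v \<in> tangent_space A p \<Longrightarrow> section_near A V p \<zeta> \<Longrightarrow>
      has_endo_deriv A D H p v (\<lambda>q. phi0 A H g PQ q (\<zeta> q)) (phi0 A H g PQ p (D p v \<zeta>))"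
  using assms unfolding adapted_at_def by simp_all

lemma section_nearI: "section_on A E W X \<Longrightarrow> p \<in> W \<Longrightarrow> section_near A E p X"
  by (auto simp: section_near_def)

lemma vector_field_nearI: "vector_field A W X \<Longrightarrow> p \<in> W \<Longrightarrow> vector_field_near A p X"
  by (auto simp: vector_field_near_def)

section \<open>Uniqueness\<close>

locale adapted = pqc_frame +
  fixes D :: "'a connection" and V :: "'a \<Rightarrow> 'a tvec set"
  assumes adapted: "q \<in> U \<Longrightarrow> adapted_at A H g PQ D V q"
    and smooth: "smooth_conn_on A U D"
begin

lemma V_subspace: "q \<in> U \<Longrightarrow> subspace (V q)"
proof -
  assume "q \<in> U"
  then obtain W X where "q \<in> W" "\<forall>q\<in>W. is_basis 3 (V q) (\<lambda>i. X i q)"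
    using adapted_atD(5)[OF adapted] by blast
  then have "V q = span ((\<lambda>i. X i q) ` {..<3})" by (simp add: is_basis_def)
  then show ?thesis using subspace_span by simp
qed

lemma HV: "q \<in> U \<Longrightarrow> H q \<inter> V q = {0}" "q \<in> U \<Longrightarrow> V q \<inter> H q = {0}"
  using adapted_atD(6)[OF adapted] by blast+

lemma V_tangent: "q \<in> U \<Longrightarrow> x \<in> V q \<Longrightarrow> x \<in> tangent_space A q"
proof -
  assume q: "q \<in> U" and x: "x \<in> V q"
  have "0 + x \<in> {x + \<xi> | x \<xi>. x \<in> H q \<and> \<xi> \<in> V q}"
    using x subspace_0[OF H_subspace[OF q]] by blast
  then show ?thesis using adapted_atD(7)[OF adapted[OF q]] by simp
qed

definition DD :: "('a \<Rightarrow> 'a tvec) \<Rightarrow> ('a \<Rightarrow> 'a tvec) \<Rightarrow> 'a \<Rightarrow> 'a tvec" where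
  "DD X Y q = D q (X q) Y"

text \<open>The V-component of [X, Y], expressed through the torsion by condition (ii), so that its
  smoothness follows from that of the connection.\<close>

definition bV :: "('a \<Rightarrow> 'a tvec) \<Rightarrow> ('a \<Rightarrow> 'a tvec) \<Rightarrow> 'a \<Rightarrow> 'a tvec" where
  "bV X Y q = lie_bracket A X Y q - (DD X Y q - DD Y X q)"

lemma DD_sec: "section_on A H U X \<Longrightarrow> section_on A H U Y \<Longrightarrow> section_on A H U (DD X Y)"
proof (rule section_onI)
  assume X: "section_on A H U X" and Y: "section_on A H U Y"
  show "vector_field A U (DD X Y)"
    unfolding DD_def[abs_def] using smooth section_onD(1)[OF X] section_onD(1)[OF Y]
    unfolding smooth_conn_on_def by blast
  show "DD X Y q \<in> H q" if q: "q \<in> U" for q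
    unfolding DD_def
    by (rule adapted_atD(8)[OF adapted[OF q] vf_tangent[OF section_onD(1)[OF X] q] section_nearI[OF Y q]])
qed

lemma bV_vf:
  assumes X: "section_on A H U X" and Y: "section_on A H U Y"
  shows "vector_field A U (bV X Y)" "q \<in> U \<Longrightarrow> bV X Y q \<in> V q"
proof -
  show "vector_field A U (bV X Y)"
    unfolding bV_def[abs_def]
    by (intro vf_diff vf_bracket section_onD(1)[OF X] section_onD(1)[OF Y] section_onD(1)[OF DD_sec] X Y)
  assume q: "q \<in> U"
  have "torsion A D X Y q = - proj_along (V q) (H q) (lie_bracket A X Y q)"
    by (rule adapted_atD(12)[OF adapted[OF q] section_nearI[OF X q] section_nearI[OF Y q]])
  then have b: "bV X Y q = proj_along (V q) (H q) (lie_bracket A X Y q)"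
    by (simp add: torsion_def bV_def DD_def algebra_simps)
  obtain x y where xy: "lie_bracket A X Y q = x + y" "x \<in> H q" "y \<in> V q"
    using bracket_tangent[OF section_onD(1)[OF X] section_onD(1)[OF Y] q] adapted_atD(7)[OF adapted[OF q]] by blast
  have "proj_along (V q) (H q) (lie_bracket A X Y q) = y"
    using xy by (intro proj_along_eq[OF V_subspace[OF q] H_subspace[OF q] HV(2)[OF q]]) simp_all
  then show "bV X Y q \<in> V q" using b xy by simp
qed

text \<open>The bracket construction of a dual frame, with the V-component in place of the bracket
  itself. The horizontal correction does not change the values of \<eta>_s, and the result lies in
  V.\<close>

lemma adapted_dual: "\<exists>\<xi>. pqc_dual A H g PQ n U \<eta> I e \<xi> \<and> (\<forall>s\<in>Idx. \<forall>q\<in>U. \<xi> s q \<in> V q)"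
proof -
  define G where "G q = g q (e 0 q) (e 0 q)" for q
  define \<xi> where "\<xi> t q = (- 1 / (2 * G q)) *\<^sub>R bV (e 0) (\<lambda>q. I t q (e 0 q)) q" for t q
  have G: "G q \<noteq> 0" if "q \<in> U" for q
    using e_nz[OF that, of 0] n by (auto simp: G_def)
  have e: "section_on A H U (e 0)" using e_sec[of 0] n by simp
  have Gs: "smooth_fun A U G" unfolding G_def[abs_def] by (rule g_smooth[OF e e])
  have It: "section_on A H U (\<lambda>q. I t q (e 0 q))" if "t \<in> Idx" for t by (rule sec_I[OF that subset_refl e])
  have "pqc_dual A H g PQ n U \<eta> I e \<xi>"
  proof
    fix t assume t: "t \<in> Idx"
    have "smooth_fun A U (\<lambda>q. - 1 / (2 * G q))"
      by (intro smooth_fun_divide smooth_fun_const openU smooth_fun_cmult Gs) (use G in simp)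
    then show "vector_field A U (\<xi> t)" unfolding \<xi>_def[abs_def] by (rule vf_scale[OF _ bV_vf(1)[OF e It[OF t]]])
    fix q s assume q: "q \<in> U" and s: "s \<in> Idx"
    interpret P: pq_endo "H q" "g q" "4 * n" "\<lambda>a. e a q" "\<lambda>s. I s q" "PQ q" "e0 q"
      by (rule pointwise[OF q])
    note b = bracket_tangent[OF section_onD(1)[OF e] section_onD(1)[OF It[OF t]] q]
    define d where "d = DD (e 0) (\<lambda>q. I t q (e 0 q)) q - DD (\<lambda>q. I t q (e 0 q)) (e 0) q"
    have d: "d \<in> H q" unfolding d_def
      by (intro P.S_closed(5) section_onD(2)[OF DD_sec q] e It t)
    have "\<eta> s q (\<xi> t q) = (- 1 / (2 * G q)) * \<eta> s q (bV (e 0) (\<lambda>q. I t q (e 0 q)) q)"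
      unfolding \<xi>_def by (simp only: linear_onD(2)[OF eta_linear[OF q s] vf_tangent[OF bV_vf(1)[OF e It[OF t]] q]] real_scaleR_def)
    also have "\<eta> s q (bV (e 0) (\<lambda>q. I t q (e 0 q)) q) = \<eta> s q (lie_bracket A (e 0) (\<lambda>q. I t q (e 0 q)) q)"
      unfolding bV_def d_def[symmetric] linear_on_diff[OF eta_linear[OF q s] tangent_subspace b H_tangent[OF q d]]
        eta_H[OF q s d] by simp
    also have "(- 1 / (2 * G q)) * \<dots> = (- 1 / (2 * G q)) * (2 * \<epsilon> s * g q (I s q (e 0 q)) (I t q (e 0 q)))"
      unfolding eta_bracket[OF s subset_refl e It[OF t] q] ..
    also have "\<dots> = (if s = t then 1 else 0)"
      unfolding P.I_inner[OF s t section_onD(2)[OF e q]] using G[OF q] by (simp add: G_def)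
    finally show "\<eta> s q (\<xi> t q) = (if s = t then 1 else 0)" .
  qed
  moreover have "\<xi> s q \<in> V q" if "s \<in> Idx" "q \<in> U" for s q
    unfolding \<xi>_def by (intro subspace_scale[OF V_subspace[OF that(2)]] bV_vf(2) e It that)
  ultimately show ?thesis by blast
qed

end

lemma diff_swap:
  fixes a b c d :: "'b::ab_group_add"
  assumes "a - b = c - d"
  shows "a - c = b - d"
proof -
  have "a = c - d + b" using assms by (simp add: diff_eq_eq)
  then show ?thesis by simp
qed

text \<open>Paired with Z, the difference of two such connections is symmetric in X, Y by the
  torsion condition and skew in Y, Z by metricity, hence zero. The hypothesis on \<xi>' at
  \<open>q\<close> makes the two horizontal projections there equal.\<close>

lemma (in hconn) horizontal_unique:
  assumes "hconn A H g PQ n U \<eta> I e \<xi>' D'" and \<xi>': "\<And>s. s \<in> Idx \<Longrightarrow> \<xi>' s q = \<xi> s q"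
    and q: "q \<in> U" and X: "section_on A H U X" and Y: "section_on A H U Y"
  shows "D X Y q = D' X Y q"
proof -
  interpret D': hconn A H g PQ n U \<eta> I e \<xi>' D' by fact
  interpret P: pq_endo "H q" "g q" "4 * n" "\<lambda>a. e a q" "\<lambda>s. I s q" "PQ q" "e0 q"
    by (rule pointwise[OF q])
  have pr: "D'.prH q v = prH q v" for v
    unfolding D'.prH_def prH_def D'.prV_def prV_def by (simp only: \<xi>' cong: sum.cong)
  have swap: "D X Y q - D' X Y q = D Y X q - D' Y X q" if "section_on A H U X" "section_on A H U Y" for X Y
  proof -
    have "D X Y q - D Y X q = D' X Y q - D' Y X q"
      using D_tors[OF that q] D'.D_tors[OF that q] unfolding pr by (rule trans[OF _ sym])
    then show ?thesis by (rule diff_swap)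
  qed
  define c where "c X Y Z = g q (D X Y q) (Z q) - g q (D' X Y q) (Z q)" for X Y Z
  have in1: "D X Y q \<in> H q" "D' X Y q \<in> H q" if "section_on A H U X" "section_on A H U Y" for X Y
    using D_in[OF that q] D'.D_in[OF that q] by auto
  have c1: "c X Y Z = c Y X Z" if S: "section_on A H U X" "section_on A H U Y" "section_on A H U Z" for X Y Z
  proof -
    note z = section_onD(2)[OF S(3) q]
    have "g q (D X Y q - D' X Y q) (Z q) = g q (D Y X q - D' Y X q) (Z q)"
      by (simp only: swap[OF S(1,2)])
    then show ?thesis
      unfolding c_def P.g_left(4)[OF z in1[OF S(1,2)]] P.g_left(4)[OF z in1[OF S(2,1)]] .
  qed
  have c2: "c X Y Z = - c X Z Y" if S: "section_on A H U X" "section_on A H U Y" "section_on A H U Z" for X Y Z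
    using D_metric[OF S q] D'.D_metric[OF S q] P.g_sym[OF section_onD(2)[OF S(2) q] in1(1)[OF S(1,3)]]
      P.g_sym[OF section_onD(2)[OF S(2) q] in1(2)[OF S(1,3)]]
    by (simp add: c_def)
  show ?thesis
  proof (rule sec_nondeg[OF q in1[OF X Y]])
    fix Z assume Z: "section_on A H U Z"
    have "c X Y Z = 0"
      using c2[OF X Y Z] c1[OF X Z Y] c2[OF Z X Y] c1[OF Z Y X] c2[OF Y Z X] c1[OF Y X Z] by linarith
    then show "g q (D X Y q) (Z q) = g q (D' X Y q) (Z q)" by (simp add: c_def)
  qed
qed

section \<open>Adapted connections relative to a dual frame of their complement\<close>

locale adapted_frame = pqc_dual A H g PQ n U \<eta> I e \<xi> + adapted A H g PQ n U \<eta> I e D V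
  for A :: "('m::{t2_space,second_countable_topology}, 'e::euclidean_space) atlas"
    and H g PQ n U \<eta> I e \<xi> D V +
  assumes xi_V: "s \<in> Idx \<Longrightarrow> q \<in> U \<Longrightarrow> \<xi> s q \<in> V q"
begin

lemma prV_V: "q \<in> U \<Longrightarrow> prV q v \<in> V q"
  unfolding prV_def by (intro subspace_sum[OF V_subspace] subspace_scale[OF V_subspace] xi_V)

lemma prV_id:
  assumes q: "q \<in> U" and v: "v \<in> V q"
  shows "prV q v = v"
proof -
  have "prH q v \<in> H q" by (rule prH_in[OF q V_tangent[OF q v]])
  moreover have "prH q v \<in> V q"
    unfolding prH_def by (rule subspace_diff[OF V_subspace[OF q] v prV_V[OF q]])
  ultimately have "prH q v = 0" using HV(1)[OF q] by blast
  then show ?thesis by (simp add: prH_def)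
qed

lemma prH_V: "q \<in> U \<Longrightarrow> v \<in> V q \<Longrightarrow> prH q v = 0"
  by (simp add: prH_def prV_id)

lemma V_eq: "q \<in> U \<Longrightarrow> V q = prV q ` tangent_space A q"
  using prV_V prV_id V_tangent by force

lemma proj_eq:
  assumes q: "q \<in> U" and v: "v \<in> tangent_space A q"
  shows "proj_along (H q) (V q) v = prH q v" "proj_along (V q) (H q) v = prV q v"
  by (rule proj_along_eq[OF H_subspace[OF q] V_subspace[OF q] HV(1)[OF q] prH_in[OF q v]])
    (simp add: prH_def prV_V[OF q],
     rule proj_along_eq[OF V_subspace[OF q] H_subspace[OF q] HV(2)[OF q] prV_V[OF q]],
     use prH_in[OF q v] in \<open>simp add: prH_def\<close>)

lemma DD_hconn: "hconn A H g PQ n U \<eta> I e \<xi> DD"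
proof
  show "section_on A H U (DD X Y)" if "section_on A H U X" "section_on A H U Y" for X Y
    by (rule DD_sec[OF that])
next
  fix X X' Y q assume S: "section_on A H U X" "section_on A H U X'" "section_on A H U Y" and q: "q \<in> U"
  show "DD (\<lambda>q. X q + X' q) Y q = DD X Y q + DD X' Y q"
    unfolding DD_def
    by (rule linear_onD(1)[OF adapted_atD(1)[OF adapted[OF q] vector_field_nearI[OF section_onD(1)[OF S(3)] q]]
          vf_tangent[OF section_onD(1)[OF S(1)] q] vf_tangent[OF section_onD(1)[OF S(2)] q]])
next
  fix f X Y q assume f: "smooth_fun A U f" and S: "section_on A H U X" "section_on A H U Y" and q: "q \<in> U"
  show "DD (\<lambda>q. f q *\<^sub>R X q) Y q = f q *\<^sub>R DD X Y q"
    unfolding DD_def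
    by (rule linear_onD(2)[OF adapted_atD(1)[OF adapted[OF q] vector_field_nearI[OF section_onD(1)[OF S(2)] q]]
          vf_tangent[OF section_onD(1)[OF S(1)] q]])
  show "DD X (\<lambda>q. f q *\<^sub>R Y q) q = X q f *\<^sub>R Y q + f q *\<^sub>R DD X Y q"
    unfolding DD_def
    by (rule adapted_atD(3)[OF adapted[OF q] vf_tangent[OF section_onD(1)[OF S(1)] q] smooth_fun_nearI[OF f q]
          vector_field_nearI[OF section_onD(1)[OF S(2)] q]])
next
  fix X Y Y' q assume S: "section_on A H U X" "section_on A H U Y" "section_on A H U Y'" and q: "q \<in> U"
  show "DD X (\<lambda>q. Y q + Y' q) q = DD X Y q + DD X Y' q"
    using adapted_atD(2)[OF adapted[OF q] vf_tangent[OF section_onD(1)[OF S(1)] q]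
        vector_field_nearI[OF section_onD(1)[OF S(2)] q] vector_field_nearI[OF section_onD(1)[OF S(3)] q]]
    unfolding DD_def plus_fun_def[of Y Y'] .
next
  fix X Y q assume S: "section_on A H U X" "section_on A H U Y" and q: "q \<in> U"
  have "torsion A D X Y q = - prV q (lie_bracket A X Y q)"
    unfolding adapted_atD(12)[OF adapted[OF q] section_nearI[OF S(1) q] section_nearI[OF S(2) q]]
      proj_eq(2)[OF q bracket_tangent[OF section_onD(1)[OF S(1)] section_onD(1)[OF S(2)] q]] ..
  then show "DD X Y q - DD Y X q = prH q (lie_bracket A X Y q)"
    unfolding torsion_def DD_def prH_def by (simp only: diff_eq_eq) (simp add: algebra_simps)
next
  fix X Y Z q assume S: "section_on A H U X" "section_on A H U Y" "section_on A H U Z" and q: "q \<in> U"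
  show "X q (\<lambda>r. g r (Y r) (Z r)) = g q (DD X Y q) (Z q) + g q (Y q) (DD X Z q)"
    unfolding DD_def
    by (rule adapted_atD(10)[OF adapted[OF q] vf_tangent[OF section_onD(1)[OF S(1)] q]
          section_nearI[OF S(2) q] section_nearI[OF S(3) q]])
qed

lemma preserves_I:
  assumes q: "q \<in> U" and s: "s \<in> Idx" and v: "v \<in> tangent_space A q"
  shows "\<exists>c. \<forall>Y. section_on A H U Y \<longrightarrow>
    D q v (\<lambda>r. I s r (Y r)) - I s q (D q v Y) = (\<Sum>t\<in>Idx. c t *\<^sub>R I t q (Y q))"
proof -
  interpret P: pq_endo "H q" "g q" "4 * n" "\<lambda>a. e a q" "\<lambda>s. I s q" "PQ q" "e0 q"
    by (rule pointwise[OF q])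
  have "\<forall>r\<in>U. I s r \<in> PQ r"
    using s unfolding Idx_def by (auto simp: data_pointwise(2) span_base)
  from adapted_atD(11)[OF adapted[OF q] q endo_I[OF s] this v]
  obtain B where B: "B \<in> PQ q" "has_endo_deriv A D H q v (I s) B" by blast
  obtain c where c: "\<And>x. B x = (\<Sum>t\<in>Idx. c t *\<^sub>R I t q x)" using P.Q_apply[OF B(1)] by blast
  have "D q v (\<lambda>r. I s r (Y r)) - I s q (D q v Y) = B (Y q)" if "section_on A H U Y" for Y
    using B(2) section_nearI[OF that q] unfolding has_endo_deriv_def represents_def by blast
  then show ?thesis unfolding c by blast
qed

lemma reeb:
  assumes q: "q \<in> U" and s: "s \<in> Idx" and x: "x \<in> H q"
  shows "af s s q x = 0"
proof -
  interpret C: hconn A H g PQ n U \<eta> I e \<xi> DD by (rule DD_hconn)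
  show ?thesis
  proof (rule C.preserving_imp_reeb[OF q _ s x])
    fix s x assume s: "s \<in> Idx" and x: "x \<in> H q"
    obtain c where c: "\<And>Y. section_on A H U Y \<Longrightarrow>
        D q x (\<lambda>r. I s r (Y r)) - I s q (D q x Y) = (\<Sum>t\<in>Idx. c t *\<^sub>R I t q (Y q))"
      using preserves_I[OF q s H_tangent[OF q x]] by blast
    have "C.T q s x y = (\<Sum>t\<in>Idx. c t *\<^sub>R I t q y)" if y: "y \<in> H q" for y
      using c[OF ext_sec[of q y]] unfolding C.T_def C.Nt_def DD_def ext_eq[OF q x] ext_eq[OF q y] .
    then show "\<exists>c. \<forall>y\<in>H q. C.T q s x y = (\<Sum>t\<in>Idx. c t *\<^sub>R I t q y)" by blast
  qed
qed

text \<open>In T(\<xi>_t, X) the term \<nabla>_X \<xi>_t stays in V and disappears under the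
  horizontal projection, so condition (iii) concerns \<nabla>_\<xi> X - [\<xi>, X]_H alone.\<close>

lemma vertical_torsion:
  assumes q: "q \<in> U" and t: "t \<in> Idx"
  shows "\<exists>B\<in>sp_n_sp_1_perp (g q) (PQ q) (H q).
    \<forall>X. section_on A H U X \<longrightarrow> B (X q) = D q (\<xi> t q) X - prH q (lie_bracket A (\<xi> t) X q)"
proof -
  have xs: "section_near A V q (\<xi> t)" by (rule section_nearI[OF section_onI[OF xi[OF t] xi_V[OF t]] q])
  obtain B where B: "B \<in> sp_n_sp_1_perp (g q) (PQ q) (H q)"
    and rep: "represents A H q (\<lambda>X. proj_along (H q) (V q) (torsion A D (\<xi> t) X q)) B"
    using adapted_atD(13)[OF adapted[OF q] xs] by blast
  have "B (X q) = D q (\<xi> t q) X - prH q (lie_bracket A (\<xi> t) X q)" if X: "section_on A H U X" for X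
  proof -
    note Xt = vf_tangent[OF section_onD(1)[OF X] q] and b = bracket_tangent[OF xi[OF t] section_onD(1)[OF X] q]
    have h: "D q (\<xi> t q) X \<in> H q"
      by (rule adapted_atD(8)[OF adapted[OF q] xi_tangent[OF q t] section_nearI[OF X q]])
    have k: "D q (X q) (\<xi> t) \<in> V q" by (rule adapted_atD(9)[OF adapted[OF q] Xt xs])
    note tg = H_tangent[OF q h] V_tangent[OF q k]
    note L = linear_on_diff[OF prH_linear[OF q] tangent_subspace]
    have "B (X q) = proj_along (H q) (V q) (torsion A D (\<xi> t) X q)"
      using rep section_nearI[OF X q] unfolding represents_def by metis
    also have "\<dots> = prH q (torsion A D (\<xi> t) X q)"
      unfolding torsion_def by (rule proj_eq(1)[OF q]) (intro subspace_diff[OF tangent_subspace] tg b)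
    also have "\<dots> = D q (\<xi> t q) X - prH q (lie_bracket A (\<xi> t) X q)"
      unfolding torsion_def L[OF subspace_diff[OF tangent_subspace tg] b] L[OF tg] prH_id[OF q h] prH_V[OF q k]
      by simp
    finally show ?thesis .
  qed
  then show ?thesis using B by blast
qed

end

lemma (in adapted_frame) unique:
  assumes "adapted_frame A H g PQ n U \<eta> I e \<xi>' D' V'" and q: "q \<in> U"
  shows "V q = V' q" "vector_field A U Y \<Longrightarrow> v \<in> tangent_space A q \<Longrightarrow> D q v Y = D' q v Y"
proof -
  interpret J: adapted_frame A H g PQ n U \<eta> I e \<xi>' D' V' by fact
  \<comment> \<open>The difference r of the two dual vectors is horizontal, and subtracting the two
    Reeb conditions gives \<eta>_t([r, e_a]) = 2 \<epsilon>_t g(I_t r, e_a) = 0 for every a. Hence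
    I_t r = 0 and r = 0.\<close>
  have xi_eq: "\<xi> t q = \<xi>' t q" if t: "t \<in> Idx" and q: "q \<in> U" for t q
  proof -
    interpret P: pq_endo "H q" "g q" "4 * n" "\<lambda>a. e a q" "\<lambda>s. I s q" "PQ q" "e0 q"
      by (rule pointwise[OF q])
    define r where "r = (\<lambda>q. \<xi> t q - \<xi>' t q)"
    have rv: "vector_field A U r" unfolding r_def by (rule vf_diff[OF xi[OF t] J.xi[OF t]])
    have r: "section_on A H U r"
    proof (rule section_onI[OF rv])
      fix p assume p: "p \<in> U"
      have "\<eta> s p (r p) = 0" if s: "s \<in> Idx" for s
        unfolding r_def linear_on_diff[OF eta_linear[OF p s] tangent_subspace xi_tangent[OF p t] J.xi_tangent[OF p t]]
          dual[OF p s t] J.dual[OF p s t] by simp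
      then show "r p \<in> H p" using H_iff[OF p vf_tangent[OF rv p]] by blast
    qed
    note Ir = P.I_in[OF t section_onD(2)[OF r q]]
    have "I t q (r q) = 0"
    proof (rule P.nondeg[OF Ir])
      fix a assume a: "a < 4 * n"
      note ea = e_sec[OF a]
      have z: "\<eta> t q (lie_bracket A (\<xi> t) (e a) q) = 0" "\<eta> t q (lie_bracket A (\<xi>' t) (e a) q) = 0"
        using af_eq[OF subset_refl ea q t t] reeb[OF q t section_onD(2)[OF ea q]]
          J.af_eq[OF subset_refl ea q t t] J.reeb[OF q t section_onD(2)[OF ea q]] by simp_all
      have "lie_bracket A (\<xi> t) (e a) q = lie_bracket A (\<lambda>q. r q + \<xi>' t q) (e a) q"
        by (simp add: r_def)
      also have "\<dots> = lie_bracket A r (e a) q + lie_bracket A (\<xi>' t) (e a) q"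
        by (rule bracket_add_left[OF rv J.xi[OF t] section_onD(1)[OF ea] q])
      finally have br: "lie_bracket A (\<xi> t) (e a) q = lie_bracket A r (e a) q + lie_bracket A (\<xi>' t) (e a) q" .
      have "\<eta> t q (lie_bracket A r (e a) q) = 0"
        using z unfolding br linear_onD(1)[OF eta_linear[OF q t] bracket_tangent[OF rv section_onD(1)[OF ea] q]
            bracket_tangent[OF J.xi[OF t] section_onD(1)[OF ea] q]] by simp
      then show "g q (I t q (r q)) (e a q) = 0"
        unfolding eta_bracket[OF t subset_refl r ea q] by simp
    qed
    then have "\<epsilon> t *\<^sub>R r q = 0"
      using P.I_sq[OF t section_onD(2)[OF r q]] linear_on_zero[OF P.I_lin[OF t] P.S] by metis
    then have "r q = 0" by (simp only: scaleR_eq_0_iff eps_nz simp_thms)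
    then show ?thesis by (simp add: r_def)
  qed
  have prV_eq: "J.prV p v = prV p v" if "p \<in> U" for p v
    unfolding J.prV_def prV_def by (simp only: xi_eq[OF _ that] cong: sum.cong)
  have prH_eq: "J.prH p v = prH p v" if "p \<in> U" for p v
    unfolding J.prH_def prH_def prV_eq[OF that] ..
  have V_eq': "V p = V' p" if p: "p \<in> U" for p
    unfolding V_eq[OF p] J.V_eq[OF p] prV_eq[OF p] ..
  show "V q = V' q" by (rule V_eq'[OF q])
  interpret P: pq_endo "H q" "g q" "4 * n" "\<lambda>a. e a q" "\<lambda>s. I s q" "PQ q" "e0 q"
    by (rule pointwise[OF q])
  note ad = adapted[OF q] and ad' = J.adapted[OF q]
  have hor: "D q x X = D' q x X" if x: "x \<in> H q" and X: "section_on A H U X" for x X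
  proof -
    interpret C: hconn A H g PQ n U \<eta> I e \<xi> DD by (rule DD_hconn)
    have "DD (ext q x) X q = J.DD (ext q x) X q"
      by (rule C.horizontal_unique[OF J.DD_hconn _ q ext_sec X]) (rule xi_eq[OF _ q, symmetric])
    then show ?thesis unfolding DD_def J.DD_def ext_eq[OF q x] .
  qed
  have ver: "D q (\<xi> t q) X = D' q (\<xi> t q) X" if t: "t \<in> Idx" and X: "section_on A H U X" for t X
  proof -
    define v where "v = \<xi> t q"
    have v: "v \<in> tangent_space A q" unfolding v_def by (rule xi_tangent[OF q t])
    obtain B where B: "B \<in> sp_n_sp_1_perp (g q) (PQ q) (H q)"
      and BX: "\<And>X. section_on A H U X \<Longrightarrow> B (X q) = D q v X - prH q (lie_bracket A (\<xi> t) X q)"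
      using vertical_torsion[OF q t] unfolding v_def by blast
    obtain B' where B': "B' \<in> sp_n_sp_1_perp (g q) (PQ q) (H q)"
      and BX': "\<And>X. section_on A H U X \<Longrightarrow> B' (X q) = D' q v X - prH q (lie_bracket A (\<xi>' t) X q)"
      using J.vertical_torsion[OF q t] unfolding v_def xi_eq[OF t q] prH_eq[OF q] by blast
    note Bp = P.perpD[OF B] and Bp' = P.perpD[OF B']
    note lB = P.lin_endo_endos[OF Bp(1)] and lB' = P.lin_endo_endos[OF Bp'(1)]
    \<comment> \<open>F is the difference of the two derivatives along \<xi>_t, as the brackets
      cancel. It is skew since both are metric, normalizes PQ since both preserve PQ, and lies in
      the orthogonal complement as a difference of two of its elements;
      \<open>perp_normalizer_zero\<close> then makes it vanish.\<close>
    define F where "F = B + (- 1) *\<^sub>R B'"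
    have F: "F y = B y - B' y" for y by (simp add: F_def)
    have FX: "F (X q) = D q v X - D' q v X" if X: "section_on A H U X" for X
    proof -
      have "lie_bracket A (\<xi> t) X q = lie_bracket A (\<xi>' t) X q"
        by (rule bracket_cong[OF xi[OF t] section_onD(1)[OF X] q xi_eq[OF t]]) simp_all
      then show ?thesis unfolding F BX[OF X] BX'[OF X] by simp
    qed
    have Fe: "F \<in> endos (H q)" unfolding F_def by (intro P.endos_lin_comb Bp(1) Bp'(1))
    note lF = P.lin_endo_endos[OF Fe]
    have trF: "P.tr F C = P.tr B C - P.tr B' C" if C: "P.lin_endo C" for C
    proof -
      have "P.tr C F = P.tr C (\<lambda>x. B x + (- 1) *\<^sub>R B' x)" by (rule P.tr_cong) (simp_all add: F)
      also have "\<dots> = P.tr C B + (- 1) * P.tr C B'"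
        unfolding P.tr_add[OF C lB P.lin_endo_lin_comb(2)[OF lB']] P.tr_scale[OF C lB'] ..
      finally show ?thesis
        using P.tr_sym[OF lF C] P.tr_sym[OF lB C] P.tr_sym[OF lB' C] by simp
    qed
    have Fp: "F \<in> sp_n_sp_1_perp (g q) (PQ q) (H q)"
      by (rule P.perpI[OF Fe])
        (simp_all add: trF[OF P.lin_endo_I] trF[OF P.lin_endo_endos[OF P.sp_nD(1)]] Bp Bp')
    have Fext: "F y = D q v (ext q y) - D' q v (ext q y)" if "y \<in> H q" for y
      using FX[OF ext_sec[of q y]] ext_eq[OF q that] by simp
    have Din: "D q v Y \<in> H q" "D' q v Y \<in> H q" if "section_on A H U Y" for Y
      using adapted_atD(8)[OF ad v section_nearI[OF that q]] adapted_atD(8)[OF ad' v section_nearI[OF that q]] by auto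
    have "F x = 0" if x: "x \<in> H q" for x
    proof -
      have skew: "g q (F x) y = - g q x (F y)" if x: "x \<in> H q" and y: "y \<in> H q" for x y
      proof -
        note sx = section_nearI[OF ext_sec[of q x] q] and sy = section_nearI[OF ext_sec[of q y] q]
        have "g q (D q v (ext q x)) y + g q x (D q v (ext q y)) = g q (D' q v (ext q x)) y + g q x (D' q v (ext q y))"
          using adapted_atD(10)[OF ad v sx sy] adapted_atD(10)[OF ad' v sx sy]
          unfolding ext_eq[OF q x] ext_eq[OF q y] by simp
        then show ?thesis
          unfolding Fext[OF x] Fext[OF y] P.g_left(4)[OF y Din[OF ext_sec]] P.g_right(4)[OF x Din[OF ext_sec]]
          by simp
      qed
      have "\<forall>s\<in>Idx. \<exists>c. \<forall>Y. section_on A H U Y \<longrightarrow>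
          D q v (\<lambda>r. I s r (Y r)) - I s q (D q v Y) = (\<Sum>t\<in>Idx. c t *\<^sub>R I t q (Y q))"
        by (rule ballI) (rule preserves_I[OF q _ v])
      from bchoice[OF this] obtain c where c0: "\<forall>s\<in>Idx. \<forall>Y. section_on A H U Y \<longrightarrow>
          D q v (\<lambda>r. I s r (Y r)) - I s q (D q v Y) = (\<Sum>t\<in>Idx. c s t *\<^sub>R I t q (Y q))" by (rule exE)
      have "\<forall>s\<in>Idx. \<exists>c. \<forall>Y. section_on A H U Y \<longrightarrow>
          D' q v (\<lambda>r. I s r (Y r)) - I s q (D' q v Y) = (\<Sum>t\<in>Idx. c t *\<^sub>R I t q (Y q))"
        by (rule ballI) (rule J.preserves_I[OF q _ v])
      from bchoice[OF this] obtain c' where c0': "\<forall>s\<in>Idx. \<forall>Y. section_on A H U Y \<longrightarrow>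
          D' q v (\<lambda>r. I s r (Y r)) - I s q (D' q v Y) = (\<Sum>t\<in>Idx. c' s t *\<^sub>R I t q (Y q))" by (rule exE)
      note c = c0[rule_format] and c' = c0'[rule_format]
      have norm: "F (I s q y) - I s q (F y) = (\<Sum>t\<in>Idx. (c s t - c' s t) *\<^sub>R I t q y)"
        if s: "s \<in> Idx" and y: "y \<in> H q" for s y
      proof -
        have a: "F (I s q y) = D q v (\<lambda>r. I s r (ext q y r)) - D' q v (\<lambda>r. I s r (ext q y r))"
          using FX[OF sec_I[OF s subset_refl ext_sec[of q y]]] ext_eq[OF q y] by simp
        have b: "I s q (F y) = I s q (D q v (ext q y)) - I s q (D' q v (ext q y))"
          unfolding Fext[OF y] by (rule P.I_linear(4)[OF s Din[OF ext_sec]])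
        have "F (I s q y) - I s q (F y) =
            (D q v (\<lambda>r. I s r (ext q y r)) - I s q (D q v (ext q y))) -
            (D' q v (\<lambda>r. I s r (ext q y r)) - I s q (D' q v (ext q y)))"
          unfolding a b by (simp only: algebra_simps)
        also have "\<dots> = (\<Sum>t\<in>Idx. (c s t - c' s t) *\<^sub>R I t q y)"
          unfolding c[OF s ext_sec] c'[OF s ext_sec] ext_eq[OF q y] scaleR_diff_left sum_subtractf ..
        finally show ?thesis .
      qed
      show ?thesis by (rule P.perp_normalizer_zero[OF Fp skew norm x])
    qed
    then have "F (X q) = 0" using section_onD(2)[OF X q] by blast
    then show ?thesis using FX[OF X] unfolding v_def by simp
  qed
  have onH: "D q v X = D' q v X" if v: "v \<in> tangent_space A q" and X: "section_on A H U X" for v X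
  proof -
    note xv = vector_field_nearI[OF section_onD(1)[OF X] q]
    note L = adapted_atD(1)[OF ad xv] and L' = adapted_atD(1)[OF ad' xv]
    note h = prH_in[OF q v]
    have xs: "\<eta> s q v *\<^sub>R \<xi> s q \<in> tangent_space A q" if "s \<in> Idx" for s
      by (rule subspace_scale[OF tangent_subspace xi_tangent[OF q that]])
    have vd: "v = prH q v + (\<Sum>s\<in>Idx. \<eta> s q v *\<^sub>R \<xi> s q)" by (simp add: prH_def prV_def)
    have exp: "F v = F (prH q v) + (\<Sum>s\<in>Idx. \<eta> s q v *\<^sub>R F (\<xi> s q))"
      if L: "linear_on (tangent_space A q) F" for F :: "'m tvec \<Rightarrow> 'm tvec"
    proof -
      have "F v = F (prH q v + (\<Sum>s\<in>Idx. \<eta> s q v *\<^sub>R \<xi> s q))" using vd by simp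
      also have "\<dots> = F (prH q v) + F (\<Sum>s\<in>Idx. \<eta> s q v *\<^sub>R \<xi> s q)"
        by (rule linear_onD(1)[OF L H_tangent[OF q h] subspace_sum[OF tangent_subspace xs]])
      also have "F (\<Sum>s\<in>Idx. \<eta> s q v *\<^sub>R \<xi> s q) = (\<Sum>s\<in>Idx. F (\<eta> s q v *\<^sub>R \<xi> s q))"
        by (rule linear_on_sum[OF L tangent_subspace xs])
      also have "\<dots> = (\<Sum>s\<in>Idx. \<eta> s q v *\<^sub>R F (\<xi> s q))"
        by (rule sum.cong[OF refl]) (rule linear_onD(2)[OF L xi_tangent[OF q]])
      finally show ?thesis .
    qed
    show ?thesis
      unfolding exp[OF L] exp[OF L'] hor[OF h X] by (simp only: ver[OF _ X] cong: sum.cong)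
  qed
  have onV: "D q v Y = D' q v Y" if v: "v \<in> tangent_space A q" and Y: "section_on A V U Y" for v Y
  proof -
    have Y': "section_on A V' U Y"
      by (rule section_onI[OF section_onD(1)[OF Y]]) (use section_onD(2)[OF Y] V_eq' in blast)
    note sY = section_nearI[OF Y q] and sY' = section_nearI[OF Y' q]
    note DV = adapted_atD(9)[OF ad v sY] and DV' = adapted_atD(9)[OF ad' v sY', folded V_eq'[OF q]]
    \<comment> \<open>A non-isotropic test vector. By \<nabla>\<phi> = 0, \<phi>(\<nabla>_v Y) x is
      determined by derivatives of sections of H, where the connections already agree; pairing it
      with I_t x recovers \<eta>_t(\<nabla>_v Y), and a vector of V is determined by these three
      numbers.\<close>
    define x where "x = e 0 q"
    have x: "x \<in> H q" and G: "g q x x \<noteq> 0" using P.E[of 0] P.E_nz[of 0] n by (auto simp: x_def)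
    define X where "X = ext q x"
    have X: "section_on A H U X" and Xq: "X q = x" unfolding X_def by (rule ext_sec) (rule ext_eq[OF q x])
    define S where "S = (\<lambda>r. phi0 A H g PQ r (Y r) (X r))"
    have S: "section_on A H U S"
    proof (rule sec_cong)
      show "section_on A H U (\<lambda>r. \<Sum>s\<in>Idx. \<eta> s r (Y r) *\<^sub>R I s r (X r))"
        by (intro sec_sum[OF subset_refl openU] sec_scale[OF subset_refl] eta_smooth[OF _ subset_refl]
            section_onD(1)[OF Y] sec_I[OF _ subset_refl X])
      fix r assume r: "r \<in> U"
      show "(\<Sum>s\<in>Idx. \<eta> s r (Y r) *\<^sub>R I s r (X r)) = S r"
        unfolding S_def phi0_eq[OF r vf_tangent[OF section_onD(1)[OF Y] r]] sum_123 by simp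
    qed
    have "phi0 A H g PQ q (D q v Y) x = D q v S - phi0 A H g PQ q (Y q) (D q v X)"
      using adapted_atD(14)[OF ad v sY] section_nearI[OF X q] Xq
      unfolding has_endo_deriv_def represents_def S_def by metis
    moreover have "phi0 A H g PQ q (D' q v Y) x = D' q v S - phi0 A H g PQ q (Y q) (D' q v X)"
      using adapted_atD(14)[OF ad' v sY'] section_nearI[OF X q] Xq
      unfolding has_endo_deriv_def represents_def S_def by metis
    ultimately have eq: "phi0 A H g PQ q (D q v Y) x = phi0 A H g PQ q (D' q v Y) x"
      unfolding onH[OF v X] onH[OF v S] by (rule trans[OF _ sym])
    have inner: "g q (phi0 A H g PQ q z x) (I t q x) = - \<epsilon> t * g q x x * \<eta> t q z"
      if t: "t \<in> Idx" and z: "z \<in> tangent_space A q" for t z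
    proof -
      have "phi0 A H g PQ q z x = (\<Sum>s\<in>Idx. \<eta> s q z *\<^sub>R I s q x)"
        unfolding phi0_eq[OF q z] sum_123 by simp
      then have "g q (phi0 A H g PQ q z x) (I t q x) = (\<Sum>s\<in>Idx. g q (\<eta> s q z *\<^sub>R I s q x) (I t q x))"
        by (simp only:) (rule P.g_sum_left[OF P.I_in[OF t x]], rule P.S_closed(3)[OF P.I_in[OF _ x]])
      also have "\<dots> = (\<Sum>s\<in>Idx. if s = t then - \<epsilon> t * g q x x * \<eta> t q z else 0)"
        by (rule sum.cong[OF refl]) (simp add: P.g_left(2)[OF P.I_in[OF t x] P.I_in[OF _ x]] P.I_inner[OF _ t x])
      finally show ?thesis using t by simp
    qed
    note tg = V_tangent[OF q DV] V_tangent[OF q DV']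
    have "\<eta> t q (D q v Y) = \<eta> t q (D' q v Y)" if t: "t \<in> Idx" for t
      using inner[OF t tg(1)] inner[OF t tg(2)] G unfolding eq by simp
    then have "prV q (D q v Y) = prV q (D' q v Y)"
      unfolding prV_def by (simp only: cong: sum.cong)
    then show ?thesis unfolding prV_id[OF q DV] prV_id[OF q DV'] .
  qed
  show "D q v Y = D' q v Y" if Y: "vector_field A U Y" and v: "v \<in> tangent_space A q"
  proof -
    define Y1 Y2 where "Y1 = (\<lambda>r. prH r (Y r))" and "Y2 = (\<lambda>r. prV r (Y r))"
    have Y1: "section_on A H U Y1" unfolding Y1_def by (rule prH_sec[OF subset_refl Y])
    have Y2: "section_on A V U Y2" unfolding Y2_def
      by (rule section_onI[OF prV_vf[OF subset_refl Y] prV_V])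
    note n1 = vector_field_nearI[OF section_onD(1)[OF Y1] q] and n2 = vector_field_nearI[OF section_onD(1)[OF Y2] q]
    have Y12: "Y = Y1 + Y2" by (rule ext) (simp add: Y1_def Y2_def prH_def)
    show ?thesis
      unfolding Y12 adapted_atD(2)[OF ad v n1 n2] adapted_atD(2)[OF ad' v n1 n2] onH[OF v Y1] onV[OF v Y2] ..
  qed
qed

text \<open>The comparison in a frame treats fields defined on the whole open set. A field known
  only near \<open>q\<close> is handled by shrinking \<open>U\<close> to its domain; all other
  arguments are sent to 0 by both connections.\<close>

lemma (in pqc_frame) adapted_unique:
  assumes 1: "\<And>r. r \<in> U \<Longrightarrow> adapted_at A H g PQ D V r" "smooth_conn_on A U D"
    and 2: "\<And>r. r \<in> U \<Longrightarrow> adapted_at A H g PQ D' V' r" "smooth_conn_on A U D'"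
    and q: "q \<in> U"
  shows "D q = D' q \<and> V q = V' q"
proof -
  have main: "V q = V' q" "vector_field A W Y \<Longrightarrow> v \<in> tangent_space A q \<Longrightarrow> D q v Y = D' q v Y"
    if W: "open W" "W \<subseteq> U" "q \<in> W" for W Y v
  proof -
    interpret F: pqc_frame A H g PQ n W \<eta> I e by (rule restrict[OF W(1,2)])
    interpret J: adapted A H g PQ n W \<eta> I e D V
      by standard (use 1 W in \<open>auto simp: smooth_conn_on_def\<close>)
    interpret J': adapted A H g PQ n W \<eta> I e D' V'
      by standard (use 2 W in \<open>auto simp: smooth_conn_on_def\<close>)
    obtain \<xi> where \<xi>: "pqc_dual A H g PQ n W \<eta> I e \<xi>" "\<forall>s\<in>Idx. \<forall>q\<in>W. \<xi> s q \<in> V q"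
      using J.adapted_dual by blast
    obtain \<xi>' where \<xi>': "pqc_dual A H g PQ n W \<eta> I e \<xi>'" "\<forall>s\<in>Idx. \<forall>q\<in>W. \<xi>' s q \<in> V' q"
      using J'.adapted_dual by blast
    interpret K: adapted_frame A H g PQ n W \<eta> I e \<xi> D V
      using \<xi> J.adapted_axioms by (intro adapted_frame.intro adapted_frame_axioms.intro) blast+
    have K': "adapted_frame A H g PQ n W \<eta> I e \<xi>' D' V'"
      using \<xi>' J'.adapted_axioms by (intro adapted_frame.intro adapted_frame_axioms.intro) blast+
    show "V q = V' q" by (rule K.unique(1)[OF K' W(3)])
    show "D q v Y = D' q v Y" if "vector_field A W Y" "v \<in> tangent_space A q"
      by (rule K.unique(2)[OF K' W(3) that])
  qed
  have "D q v Y = D' q v Y" for v Y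
  proof (cases "v \<in> tangent_space A q \<and> vector_field_near A q Y")
    case True
    then obtain W where W: "q \<in> W" "vector_field A W Y" unfolding vector_field_near_def by blast
    note o = vf_open[OF W(2)]
    show ?thesis
      by (rule main(2)[of "U \<inter> W", OF _ _ _ vf_subset[OF W(2)]]) (use o openU q W True in auto)
  next
    case False
    then show ?thesis using adapted_atD(4)[OF 1(1)[OF q], of v Y] adapted_atD(4)[OF 2(1)[OF q], of v Y] by metis
  qed
  then show ?thesis using main(1)[OF openU subset_refl q] by (simp add: fun_eq_iff)
qed

section \<open>Vertical derivatives\<close>

lemma (in pqc_frame) tensor_ext:
  fixes F :: "('m \<Rightarrow> 'm tvec) \<Rightarrow> 'b::real_vector"
  assumes q: "q \<in> U"
    and add: "\<And>X Y. section_on A H U X \<Longrightarrow> section_on A H U Y \<Longrightarrow> F (\<lambda>q. X q + Y q) = F X + F Y"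
    and scale: "\<And>f X. smooth_fun A U f \<Longrightarrow> section_on A H U X \<Longrightarrow> F (\<lambda>q. f q *\<^sub>R X q) = f q *\<^sub>R F X"
  shows "section_on A H U X \<Longrightarrow> F X = F (ext q (X q))" "linear_on (H q) (\<lambda>x. F (ext q x))"
proof -
  have t: "F X = (\<Sum>a<4*n. co a q (X q) *\<^sub>R F (e a))" if "section_on A H U X" for X
    by (rule tensorial[where F = F, OF subset_refl q that add scale])
  have e: "F (ext q x) = (\<Sum>a<4*n. co a q x *\<^sub>R F (e a))" if "x \<in> H q" for x
    using t[OF ext_sec[of q x]] ext_eq[OF q that] by simp
  show "section_on A H U X \<Longrightarrow> F X = F (ext q (X q))"
    using t e section_onD(2)[OF _ q] by metis
  have l: "linear_on (H q) (\<lambda>x. \<Sum>a<4*n. co a q x *\<^sub>R F (e a))"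
    by (intro linear_on_sum_fun linear_on_scaleR_vec co_linear[OF q]) simp
  show "linear_on (H q) (\<lambda>x. F (ext q x))"
    unfolding linear_on_def
  proof (intro conjI ballI allI)
    fix x y assume x: "x \<in> H q" and y: "y \<in> H q"
    show "F (ext q (x + y)) = F (ext q x) + F (ext q y)"
      unfolding e[OF x] e[OF y] e[OF subspace_add[OF H_subspace[OF q] x y]]
      by (rule linear_onD(1)[OF l x y])
  next
    fix c x assume x: "x \<in> H q"
    show "F (ext q (c *\<^sub>R x)) = c *\<^sub>R F (ext q x)"
      unfolding e[OF x] e[OF subspace_scale[OF H_subspace[OF q] x]]
      by (rule linear_onD(2)[OF l x])
  qed
qed

text \<open>Metric covariant derivatives of sections of \<open>H\<close> along a vector field \<open>x\<close>.\<close>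

locale mder = pqc_dual +
  fixes x :: "'a \<Rightarrow> 'a tvec" and L :: "('a \<Rightarrow> 'a tvec) \<Rightarrow> 'a \<Rightarrow> 'a tvec"
  assumes x: "vector_field A U x"
    and L_sec: "section_on A H U Y \<Longrightarrow> section_on A H U (L Y)"
    and L_add: "section_on A H U Y \<Longrightarrow> section_on A H U Z \<Longrightarrow> q \<in> U \<Longrightarrow>
      L (\<lambda>q. Y q + Z q) q = L Y q + L Z q"
    and L_leib: "smooth_fun A U f \<Longrightarrow> section_on A H U Y \<Longrightarrow> q \<in> U \<Longrightarrow>
      L (\<lambda>q. f q *\<^sub>R Y q) q = x q f *\<^sub>R Y q + f q *\<^sub>R L Y q"
    and L_metric: "section_on A H U Y \<Longrightarrow> section_on A H U Z \<Longrightarrow> q \<in> U \<Longrightarrow>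
      x q (\<lambda>r. g r (Y r) (Z r)) = g q (L Y q) (Z q) + g q (Y q) (L Z q)"
begin

lemma x_tangent: "q \<in> U \<Longrightarrow> x q \<in> tangent_space A q"
  by (rule vf_tangent[OF x])

lemma L_in: "section_on A H U Y \<Longrightarrow> q \<in> U \<Longrightarrow> L Y q \<in> H q"
  by (rule section_onD(2)[OF L_sec])

lemma sec_IU: "s \<in> Idx \<Longrightarrow> section_on A H U Y \<Longrightarrow> section_on A H U (\<lambda>q. I s q (Y q))"
  by (rule sec_I[OF _ subset_refl])

lemma L_cscale:
  assumes Y: "section_on A H U Y" and q: "q \<in> U"
  shows "L (\<lambda>r. c *\<^sub>R Y r) q = c *\<^sub>R L Y q"
  using L_leib[OF smooth_fun_const[OF openU] Y q, of c] tangent_const[OF x_tangent[OF q]] by simp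

lemma L_cong:
  assumes Y: "section_on A H U Y" and Y': "section_on A H U Y'"
    and q: "q \<in> U" and eq: "\<And>r. r \<in> U \<Longrightarrow> Y r = Y' r"
  shows "L Y q = L Y' q"
proof -
  define c where "c = (\<lambda>q. if q \<in> U then 1::real else 0)"
  have c: "smooth_fun A U c" unfolding c_def by (rule smooth_fun_indicator[OF openU])
  have "x q c = x q (\<lambda>r. 1)"
    by (rule tangent_cong[OF x_tangent[OF q] openU q]) (simp add: c_def)
  then have xc: "x q c = 0" using tangent_const[OF x_tangent[OF q]] by simp
  have "(\<lambda>r. c r *\<^sub>R Y r) = (\<lambda>r. c r *\<^sub>R Y' r)" using eq by (auto simp: c_def)
  then have "L (\<lambda>r. c r *\<^sub>R Y r) q = L (\<lambda>r. c r *\<^sub>R Y' r) q" by metis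
  then show ?thesis
    unfolding L_leib[OF c Y q] L_leib[OF c Y' q] xc using q by (simp add: c_def)
qed

lemma I_linear:
  assumes s: "s \<in> Idx" and q: "q \<in> U" and y: "y \<in> H q"
  shows "z \<in> H q \<Longrightarrow> I s q (y + z) = I s q y + I s q z" "I s q (c *\<^sub>R y) = c *\<^sub>R I s q y"
    "z \<in> H q \<Longrightarrow> I s q (y - z) = I s q y - I s q z" "I s q y \<in> H q" "I s q (I s q y) = \<epsilon> s *\<^sub>R y"
    "I s q (- y) = - I s q y"
proof -
  interpret P: pq_endo "H q" "g q" "4 * n" "\<lambda>a. e a q" "\<lambda>s. I s q" "PQ q" "e0 q"
    by (rule pointwise[OF q])
  show "z \<in> H q \<Longrightarrow> I s q (y + z) = I s q y + I s q z" "I s q (c *\<^sub>R y) = c *\<^sub>R I s q y"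
    "z \<in> H q \<Longrightarrow> I s q (y - z) = I s q y - I s q z" "I s q y \<in> H q" "I s q (I s q y) = \<epsilon> s *\<^sub>R y"
    "I s q (- y) = - I s q y"
    using P.I_linear[OF s y] P.I_in[OF s y] P.I_sq[OF s y] by blast+
qed

lemma I_cyc:
  assumes c: "cyc i j k" and q: "q \<in> U" and y: "y \<in> H q"
  shows "I i q (I j q y) = - \<epsilon> k *\<^sub>R I k q y" "I j q (I i q y) = \<epsilon> k *\<^sub>R I k q y"
proof -
  interpret P: pq_endo "H q" "g q" "4 * n" "\<lambda>a. e a q" "\<lambda>s. I s q" "PQ q" "e0 q"
    by (rule pointwise[OF q])
  show "I i q (I j q y) = - \<epsilon> k *\<^sub>R I k q y" "I j q (I i q y) = \<epsilon> k *\<^sub>R I k q y"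
    by (rule P.I_cyc[OF c y])+
qed

lemma LI_add:
  assumes s: "s \<in> Idx" and Y: "section_on A H U Y" and Z: "section_on A H U Z" and q: "q \<in> U"
  shows "L (\<lambda>r. I s r (Y r + Z r)) q = L (\<lambda>r. I s r (Y r)) q + L (\<lambda>r. I s r (Z r)) q"
proof -
  have "L (\<lambda>r. I s r (Y r + Z r)) q = L (\<lambda>r. I s r (Y r) + I s r (Z r)) q"
    by (rule L_cong[OF sec_IU[OF s sec_add[OF subset_refl Y Z]] sec_add[OF subset_refl sec_IU[OF s Y] sec_IU[OF s Z]] q])
      (rule I_linear(1)[OF s _ section_onD(2)[OF Y] section_onD(2)[OF Z]])
  then show ?thesis unfolding L_add[OF sec_IU[OF s Y] sec_IU[OF s Z] q] .
qed

lemma LI_leib: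
  assumes s: "s \<in> Idx" and f: "smooth_fun A U f" and Y: "section_on A H U Y" and q: "q \<in> U"
  shows "L (\<lambda>r. I s r (f r *\<^sub>R Y r)) q = x q f *\<^sub>R I s q (Y q) + f q *\<^sub>R L (\<lambda>r. I s r (Y r)) q"
proof -
  have "L (\<lambda>r. I s r (f r *\<^sub>R Y r)) q = L (\<lambda>r. f r *\<^sub>R I s r (Y r)) q"
    by (rule L_cong[OF sec_IU[OF s sec_scale[OF subset_refl f Y]] sec_scale[OF subset_refl f sec_IU[OF s Y]] q])
      (rule I_linear(2)[OF s _ section_onD(2)[OF Y]])
  then show ?thesis unfolding L_leib[OF f sec_IU[OF s Y] q] .
qed

text \<open>The commutator of L with I_s. The derivative terms cancel, so it is a tensor, and it
  anticommutes with I_s because I_s I_s is constant.\<close>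

definition R :: "nat \<Rightarrow> ('a \<Rightarrow> 'a tvec) \<Rightarrow> 'a \<Rightarrow> 'a tvec" where
  "R s Y q = L (\<lambda>r. I s r (Y r)) q - I s q (L Y q)"

lemma R_in: "s \<in> Idx \<Longrightarrow> section_on A H U Y \<Longrightarrow> q \<in> U \<Longrightarrow> R s Y q \<in> H q"
  unfolding R_def by (intro subspace_diff[OF H_subspace] L_in I_linear(4) sec_IU)

lemma R_add:
  assumes s: "s \<in> Idx" and Y: "section_on A H U Y" and Z: "section_on A H U Z" and q: "q \<in> U"
  shows "R s (\<lambda>q. Y q + Z q) q = R s Y q + R s Z q"
  unfolding R_def LI_add[OF assms] L_add[OF Y Z q] I_linear(1)[OF s q L_in[OF Y q] L_in[OF Z q]]
  by (simp only: algebra_simps)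

lemma R_scale:
  assumes s: "s \<in> Idx" and f: "smooth_fun A U f" and Y: "section_on A H U Y" and q: "q \<in> U"
  shows "R s (\<lambda>q. f q *\<^sub>R Y q) q = f q *\<^sub>R R s Y q"
proof -
  note sc = subspace_scale[OF H_subspace[OF q]]
  show ?thesis
    unfolding R_def LI_leib[OF assms] L_leib[OF f Y q]
      I_linear(1)[OF s q sc[OF section_onD(2)[OF Y q]] sc[OF L_in[OF Y q]]]
      I_linear(2)[OF s q section_onD(2)[OF Y q]] I_linear(2)[OF s q L_in[OF Y q]]
    by (simp only: algebra_simps)
qed

lemma R_anti:
  assumes s: "s \<in> Idx" and Y: "section_on A H U Y" and q: "q \<in> U"
  shows "R s (\<lambda>r. I s r (Y r)) q = - I s q (R s Y q)"
proof -
  have "L (\<lambda>r. I s r (I s r (Y r))) q = L (\<lambda>r. \<epsilon> s *\<^sub>R Y r) q"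
    by (rule L_cong[OF sec_IU[OF s sec_IU[OF s Y]] sec_cscale[OF subset_refl Y] q])
      (rule I_linear(5)[OF s _ section_onD(2)[OF Y]])
  also have "\<dots> = I s q (I s q (L Y q))"
    unfolding L_cscale[OF Y q] I_linear(5)[OF s q L_in[OF Y q]] ..
  finally have LII: "L (\<lambda>r. I s r (I s r (Y r))) q = I s q (I s q (L Y q))" .
  show ?thesis
    unfolding R_def LII I_linear(3)[OF s q L_in[OF sec_IU[OF s Y] q] I_linear(4)[OF s q L_in[OF Y q]]]
    by (simp only: minus_diff_eq)
qed

text \<open>The mean of L and its conjugates by the three structures: again a metric derivative
  along \<open>x\<close>, but one that commutes with I_1, I_2, I_3 and in particular preserves
  PQ.\<close>

definition Qv :: "('a \<Rightarrow> 'a tvec) \<Rightarrow> 'a \<Rightarrow> 'a tvec" where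
  "Qv Y q = (1/4) *\<^sub>R (L Y q + (\<Sum>s\<in>Idx. \<epsilon> s *\<^sub>R I s q (L (\<lambda>r. I s r (Y r)) q)))"

text \<open>\<epsilon>_s I_s R_s is the conjugate of L by I_s minus L itself. This shows that
  \<open>Qv\<close> differs from L by a tensor, and it is the form of the difference in which
  \<open>perp_construction\<close> applies.\<close>

lemma Qv_diff:
  assumes Y: "section_on A H U Y" and q: "q \<in> U"
  shows "Qv Y q = L Y q + (\<Sum>s\<in>Idx. (\<epsilon> s / 4) *\<^sub>R I s q (R s Y q))"
proof -
  have s: "(\<epsilon> s / 4) *\<^sub>R I s q (R s Y q) = (1/4) *\<^sub>R (\<epsilon> s *\<^sub>R I s q (L (\<lambda>r. I s r (Y r)) q)) - (1/4) *\<^sub>R L Y q"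
    if s: "s \<in> Idx" for s
    unfolding R_def I_linear(3)[OF s q L_in[OF sec_IU[OF s Y] q] I_linear(4)[OF s q L_in[OF Y q]]]
      I_linear(5)[OF s q L_in[OF Y q]] scaleR_diff_right by simp
  have q4: "(1/4) *\<^sub>R z + (1/4) *\<^sub>R z + (1/4) *\<^sub>R z + (1/4) *\<^sub>R z = z" for z :: "'a tvec"
    by (simp flip: scaleR_left.add)
  have "(\<Sum>s\<in>Idx. (\<epsilon> s / 4) *\<^sub>R I s q (R s Y q)) =
      (\<Sum>s\<in>Idx. (1/4) *\<^sub>R (\<epsilon> s *\<^sub>R I s q (L (\<lambda>r. I s r (Y r)) q)) - (1/4) *\<^sub>R L Y q)"
    by (rule sum.cong[OF refl s])
  also have "\<dots> = (1/4) *\<^sub>R (\<Sum>s\<in>Idx. \<epsilon> s *\<^sub>R I s q (L (\<lambda>r. I s r (Y r)) q)) -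
      ((1/4) *\<^sub>R L Y q + (1/4) *\<^sub>R L Y q + (1/4) *\<^sub>R L Y q)"
    unfolding sum_subtractf scaleR_sum_right by (simp only: sum_123[of "\<lambda>s. (1/4) *\<^sub>R L Y q"])
  finally have *: "(\<Sum>s\<in>Idx. (\<epsilon> s / 4) *\<^sub>R I s q (R s Y q)) =
      (1/4) *\<^sub>R (\<Sum>s\<in>Idx. \<epsilon> s *\<^sub>R I s q (L (\<lambda>r. I s r (Y r)) q)) -
      ((1/4) *\<^sub>R L Y q + (1/4) *\<^sub>R L Y q + (1/4) *\<^sub>R L Y q)" .
  have swap: "a + b = z + (b - (a + a + a))" if "a + a + a + a = z" for a b z :: "'a tvec"
    using that by (metis (no_types, opaque_lifting) add.assoc add.commute add_diff_cancel_right' diff_add_eq)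
  show ?thesis unfolding Qv_def scaleR_add_right * by (rule swap[OF q4])
qed

text \<open>The structures are not constant for L, so their products are simplified inside the
  argument of L, where they are identities between sections; what remains is
  \<open>avg_commute\<close> at the point \<open>q\<close>.\<close>

lemma Qv_commute:
  assumes t: "t \<in> Idx" and Y: "section_on A H U Y" and q: "q \<in> U"
  shows "Qv (\<lambda>r. I t r (Y r)) q = I t q (Qv Y q)"
proof -
  interpret P: pq_endo "H q" "g q" "4 * n" "\<lambda>a. e a q" "\<lambda>s. I s q" "PQ q" "e0 q"
    by (rule pointwise[OF q])
  obtain j k where c: "cyc t j k" using cyc_cases[OF t] by blast
  have mem: "j \<in> Idx" "k \<in> Idx" and ne: "t \<noteq> j" "t \<noteq> k" "j \<noteq> k"
    using cyc_mem[OF c] cyc_distinct[OF c] by auto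
  note c2 = cyc_rot[OF cyc_rot[OF c]]
  note It = sec_IU[OF t Y]
  note in1 = L_in[OF Y q] and in2 = L_in[OF sec_IU[OF _ Y] q]
  have 1: "L (\<lambda>r. I t r (I t r (Y r))) q = \<epsilon> t *\<^sub>R L Y q"
    unfolding L_cscale[OF Y q, symmetric]
    by (rule L_cong[OF sec_IU[OF t It] sec_cscale[OF subset_refl Y] q]) (rule I_linear(5)[OF t _ section_onD(2)[OF Y]])
  have 2: "L (\<lambda>r. I j r (I t r (Y r))) q = \<epsilon> k *\<^sub>R L (\<lambda>r. I k r (Y r)) q"
    unfolding L_cscale[OF sec_IU[OF mem(2) Y] q, symmetric]
    by (rule L_cong[OF sec_IU[OF mem(1) It] sec_cscale[OF subset_refl sec_IU[OF mem(2) Y]] q])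
      (rule I_cyc(2)[OF c _ section_onD(2)[OF Y]])
  have 3: "L (\<lambda>r. I k r (I t r (Y r))) q = - \<epsilon> j *\<^sub>R L (\<lambda>r. I j r (Y r)) q"
    unfolding L_cscale[OF sec_IU[OF mem(1) Y] q, symmetric]
    by (rule L_cong[OF sec_IU[OF mem(2) It] sec_cscale[OF subset_refl sec_IU[OF mem(1) Y]] q])
      (rule I_cyc(1)[OF c2 _ section_onD(2)[OF Y]])
  have "Qv (\<lambda>r. I t r (Y r)) q = P.avg (L (\<lambda>r. I t r (Y r)) q) (\<lambda>s. if s = t then \<epsilon> t *\<^sub>R L Y q
      else if s = j then \<epsilon> k *\<^sub>R L (\<lambda>r. I k r (Y r)) q else - \<epsilon> j *\<^sub>R L (\<lambda>r. I j r (Y r)) q)"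
    unfolding Qv_def P.avg_def sum_cyc[OF c] 1 2 3 using ne by simp
  also have "\<dots> = I t q (P.avg (L Y q) (\<lambda>s. L (\<lambda>r. I s r (Y r)) q))"
    by (rule P.avg_commute[OF c in1 in2])
  finally show ?thesis by (simp only: Qv_def P.avg_def)
qed

lemma Qv_sec:
  assumes Y: "section_on A H U Y"
  shows "section_on A H U (Qv Y)"
  unfolding Qv_def[abs_def]
  by (intro sec_cscale sec_add sec_sum subset_refl openU L_sec Y sec_IU)

lemma Qv_mder: "mder A H g PQ n U \<eta> I e \<xi> x Qv"
proof
  show "vector_field A U x" by (rule x)
  show "section_on A H U (Qv Y)" if "section_on A H U Y" for Y by (rule Qv_sec[OF that])
next
  fix Y Z q assume Y: "section_on A H U Y" and Z: "section_on A H U Z" and q: "q \<in> U"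
  interpret P: pq_endo "H q" "g q" "4 * n" "\<lambda>a. e a q" "\<lambda>s. I s q" "PQ q" "e0 q"
    by (rule pointwise[OF q])
  have "I s q (R s (\<lambda>q. Y q + Z q) q) = I s q (R s Y q) + I s q (R s Z q)" if s: "s \<in> Idx" for s
    unfolding R_add[OF s Y Z q] by (rule I_linear(1)[OF s q R_in[OF s Y q] R_in[OF s Z q]])
  then show "Qv (\<lambda>q. Y q + Z q) q = Qv Y q + Qv Z q"
    unfolding Qv_diff[OF Y q] Qv_diff[OF Z q] Qv_diff[OF sec_add[OF subset_refl Y Z] q] L_add[OF Y Z q]
    by (simp only: scaleR_add_right sum.distrib add_ac cong: sum.cong)
  \<comment> \<open>Differentiating g(I_s Y, I_s Z) = -\<epsilon>_s g(Y, Z) along \<open>x\<close>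
    shows that each conjugate of L is metric.\<close>
  have m: "g q (I s q (L (\<lambda>r. I s r (Y r)) q)) (Z q) + g q (Y q) (I s q (L (\<lambda>r. I s r (Z r)) q)) =
      \<epsilon> s * x q (\<lambda>r. g r (Y r) (Z r))" if s: "s \<in> Idx" for s
  proof -
    note IY = sec_IU[OF s Y] and IZ = sec_IU[OF s Z]
    have "x q (\<lambda>r. g r (I s r (Y r)) (I s r (Z r))) = x q (\<lambda>r. - \<epsilon> s * g r (Y r) (Z r))"
      by (rule tangent_cong[OF x_tangent[OF q] openU q])
        (rule data_pointwise(4)[OF _ s section_onD(2)[OF Y] section_onD(2)[OF Z]])
    also have "\<dots> = - \<epsilon> s * x q (\<lambda>r. g r (Y r) (Z r))"
      by (rule tangent_cmult[OF x_tangent[OF q] smooth_fun_nearI[OF g_smooth[OF Y Z] q]])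
    finally have "g q (L (\<lambda>r. I s r (Y r)) q) (I s q (Z q)) + g q (I s q (Y q)) (L (\<lambda>r. I s r (Z r)) q) =
        - \<epsilon> s * x q (\<lambda>r. g r (Y r) (Z r))"
      unfolding L_metric[OF IY IZ q] .
    then show ?thesis
      using P.I_skew[OF s L_in[OF IY q] section_onD(2)[OF Z q]] P.I_skew[OF s section_onD(2)[OF Y q] L_in[OF IZ q]]
      by simp
  qed
  have gQ: "g q (Qv Y q) (Z q) = (1/4) * (g q (L Y q) (Z q) + (\<Sum>s\<in>Idx. \<epsilon> s * g q (I s q (L (\<lambda>r. I s r (Y r)) q)) (Z q)))"
    if Y: "section_on A H U Y" and Z: "section_on A H U Z" for Y Z
  proof -
    note z = section_onD(2)[OF Z q] and i = P.I_in[OF _ L_in[OF sec_IU[OF _ Y] q]]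
    show ?thesis
      unfolding Qv_def sum_123
      using z L_in[OF Y q] i[of 1 1] i[of 2 2] i[of 3 3] by simp
  qed
  have sy: "g q (Y q) (Qv Z q) = g q (Qv Z q) (Y q)"
    by (rule P.g_sym[OF section_onD(2)[OF Y q] section_onD(2)[OF Qv_sec[OF Z] q]])
  have sy2: "g q (L Z q) (Y q) = g q (Y q) (L Z q)" by (rule P.g_sym[OF L_in[OF Z q] section_onD(2)[OF Y q]])
  have sy3: "g q (I s q (L (\<lambda>r. I s r (Z r)) q)) (Y q) = g q (Y q) (I s q (L (\<lambda>r. I s r (Z r)) q))"
    if s: "s \<in> Idx" for s
    by (rule P.g_sym[OF P.I_in[OF s L_in[OF sec_IU[OF s Z] q]] section_onD(2)[OF Y q]])
  have "g q (Qv Y q) (Z q) + g q (Y q) (Qv Z q) =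
      (1/4) * ((g q (L Y q) (Z q) + g q (Y q) (L Z q)) + (\<Sum>s\<in>Idx. \<epsilon> s *
        (g q (I s q (L (\<lambda>r. I s r (Y r)) q)) (Z q) + g q (Y q) (I s q (L (\<lambda>r. I s r (Z r)) q)))))"
    unfolding sy gQ[OF Y Z] gQ[OF Z Y] sy2 by (simp add: sy3 sum.distrib distrib_left cong: sum.cong)
  also have "\<dots> = (1/4) * (x q (\<lambda>r. g r (Y r) (Z r)) + (\<Sum>s\<in>Idx. x q (\<lambda>r. g r (Y r) (Z r))))"
    unfolding L_metric[OF Y Z q, symmetric] by (simp add: m cong: sum.cong)
  also have "\<dots> = x q (\<lambda>r. g r (Y r) (Z r))"
    unfolding sum_123 by simp
  finally show "x q (\<lambda>r. g r (Y r) (Z r)) = g q (Qv Y q) (Z q) + g q (Y q) (Qv Z q)" by (rule sym)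
next
  fix f Y q assume f: "smooth_fun A U f" and Y: "section_on A H U Y" and q: "q \<in> U"
  have "I s q (R s (\<lambda>q. f q *\<^sub>R Y q) q) = f q *\<^sub>R I s q (R s Y q)" if s: "s \<in> Idx" for s
    unfolding R_scale[OF s f Y q] by (rule I_linear(2)[OF s q R_in[OF s Y q]])
  then have s: "(\<Sum>s\<in>Idx. (\<epsilon> s / 4) *\<^sub>R I s q (R s (\<lambda>q. f q *\<^sub>R Y q) q)) = f q *\<^sub>R (\<Sum>s\<in>Idx. (\<epsilon> s / 4) *\<^sub>R I s q (R s Y q))"
    unfolding scaleR_sum_right by (simp only: scaleR_left_commute cong: sum.cong)
  show "Qv (\<lambda>q. f q *\<^sub>R Y q) q = x q f *\<^sub>R Y q + f q *\<^sub>R Qv Y q"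
    unfolding Qv_diff[OF Y q] Qv_diff[OF sec_scale[OF subset_refl f Y] q] L_leib[OF f Y q] s
    by (simp only: scaleR_add_right add.assoc)
qed

lemma add_I_mder:
  assumes c: "\<And>u. u \<in> Idx \<Longrightarrow> smooth_fun A U (c u)"
  shows "mder A H g PQ n U \<eta> I e \<xi> x (\<lambda>Y q. L Y q + (\<Sum>u\<in>Idx. c u q *\<^sub>R I u q (Y q)))"
proof
  show "vector_field A U x" by (rule x)
  show "section_on A H U (\<lambda>q. L Y q + (\<Sum>u\<in>Idx. c u q *\<^sub>R I u q (Y q)))" if Y: "section_on A H U Y" for Y
    by (intro sec_add sec_sum sec_scale subset_refl openU L_sec Y sec_IU c)
next
  fix Y Z q assume Y: "section_on A H U Y" and Z: "section_on A H U Z" and q: "q \<in> U"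
  interpret P: pq_endo "H q" "g q" "4 * n" "\<lambda>a. e a q" "\<lambda>s. I s q" "PQ q" "e0 q"
    by (rule pointwise[OF q])
  note y = section_onD(2)[OF Y q] and z = section_onD(2)[OF Z q]
  have "(\<Sum>u\<in>Idx. c u q *\<^sub>R I u q (Y q + Z q)) = (\<Sum>u\<in>Idx. c u q *\<^sub>R I u q (Y q)) + (\<Sum>u\<in>Idx. c u q *\<^sub>R I u q (Z q))"
    by (simp only: I_linear(1)[OF _ q y z] scaleR_add_right sum.distrib cong: sum.cong)
  then show "L (\<lambda>q. Y q + Z q) q + (\<Sum>u\<in>Idx. c u q *\<^sub>R I u q (Y q + Z q)) =
      L Y q + (\<Sum>u\<in>Idx. c u q *\<^sub>R I u q (Y q)) + (L Z q + (\<Sum>u\<in>Idx. c u q *\<^sub>R I u q (Z q)))"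
    unfolding L_add[OF Y Z q] by (simp only: add_ac)
  have "g q (\<Sum>u\<in>Idx. c u q *\<^sub>R I u q (Y q)) (Z q) + g q (Y q) (\<Sum>u\<in>Idx. c u q *\<^sub>R I u q (Z q)) = 0"
    unfolding sum_123 using y z P.I_skew[OF Idx_mem(1) y z] P.I_skew[OF Idx_mem(3) y z] P.I_skew[OF Idx_mem(4) y z]
    by simp
  moreover have "(\<Sum>u\<in>Idx. c u q *\<^sub>R I u q (Y q)) \<in> H q" "(\<Sum>u\<in>Idx. c u q *\<^sub>R I u q (Z q)) \<in> H q"
    by ((intro P.S_sum P.S_closed(3) P.I_in y; assumption), (intro P.S_sum P.S_closed(3) P.I_in z; assumption))
  ultimately show "x q (\<lambda>r. g r (Y r) (Z r)) = g q (L Y q + (\<Sum>u\<in>Idx. c u q *\<^sub>R I u q (Y q))) (Z q)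
      + g q (Y q) (L Z q + (\<Sum>u\<in>Idx. c u q *\<^sub>R I u q (Z q)))"
    unfolding L_metric[OF Y Z q] using L_in[OF Y q] L_in[OF Z q] y z by simp
next
  fix f Y q assume f: "smooth_fun A U f" and Y: "section_on A H U Y" and q: "q \<in> U"
  have "(\<Sum>u\<in>Idx. c u q *\<^sub>R I u q (f q *\<^sub>R Y q)) = f q *\<^sub>R (\<Sum>u\<in>Idx. c u q *\<^sub>R I u q (Y q))"
    unfolding scaleR_sum_right
    by (simp only: I_linear(2)[OF _ q section_onD(2)[OF Y q]] scaleR_left_commute cong: sum.cong)
  then show "L (\<lambda>q. f q *\<^sub>R Y q) q + (\<Sum>u\<in>Idx. c u q *\<^sub>R I u q (f q *\<^sub>R Y q)) =
      x q f *\<^sub>R Y q + f q *\<^sub>R (L Y q + (\<Sum>u\<in>Idx. c u q *\<^sub>R I u q (Y q)))"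
    unfolding L_leib[OF f Y q] by (simp only: scaleR_add_right add.assoc)
qed

end

section \<open>A metric derivative along one vector field that preserves PQ and differs from the
  bracket by an element of the orthogonal complement\<close>

context pqc_dual
begin

text \<open>The Lie derivative of g along \<open>x\<close>, formed with the horizontal part of the
  bracket. \<open>Sy\<close> is half of its metric dual, a symmetric endomorphism.\<close>

definition sig :: "('a \<Rightarrow> 'a tvec) \<Rightarrow> ('a \<Rightarrow> 'a tvec) \<Rightarrow> ('a \<Rightarrow> 'a tvec) \<Rightarrow> 'a \<Rightarrow> real" where
  "sig x Y Z q = x q (\<lambda>r. g r (Y r) (Z r)) - g q (bH x Y q) (Z q) - g q (Y q) (bH x Z q)"

definition Sy :: "('a \<Rightarrow> 'a tvec) \<Rightarrow> ('a \<Rightarrow> 'a tvec) \<Rightarrow> 'a \<Rightarrow> 'a tvec" where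
  "Sy x Y q = (\<Sum>a<4*n. (sig x Y (e a) q / (2 * g q (e a q) (e a q))) *\<^sub>R e a q)"

text \<open>The operator \<open>[x, Y]\<^sub>H\<close> corrected by half of the Lie derivative of \<open>g\<close> to be metric.\<close>

definition L1 :: "('a \<Rightarrow> 'a tvec) \<Rightarrow> ('a \<Rightarrow> 'a tvec) \<Rightarrow> 'a \<Rightarrow> 'a tvec" where
  "L1 x Y q = bH x Y q + Sy x Y q"

text \<open>The constant c_u of \<open>perp_construction\<close> for N = 4n: \<epsilon>_u times the
  trace of \<open>Qv\<close> minus \<open>L1\<close> against I_u, divided by N.\<close>

definition cu :: "('a \<Rightarrow> 'a tvec) \<Rightarrow> nat \<Rightarrow> 'a \<Rightarrow> real" where
  "cu x u q = \<epsilon> u * (\<Sum>a<4*n. g q (mder.Qv I (L1 x) (e a) q - L1 x (e a) q) (I u q (e a q))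
     / g q (e a q) (e a q)) / (4 * real n)"

text \<open>Three corrections are made to [x, Y]_H: the symmetric one in \<open>L1\<close> makes it
  metric, the average \<open>Qv\<close> makes it commute with the structures, and the last one makes
  the total correction orthogonal to sp(1,R) while still normalizing PQ.\<close>

definition Gv :: "('a \<Rightarrow> 'a tvec) \<Rightarrow> ('a \<Rightarrow> 'a tvec) \<Rightarrow> 'a \<Rightarrow> 'a tvec" where
  "Gv x Y q = mder.Qv I (L1 x) Y q + (\<Sum>u\<in>Idx. cu x u q *\<^sub>R I u q (Y q))"

context
  fixes x assumes x: "vector_field A U x"
begin

context
  fixes q assumes q: "q \<in> U"
begin

interpretation P: pq_endo "H q" "g q" "4 * n" "\<lambda>a. e a q" "\<lambda>s. I s q" "PQ q" "e0 q"
  by (rule pointwise[OF q])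

lemma xq: "x q \<in> tangent_space A q"
  by (rule vf_tangent[OF x q])

lemma xg_add:
  assumes "section_on A H U Y" "section_on A H U Z" "section_on A H U W"
  shows "x q (\<lambda>r. g r (Y r + Z r) (W r)) = x q (\<lambda>r. g r (Y r) (W r)) + x q (\<lambda>r. g r (Z r) (W r))"
proof -
  have "x q (\<lambda>r. g r (Y r + Z r) (W r)) = x q (\<lambda>r. g r (Y r) (W r) + g r (Z r) (W r))"
    by (rule tangent_cong[OF xq openU q]) (rule g_add_fun(1)[OF q assms])
  then show ?thesis
    using tangent_add[OF xq smooth_fun_nearI[OF g_smooth[OF assms(1,3)] q] smooth_fun_nearI[OF g_smooth[OF assms(2,3)] q]]
    by simp
qed

lemma xg_scale:
  assumes f: "smooth_fun A U f" and Y: "section_on A H U Y" and W: "section_on A H U W"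
  shows "x q (\<lambda>r. g r (f r *\<^sub>R Y r) (W r)) = x q f * g q (Y q) (W q) + f q * x q (\<lambda>r. g r (Y r) (W r))"
proof -
  have "x q (\<lambda>r. g r (f r *\<^sub>R Y r) (W r)) = x q (\<lambda>r. f r * g r (Y r) (W r))"
    by (rule tangent_cong[OF xq openU q]) (rule g_scale_fun(1)[OF q Y W])
  then show ?thesis
    using tangent_mult[OF xq smooth_fun_nearI[OF f q] smooth_fun_nearI[OF g_smooth[OF Y W] q]] by simp
qed

lemma sig_sym:
  assumes Y: "section_on A H U Y" and Z: "section_on A H U Z"
  shows "sig x Y Z q = sig x Z Y q"
proof -
  have "x q (\<lambda>r. g r (Y r) (Z r)) = x q (\<lambda>r. g r (Z r) (Y r))"
    by (rule tangent_cong[OF xq openU q]) (rule g_scale_fun(3)[OF q Y Z])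
  then show ?thesis
    unfolding sig_def
    using P.g_sym[OF bH_in[OF q x section_onD(1)[OF Y]] section_onD(2)[OF Z q]]
      P.g_sym[OF section_onD(2)[OF Y q] bH_in[OF q x section_onD(1)[OF Z]]] by simp
qed

lemma sig_add:
  assumes Y: "section_on A H U Y" and Z: "section_on A H U Z" and W: "section_on A H U W"
  shows "sig x (\<lambda>q. Y q + Z q) W q = sig x Y W q + sig x Z W q"
  unfolding sig_def xg_add[OF assms] bH_add(1)[OF q x section_onD(1)[OF Y] section_onD(1)[OF Z]]
  using section_onD(2)[OF Y q] section_onD(2)[OF Z q] section_onD(2)[OF W q]
    bH_in[OF q x section_onD(1)[OF Y]] bH_in[OF q x section_onD(1)[OF Z]] bH_in[OF q x section_onD(1)[OF W]]
  by simp

lemma sig_scale: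
  assumes f: "smooth_fun A U f" and Y: "section_on A H U Y" and W: "section_on A H U W"
  shows "sig x (\<lambda>q. f q *\<^sub>R Y q) W q = f q * sig x Y W q"
  unfolding sig_def xg_scale[OF assms] bH_scale(1)[OF q x Y f]
  using section_onD(2)[OF Y q] section_onD(2)[OF W q]
    bH_in[OF q x section_onD(1)[OF Y]] bH_in[OF q x section_onD(1)[OF W]]
  by (simp add: algebra_simps)

lemma Sy_in: "Sy x Y q \<in> H q"
  unfolding Sy_def by (intro P.S_sum P.S_closed(3) P.E) simp

lemma g_Sy:
  assumes Y: "section_on A H U Y" and Z: "section_on A H U Z"
  shows "g q (Sy x Y q) (Z q) = sig x Y Z q / 2"
proof -
  have add: "sig x Y (\<lambda>q. Z q + W q) q = sig x Y Z q + sig x Y W q"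
    if Z: "section_on A H U Z" and W: "section_on A H U W" for Z W
    unfolding sig_sym[OF Y sec_add[OF subset_refl Z W]] sig_add[OF Z W Y] sig_sym[OF Y Z] sig_sym[OF Y W] ..
  have scale: "sig x Y (\<lambda>q. f q *\<^sub>R Z q) q = f q *\<^sub>R sig x Y Z q"
    if f: "smooth_fun A U f" and Z: "section_on A H U Z" for f Z
    unfolding sig_sym[OF Y sec_scale[OF subset_refl f Z]] sig_scale[OF f Z Y] sig_sym[OF Y Z] by simp
  have "sig x Y Z q = (\<Sum>a<4*n. co a q (Z q) *\<^sub>R sig x Y (e a) q)"
    by (rule tensorial[where F = "\<lambda>Z. sig x Y Z q", OF subset_refl q Z add scale])
  moreover have "g q (Sy x Y q) (Z q) =
      (\<Sum>a<4*n. g q ((sig x Y (e a) q / (2 * g q (e a q) (e a q))) *\<^sub>R e a q) (Z q))"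
    unfolding Sy_def by (rule P.g_sum_left[OF section_onD(2)[OF Z q]]) (use P.E in simp)
  moreover have "\<dots> = (\<Sum>a<4*n. co a q (Z q) * sig x Y (e a) q / 2)"
    using P.E section_onD(2)[OF Z q] P.g_sym[OF P.E section_onD(2)[OF Z q]]
    by (intro sum.cong) (simp_all add: co_def ac_simps)
  ultimately show ?thesis by (simp add: sum_divide_distrib)
qed

lemma Sy_add:
  assumes Y: "section_on A H U Y" and Z: "section_on A H U Z"
  shows "Sy x (\<lambda>q. Y q + Z q) q = Sy x Y q + Sy x Z q"
  by (rule sec_nondeg[OF q Sy_in P.S_closed(2)[OF Sy_in Sy_in]])
    (simp add: Sy_in section_onD(2)[OF _ q] g_Sy sec_add[OF subset_refl Y Z] Y Z sig_add add_divide_distrib)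

lemma Sy_scale:
  assumes f: "smooth_fun A U f" and Y: "section_on A H U Y"
  shows "Sy x (\<lambda>q. f q *\<^sub>R Y q) q = f q *\<^sub>R Sy x Y q"
  by (rule sec_nondeg[OF q Sy_in P.S_closed(3)[OF Sy_in]])
    (simp add: Sy_in section_onD(2)[OF _ q] g_Sy sec_scale[OF subset_refl f Y] Y f sig_scale)

end

lemma L1_mder: "mder A H g PQ n U \<eta> I e \<xi> x (L1 x)"
proof
  show "vector_field A U x" by (rule x)
next
  fix Y assume Y: "section_on A H U Y"
  have b: "section_on A H U (bH x Y)" if "section_on A H U Y" for Y
    unfolding bH_def[abs_def] by (rule prH_sec[OF subset_refl vf_bracket[OF x section_onD(1)[OF that]]])
  have "section_on A H U (Sy x Y)"
    unfolding Sy_def[abs_def]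
  proof (intro sec_sum sec_scale subset_refl openU)
    fix a assume "a \<in> {..<4*n}"
    then have a: "a < 4 * n" by simp
    note ea = e_sec[OF a]
    show "section_on A H U (e a)" by (rule ea)
    show "smooth_fun A U (\<lambda>q. sig x Y (e a) q / (2 * g q (e a q) (e a q)))"
    proof (rule smooth_fun_divide[OF _ smooth_fun_cmult[OF g_smooth[OF ea ea]]])
      show "smooth_fun A U (sig x Y (e a))"
        unfolding sig_def[abs_def]
        by (rule smooth_fun_diff[OF smooth_fun_diff[OF vf_smooth[OF x subset_refl g_smooth[OF Y ea]]
              g_smooth[OF b[OF Y] ea]] g_smooth[OF Y b[OF ea]]])
      show "2 * g q (e a q) (e a q) \<noteq> 0" if "q \<in> U" for q using e_nz[OF that a] by simp
    qed
  qed
  then show "section_on A H U (L1 x Y)"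
    unfolding L1_def[abs_def] by (rule sec_add[OF subset_refl b[OF Y]])
next
  fix Y Z q assume Y: "section_on A H U Y" and Z: "section_on A H U Z" and q: "q \<in> U"
  interpret P: pq_endo "H q" "g q" "4 * n" "\<lambda>a. e a q" "\<lambda>s. I s q" "PQ q" "e0 q"
    by (rule pointwise[OF q])
  show "L1 x (\<lambda>q. Y q + Z q) q = L1 x Y q + L1 x Z q"
    unfolding L1_def Sy_add[OF q Y Z] bH_add(1)[OF q x section_onD(1)[OF Y] section_onD(1)[OF Z]]
    by (simp only: add_ac)
  note y = section_onD(2)[OF Y q] and z = section_onD(2)[OF Z q]
  note bY = bH_in[OF q x section_onD(1)[OF Y]] and bZ = bH_in[OF q x section_onD(1)[OF Z]]
  have "g q (Y q) (Sy x Z q) = sig x Y Z q / 2"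
    unfolding P.g_sym[OF y Sy_in[OF q]] g_Sy[OF q Z Y] sig_sym[OF q Y Z] ..
  then show "x q (\<lambda>r. g r (Y r) (Z r)) = g q (L1 x Y q) (Z q) + g q (Y q) (L1 x Z q)"
    unfolding L1_def P.g_left(1)[OF z bY Sy_in[OF q]] P.g_right(1)[OF y bZ Sy_in[OF q]] g_Sy[OF q Y Z]
    by (simp only: sig_def) (simp add: field_simps)
next
  fix f Y q assume f: "smooth_fun A U f" and Y: "section_on A H U Y" and q: "q \<in> U"
  show "L1 x (\<lambda>q. f q *\<^sub>R Y q) q = x q f *\<^sub>R Y q + f q *\<^sub>R L1 x Y q"
    unfolding L1_def Sy_scale[OF q f Y] bH_scale(1)[OF q x Y f]
    by (simp only: scaleR_add_right add.assoc)
qed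

interpretation L: mder A H g PQ n U \<eta> I e \<xi> x "L1 x"
  by (rule L1_mder)

lemma cu_smooth:
  assumes u: "u \<in> Idx"
  shows "smooth_fun A U (cu x u)"
proof -
  have s: "smooth_fun A U (\<lambda>q. g q (L.Qv (e a) q - L1 x (e a) q) (I u q (e a q)) / g q (e a q) (e a q))"
    if a: "a < 4 * n" for a
    by (rule smooth_fun_divide[OF g_smooth[OF sec_diff[OF subset_refl L.Qv_sec[OF e_sec[OF a]] L.L_sec[OF e_sec[OF a]]]
          L.sec_IU[OF u e_sec[OF a]]] g_smooth[OF e_sec[OF a] e_sec[OF a]] e_nz[OF _ a]])
  have "smooth_fun A U (\<lambda>q. \<Sum>a<4 * n. g q (L.Qv (e a) q - L1 x (e a) q) (I u q (e a q)) / g q (e a q) (e a q))"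
    by (rule smooth_fun_sum[OF openU]) (rule s, simp)
  then show ?thesis
    unfolding cu_def[abs_def]
    by (rule smooth_fun_divide[OF smooth_fun_cmult smooth_fun_const[OF openU]]) (use n in simp)
qed

lemma Gv_mder: "mder A H g PQ n U \<eta> I e \<xi> x (Gv x)"
proof -
  interpret M: mder A H g PQ n U \<eta> I e \<xi> x L.Qv by (rule L.Qv_mder)
  show ?thesis unfolding Gv_def[abs_def] by (rule M.add_I_mder[OF cu_smooth])
qed

text \<open>The averaged operator commutes with I_t, so only the added combination of the I_u
  contributes.\<close>

lemma Gv_commutator:
  assumes t: "t \<in> Idx" and Y: "section_on A H U Y" and q: "q \<in> U"
  shows "Gv x (\<lambda>r. I t r (Y r)) q - I t q (Gv x Y q) =
    (\<Sum>u\<in>Idx. cu x u q *\<^sub>R (I u q (I t q (Y q)) - I t q (I u q (Y q))))"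
proof -
  interpret P: pq_endo "H q" "g q" "4 * n" "\<lambda>a. e a q" "\<lambda>s. I s q" "PQ q" "e0 q"
    by (rule pointwise[OF q])
  note y = section_onD(2)[OF Y q] and Q = section_onD(2)[OF L.Qv_sec[OF Y] q]
  have cI: "cu x u q *\<^sub>R I u q (Y q) \<in> H q" if "u \<in> Idx" for u
    by (rule P.S_closed(3)[OF P.I_in[OF that y]])
  have "I t q (Gv x Y q) = I t q (L.Qv Y q) + I t q (\<Sum>u\<in>Idx. cu x u q *\<^sub>R I u q (Y q))"
    unfolding Gv_def by (rule P.I_linear(1)[OF t Q P.S_sum[OF cI]])
  also have "I t q (\<Sum>u\<in>Idx. cu x u q *\<^sub>R I u q (Y q)) = (\<Sum>u\<in>Idx. I t q (cu x u q *\<^sub>R I u q (Y q)))"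
    by (rule linear_on_sum[OF P.I_lin[OF t] P.S cI])
  also have "\<dots> = (\<Sum>u\<in>Idx. cu x u q *\<^sub>R I t q (I u q (Y q)))"
    by (rule sum.cong[OF refl]) (rule P.I_linear(2)[OF t P.I_in[OF _ y]])
  finally have *: "I t q (Gv x Y q) = I t q (L.Qv Y q) + (\<Sum>u\<in>Idx. cu x u q *\<^sub>R I t q (I u q (Y q)))" .
  show ?thesis
    unfolding * unfolding Gv_def L.Qv_commute[OF t Y q] scaleR_diff_right sum_subtractf
    by (simp only: add_diff_cancel_left)
qed

text \<open>The total correction consists of the average of the commutators, the symmetric
  \<open>Sy\<close> and the multiples \<open>cu\<close> of the structures, which is the
  decomposition handled by \<open>perp_construction\<close>.\<close>

lemma Gv_perp:
  assumes q: "q \<in> U"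
  shows "\<exists>B\<in>sp_n_sp_1_perp (g q) (PQ q) (H q).
    \<forall>Y. section_on A H U Y \<longrightarrow> B (Y q) = Gv x Y q - bH x Y q"
proof -
  interpret P: pq_endo "H q" "g q" "4 * n" "\<lambda>a. e a q" "\<lambda>s. I s q" "PQ q" "e0 q"
    by (rule pointwise[OF q])
  define R where "R s y = L.R s (ext q y) q" for s y
  define S where "S y = Sy x (ext q y) q" for y
  define Pp where "Pp y = (\<Sum>s\<in>Idx. (\<epsilon> s / 4) *\<^sub>R I s q (R s y))" for y
  define B where "B y = (if y \<in> H q then Pp y + S y + (\<Sum>u\<in>Idx. cu x u q *\<^sub>R I u q y) else 0)" for y
  have Rl: "P.lin_endo (R s)" if s: "s \<in> Idx" for s
    unfolding P.lin_endo_def R_def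
  proof (intro conjI allI impI)
    show "linear_on (H q) (\<lambda>y. L.R s (ext q y) q)"
      by (rule tensor_ext(2)[where F = "\<lambda>Y. L.R s Y q", OF q])
        (rule L.R_add[OF s _ _ q], assumption+, rule L.R_scale[OF s _ _ q], assumption+)
  qed (use L.R_in[OF s ext_sec q] in auto)
  have Sl: "P.lin_endo S"
    unfolding P.lin_endo_def S_def
  proof (intro conjI allI impI)
    show "linear_on (H q) (\<lambda>y. Sy x (ext q y) q)"
      by (rule tensor_ext(2)[where F = "\<lambda>Y. Sy x Y q", OF q])
        (rule Sy_add[OF q], assumption+, rule Sy_scale[OF q], assumption+)
  qed (use Sy_in[OF q] in auto)
  have RY: "L.R s Y q = R s (Y q)" if s: "s \<in> Idx" and Y: "section_on A H U Y" for s Y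
    unfolding R_def
    by (rule tensor_ext(1)[where F = "\<lambda>Y. L.R s Y q", OF q])
      (rule L.R_add[OF s _ _ q], assumption+, rule L.R_scale[OF s _ _ q], assumption+, rule Y)
  have SY: "Sy x Y q = S (Y q)" if Y: "section_on A H U Y" for Y
    unfolding S_def
    by (rule tensor_ext(1)[where F = "\<lambda>Y. Sy x Y q", OF q])
      (rule Sy_add[OF q], assumption+, rule Sy_scale[OF q], assumption+, rule Y)
  have Ranti: "R s (I s q y) = - I s q (R s y)" if s: "s \<in> Idx" and y: "y \<in> H q" for s y
    using RY[OF s L.sec_IU[OF s ext_sec[of q y]]] L.R_anti[OF s ext_sec q, of q y] ext_eq[OF q y]
    by (simp add: R_def)
  have Ssym: "g q (S y) z = g q y (S z)" if y: "y \<in> H q" and z: "z \<in> H q" for y z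
    using g_Sy[OF q ext_sec[of q y] ext_sec[of q z]] g_Sy[OF q ext_sec[of q z] ext_sec[of q y]]
      sig_sym[OF q ext_sec[of q y] ext_sec[of q z]] ext_eq[OF q y] ext_eq[OF q z] P.g_sym[OF y Sy_in[OF q]]
    by (simp add: S_def)
  have QP: "L.Qv Y q - L1 x Y q = Pp (Y q)" if Y: "section_on A H U Y" for Y
    unfolding L.Qv_diff[OF Y q] Pp_def by (simp add: RY[OF _ Y] cong: sum.cong)
  have cu: "cu x u q = \<epsilon> u * P.tr Pp (I u q) / real (4 * n)" for u
    unfolding cu_def P.tr_def using QP[OF e_sec] by simp
  have lP: "P.lin_endo Pp"
    unfolding Pp_def
    by (rule P.lin_endo_sum) (rule P.lin_endo_lin_comb(2)[OF P.lin_endo_comp[OF P.lin_endo_I Rl]])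
  have lB: "P.lin_endo (\<lambda>y. Pp y + S y + (\<Sum>u\<in>Idx. cu x u q *\<^sub>R I u q y))"
    by (intro P.lin_endo_lin_comb(1) lP Sl P.lin_endo_sum P.lin_endo_lin_comb(2) P.lin_endo_I)
  have Be: "B \<in> endos (H q)"
    using P.lin_endoD[OF lB] unfolding endos_def linear_on_def B_def by (simp add: image_subset_iff)
  have "B \<in> sp_n_sp_1_perp (g q) (PQ q) (H q)"
  proof (rule P.perp_construction[where R = R and P = Pp and c = "\<lambda>u. cu x u q", OF Sl])
    show "B y = Pp y + S y + (\<Sum>u\<in>Idx. cu x u q *\<^sub>R I u q y)" if "y \<in> H q" for y
      using that by (simp only: B_def if_True)
  qed (rule Ssym Rl Ranti Pp_def cu Be, assumption?, assumption?)+
  moreover have "B (Y q) = Gv x Y q - bH x Y q" if Y: "section_on A H U Y" for Y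
  proof -
    have "L.Qv Y q = Pp (Y q) + L1 x Y q" using QP[OF Y] by (simp add: diff_eq_eq)
    then show ?thesis
      using section_onD(2)[OF Y q] unfolding B_def Gv_def L1_def SY[OF Y]
      by (simp add: algebra_simps)
  qed
  ultimately show ?thesis by blast
qed

end

end

text \<open>Structure constants: \<open>[I\<^sub>u, I\<^sub>t] = \<Sum>\<^sub>w br u t w I\<^sub>w\<close>.\<close>

definition br :: "nat \<Rightarrow> nat \<Rightarrow> nat \<Rightarrow> real" where
  "br u t w = (if cyc u t w then - 2 * \<epsilon> w else if cyc t u w then 2 * \<epsilon> w else 0)"

lemma (in pq_space) I_commutator:
  assumes u: "u \<in> Idx" and t: "t \<in> Idx" and x: "x \<in> S"
  shows "I u (I t x) - I t (I u x) = (\<Sum>w\<in>Idx. br u t w *\<^sub>R I w x)"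
proof (cases "u = t")
  case True
  then have "br u t w = 0" for w by (simp add: br_def cyc_def)
  then show ?thesis using True by simp
next
  case False
  then obtain k where k: "cyc u t k \<or> cyc t u k" using cyc_pair[OF u t] by blast
  then have kI: "k \<in> Idx" using cyc_mem by blast
  have b: "br u t w = (if w = k then br u t k else 0)" if "w \<in> Idx" for w
    using k by (auto simp: br_def cyc_def)
  have "(\<Sum>w\<in>Idx. br u t w *\<^sub>R I w x) = (\<Sum>w\<in>Idx. if w = k then br u t k *\<^sub>R I k x else 0)"
    by (rule sum.cong[OF refl], subst b) auto
  also have "\<dots> = br u t k *\<^sub>R I k x" using kI by simp
  also have "\<dots> = I u (I t x) - I t (I u x)"
    using k
  proof
    assume c: "cyc u t k"
    then have b: "br u t k = - \<epsilon> k - \<epsilon> k" by (simp add: br_def)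
    show ?thesis unfolding b I_cyc[OF c x] by (rule scaleR_left_diff_distrib)
  next
    assume c: "cyc t u k"
    then have "\<not> cyc u t k" 
      unfolding cyc_def insert_iff prod.inject empty_iff by (elim disjE conjE FalseE) simp_all
    with c have b: "br u t k = \<epsilon> k - (- \<epsilon> k)" by (simp add: br_def)
    show ?thesis unfolding b I_cyc[OF c x] by (rule scaleR_left_diff_distrib)
  qed
  finally show ?thesis by simp
qed

section \<open>Existence\<close>

lemma linear_on_eval: "linear_on S (\<lambda>v. v f :: real)" for S :: "('b \<Rightarrow> real) set"
  by (simp add: linear_on_def)

lemma tvec_sum_apply: "(\<Sum>i\<in>J. c i *\<^sub>R X i) f = (\<Sum>i\<in>J. c i * X i f)" for X :: "'c \<Rightarrow> 'b \<Rightarrow> real"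
  using linear_on_sum[OF linear_on_eval[of UNIV f] subspace_UNIV, of J "\<lambda>i. c i *\<^sub>R X i"] by simp

section \<open>The connection on H, assembled from the frame directions\<close>

locale reeb_frame = pqc_dual +
  assumes reeb: "q \<in> U \<Longrightarrow> s \<in> Idx \<Longrightarrow> x \<in> H q \<Longrightarrow> af s s q x = 0"
begin

text \<open>\<open>fr\<close> is a frame of the tangent bundle and \<open>cf\<close> its dual, \<open>Lf i\<close> differentiates sections of \<open>H\<close>
  along \<open>fr i\<close>, and \<open>AA\<close> are the resulting connection forms on \<open>PQ\<close>.\<close>

definition fr :: "nat \<Rightarrow> 'a \<Rightarrow> 'a tvec" where
  "fr i = (if i < 4 * n then e i else \<xi> (i - 4 * n + 1))"

definition cf :: "nat \<Rightarrow> 'a \<Rightarrow> 'a tvec \<Rightarrow> real" where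
  "cf i q v = (if i < 4 * n then co i q (prH q v) else \<eta> (i - 4 * n + 1) q v)"

definition Lf :: "nat \<Rightarrow> ('a \<Rightarrow> 'a tvec) \<Rightarrow> 'a \<Rightarrow> 'a tvec" where
  "Lf i = (if i < 4 * n then K (e i) else Gv (\<xi> (i - 4 * n + 1)))"

text \<open>The coefficients of the derivative of I_t along \<open>fr i\<close>. In horizontal
  directions they are the structure forms, by the Reeb condition; in vertical directions they come
  from the commutators of the added terms \<open>cu\<close> I_u.\<close>

definition Nf :: "nat \<Rightarrow> nat \<Rightarrow> nat \<Rightarrow> 'a \<Rightarrow> real" where
  "Nf t w i q = (if i < 4 * n then af t w q (e i q)
     else (\<Sum>u\<in>Idx. br u t w * cu (\<xi> (i - 4 * n + 1)) u q))"

definition DH :: "'a \<Rightarrow> 'a tvec \<Rightarrow> ('a \<Rightarrow> 'a tvec) \<Rightarrow> 'a tvec" where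
  "DH q v Y = (\<Sum>i<4*n+3. cf i q v *\<^sub>R Lf i Y q)"

definition AA :: "nat \<Rightarrow> nat \<Rightarrow> 'a \<Rightarrow> 'a tvec \<Rightarrow> real" where
  "AA t w q v = (\<Sum>i<4*n+3. cf i q v * Nf t w i q)"

lemma fr_Idx: "\<not> i < 4 * n \<Longrightarrow> i < 4 * n + 3 \<Longrightarrow> i - 4 * n + 1 \<in> Idx"
  by (auto simp: Idx_def)

text \<open>The indices 4n, 4n + 1, 4n + 2 stand for \<xi>_1, \<xi>_2, \<xi>_3, numbered from 1;
  hence the shift by 4n - 1.\<close>

lemma frame_sum:
  fixes f h :: "nat \<Rightarrow> 'c::comm_monoid_add"
  shows "(\<Sum>i<4*n+3. if i < 4 * n then f i else h (i - 4 * n + 1)) = (\<Sum>a<4*n. f a) + (\<Sum>s\<in>Idx. h s)"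
proof -
  have "{..<4*n+3} = {..<4*n} \<union> (\<lambda>s. s + 4 * n - 1) ` Idx"
    by (auto simp: Idx_def)
  moreover have "inj_on (\<lambda>s. s + 4 * n - 1) Idx" by (auto simp: inj_on_def Idx_def)
  moreover have "{..<4*n} \<inter> (\<lambda>s. s + 4 * n - 1) ` Idx = {}" by (auto simp: Idx_def)
  moreover have "s + 4 * n - 1 - 4 * n + 1 = s \<and> \<not> s + 4 * n - 1 < 4 * n" if "s \<in> Idx" for s
    using that by (auto simp: Idx_def)
  moreover have "(\<Sum>i<4*n. if i < 4 * n then f i else h (i - 4 * n + 1)) = (\<Sum>a<4*n. f a)"
    by (rule sum.cong[OF refl]) simp
  ultimately show ?thesis
    by (simp add: sum.union_disjoint sum.reindex cong: sum.cong)
qed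

text \<open>None of the constructions mentions \<open>U\<close>, so over a smaller open set they are
  literally the same functions. This is how results for sections over \<open>U\<close> reach
  sections defined only near a point.\<close>

lemma restrict_reeb:
  assumes W: "open W" "W \<subseteq> U"
  shows "reeb_frame A H g PQ n W \<eta> I e \<xi>"
proof -
  interpret F: pqc_frame A H g PQ n W \<eta> I e by (rule restrict[OF W])
  have "pqc_dual A H g PQ n W \<eta> I e \<xi>"
    by standard (rule vf_subset[OF xi W], assumption, use dual W in blast)
  then show ?thesis
    by (rule reeb_frame.intro) (unfold_locales, use reeb W in blast)
qed

lemma K_mder: "section_on A H U x \<Longrightarrow> mder A H g PQ n U \<eta> I e \<xi> x (K x)"
proof -
  assume x: "section_on A H U x"
  interpret C: hconn A H g PQ n U \<eta> I e \<xi> K by (rule Koszul_hconn)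
  show ?thesis
    by standard (rule section_onD(1)[OF x] C.D_sec[OF x] C.D_add2[OF x] C.D_leib[OF _ x] C.D_metric[OF x];
      assumption)+
qed

lemma Lf_mder:
  assumes i: "i < 4 * n + 3"
  shows "mder A H g PQ n U \<eta> I e \<xi> (fr i) (Lf i)"
proof (cases "i < 4 * n")
  case True
  show ?thesis unfolding fr_def Lf_def if_P[OF True] by (rule K_mder[OF e_sec[OF True]])
next
  case False
  show ?thesis unfolding fr_def Lf_def if_not_P[OF False] by (rule Gv_mder[OF xi[OF fr_Idx[OF False i]]])
qed

lemma cf_linear:
  assumes q: "q \<in> U" and i: "i < 4 * n + 3"
  shows "linear_on (tangent_space A q) (cf i q)"
proof (cases "i < 4 * n")
  case True
  note l = linear_onD[OF prH_linear[OF q]] and c = linear_onD[OF co_linear[OF q True]]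
  show ?thesis
    unfolding cf_def if_P[OF True] linear_on_def
    by (intro conjI ballI allI) (simp_all only: l c prH_in[OF q])
next
  case False
  show ?thesis
    unfolding cf_def if_not_P[OF False] by (rule eta_linear[OF q fr_Idx[OF False i]])
qed

lemma cf_smooth:
  assumes X: "vector_field A U X" and i: "i < 4 * n + 3"
  shows "smooth_fun A U (\<lambda>q. cf i q (X q))"
proof (cases "i < 4 * n")
  case True
  show ?thesis
    unfolding cf_def if_P[OF True] by (rule co_smooth[OF subset_refl prH_sec[OF subset_refl X] True])
next
  case False
  show ?thesis
    unfolding cf_def if_not_P[OF False] by (rule eta_smooth[OF fr_Idx[OF False i] subset_refl X])
qed

lemma Nf_smooth:
  assumes i: "i < 4 * n + 3" and t: "t \<in> Idx" and w: "w \<in> Idx"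
  shows "smooth_fun A U (Nf t w i)"
proof (cases "i < 4 * n")
  case True
  have "smooth_fun A U (\<lambda>q. \<epsilon> t * \<epsilon> w * \<eta> t q (lie_bracket A (\<xi> w) (e i) q))"
    by (rule smooth_fun_cmult[OF eta_smooth[OF t subset_refl vf_bracket[OF xi[OF w] section_onD(1)[OF e_sec[OF True]]]]])
  then show ?thesis
    unfolding Nf_def[abs_def] if_P[OF True]
    by (rule smooth_fun_cong) (rule af_eq[OF subset_refl e_sec[OF True] _ t w, symmetric])
next
  case False
  show ?thesis
    unfolding Nf_def[abs_def] if_not_P[OF False]
    by (rule smooth_fun_sum[OF openU smooth_fun_cmult[OF cu_smooth[OF xi[OF fr_Idx[OF False i]]]]])
qed

lemma AA_smooth:
  assumes X: "vector_field A U X" and t: "t \<in> Idx" and w: "w \<in> Idx"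
  shows "smooth_fun A U (\<lambda>q. AA t w q (X q))"
  unfolding AA_def
  by (rule smooth_fun_sum[OF openU smooth_fun_mult[OF cf_smooth[OF X] Nf_smooth[OF _ t w]]]) simp_all

lemma DH_sec:
  assumes X: "vector_field A U X" and Y: "section_on A H U Y"
  shows "section_on A H U (\<lambda>q. DH q (X q) Y)"
  unfolding DH_def
proof (rule sec_sum[OF subset_refl openU])
  fix i assume "i \<in> {..<4*n+3}"
  then have i: "i < 4 * n + 3" by simp
  interpret L: mder A H g PQ n U \<eta> I e \<xi> "fr i" "Lf i" by (rule Lf_mder[OF i])
  show "section_on A H U (\<lambda>q. cf i q (X q) *\<^sub>R Lf i Y q)"
    by (rule sec_scale[OF subset_refl cf_smooth[OF X i] L.L_sec[OF Y]])
qed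

context
  fixes q assumes q: "q \<in> U"
begin

interpretation P: pq_endo "H q" "g q" "4 * n" "\<lambda>a. e a q" "\<lambda>s. I s q" "PQ q" "e0 q"
  by (rule pointwise[OF q])

lemma Lf_in: "i < 4 * n + 3 \<Longrightarrow> section_on A H U Y \<Longrightarrow> Lf i Y q \<in> H q"
  using section_onD(2)[OF mder.L_sec[OF Lf_mder] q] .

lemma DH_in: "section_on A H U Y \<Longrightarrow> DH q v Y \<in> H q"
  unfolding DH_def by (rule P.S_sum) (rule P.S_closed(3)[OF Lf_in], simp_all)

lemma DH_linear: "linear_on (tangent_space A q) (\<lambda>v. DH q v Y)"
  unfolding DH_def by (rule linear_on_sum_fun, rule linear_on_scaleR_vec, rule cf_linear[OF q]) simp

lemma AA_linear: "linear_on (tangent_space A q) (AA t w q)"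
proof -
  have "linear_on (tangent_space A q) (\<lambda>v. \<Sum>i<4*n+3. cf i q v *\<^sub>R Nf t w i q)"
    by (rule linear_on_sum_fun, rule linear_on_scaleR_vec, rule cf_linear[OF q]) simp
  then show ?thesis unfolding AA_def[abs_def] real_scaleR_def .
qed

lemma DH_add:
  assumes "section_on A H U Y" "section_on A H U Z"
  shows "DH q v (\<lambda>r. Y r + Z r) = DH q v Y + DH q v Z"
proof -
  have "cf i q v *\<^sub>R Lf i (\<lambda>r. Y r + Z r) q = cf i q v *\<^sub>R Lf i Y q + cf i q v *\<^sub>R Lf i Z q"
    if "i \<in> {..<4*n+3}" for i
    unfolding mder.L_add[OF Lf_mder assms q, of i] using that mder.L_add[OF Lf_mder assms q, of i]
    by (simp only: lessThan_iff scaleR_add_right)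
  then show ?thesis unfolding DH_def sum.distrib[symmetric] by (rule sum.cong[OF refl])
qed

lemma v_expand:
  assumes v: "v \<in> tangent_space A q"
  shows "v = (\<Sum>i<4*n+3. cf i q v *\<^sub>R fr i q)"
proof -
  have "(\<Sum>i<4*n+3. cf i q v *\<^sub>R fr i q) = (\<Sum>i<4*n+3. if i < 4 * n then co i q (prH q v) *\<^sub>R e i q
      else \<eta> (i - 4 * n + 1) q v *\<^sub>R \<xi> (i - 4 * n + 1) q)"
    by (rule sum.cong[OF refl]) (simp add: cf_def fr_def)
  also have "\<dots> = (\<Sum>a<4*n. co a q (prH q v) *\<^sub>R e a q) + (\<Sum>s\<in>Idx. \<eta> s q v *\<^sub>R \<xi> s q)"
    by (rule frame_sum)
  also have "\<dots> = prH q v + prV q v"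
    unfolding frame_expand[OF q prH_in[OF q v], symmetric] prV_def ..
  also have "\<dots> = v" by (simp add: prH_def)
  finally show ?thesis by (rule sym)
qed

lemma v_apply:
  assumes v: "v \<in> tangent_space A q"
  shows "v f = (\<Sum>i<4*n+3. cf i q v * fr i q f)"
  by (subst v_expand[OF v]) (rule tvec_sum_apply)

lemma DH_leib:
  assumes v: "v \<in> tangent_space A q" and f: "smooth_fun A U f" and Y: "section_on A H U Y"
  shows "DH q v (\<lambda>r. f r *\<^sub>R Y r) = v f *\<^sub>R Y q + f q *\<^sub>R DH q v Y"
proof -
  have "cf i q v *\<^sub>R Lf i (\<lambda>r. f r *\<^sub>R Y r) q =
      (cf i q v * fr i q f) *\<^sub>R Y q + f q *\<^sub>R cf i q v *\<^sub>R Lf i Y q" if "i \<in> {..<4*n+3}" for i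
    using that mder.L_leib[OF Lf_mder f Y q, of i]
    by (simp only: lessThan_iff scaleR_add_right scaleR_scaleR mult.commute)
  then have "DH q v (\<lambda>r. f r *\<^sub>R Y r) =
      (\<Sum>i<4*n+3. (cf i q v * fr i q f) *\<^sub>R Y q + f q *\<^sub>R cf i q v *\<^sub>R Lf i Y q)"
    unfolding DH_def by (rule sum.cong[OF refl])
  then show ?thesis
    unfolding v_apply[OF v, of f] DH_def sum.distrib scaleR_sum_left scaleR_sum_right .
qed

lemma DH_metric:
  assumes v: "v \<in> tangent_space A q" and Y: "section_on A H U Y" and Z: "section_on A H U Z"
  shows "v (\<lambda>r. g r (Y r) (Z r)) = g q (DH q v Y) (Z q) + g q (Y q) (DH q v Z)"
proof -
  note y = section_onD(2)[OF Y q] and z = section_onD(2)[OF Z q]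
  have 1: "g q (DH q v Y) (Z q) = (\<Sum>i<4*n+3. cf i q v * g q (Lf i Y q) (Z q))"
    unfolding DH_def using P.g_sum_left[OF z, of "{..<4*n+3}" "\<lambda>i. cf i q v *\<^sub>R Lf i Y q"] Lf_in[OF _ Y] z
    by simp
  have 2: "g q (Y q) (DH q v Z) = (\<Sum>i<4*n+3. cf i q v * g q (Y q) (Lf i Z q))"
    unfolding DH_def using P.g_sum_right[OF y, of "{..<4*n+3}" "\<lambda>i. cf i q v *\<^sub>R Lf i Z q"] Lf_in[OF _ Z] y
    by simp
  have "cf i q v * fr i q (\<lambda>r. g r (Y r) (Z r)) =
      cf i q v * g q (Lf i Y q) (Z q) + cf i q v * g q (Y q) (Lf i Z q)" if "i \<in> {..<4*n+3}" for i
    using that mder.L_metric[OF Lf_mder Y Z q, of i] by (simp only: lessThan_iff distrib_left)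
  then show ?thesis
    unfolding v_apply[OF v, of "\<lambda>r. g r (Y r) (Z r)"] 1 2 sum.distrib[symmetric] by (rule sum.cong[OF refl])
qed

lemma DH_cong:
  assumes v: "v \<in> tangent_space A q" and Y: "section_on A H U Y" and eq: "\<And>r. r \<in> U \<Longrightarrow> Y r = Y' r"
  shows "DH q v Y = DH q v Y'"
proof -
  have Y': "section_on A H U Y'" by (rule sec_cong[OF Y eq])
  define c where "c = (\<lambda>q. if q \<in> U then 1::real else 0)"
  have c: "smooth_fun A U c" unfolding c_def by (rule smooth_fun_indicator[OF openU])
  have "v c = v (\<lambda>r. 1)"
    by (rule tangent_cong[OF v openU q]) (simp add: c_def)
  then have vc: "v c = 0" using tangent_const[OF v] by simp
  have "(\<lambda>r. c r *\<^sub>R Y r) = (\<lambda>r. c r *\<^sub>R Y' r)" using eq by (auto simp: c_def)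
  then have "DH q v (\<lambda>r. c r *\<^sub>R Y r) = DH q v (\<lambda>r. c r *\<^sub>R Y' r)" by (rule arg_cong)
  moreover have "c q = 1" using q by (simp add: c_def)
  ultimately show ?thesis
    unfolding DH_leib[OF v c Y] DH_leib[OF v c Y'] vc by (simp only: scaleR_zero_left scaleR_one add_0_left)
qed

lemma DH_zero:
  assumes v: "v \<in> tangent_space A q"
  shows "DH q v (\<lambda>r. 0) = 0"
proof -
  have "DH q v (\<lambda>r. 0 *\<^sub>R ext q 0 r) = v (\<lambda>r. 0) *\<^sub>R ext q 0 q + 0 *\<^sub>R DH q v (ext q 0)"
    by (rule DH_leib[OF v smooth_fun_const[OF openU] ext_sec])
  then show ?thesis using tangent_const[OF v, of 0] by simp
qed

lemma DH_horizontal: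
  assumes X: "section_on A H U X" and Y: "section_on A H U Y"
  shows "DH q (X q) Y = K X Y q"
proof -
  interpret C: hconn A H g PQ n U \<eta> I e \<xi> K by (rule Koszul_hconn)
  note x = section_onD(2)[OF X q]
  have "cf i q (X q) *\<^sub>R Lf i Y q = (if i < 4 * n then co i q (X q) *\<^sub>R K (e i) Y q else 0)"
    if "i \<in> {..<4*n+3}" for i
  proof (cases "i < 4 * n")
    case False
    then have "cf i q (X q) = 0" using eta_H[OF q fr_Idx[OF False] x] that by (simp add: cf_def)
    then show ?thesis using False by simp
  qed (simp add: cf_def Lf_def prH_id[OF q x])
  then have "DH q (X q) Y = (\<Sum>i<4*n+3. if i < 4 * n then co i q (X q) *\<^sub>R K (e i) Y q else 0)"
    unfolding DH_def by (rule sum.cong[OF refl])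
  also have "\<dots> = (\<Sum>a<4*n. co a q (X q) *\<^sub>R K (e a) Y q)"
    using frame_sum[of "\<lambda>i. co i q (X q) *\<^sub>R K (e i) Y q" "\<lambda>_. 0"] by simp
  also have "\<dots> = K X Y q"
    by (rule tensorial[where F = "\<lambda>X. K X Y q", OF subset_refl q X, symmetric])
      (rule C.D_add1[OF _ _ Y q], assumption+, rule C.D_scale1[OF _ _ Y q], assumption+)
  finally show ?thesis .
qed

lemma DH_vertical:
  assumes p: "prH q v = 0"
  shows "DH q v Y = (\<Sum>s\<in>Idx. \<eta> s q v *\<^sub>R Gv (\<xi> s) Y q)"
proof -
  have z: "co i q 0 = 0" if "i < 4 * n" for i
    by (rule linear_on_zero[OF co_linear[OF q that] P.S])
  have "DH q v Y = (\<Sum>i<4*n+3. if i < 4 * n then 0 else \<eta> (i - 4 * n + 1) q v *\<^sub>R Gv (\<xi> (i - 4 * n + 1)) Y q)"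
    unfolding DH_def by (rule sum.cong[OF refl]) (simp add: cf_def Lf_def p z)
  also have "\<dots> = (\<Sum>s\<in>Idx. \<eta> s q v *\<^sub>R Gv (\<xi> s) Y q)"
    unfolding frame_sum[of "\<lambda>_. 0" "\<lambda>s. \<eta> s q v *\<^sub>R Gv (\<xi> s) Y q"] by simp
  finally show ?thesis .
qed

lemma Lf_I:
  assumes i: "i < 4 * n + 3" and t: "t \<in> Idx" and Y: "section_on A H U Y"
  shows "Lf i (\<lambda>r. I t r (Y r)) q - I t q (Lf i Y q) = (\<Sum>w\<in>Idx. Nf t w i q *\<^sub>R I w q (Y q))"
proof (cases "i < 4 * n")
  case True
  interpret C: hconn A H g PQ n U \<eta> I e \<xi> K by (rule Koszul_hconn)
  have "K (e i) (\<lambda>r. I t r (Y r)) q - I t q (K (e i) Y q) = C.Nt t (e i) Y q"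
    by (simp only: C.Nt_def)
  also have "\<dots> = (\<Sum>w\<in>Idx. af t w q (e i q) *\<^sub>R I w q (Y q))"
    by (rule C.reeb_imp_preserving[OF q reeb[OF q] t e_sec[OF True] Y])
  finally show ?thesis unfolding Lf_def Nf_def if_P[OF True] .
next
  case False
  let ?x = "\<xi> (i - 4 * n + 1)"
  note y = section_onD(2)[OF Y q]
  have "Gv ?x (\<lambda>r. I t r (Y r)) q - I t q (Gv ?x Y q) =
      (\<Sum>u\<in>Idx. cu ?x u q *\<^sub>R (I u q (I t q (Y q)) - I t q (I u q (Y q))))"
    by (rule Gv_commutator[OF xi[OF fr_Idx[OF False i]] t Y q])
  also have "\<dots> = (\<Sum>u\<in>Idx. cu ?x u q *\<^sub>R (\<Sum>w\<in>Idx. br u t w *\<^sub>R I w q (Y q)))"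
    by (rule sum.cong[OF refl]) (simp only: P.I_commutator[OF _ t y])
  also have "\<dots> = (\<Sum>w\<in>Idx. \<Sum>u\<in>Idx. (br u t w * cu ?x u q) *\<^sub>R I w q (Y q))"
    unfolding scaleR_sum_right by (subst sum.swap) (simp only: scaleR_scaleR mult.commute)
  also have "\<dots> = (\<Sum>w\<in>Idx. (\<Sum>u\<in>Idx. br u t w * cu ?x u q) *\<^sub>R I w q (Y q))"
    by (simp only: scaleR_sum_left)
  finally show ?thesis unfolding Lf_def Nf_def if_not_P[OF False] .
qed

lemma DH_I:
  assumes t: "t \<in> Idx" and Y: "section_on A H U Y"
  shows "DH q v (\<lambda>r. I t r (Y r)) = I t q (DH q v Y) + (\<Sum>w\<in>Idx. AA t w q v *\<^sub>R I w q (Y q))"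
proof -
  have s: "cf i q v *\<^sub>R Lf i Y q \<in> H q" if "i \<in> {..<4*n+3}" for i
    by (rule P.S_closed(3)[OF Lf_in[OF _ Y]]) (use that in simp)
  have "I t q (DH q v Y) = (\<Sum>i<4*n+3. I t q (cf i q v *\<^sub>R Lf i Y q))"
    unfolding DH_def by (rule linear_on_sum[OF P.I_lin[OF t] P.S s])
  also have "\<dots> = (\<Sum>i<4*n+3. cf i q v *\<^sub>R I t q (Lf i Y q))"
    by (rule sum.cong[OF refl]) (rule P.I_linear(2)[OF t Lf_in[OF _ Y]], simp)
  finally have 1: "I t q (DH q v Y) = (\<Sum>i<4*n+3. cf i q v *\<^sub>R I t q (Lf i Y q))" .
  have 2: "(\<Sum>w\<in>Idx. AA t w q v *\<^sub>R I w q (Y q)) =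
      (\<Sum>i<4*n+3. cf i q v *\<^sub>R (\<Sum>w\<in>Idx. Nf t w i q *\<^sub>R I w q (Y q)))"
    unfolding AA_def scaleR_sum_left scaleR_sum_right by (subst sum.swap) (simp only: scaleR_scaleR)
  have "cf i q v *\<^sub>R Lf i (\<lambda>r. I t r (Y r)) q =
      cf i q v *\<^sub>R I t q (Lf i Y q) + cf i q v *\<^sub>R (\<Sum>w\<in>Idx. Nf t w i q *\<^sub>R I w q (Y q))"
    if "i \<in> {..<4*n+3}" for i
    unfolding Lf_I[OF that[unfolded lessThan_iff] t Y, symmetric] 
    by (simp only: scaleR_diff_right add.commute[of _ "_ - _"] diff_add_cancel)
  then show ?thesis
    unfolding 1 2 sum.distrib[symmetric] unfolding DH_def by (rule sum.cong[OF refl])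
qed

end

end

lemma fun_sum_apply: "(\<Sum>i\<in>J. c i *\<^sub>R X i) x = (\<Sum>i\<in>J. c i *\<^sub>R X i x)"
  for X :: "'c \<Rightarrow> 'b \<Rightarrow> 'd::real_vector"
proof -
  have "linear_on UNIV (\<lambda>F :: 'b \<Rightarrow> 'd. F x)" by (simp add: linear_on_def)
  from linear_on_sum[OF this subspace_UNIV, of J "\<lambda>i. c i *\<^sub>R X i"] show ?thesis by simp
qed

lemma dual_independent:
  fixes f :: "nat \<Rightarrow> 'b::real_vector \<Rightarrow> real"
  assumes J: "finite J" and S: "subspace S" and x: "\<And>i. i \<in> J \<Longrightarrow> x i \<in> S"
    and f: "\<And>i. i \<in> J \<Longrightarrow> linear_on S (f i)"
    and fx: "\<And>i j. i \<in> J \<Longrightarrow> j \<in> J \<Longrightarrow> f i (x j) = (if i = j then 1 else 0)"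
  shows "inj_on x J" "independent (x ` J)"
proof -
  show inj: "inj_on x J"
  proof (rule inj_onI)
    fix i j assume "i \<in> J" "j \<in> J" "x i = x j"
    then show "i = j" using fx[of i i] fx[of i j] by (auto split: if_splits)
  qed
  show "independent (x ` J)"
  proof
    assume "dependent (x ` J)"
    then obtain u i where i: "i \<in> J" "u (x i) \<noteq> 0" and "(\<Sum>v\<in>x ` J. u v *\<^sub>R v) = 0"
      unfolding dependent_finite[OF finite_imageI[OF J]] by auto
    then have 0: "(\<Sum>j\<in>J. u (x j) *\<^sub>R x j) = 0" by (simp add: sum.reindex[OF inj])
    have "f i (\<Sum>j\<in>J. u (x j) *\<^sub>R x j) = (\<Sum>j\<in>J. f i (u (x j) *\<^sub>R x j))"
      by (rule linear_on_sum[OF f[OF i(1)] S]) (rule subspace_scale[OF S x])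
    also have "\<dots> = (\<Sum>j\<in>J. if j = i then u (x i) else 0)"
      by (rule sum.cong[OF refl]) (simp add: linear_onD(2)[OF f[OF i(1)] x] fx i(1))
    also have "\<dots> = u (x i)" using i(1) J by simp
    finally show False using i(2) linear_on_zero[OF f[OF i(1)] S] unfolding 0 by simp
  qed
qed

lemma (in smooth_mfd) section_common:
  assumes "open U" "q \<in> U" "section_near A E q Y" "section_near A F q Z"
  obtains W where "open W" "W \<subseteq> U" "q \<in> W" "section_on A E W Y" "section_on A F W Z"
proof -
  obtain W1 W2 where W: "q \<in> W1" "section_on A E W1 Y" "q \<in> W2" "section_on A F W2 Z"
    using assms(3,4) unfolding section_near_def by blast
  have o: "open W1" "open W2" using vf_open section_onD(1) W by blast+
  show thesis
  proof
    show "section_on A E (U \<inter> (W1 \<inter> W2)) Y" "section_on A F (U \<inter> (W1 \<inter> W2)) Z"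
      by (rule section_subset[OF W(2)] section_subset[OF W(4)]; use o assms(1) in blast)+
  qed (use W o assms in auto)
qed

text \<open>Vector fields are treated as sections of the family of full sets, so that
  \<open>section_common\<close> also serves for them.\<close>

lemma section_UNIV: "section_on A (\<lambda>_. UNIV) W Y = vector_field A W Y"
  "section_near A (\<lambda>_. UNIV) q Y = vector_field_near A q Y"
  by (simp_all add: section_on_def section_near_def vector_field_near_def)

lemma (in pq_endo) perp_subspace: "subspace (sp_n_sp_1_perp g Q S)"
proof (rule subspaceI)
  have z: "linear_on S (\<lambda>x. 0 :: 'a)" by (simp add: linear_on_def)
  have tr: "tr (B + C) D = tr B D + tr C D" "tr (c *\<^sub>R B) D = c * tr B D" "tr 0 D = 0"
    if "lin_endo B" "lin_endo C" "lin_endo D" for B C D c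
    unfolding tr_def using that E
    by (simp_all add: lin_endoD(1) add_divide_distrib sum.distrib sum_distrib_left linear_on_zero[OF g_lin_left S])
  have I: "lin_endo (I s)" if "s \<in> Idx" for s by (rule lin_endo_I[OF that])
  have sp: "lin_endo C" if "C \<in> sp_n g Q S" for C by (rule lin_endo_endos[OF sp_nD(1)[OF that]])
  show "0 \<in> sp_n_sp_1_perp g Q S"
    by (rule perpI[OF endos_lin_comb(3)]) (rule tr(3)[OF I I I] tr(3)[OF sp sp sp]; assumption)+
  fix B assume B: "B \<in> sp_n_sp_1_perp g Q S"
  note b = perpD[OF B] and lB = lin_endo_endos[OF perpD(1)[OF B]]
  show "c *\<^sub>R B \<in> sp_n_sp_1_perp g Q S" for c
    by (rule perpI[OF endos_lin_comb(2)[OF b(1)]]) (simp_all add: tr(2)[OF lB lB I] tr(2)[OF lB lB sp] b)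
  fix C assume C: "C \<in> sp_n_sp_1_perp g Q S"
  note c = perpD[OF C] and lC = lin_endo_endos[OF perpD(1)[OF C]]
  show "B + C \<in> sp_n_sp_1_perp g Q S"
    by (rule perpI[OF endos_lin_comb(1)[OF b(1) c(1)]]) (simp_all add: tr(1)[OF lB lC I] tr(1)[OF lB lC sp] b c)
qed

text \<open>The coefficients exist at each point by the definition of PQ. Their smoothness comes
  from reading them off as inner products of \<sigma> (e 0) with I_s (e 0), whose square length
  -\<epsilon>_s g(e 0, e 0) is nowhere zero.\<close>

lemma (in pqc_frame) endo_expand:
  assumes \<sigma>: "endo_field A H U \<sigma>" "\<And>r. r \<in> U \<Longrightarrow> \<sigma> r \<in> PQ r"
  obtains f where "\<And>s. s \<in> Idx \<Longrightarrow> smooth_fun A U (f s)"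
    "\<And>r x. r \<in> U \<Longrightarrow> \<sigma> r x = (\<Sum>s\<in>Idx. f s r *\<^sub>R I s r x)"
proof
  define G where "G r = g r (e 0 r) (e 0 r)" for r
  let ?f = "\<lambda>s r. g r (\<sigma> r (e 0 r)) (I s r (e 0 r)) / (- \<epsilon> s * G r)"
  have n0: "0 < 4 * n" using n by simp
  note e = e_sec[OF n0]
  show "smooth_fun A U (?f s)" if s: "s \<in> Idx" for s
  proof (rule smooth_fun_divide[OF g_smooth smooth_fun_cmult])
    show "section_on A H U (\<lambda>r. \<sigma> r (e 0 r))" using \<sigma>(1) e unfolding endo_field_def by blast
    show "section_on A H U (\<lambda>r. I s r (e 0 r))" by (rule sec_I[OF s subset_refl e])
    show "smooth_fun A U G" unfolding G_def[abs_def] by (rule g_smooth[OF e e])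
    show "- \<epsilon> s * G r \<noteq> 0" if "r \<in> U" for r using e_nz[OF that n0] by (simp add: G_def)
  qed
  fix r x assume r: "r \<in> U"
  interpret P: pq_endo "H r" "g r" "4 * n" "\<lambda>a. e a r" "\<lambda>s. I s r" "PQ r" "e0 r"
    by (rule pointwise[OF r])
  note er = section_onD(2)[OF e r]
  obtain c where c: "\<And>x. \<sigma> r x = (\<Sum>t\<in>Idx. c t *\<^sub>R I t r x)" using P.Q_apply[OF \<sigma>(2)[OF r]] by blast
  have "?f s r = c s" if s: "s \<in> Idx" for s
  proof -
    have "g r (\<sigma> r (e 0 r)) (I s r (e 0 r)) = (\<Sum>t\<in>Idx. g r (c t *\<^sub>R I t r (e 0 r)) (I s r (e 0 r)))"
      unfolding c by (rule P.g_sum_left[OF P.I_in[OF s er]]) (rule P.S_closed(3)[OF P.I_in[OF _ er]])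
    also have "\<dots> = (\<Sum>t\<in>Idx. if t = s then c s * (- \<epsilon> s * G r) else 0)"
      by (rule sum.cong[OF refl]) (simp add: P.I_in er s P.I_inner G_def)
    also have "\<dots> = c s * (- \<epsilon> s * G r)" using s by simp
    finally show ?thesis using e_nz[OF r n0] by (simp add: G_def)
  qed
  then show "\<sigma> r x = (\<Sum>s\<in>Idx. ?f s r *\<^sub>R I s r x)" unfolding c by (intro sum.cong refl) simp
qed

section \<open>The complement and the connection on the whole tangent bundle\<close>

context reeb_frame
begin

lemma prV_in_span: "prV q v \<in> span ((\<lambda>s. \<xi> s q) ` Idx)"
  unfolding prV_def by (intro span_sum span_scale span_base imageI)

definition VV :: "'a \<Rightarrow> 'a tvec set" where
  "VV q = prV q ` tangent_space A q"

text \<open>The coefficient of I_t in the covariant derivative of the section of PQ with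
  coefficients \<eta>_s(Y). Using it for \<xi>_t transports the connection from PQ to V.\<close>

definition vc :: "nat \<Rightarrow> 'a \<Rightarrow> 'a tvec \<Rightarrow> ('a \<Rightarrow> 'a tvec) \<Rightarrow> real" where
  "vc t q v Y = v (\<lambda>r. \<eta> t r (Y r)) + (\<Sum>s\<in>Idx. \<eta> s q (Y q) * AA s t q v)"

definition cn :: "'a \<Rightarrow> 'a tvec \<Rightarrow> ('a \<Rightarrow> 'a tvec) \<Rightarrow> 'a tvec" where
  "cn q v Y = DH q v (\<lambda>r. prH r (Y r)) + (\<Sum>t\<in>Idx. vc t q v Y *\<^sub>R \<xi> t q)"

text \<open>The value 0 on inadmissible arguments is the convention of
  \<open>linear_connection\<close>, under which connections are compared as functions.\<close>

definition conn :: "'a connection" where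
  "conn q v Y = (if v \<in> tangent_space A q \<and> vector_field_near A q Y then cn q v Y else 0)"

lemma conn_eq: "vector_field A W Y \<Longrightarrow> q \<in> W \<Longrightarrow> v \<in> tangent_space A q \<Longrightarrow> conn q v Y = cn q v Y"
  using vector_field_nearI[of A W Y q] by (simp add: conn_def)

lemma cn_smooth:
  assumes X: "vector_field A U X" and Y: "vector_field A U Y"
  shows "vector_field A U (\<lambda>q. cn q (X q) Y)"
  unfolding cn_def
proof (rule vf_add[OF section_onD(1)[OF DH_sec[OF X prH_sec[OF subset_refl Y]]]], rule vf_sum[OF openU])
  fix t assume t: "t \<in> Idx"
  have "smooth_fun A U (\<lambda>q. vc t q (X q) Y)"
    unfolding vc_def
    by (rule smooth_fun_add[OF vf_smooth[OF X subset_refl eta_smooth[OF t subset_refl Y]]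
          smooth_fun_sum[OF openU smooth_fun_mult[OF eta_smooth[OF _ subset_refl Y] AA_smooth[OF X _ t]]]])
  then show "vector_field A U (\<lambda>q. vc t q (X q) Y *\<^sub>R \<xi> t q)" by (rule vf_scale[OF _ xi[OF t]])
qed

lemma conn_smooth: "smooth_conn_on A U conn"
  unfolding smooth_conn_on_def
proof (intro allI impI, elim conjE)
  fix W X Y assume W: "W \<subseteq> U" and X: "vector_field A W X" and Y: "vector_field A W Y"
  interpret R: reeb_frame A H g PQ n W \<eta> I e \<xi> by (rule restrict_reeb[OF vf_open[OF X] W])
  show "vector_field A W (\<lambda>q. conn q (X q) Y)"
    by (rule vf_cong[OF R.cn_smooth[OF X Y]]) (rule conn_eq[OF Y _ vf_tangent[OF X], symmetric])
qed

lemma VV_iff: 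
  assumes q: "q \<in> U"
  shows "x \<in> VV q \<longleftrightarrow> x \<in> tangent_space A q \<and> prH q x = 0"
proof
  assume "x \<in> VV q"
  then obtain v where v: "v \<in> tangent_space A q" "x = prV q v" unfolding VV_def by blast
  have "prV q (prV q v) = (\<Sum>s\<in>Idx. \<eta> s q (prV q v) *\<^sub>R \<xi> s q)" by (rule prV_def)
  also have "\<dots> = (\<Sum>s\<in>Idx. \<eta> s q v *\<^sub>R \<xi> s q)" by (rule sum.cong[OF refl]) (simp only: eta_prV[OF q])
  also have "\<dots> = prV q v" by (rule prV_def[symmetric])
  finally show "x \<in> tangent_space A q \<and> prH q x = 0" using prV_tangent[OF q] by (simp add: v prH_def)
next
  assume "x \<in> tangent_space A q \<and> prH q x = 0"
  then show "x \<in> VV q" unfolding VV_def by (intro image_eqI[of _ _ x]) (simp_all add: prH_def)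
qed

lemma prH_xi:
  assumes q: "q \<in> U" and t: "t \<in> Idx"
  shows "prH q (\<xi> t q) = 0"
proof -
  have "prV q (\<xi> t q) = (\<Sum>s\<in>Idx. if s = t then \<xi> t q else 0)"
    unfolding prV_def by (rule sum.cong[OF refl]) (simp add: dual[OF q _ t])
  then show ?thesis using t by (simp add: prH_def)
qed

lemma xi_VV: "q \<in> U \<Longrightarrow> t \<in> Idx \<Longrightarrow> \<xi> t q \<in> VV q"
  using VV_iff xi_tangent prH_xi by simp

lemma VV_subspace: "q \<in> U \<Longrightarrow> subspace (VV q)"
proof -
  assume q: "q \<in> U"
  note l = linear_onD[OF prH_linear[OF q]] and T = tangent_subspace[of q]
  show ?thesis
    using VV_iff[OF q] subspace_add[OF T] subspace_scale[OF T] subspace_0[OF T]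
    by (intro subspaceI) (simp_all add: l linear_on_zero[OF prH_linear[OF q] T])
qed

lemma VV_span: "q \<in> U \<Longrightarrow> span ((\<lambda>s. \<xi> s q) ` Idx) = VV q"
proof
  assume q: "q \<in> U"
  show "span ((\<lambda>s. \<xi> s q) ` Idx) \<subseteq> VV q"
    by (rule span_minimal[OF _ VV_subspace[OF q]]) (use xi_VV[OF q] in auto)
  show "VV q \<subseteq> span ((\<lambda>s. \<xi> s q) ` Idx)" using prV_in_span by (auto simp: VV_def)
qed

lemma VV_basis:
  assumes q: "q \<in> U"
  shows "is_basis 3 (VV q) (\<lambda>i. \<xi> (Suc i) q)"
proof -
  have im: "(\<lambda>i. \<xi> (Suc i) q) ` {..<3} = (\<lambda>s. \<xi> s q) ` Idx"
  proof -
    have "{..<3} = {0, 1, 2::nat}" by auto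
    then have "Suc ` {..<3} = Idx" by (simp add: Idx_def One_nat_def numeral_eq_Suc)
    then show ?thesis using image_image[of "\<lambda>s. \<xi> s q" Suc "{..<3}"] by simp
  qed
  have I: "Suc i \<in> Idx" if "i \<in> {..<3}" for i using that by (auto simp: Idx_def)
  note d = dual_independent[of "{..<3}" "tangent_space A q" "\<lambda>i. \<xi> (Suc i) q" "\<lambda>i. \<eta> (Suc i) q"]
  have "inj_on (\<lambda>i. \<xi> (Suc i) q) {..<3}" "independent ((\<lambda>i. \<xi> (Suc i) q) ` {..<3})"
    by (rule d; (rule tangent_subspace xi_tangent[OF q I] eta_linear[OF q I], assumption?)?;
      simp add: dual[OF q I I] del: lessThan_Suc)+
  then show ?thesis unfolding is_basis_def im VV_span[OF q] by simp
qed

lemma VV_split: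
  assumes q: "q \<in> U"
  shows "H q \<inter> VV q = {0}" "{x + \<xi> | x \<xi>. x \<in> H q \<and> \<xi> \<in> VV q} = tangent_space A q"
proof -
  show "H q \<inter> VV q = {0}"
    using VV_iff[OF q] prH_id[OF q] subspace_0[OF H_subspace[OF q]] subspace_0[OF VV_subspace[OF q]] by auto
  show "{x + \<xi> | x \<xi>. x \<in> H q \<and> \<xi> \<in> VV q} = tangent_space A q"
  proof (intro equalityI subsetI)
    fix v assume "v \<in> {x + \<xi> | x \<xi>. x \<in> H q \<and> \<xi> \<in> VV q}"
    then obtain x \<zeta> where "v = x + \<zeta>" "x \<in> H q" "\<zeta> \<in> VV q" by blast
    then show "v \<in> tangent_space A q"
      using subspace_add[OF tangent_subspace H_tangent[OF q]] VV_iff[OF q] by simp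
  next
    fix v assume v: "v \<in> tangent_space A q"
    have "v = prH q v + prV q v" by (simp add: prH_def)
    moreover have "prV q v \<in> VV q" using v by (simp add: VV_def)
    ultimately show "v \<in> {x + \<xi> | x \<xi>. x \<in> H q \<and> \<xi> \<in> VV q}" using prH_in[OF q v] by blast
  qed
qed

context
  fixes q assumes q: "q \<in> U"
begin

interpretation P: pq_endo "H q" "g q" "4 * n" "\<lambda>a. e a q" "\<lambda>s. I s q" "PQ q" "e0 q"
  by (rule pointwise[OF q])

lemma cn_linear: "linear_on (tangent_space A q) (\<lambda>v. cn q v Y)"
proof -
  have "linear_on (tangent_space A q) (\<lambda>v. \<Sum>s\<in>Idx. \<eta> s q (Y q) *\<^sub>R AA s t q v)" for t
    by (rule linear_on_sum_fun, rule linear_on_scaleR_fun, rule AA_linear[OF q])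
  then have "linear_on (tangent_space A q) (\<lambda>v. vc t q v Y)" for t
    unfolding vc_def real_scaleR_def by (rule linear_on_add_fun[OF linear_on_eval])
  then show ?thesis
    unfolding cn_def
    by (rule linear_on_add_fun[OF DH_linear[OF q] linear_on_sum_fun[OF linear_on_scaleR_vec]])
qed

context
  fixes v assumes v: "v \<in> tangent_space A q"
begin

lemma eta_smooth_near: "t \<in> Idx \<Longrightarrow> vector_field A U Y \<Longrightarrow> smooth_fun_near A q (\<lambda>r. \<eta> t r (Y r))"
  by (rule smooth_fun_nearI[OF eta_smooth[OF _ subset_refl] q])

lemma cn_add:
  assumes Y: "vector_field A U Y" and Z: "vector_field A U Z"
  shows "cn q v (\<lambda>r. Y r + Z r) = cn q v Y + cn q v Z"
proof -
  have "DH q v (\<lambda>r. prH r (Y r + Z r)) = DH q v (\<lambda>r. prH r (Y r) + prH r (Z r))"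
    by (rule DH_cong[OF q v prH_sec[OF subset_refl vf_add[OF Y Z]]])
      (rule linear_onD(1)[OF prH_linear vf_tangent[OF Y] vf_tangent[OF Z]])
  also have "\<dots> = DH q v (\<lambda>r. prH r (Y r)) + DH q v (\<lambda>r. prH r (Z r))"
    by (rule DH_add[OF q prH_sec[OF subset_refl Y] prH_sec[OF subset_refl Z]])
  finally have 1: "DH q v (\<lambda>r. prH r (Y r + Z r)) = DH q v (\<lambda>r. prH r (Y r)) + DH q v (\<lambda>r. prH r (Z r))" .
  have eta: "\<eta> t r (Y r + Z r) = \<eta> t r (Y r) + \<eta> t r (Z r)" if "r \<in> U" "t \<in> Idx" for r t
    by (rule linear_onD(1)[OF eta_linear[OF that] vf_tangent[OF Y that(1)] vf_tangent[OF Z that(1)]])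
  have 2: "vc t q v (\<lambda>r. Y r + Z r) = vc t q v Y + vc t q v Z" if t: "t \<in> Idx" for t
  proof -
    have "v (\<lambda>r. \<eta> t r (Y r + Z r)) = v (\<lambda>r. \<eta> t r (Y r) + \<eta> t r (Z r))"
      by (rule tangent_cong[OF v openU q eta[OF _ t]])
    also have "\<dots> = v (\<lambda>r. \<eta> t r (Y r)) + v (\<lambda>r. \<eta> t r (Z r))"
      by (rule tangent_add[OF v eta_smooth_near[OF t Y] eta_smooth_near[OF t Z]])
    finally show ?thesis
      unfolding vc_def by (simp add: eta[OF q] distrib_right sum.distrib cong: sum.cong)
  qed
  have 3: "(\<Sum>t\<in>Idx. vc t q v (\<lambda>r. Y r + Z r) *\<^sub>R \<xi> t q) =
      (\<Sum>t\<in>Idx. vc t q v Y *\<^sub>R \<xi> t q) + (\<Sum>t\<in>Idx. vc t q v Z *\<^sub>R \<xi> t q)"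
    unfolding sum.distrib[symmetric] by (rule sum.cong[OF refl]) (simp only: 2 scaleR_add_left)
  show ?thesis unfolding cn_def 1 3 by (simp only: add_ac)
qed

lemma cn_leib:
  assumes f: "smooth_fun A U f" and Y: "vector_field A U Y"
  shows "cn q v (\<lambda>r. f r *\<^sub>R Y r) = v f *\<^sub>R Y q + f q *\<^sub>R cn q v Y"
proof -
  have "DH q v (\<lambda>r. prH r (f r *\<^sub>R Y r)) = DH q v (\<lambda>r. f r *\<^sub>R prH r (Y r))"
    by (rule DH_cong[OF q v prH_sec[OF subset_refl vf_scale[OF f Y]]])
      (rule linear_onD(2)[OF prH_linear vf_tangent[OF Y]])
  also have "\<dots> = v f *\<^sub>R prH q (Y q) + f q *\<^sub>R DH q v (\<lambda>r. prH r (Y r))"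
    by (rule DH_leib[OF q v f prH_sec[OF subset_refl Y]])
  finally have 1: "DH q v (\<lambda>r. prH r (f r *\<^sub>R Y r)) =
      v f *\<^sub>R prH q (Y q) + f q *\<^sub>R DH q v (\<lambda>r. prH r (Y r))" .
  have eta: "\<eta> t r (f r *\<^sub>R Y r) = f r * \<eta> t r (Y r)" if "r \<in> U" "t \<in> Idx" for r t
    using linear_onD(2)[OF eta_linear[OF that] vf_tangent[OF Y that(1)]] by simp
  have 2: "vc t q v (\<lambda>r. f r *\<^sub>R Y r) = v f * \<eta> t q (Y q) + f q * vc t q v Y" if t: "t \<in> Idx" for t
  proof -
    have "v (\<lambda>r. \<eta> t r (f r *\<^sub>R Y r)) = v (\<lambda>r. f r * \<eta> t r (Y r))"
      by (rule tangent_cong[OF v openU q eta[OF _ t]])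
    also have "\<dots> = v f * \<eta> t q (Y q) + f q * v (\<lambda>r. \<eta> t r (Y r))"
      by (rule tangent_mult[OF v smooth_fun_nearI[OF f q] eta_smooth_near[OF t Y]])
    finally show ?thesis
      unfolding vc_def
      by (simp add: eta[OF q] distrib_left sum_distrib_left mult.assoc cong: sum.cong)
  qed
  have 3: "(\<Sum>t\<in>Idx. vc t q v (\<lambda>r. f r *\<^sub>R Y r) *\<^sub>R \<xi> t q) =
      v f *\<^sub>R prV q (Y q) + f q *\<^sub>R (\<Sum>t\<in>Idx. vc t q v Y *\<^sub>R \<xi> t q)"
    unfolding prV_def scaleR_sum_right sum.distrib[symmetric]
    by (rule sum.cong[OF refl]) (simp only: 2 scaleR_add_left scaleR_scaleR)
  have "Y q = prH q (Y q) + prV q (Y q)" by (simp add: prH_def)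
  then have "v f *\<^sub>R Y q = v f *\<^sub>R prH q (Y q) + v f *\<^sub>R prV q (Y q)"
    by (simp only: scaleR_add_right[symmetric])
  then show ?thesis unfolding cn_def 1 3 by (simp only: add_ac scaleR_add_right)
qed

lemma cn_H:
  assumes Y: "section_on A H U Y"
  shows "cn q v Y = DH q v Y"
proof -
  have 1: "DH q v (\<lambda>r. prH r (Y r)) = DH q v Y"
    by (rule DH_cong[OF q v prH_sec[OF subset_refl section_onD(1)[OF Y]]]) (rule prH_id[OF _ section_onD(2)[OF Y]])
  have "vc t q v Y = 0" if t: "t \<in> Idx" for t
  proof -
    have "v (\<lambda>r. \<eta> t r (Y r)) = v (\<lambda>r. 0)"
      by (rule tangent_cong[OF v openU q]) (rule eta_H[OF _ t section_onD(2)[OF Y]])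
    then show ?thesis
      unfolding vc_def tangent_const[OF v] using eta_H[OF q _ section_onD(2)[OF Y q]] by simp
  qed
  then show ?thesis unfolding cn_def 1 by simp
qed

lemma cn_V:
  assumes Y: "section_on A VV U Y"
  shows "cn q v Y = (\<Sum>t\<in>Idx. vc t q v Y *\<^sub>R \<xi> t q)" "cn q v Y \<in> VV q"
    "t \<in> Idx \<Longrightarrow> \<eta> t q (cn q v Y) = vc t q v Y"
proof -
  have "DH q v (\<lambda>r. prH r (Y r)) = DH q v (\<lambda>r. 0)"
    by (rule DH_cong[OF q v prH_sec[OF subset_refl section_onD(1)[OF Y]]])
      (use VV_iff section_onD(2)[OF Y] in blast)
  then show 1: "cn q v Y = (\<Sum>t\<in>Idx. vc t q v Y *\<^sub>R \<xi> t q)"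
    unfolding cn_def DH_zero[OF q v] by simp
  show "cn q v Y \<in> VV q"
    unfolding 1 by (intro subspace_sum subspace_scale VV_subspace[OF q] xi_VV[OF q])
  assume t: "t \<in> Idx"
  have "\<eta> t q (\<Sum>s\<in>Idx. vc s q v Y *\<^sub>R \<xi> s q) = (\<Sum>s\<in>Idx. \<eta> t q (vc s q v Y *\<^sub>R \<xi> s q))"
    by (rule linear_on_sum[OF eta_linear[OF q t] tangent_subspace])
      (rule subspace_scale[OF tangent_subspace xi_tangent[OF q]])
  also have "\<dots> = (\<Sum>s\<in>Idx. if s = t then vc t q v Y else 0)"
    by (rule sum.cong[OF refl]) (simp add: linear_onD(2)[OF eta_linear[OF q t] xi_tangent[OF q]] dual[OF q t])
  finally show "\<eta> t q (cn q v Y) = vc t q v Y" unfolding 1 using t by simp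
qed

lemma DH_sum:
  assumes "\<And>i. i \<in> J \<Longrightarrow> section_on A H U (Y i)"
  shows "DH q v (\<lambda>r. \<Sum>i\<in>J. Y i r) = (\<Sum>i\<in>J. DH q v (Y i))"
  using assms
proof (induction J rule: infinite_finite_induct)
  case (insert i J)
  then have Y: "section_on A H U (Y i)" "section_on A H U (\<lambda>r. \<Sum>i\<in>J. Y i r)"
    by (blast, intro sec_sum[OF subset_refl openU]) blast
  show ?case
    unfolding sum.insert[OF insert.hyps] DH_add[OF q Y]
    by (subst insert.IH) (use insert.prems in blast, rule refl)
qed (simp_all only: sum.infinite sum.empty not_False_eq_True DH_zero[OF q v])

lemma DH_comb:
  assumes f: "\<And>t. t \<in> Idx \<Longrightarrow> smooth_fun A U (f t)" and Y: "section_on A H U Y"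
  shows "DH q v (\<lambda>r. \<Sum>t\<in>Idx. f t r *\<^sub>R I t r (Y r)) = (\<Sum>t\<in>Idx. f t q *\<^sub>R I t q (DH q v Y))
    + (\<Sum>t\<in>Idx. (v (f t) + (\<Sum>s\<in>Idx. f s q * AA s t q v)) *\<^sub>R I t q (Y q))"
proof -
  have IY: "section_on A H U (\<lambda>r. I t r (Y r))" if "t \<in> Idx" for t by (rule sec_I[OF that subset_refl Y])
  have "DH q v (\<lambda>r. \<Sum>t\<in>Idx. f t r *\<^sub>R I t r (Y r)) = (\<Sum>t\<in>Idx. DH q v (\<lambda>r. f t r *\<^sub>R I t r (Y r)))"
    by (rule DH_sum) (rule sec_scale[OF subset_refl f IY])
  also have "\<dots> = (\<Sum>t\<in>Idx. v (f t) *\<^sub>R I t q (Y q) + (f t q *\<^sub>R I t q (DH q v Y)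
      + f t q *\<^sub>R (\<Sum>w\<in>Idx. AA t w q v *\<^sub>R I w q (Y q))))"
    by (rule sum.cong[OF refl]) (simp only: DH_leib[OF q v f IY] DH_I[OF q _ Y] scaleR_add_right)
  also have "\<dots> = (\<Sum>t\<in>Idx. v (f t) *\<^sub>R I t q (Y q)) + ((\<Sum>t\<in>Idx. f t q *\<^sub>R I t q (DH q v Y))
      + (\<Sum>t\<in>Idx. f t q *\<^sub>R (\<Sum>w\<in>Idx. AA t w q v *\<^sub>R I w q (Y q))))"
    by (simp only: sum.distrib)
  also have "(\<Sum>t\<in>Idx. f t q *\<^sub>R (\<Sum>w\<in>Idx. AA t w q v *\<^sub>R I w q (Y q))) =
      (\<Sum>w\<in>Idx. (\<Sum>t\<in>Idx. f t q * AA t w q v) *\<^sub>R I w q (Y q))"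
    unfolding scaleR_sum_right scaleR_sum_left by (subst sum.swap) (simp only: scaleR_scaleR)
  finally show ?thesis by (simp only: sum.distrib scaleR_add_left add_ac)
qed

end

text \<open>The endomorphism in \<open>(sp(n,\<real>) \<oplus> sp(1,\<real>))\<^sup>\<bottom>\<close> does not depend on the domain of the
  section it is applied to, as every vector at \<open>q\<close> extends to a section over \<open>U\<close>.\<close>

lemma Gv_perp_near:
  assumes x: "vector_field A U x"
  shows "\<exists>B\<in>sp_n_sp_1_perp (g q) (PQ q) (H q). \<forall>W Y. open W \<and> W \<subseteq> U \<and> q \<in> W \<and> section_on A H W Y \<longrightarrow>
    B (Y q) = Gv x Y q - bH x Y q"
proof -
  obtain B where B: "B \<in> sp_n_sp_1_perp (g q) (PQ q) (H q)"
    and BY: "\<And>Y. section_on A H U Y \<Longrightarrow> B (Y q) = Gv x Y q - bH x Y q"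
    using Gv_perp[OF x q] by blast
  have "B (Y q) = Gv x Y q - bH x Y q"
    if W: "open W" "W \<subseteq> U" "q \<in> W" and Y: "section_on A H W Y" for W Y
  proof -
    interpret R: reeb_frame A H g PQ n W \<eta> I e \<xi> by (rule restrict_reeb[OF W(1,2)])
    obtain B' where B': "\<And>Y. section_on A H W Y \<Longrightarrow> B' (Y q) = Gv x Y q - bH x Y q"
      using R.Gv_perp[OF vf_subset[OF x W(1,2)] W(3)] by blast
    have "B' (ext q (Y q) q) = B (ext q (Y q) q)"
      unfolding BY[OF ext_sec] B'[OF R.ext_sec] ..
    then have "B (Y q) = B' (Y q)" unfolding ext_eq[OF q section_onD(2)[OF Y W(3)]] by (rule sym)
    then show ?thesis unfolding B'[OF Y] .
  qed
  then show ?thesis using B by blast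
qed

text \<open>The derivatives of the coefficients of \<open>Y\<close> multiply the fields \<xi>_s and
  are removed by the horizontal projection, so for vertical \<open>Y\<close> the horizontal part of
  the bracket is tensorial in \<open>Y\<close>.\<close>

lemma bH_vertical:
  assumes Y: "section_on A VV U Y" and X: "vector_field A U X"
  shows "bH Y X q = (\<Sum>s\<in>Idx. \<eta> s q (Y q) *\<^sub>R bH (\<xi> s) X q)"
proof -
  note Yv = section_onD(1)[OF Y]
  have h: "smooth_fun A U (\<lambda>r. \<eta> s r (Y r))" if "s \<in> Idx" for s by (rule eta_smooth[OF that subset_refl Yv])
  have hx: "vector_field A U (\<lambda>r. \<eta> s r (Y r) *\<^sub>R \<xi> s r)" if "s \<in> Idx" for s
    by (rule vf_scale[OF h[OF that] xi[OF that]])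
  have eq: "Y r = (\<Sum>s\<in>Idx. \<eta> s r (Y r) *\<^sub>R \<xi> s r)" if r: "r \<in> U" for r
  proof -
    have "prH r (Y r) = 0" using VV_iff[OF r] section_onD(2)[OF Y r] by blast
    then show ?thesis unfolding prH_def prV_def by (simp only: right_minus_eq)
  qed
  note L = prH_linear[OF q] and T = tangent_subspace[of q] and Xq = vf_tangent[OF X q]
  have b: "lie_bracket A (\<xi> s) X q \<in> tangent_space A q" if "s \<in> Idx" for s
    by (rule bracket_tangent[OF xi[OF that] X q])
  have bb: "lie_bracket A X (\<lambda>r. \<eta> s r (Y r) *\<^sub>R \<xi> s r) q \<in> tangent_space A q" if "s \<in> Idx" for s
    by (rule bracket_tangent[OF X hx[OF that] q])
  have "lie_bracket A X Y q = lie_bracket A X (\<lambda>r. \<Sum>s\<in>Idx. \<eta> s r (Y r) *\<^sub>R \<xi> s r) q"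
    by (rule bracket_cong[OF X Yv q refl eq])
  also have "\<dots> = (\<Sum>s\<in>Idx. lie_bracket A X (\<lambda>r. \<eta> s r (Y r) *\<^sub>R \<xi> s r) q)"
    by (rule bracket_sum[OF X hx q])
  finally have "bH X Y q = (\<Sum>s\<in>Idx. bH X (\<lambda>r. \<eta> s r (Y r) *\<^sub>R \<xi> s r) q)"
    unfolding bH_def by (simp only: linear_on_sum[OF L T bb])
  also have "\<dots> = (\<Sum>s\<in>Idx. - (\<eta> s q (Y q) *\<^sub>R bH (\<xi> s) X q))"
  proof (rule sum.cong[OF refl])
    fix s assume s: "s \<in> Idx"
    have "bH (\<lambda>r. \<eta> s r (Y r) *\<^sub>R \<xi> s r) X q =
        prH q (\<eta> s q (Y q) *\<^sub>R lie_bracket A (\<xi> s) X q) - prH q (X q (\<lambda>r. \<eta> s r (Y r)) *\<^sub>R \<xi> s q)"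
      unfolding bH_def bracket_scale_left[OF xi[OF s] X h[OF s] q]
      by (rule linear_on_diff[OF L T subspace_scale[OF T b[OF s]] subspace_scale[OF T xi_tangent[OF q s]]])
    also have "\<dots> = \<eta> s q (Y q) *\<^sub>R bH (\<xi> s) X q"
      unfolding linear_onD(2)[OF L b[OF s]] linear_onD(2)[OF L xi_tangent[OF q s]] prH_xi[OF q s] bH_def
      by (simp only: scaleR_zero_right diff_zero)
    finally show "bH X (\<lambda>r. \<eta> s r (Y r) *\<^sub>R \<xi> s r) q = - (\<eta> s q (Y q) *\<^sub>R bH (\<xi> s) X q)"
      unfolding bH_swap[OF q hx[OF s] X] by simp
  qed
  finally show ?thesis unfolding bH_swap[OF q Yv X] by (simp only: sum_negf neg_equal_iff_equal)
qed

end

end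

lemma diff_diff_diff: "(d - c - b) - (d - (b - p)) = - (c + p)" for b :: "'b::ab_group_add"
  by (simp add: algebra_simps)

section \<open>Verification of the defining conditions for this connection\<close>

context reeb_frame
begin

lemma conn_H:
  assumes "q \<in> U" "v \<in> tangent_space A q" "section_on A H U Y"
  shows "conn q v Y = DH q v Y"
  unfolding conn_eq[OF section_onD(1)[OF assms(3)] assms(1,2)] by (rule cn_H[OF assms])

context
  fixes q assumes q: "q \<in> U"
begin

interpretation P: pq_endo "H q" "g q" "4 * n" "\<lambda>a. e a q" "\<lambda>s. I s q" "PQ q" "e0 q"
  by (rule pointwise[OF q])

text \<open>Serves twice: it shows that PQ is preserved, and its coefficients are those of
  \<open>vc\<close>, so that \<nabla>\<phi> = 0 holds by construction. The expansion of \<sigma> is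
  assumed only near \<open>q\<close>, because derivatives depend on germs.\<close>

lemma endo_deriv:
  assumes W: "open W" "W \<subseteq> U" "q \<in> W" and f: "\<And>s. s \<in> Idx \<Longrightarrow> smooth_fun A W (f s)"
    and \<sigma>: "\<And>r x. r \<in> W \<Longrightarrow> x \<in> H r \<Longrightarrow> \<sigma> r x = (\<Sum>s\<in>Idx. f s r *\<^sub>R I s r x)"
    and v: "v \<in> tangent_space A q"
  shows "has_endo_deriv A conn H q v \<sigma> (\<Sum>t\<in>Idx. (v (f t) + (\<Sum>s\<in>Idx. f s q * AA s t q v)) *\<^sub>R I t q)"
  unfolding has_endo_deriv_def represents_def
proof (intro conjI allI impI)
  show "(\<Sum>t\<in>Idx. (v (f t) + (\<Sum>s\<in>Idx. f s q * AA s t q v)) *\<^sub>R I t q) \<in> endos (H q)"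
    by (rule P.Q_endos) (unfold P.Q_sum, rule exI, rule refl)
  fix X assume "section_near A H q X"
  from section_common[OF W(1,3) this this] obtain T where T: "open T" "T \<subseteq> W" "q \<in> T"
    and X: "section_on A H T X" .
  interpret R: reeb_frame A H g PQ n T \<eta> I e \<xi> by (rule restrict_reeb[OF T(1) subset_trans[OF T(2) W(2)]])
  have fT: "smooth_fun A T (f s)" if "s \<in> Idx" for s by (rule smooth_fun_subset[OF f[OF that] T(1,2)])
  have S: "section_on A H T (\<lambda>r. \<Sum>s\<in>Idx. f s r *\<^sub>R I s r (X r))"
    by (rule R.sec_sum[OF subset_refl T(1) R.sec_scale[OF subset_refl fT R.sec_I[OF _ subset_refl X]]])
  have eq: "(\<Sum>s\<in>Idx. f s r *\<^sub>R I s r (X r)) = \<sigma> r (X r)" if r: "r \<in> T" for r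
    by (rule \<sigma>[symmetric]) (use r T(2) in blast, rule section_onD(2)[OF X r])
  have "conn q v (\<lambda>r. \<sigma> r (X r)) = DH q v (\<lambda>r. \<sigma> r (X r))"
    by (rule R.conn_H[OF T(3) v sec_cong[OF S eq]])
  also have "\<dots> = DH q v (\<lambda>r. \<Sum>s\<in>Idx. f s r *\<^sub>R I s r (X r))"
    by (rule R.DH_cong[OF T(3) v S eq, symmetric])
  also have "\<dots> = (\<Sum>t\<in>Idx. f t q *\<^sub>R I t q (DH q v X))
    + (\<Sum>t\<in>Idx. (v (f t) + (\<Sum>s\<in>Idx. f s q * AA s t q v)) *\<^sub>R I t q (X q))"
    by (rule R.DH_comb[OF T(3) v fT X])
  finally have 1: "conn q v (\<lambda>r. \<sigma> r (X r)) = (\<Sum>t\<in>Idx. f t q *\<^sub>R I t q (DH q v X))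
    + (\<Sum>t\<in>Idx. (v (f t) + (\<Sum>s\<in>Idx. f s q * AA s t q v)) *\<^sub>R I t q (X q))" .
  have 2: "\<sigma> q (conn q v X) = (\<Sum>t\<in>Idx. f t q *\<^sub>R I t q (DH q v X))"
    unfolding R.conn_H[OF T(3) v X] by (rule \<sigma>[OF W(3) R.DH_in[OF T(3) X]])
  show "conn q v (\<lambda>r. \<sigma> r (X r)) - \<sigma> q (conn q v X) =
      (\<Sum>t\<in>Idx. (v (f t) + (\<Sum>s\<in>Idx. f s q * AA s t q v)) *\<^sub>R I t q) (X q)"
    unfolding 1 2 fun_sum_apply by (simp only: add_diff_cancel_left')
qed

text \<open>For vertical \<zeta> both the derivative and the horizontal part of the bracket depend
  linearly on \<zeta> at \<open>q\<close>, so the torsion is the combination, with coefficients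
  \<eta>_s(\<zeta>), of the endomorphisms belonging to the \<xi>_s, and the orthogonal complement is
  a subspace.\<close>

lemma torsion_perp:
  assumes Z: "section_near A VV q \<zeta>"
  shows "\<exists>B \<in> sp_n_sp_1_perp (g q) (PQ q) (H q).
    represents A H q (\<lambda>X. proj_along (H q) (VV q) (torsion A conn \<zeta> X q)) B"
proof -
  have "\<forall>s\<in>Idx. \<exists>B. B \<in> sp_n_sp_1_perp (g q) (PQ q) (H q) \<and>
    (\<forall>W Y. open W \<and> W \<subseteq> U \<and> q \<in> W \<and> section_on A H W Y \<longrightarrow> B (Y q) = Gv (\<xi> s) Y q - bH (\<xi> s) Y q)"
  proof
    fix s assume "s \<in> Idx"
    from Gv_perp_near[OF q xi[OF this]] show "\<exists>B. B \<in> sp_n_sp_1_perp (g q) (PQ q) (H q) \<and>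
      (\<forall>W Y. open W \<and> W \<subseteq> U \<and> q \<in> W \<and> section_on A H W Y \<longrightarrow> B (Y q) = Gv (\<xi> s) Y q - bH (\<xi> s) Y q)"
      unfolding Bex_def .
  qed
  from bchoice[OF this] obtain B where *: "\<forall>s\<in>Idx. B s \<in> sp_n_sp_1_perp (g q) (PQ q) (H q) \<and>
    (\<forall>W Y. open W \<and> W \<subseteq> U \<and> q \<in> W \<and> section_on A H W Y \<longrightarrow> B s (Y q) = Gv (\<xi> s) Y q - bH (\<xi> s) Y q)" ..
  have B: "B s \<in> sp_n_sp_1_perp (g q) (PQ q) (H q)" if "s \<in> Idx" for s
    by (rule conjunct1[OF bspec[OF * that]])
  have BY: "B s (Y q) = Gv (\<xi> s) Y q - bH (\<xi> s) Y q"
    if "s \<in> Idx" "open W" "W \<subseteq> U" "q \<in> W" "section_on A H W Y" for s W Y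
    using conjunct2[OF bspec[OF * that(1)], rule_format, of W Y] that(2-5) by simp
  define BB where "BB = (\<Sum>s\<in>Idx. \<eta> s q (\<zeta> q) *\<^sub>R B s)"
  have BB: "BB \<in> sp_n_sp_1_perp (g q) (PQ q) (H q)"
    unfolding BB_def by (rule subspace_sum[OF P.perp_subspace subspace_scale[OF P.perp_subspace B]])
  have "proj_along (H q) (VV q) (torsion A conn \<zeta> X q) = BB (X q)" if Xn: "section_near A H q X" for X
  proof -
    from section_common[OF openU q Xn Z] obtain W where W: "open W" "W \<subseteq> U" "q \<in> W"
      and X: "section_on A H W X" and Z: "section_on A VV W \<zeta>" .
    interpret R: reeb_frame A H g PQ n W \<eta> I e \<xi> by (rule restrict_reeb[OF W(1,2)])
    note Xv = section_onD(1)[OF X] and Zv = section_onD(1)[OF Z]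
    note Xq = vf_tangent[OF Xv W(3)] and Zq = vf_tangent[OF Zv W(3)]
    have b: "lie_bracket A \<zeta> X q \<in> tangent_space A q" by (rule bracket_tangent[OF Zv Xv W(3)])
    have pz: "prH q (\<zeta> q) = 0" using VV_iff[OF q] section_onD(2)[OF Z W(3)] by blast
    have BX: "BB (X q) = (\<Sum>s\<in>Idx. \<eta> s q (\<zeta> q) *\<^sub>R B s (X q))"
      unfolding BB_def by (rule fun_sum_apply)
    have w: "DH q (\<zeta> q) X - bH \<zeta> X q = BB (X q)"
      unfolding R.DH_vertical[OF W(3) pz] R.bH_vertical[OF W(3) Z Xv] BX sum_subtractf[symmetric]
      by (rule sum.cong[OF refl]) (simp only: BY[OF _ W X] scaleR_diff_right)
    have "proj_along (H q) (VV q) (torsion A conn \<zeta> X q) = DH q (\<zeta> q) X - bH \<zeta> X q"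
    proof (rule proj_along_eq[OF H_subspace[OF q] VV_subspace[OF q] VV_split(1)[OF q]])
      show "DH q (\<zeta> q) X - bH \<zeta> X q \<in> H q"
        by (rule P.S_closed(5)[OF R.DH_in[OF W(3) X] R.bH_in[OF W(3) Zv Xv]])
      have "torsion A conn \<zeta> X q - (DH q (\<zeta> q) X - bH \<zeta> X q) =
          - (cn q (X q) \<zeta> + prV q (lie_bracket A \<zeta> X q))"
        unfolding torsion_def R.conn_H[OF W(3) Zq X] conn_eq[OF Zv W(3) Xq] bH_def prH_def
        by (rule diff_diff_diff)
      moreover have "prV q (lie_bracket A \<zeta> X q) \<in> VV q" using b by (simp add: VV_def)
      ultimately show "torsion A conn \<zeta> X q - (DH q (\<zeta> q) X - bH \<zeta> X q) \<in> VV q"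
        using subspace_neg[OF VV_subspace[OF q] subspace_add[OF VV_subspace[OF q] R.cn_V(2)[OF W(3) Xq Z]]]
        by simp
    qed
    then show ?thesis unfolding w .
  qed
  then have "represents A H q (\<lambda>X. proj_along (H q) (VV q) (torsion A conn \<zeta> X q)) BB"
    unfolding represents_def using P.perpD(1)[OF BB] by blast
  then show ?thesis using BB by blast
qed

lemma conn_adapted: "adapted_at A H g PQ conn VV q"
  unfolding adapted_at_def
proof (intro conjI allI ballI impI)
  fix Y assume Y: "vector_field_near A q Y"
  show "linear_on (tangent_space A q) (\<lambda>v. conn q v Y)"
    using cn_linear[OF q, of Y] subspace_add[OF tangent_subspace[of q]] subspace_scale[OF tangent_subspace[of q]] Y
    by (simp add: linear_on_def conn_def)
next
  fix v Y Z assume v: "v \<in> tangent_space A q" and "vector_field_near A q Y \<and> vector_field_near A q Z"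
  then have "section_near A (\<lambda>_. UNIV) q Y" "section_near A (\<lambda>_. UNIV) q Z"
    by (simp_all add: section_UNIV)
  from section_common[OF openU q this, unfolded section_UNIV] obtain W
    where W: "open W" "W \<subseteq> U" "q \<in> W" and Y: "vector_field A W Y" and Z: "vector_field A W Z" .
  interpret R: reeb_frame A H g PQ n W \<eta> I e \<xi> by (rule restrict_reeb[OF W(1,2)])
  have eq: "Y + Z = (\<lambda>r. Y r + Z r)" by (rule plus_fun_def)
  show "conn q v (Y + Z) = conn q v Y + conn q v Z"
    unfolding eq conn_eq[OF vf_add[OF Y Z] W(3) v] conn_eq[OF Y W(3) v] conn_eq[OF Z W(3) v]
    by (rule R.cn_add[OF W(3) v Y Z])
next
  fix v f Y assume v: "v \<in> tangent_space A q" and *: "smooth_fun_near A q f \<and> vector_field_near A q Y"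
  then obtain T where T: "q \<in> T" "smooth_fun A T f" unfolding smooth_fun_near_def by blast
  have Yn: "section_near A (\<lambda>_. UNIV) q Y" using * by (simp add: section_UNIV)
  have o: "open (T \<inter> U)" and qT: "q \<in> T \<inter> U" using smooth_fun_open[OF T(2)] openU T q by auto
  from section_common[OF o qT Yn Yn, unfolded section_UNIV] obtain W
    where W: "open W" "W \<subseteq> T \<inter> U" "q \<in> W" and Y: "vector_field A W Y" .
  have W': "W \<subseteq> U" "W \<subseteq> T" using W by auto
  note f = smooth_fun_subset[OF T(2) W(1) W'(2)]
  interpret R: reeb_frame A H g PQ n W \<eta> I e \<xi> by (rule restrict_reeb[OF W(1) W'(1)])
  show "conn q v (\<lambda>q. f q *\<^sub>R Y q) = v f *\<^sub>R Y q + f q *\<^sub>R conn q v Y"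
    unfolding conn_eq[OF vf_scale[OF f Y] W(3) v] conn_eq[OF Y W(3) v] by (rule R.cn_leib[OF W(3) v f Y])
next
  fix v Y assume "v \<notin> tangent_space A q \<or> \<not> vector_field_near A q Y"
  then show "conn q v Y = 0" by (auto simp: conn_def)
next
  have "Suc i \<in> Idx" if "i < 3" for i using that by (auto simp: Idx_def)
  then have "\<forall>i<3. vector_field A U (\<xi> (Suc i))" using xi by blast
  then show "\<exists>U X. q \<in> U \<and> (\<forall>i<3. vector_field A U (X i)) \<and> (\<forall>q\<in>U. is_basis 3 (VV q) (\<lambda>i. X i q))"
    using VV_basis q by (intro exI[of _ U] exI[of _ "\<lambda>i. \<xi> (Suc i)"]) blast
next
  show "H q \<inter> VV q = {0}" "{x + \<xi> |x \<xi>. x \<in> H q \<and> \<xi> \<in> VV q} = tangent_space A q"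
    by (rule VV_split[OF q])+
next
  fix v Y assume v: "v \<in> tangent_space A q" and Y: "section_near A H q Y"
  from section_common[OF openU q Y Y] obtain W where W: "open W" "W \<subseteq> U" "q \<in> W" and Y: "section_on A H W Y" .
  interpret R: reeb_frame A H g PQ n W \<eta> I e \<xi> by (rule restrict_reeb[OF W(1,2)])
  show "conn q v Y \<in> H q" unfolding R.conn_H[OF W(3) v Y] by (rule R.DH_in[OF W(3) Y])
next
  fix v Y assume v: "v \<in> tangent_space A q" and Y: "section_near A VV q Y"
  from section_common[OF openU q Y Y] obtain W where W: "open W" "W \<subseteq> U" "q \<in> W" and Y: "section_on A VV W Y" .
  interpret R: reeb_frame A H g PQ n W \<eta> I e \<xi> by (rule restrict_reeb[OF W(1,2)])
  show "conn q v Y \<in> VV q" unfolding conn_eq[OF section_onD(1)[OF Y] W(3) v] by (rule R.cn_V(2)[OF W(3) v Y])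
next
  fix v Y Z assume v: "v \<in> tangent_space A q" and *: "section_near A H q Y \<and> section_near A H q Z"
  from section_common[OF openU q conjunct1[OF *] conjunct2[OF *]] obtain W
    where W: "open W" "W \<subseteq> U" "q \<in> W" and Y: "section_on A H W Y" and Z: "section_on A H W Z" .
  interpret R: reeb_frame A H g PQ n W \<eta> I e \<xi> by (rule restrict_reeb[OF W(1,2)])
  show "v (\<lambda>q. g q (Y q) (Z q)) = g q (conn q v Y) (Z q) + g q (Y q) (conn q v Z)"
    unfolding R.conn_H[OF W(3) v Y] R.conn_H[OF W(3) v Z] by (rule R.DH_metric[OF W(3) v Y Z])
next
  fix T \<sigma> v assume *: "q \<in> T \<and> endo_field A H T \<sigma> \<and> (\<forall>q\<in>T. \<sigma> q \<in> PQ q)" and v: "v \<in> tangent_space A q"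
  define W where "W = T \<inter> U"
  have "open T" using * unfolding endo_field_def by blast
  then have W: "open W" "W \<subseteq> U" "q \<in> W" "W \<subseteq> T" using * openU q by (auto simp: W_def)
  interpret R: reeb_frame A H g PQ n W \<eta> I e \<xi> by (rule restrict_reeb[OF W(1,2)])
  have \<sigma>: "endo_field A H W \<sigma>" "\<And>r. r \<in> W \<Longrightarrow> \<sigma> r \<in> PQ r"
    using * W unfolding endo_field_def by blast+
  obtain f where f: "\<And>s. s \<in> Idx \<Longrightarrow> smooth_fun A W (f s)"
    and eq: "\<And>r x. r \<in> W \<Longrightarrow> \<sigma> r x = (\<Sum>s\<in>Idx. f s r *\<^sub>R I s r x)"
    using R.endo_expand[OF \<sigma>] by blast
  have "has_endo_deriv A conn H q v \<sigma> (\<Sum>t\<in>Idx. (v (f t) + (\<Sum>s\<in>Idx. f s q * AA s t q v)) *\<^sub>R I t q)"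
    by (rule endo_deriv[OF W(1-3) f eq v])
  moreover have "(\<Sum>t\<in>Idx. (v (f t) + (\<Sum>s\<in>Idx. f s q * AA s t q v)) *\<^sub>R I t q) \<in> PQ q"
    unfolding P.Q_sum by (rule exI, rule refl)
  ultimately show "\<exists>B\<in>PQ q. has_endo_deriv A conn H q v \<sigma> B" by blast
next
  fix X Y assume *: "section_near A H q X \<and> section_near A H q Y"
  from section_common[OF openU q conjunct1[OF *] conjunct2[OF *]] obtain W
    where W: "open W" "W \<subseteq> U" "q \<in> W" and X: "section_on A H W X" and Y: "section_on A H W Y" .
  interpret R: reeb_frame A H g PQ n W \<eta> I e \<xi> by (rule restrict_reeb[OF W(1,2)])
  interpret C: hconn A H g PQ n W \<eta> I e \<xi> K by (rule R.Koszul_hconn)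
  note Xv = section_onD(1)[OF X] and Yv = section_onD(1)[OF Y]
  have b: "lie_bracket A X Y q \<in> tangent_space A q" by (rule bracket_tangent[OF Xv Yv W(3)])
  have "proj_along (VV q) (H q) (lie_bracket A X Y q) = prV q (lie_bracket A X Y q)"
  proof (rule proj_along_eq[OF VV_subspace[OF q] H_subspace[OF q]])
    show "VV q \<inter> H q = {0}" using VV_split(1)[OF q] by blast
    show "prV q (lie_bracket A X Y q) \<in> VV q" using b by (simp add: VV_def)
    show "lie_bracket A X Y q - prV q (lie_bracket A X Y q) \<in> H q"
      using prH_in[OF q b] by (simp add: prH_def)
  qed
  moreover have "torsion A conn X Y q = prH q (lie_bracket A X Y q) - lie_bracket A X Y q"
    unfolding torsion_def R.conn_H[OF W(3) vf_tangent[OF Xv W(3)] Y] R.conn_H[OF W(3) vf_tangent[OF Yv W(3)] X]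
      R.DH_horizontal[OF W(3) X Y] R.DH_horizontal[OF W(3) Y X] C.D_tors[OF X Y W(3)] ..
  ultimately show "torsion A conn X Y q = - proj_along (VV q) (H q) (lie_bracket A X Y q)"
    by (simp add: prH_def)
next
  fix \<zeta> assume "section_near A VV q \<zeta>"
  then show "\<exists>B \<in> sp_n_sp_1_perp (g q) (PQ q) (H q).
    represents A H q (\<lambda>X. proj_along (H q) (VV q) (torsion A conn \<zeta> X q)) B" by (rule torsion_perp)
next
  fix v \<zeta> assume v: "v \<in> tangent_space A q" and Z: "section_near A VV q \<zeta>"
  from section_common[OF openU q Z Z] obtain W where W: "open W" "W \<subseteq> U" "q \<in> W" and Z: "section_on A VV W \<zeta>" .
  interpret R: reeb_frame A H g PQ n W \<eta> I e \<xi> by (rule restrict_reeb[OF W(1,2)])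
  note Zv = section_onD(1)[OF Z]
  have "has_endo_deriv A conn H q v (\<lambda>r. phi0 A H g PQ r (\<zeta> r))
    (\<Sum>t\<in>Idx. (v (\<lambda>r. \<eta> t r (\<zeta> r)) + (\<Sum>s\<in>Idx. \<eta> s q (\<zeta> q) * AA s t q v)) *\<^sub>R I t q)"
  proof (rule endo_deriv[OF W, where f = "\<lambda>s r. \<eta> s r (\<zeta> r)"])
    show "smooth_fun A W (\<lambda>r. \<eta> s r (\<zeta> r))" if "s \<in> Idx" for s by (rule eta_smooth[OF that W(2) Zv])
    show "phi0 A H g PQ r (\<zeta> r) x = (\<Sum>s\<in>Idx. \<eta> s r (\<zeta> r) *\<^sub>R I s r x)" if "r \<in> W" for r x
      unfolding R.phi0_eq[OF that vf_tangent[OF Zv that]] by (rule fun_sum_apply)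
  qed (rule v)
  moreover have "phi0 A H g PQ q (conn q v \<zeta>) =
    (\<Sum>t\<in>Idx. (v (\<lambda>r. \<eta> t r (\<zeta> r)) + (\<Sum>s\<in>Idx. \<eta> s q (\<zeta> q) * AA s t q v)) *\<^sub>R I t q)"
  proof -
    have "cn q v \<zeta> \<in> tangent_space A q" using R.cn_V(2)[OF W(3) v Z] VV_iff[OF q] by blast
    then show ?thesis
      unfolding conn_eq[OF Zv W(3) v] R.phi0_eq[OF W(3) \<open>cn q v \<zeta> \<in> tangent_space A q\<close>]
      by (intro sum.cong refl) (simp only: R.cn_V(3)[OF W(3) v Z] vc_def)
  qed
  ultimately show "has_endo_deriv A conn H q v (\<lambda>q. phi0 A H g PQ q (\<zeta> q)) (phi0 A H g PQ q (conn q v \<zeta>))"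
    by simp
qed

end

end

context pqc_frame
begin

lemma adapted_exists:
  "\<exists>D V. (\<forall>q\<in>U. adapted_at A H g PQ D V q) \<and> smooth_conn_on A U D"
proof -
  obtain \<zeta> where "pqc_dual A H g PQ n U \<eta> I e \<zeta>" using dual_frame_exists by blast
  from pqc_dual.reeb_frame_exists[OF this] obtain \<xi> where
    x: "pqc_dual A H g PQ n U \<eta> I e \<xi>" and r: "\<forall>q\<in>U. \<forall>s\<in>Idx. \<forall>x\<in>H q. pqc_dual.af A g n \<eta> e \<xi> s s q x = 0"
    by blast
  interpret reeb_frame A H g PQ n U \<eta> I e \<xi>
    by (rule reeb_frame.intro[OF x]) (unfold_locales, use r in blast)
  show ?thesis using conn_adapted conn_smooth by blast
qed

end

section \<open>Existence of frames and change of the metric\<close>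

lemma is_basis_expand:
  assumes "is_basis r S e" "x \<in> S"
  shows "\<exists>c. x = (\<Sum>i<r. c i *\<^sub>R e i)"
proof -
  have inj: "inj_on e {..<r}" and "x \<in> span (e ` {..<r})" using assms by (simp_all add: is_basis_def)
  then obtain u where "x = (\<Sum>v\<in>e ` {..<r}. u v *\<^sub>R v)" by (auto simp: span_finite)
  then have "x = (\<Sum>i<r. u (e i) *\<^sub>R e i)" by (simp add: sum.reindex[OF inj])
  then show ?thesis by (rule exI[of _ "\<lambda>i. u (e i)"])
qed

lemma is_basis_mem: "is_basis r S e \<Longrightarrow> i < r \<Longrightarrow> e i \<in> S"
  using span_base[of "e i" "e ` {..<r}"] by (simp add: is_basis_def)

lemma independent_card_span:
  assumes "is_basis r S e" "inj_on f {..<r}" "independent (f ` {..<r})" "f ` {..<r} \<subseteq> S"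
  shows "span (f ` {..<r}) = S"
proof
  have e: "inj_on e {..<r}" "span (e ` {..<r}) = S" using assms(1) by (auto simp: is_basis_def)
  have "subspace S" using subspace_span[of "e ` {..<r}"] e(2) by simp
  then show "span (f ` {..<r}) \<subseteq> S" by (rule span_minimal[OF assms(4)])
  show "S \<subseteq> span (f ` {..<r})"
  proof (rule subsetI, rule ccontr)
    fix x assume x: "x \<in> S" "x \<notin> span (f ` {..<r})"
    then have x': "x \<notin> f ` {..<r}" using span_base[of x "f ` {..<r}"] by argo
    then have ind: "independent (insert x (f ` {..<r}))" using assms(3) x(2) by (simp add: independent_insert)
    have sub: "insert x (f ` {..<r}) \<subseteq> span (e ` {..<r})" using x(1) assms(4) e(2) by simp
    have "card (insert x (f ` {..<r})) \<le> card (e ` {..<r})"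
      using independent_span_bound[OF finite_imageI[OF finite_lessThan] ind sub] by (rule conjunct2)
    then show False using x' by (simp add: card_image assms(2) e(1))
  qed
qed

section \<open>Smooth orthogonal frames of H near every point\<close>

locale pqc_metric = smooth_mfd A
  for A :: "('m::{t2_space,second_countable_topology}, 'e::euclidean_space) atlas" +
  fixes H :: "'m \<Rightarrow> 'm tvec set" and g :: "'m \<Rightarrow> 'm tvec \<Rightarrow> 'm tvec \<Rightarrow> real"
    and PQ :: "'m \<Rightarrow> ('m tvec \<Rightarrow> 'm tvec) set" and n :: nat
  assumes n: "n \<ge> 2" and metric: "metric_on A H (2 * n) (2 * n) g" and sub: "subbundle A (4 * n) H"
    and data: "\<exists>U \<eta> I. p \<in> U \<and> local_data A H g PQ U \<eta> I"
begin

lemma H_subspace: "subspace (H q)"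
proof -
  obtain W X where "q \<in> W" "\<forall>q\<in>W. is_basis (4 * n) (H q) (\<lambda>i. X i q)"
    using sub unfolding subbundle_def by blast
  then have "H q = span ((\<lambda>i. X i q) ` {..<4 * n})" by (simp add: is_basis_def)
  then show ?thesis using subspace_span by simp
qed

lemma g_lin: "x \<in> H q \<Longrightarrow> linear_on (H q) (g q x)"
  using metric[unfolded metric_on_def, THEN conjunct1, THEN spec, of q] by (elim conjE bspec)

lemma g_sym: "x \<in> H q \<Longrightarrow> y \<in> H q \<Longrightarrow> g q x y = g q y x"
  using metric[unfolded metric_on_def, THEN conjunct1, THEN spec, of q] by (elim conjE) (drule bspec, assumption, drule bspec)

lemma g_smooth: "section_on A H W X \<Longrightarrow> section_on A H W Y \<Longrightarrow> smooth_fun A W (\<lambda>q. g q (X q) (Y q))"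
  using metric[unfolded metric_on_def, THEN conjunct2, THEN spec, THEN spec, THEN spec, of W X Y] by simp

lemma g_lin_left: "z \<in> H q \<Longrightarrow> linear_on (H q) (\<lambda>x. g q x z)"
proof -
  assume z: "z \<in> H q"
  note l = linear_onD[OF g_lin[OF z]]
  show ?thesis
    unfolding linear_on_def
    by (intro conjI ballI allI)
      (simp_all only: g_sym[OF _ z] l subspace_add[OF H_subspace] subspace_scale[OF H_subspace])
qed

text \<open>The signature provides an orthonormal basis at the point \<open>p\<close> only. Its
  coefficients with respect to a smooth frame are kept constant, which gives smooth sections that
  are orthonormal at \<open>p\<close> and nothing more elsewhere.\<close>

lemma orthonormal_extension:
  "\<exists>U Y. open U \<and> p \<in> U \<and> (\<forall>a<4*n. section_on A H U (Y a)) \<and>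
    (\<forall>a<4*n. \<forall>b<4*n. \<bar>g p (Y a p) (Y b p)\<bar> = (if a = b then 1 else 0)) \<and>
    (\<forall>q\<in>U. \<exists>X. is_basis (4 * n) (H q) X)"
proof -
  obtain U X where p: "p \<in> U" and U': "\<forall>i<4*n. vector_field A U (X i)"
    and X': "\<forall>q\<in>U. is_basis (4 * n) (H q) (\<lambda>i. X i q)"
    using sub[unfolded subbundle_def, THEN spec, of p] by (elim exE conjE) (rule that)
  note U = p U'[rule_format] and X = X'[rule_format]
  have o: "open U" using vf_open[OF U(2)[of 0]] n by simp
  have dim: "dim (H p) = 4 * n"
  proof -
    have b: "inj_on (\<lambda>i. X i p) {..<4 * n}" "independent ((\<lambda>i. X i p) ` {..<4 * n})"
      "span ((\<lambda>i. X i p) ` {..<4 * n}) = H p" using X[OF U(1)] by (auto simp: is_basis_def)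
    have "dim (H p) = card ((\<lambda>i. X i p) ` {..<4 * n})"
      by (rule dim_eq_card[OF _ b(2)]) (simp only: b(3) span_eq_iff[THEN iffD2, OF H_subspace])
    then show ?thesis by (simp add: card_image[OF b(1)])
  qed
  have "has_signature (g p) (H p) (2 * n) (2 * n)"
    using metric[unfolded metric_on_def, THEN conjunct1, THEN spec, of p] by (elim conjE)
  then obtain E where "orthonormal_basis (g p) (H p) E" unfolding has_signature_def by blast
  then have E: "is_basis (4 * n) (H p) E"
    and EE: "\<And>a b. a < 4 * n \<Longrightarrow> b < 4 * n \<Longrightarrow> \<bar>g p (E a) (E b)\<bar> = (if a = b then 1 else 0)"
    unfolding orthonormal_basis_def dim by blast+
  have "\<forall>a\<in>{..<4*n}. \<exists>c. E a = (\<Sum>i<4*n. c i *\<^sub>R X i p)"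
    by (intro ballI is_basis_expand[OF X[OF U(1)]] is_basis_mem[OF E]) simp
  from bchoice[OF this] obtain c where c0: "\<forall>a\<in>{..<4*n}. E a = (\<Sum>i<4*n. c a i *\<^sub>R X i p)" ..
  have c: "E a = (\<Sum>i<4*n. c a i *\<^sub>R X i p)" if "a < 4 * n" for a
    by (rule bspec[OF c0]) (use that in simp)
  define Y where "Y a q = (\<Sum>i<4*n. c a i *\<^sub>R X i q)" for a q
  have Xs: "section_on A H U (X i)" if "i < 4 * n" for i
    by (rule section_onI[OF U(2)[OF that]]) (rule is_basis_mem[OF X that])
  show ?thesis
  proof (intro exI conjI allI impI ballI)
    show "open U" "p \<in> U" by (rule o, rule U(1))
    show "section_on A H U (Y a)" for a
    proof (rule section_onI)
      show "vector_field A U (Y a)"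
        unfolding Y_def[abs_def] by (rule vf_sum[OF o vf_cscale[OF U(2)]]) simp
      show "Y a q \<in> H q" if "q \<in> U" for q
        unfolding Y_def by (rule subspace_sum[OF H_subspace subspace_scale[OF H_subspace section_onD(2)[OF Xs that]]]) simp
    qed
    show "\<bar>g p (Y a p) (Y b p)\<bar> = (if a = b then 1 else 0)" if "a < 4 * n" "b < 4 * n" for a b
      using EE[OF that] unfolding Y_def c[OF that(1), symmetric] c[OF that(2), symmetric] .
    show "is_basis (4 * n) (H q) (\<lambda>i. X i q)" if "q \<in> U" for q by (rule X[OF that])
  qed
qed

definition orth_on :: "'m set \<Rightarrow> nat \<Rightarrow> (nat \<Rightarrow> 'm \<Rightarrow> 'm tvec) \<Rightarrow> bool" where
  "orth_on W m e \<longleftrightarrow> (\<forall>a<m. section_on A H W (e a)) \<and> (\<forall>q\<in>W. \<forall>a<m. g q (e a q) (e a q) \<noteq> 0) \<and>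
    (\<forall>q\<in>W. \<forall>a<m. \<forall>b<m. a \<noteq> b \<longrightarrow> g q (e a q) (e b q) = 0)"

text \<open>The Gram--Schmidt process does not change the frame at \<open>p\<close>, where it is orthonormal, hence no
  vector becomes isotropic near \<open>p\<close>.\<close>

lemma gram_schmidt:
  assumes U: "open U" "p \<in> U" and Y: "\<And>a. a < N \<Longrightarrow> section_on A H U (Y a)"
    and orth: "\<And>a b. a < N \<Longrightarrow> b < N \<Longrightarrow> \<bar>g p (Y a p) (Y b p)\<bar> = (if a = b then 1 else 0)"
  shows "m \<le> N \<Longrightarrow> \<exists>W e. open W \<and> W \<subseteq> U \<and> p \<in> W \<and> orth_on W m e \<and> (\<forall>a<m. e a p = Y a p)"
proof (induction m)
  case 0
  have "orth_on U 0 Y" by (simp add: orth_on_def)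
  then show ?case using U by blast
next
  case (Suc m)
  then obtain W e where W: "open W" "W \<subseteq> U" "p \<in> W" and oe: "orth_on W m e" and ep: "\<And>a. a < m \<Longrightarrow> e a p = Y a p"
    by (metis Suc_leD)
  have m: "m < N" using Suc.prems by simp
  have es: "section_on A H W (e a)" if "a < m" for a using oe that unfolding orth_on_def by blast
  have nz: "g q (e a q) (e a q) \<noteq> 0" if "q \<in> W" "a < m" for q a using oe that unfolding orth_on_def by blast
  have oo: "g q (e a q) (e b q) = 0" if "q \<in> W" "a < m" "b < m" "a \<noteq> b" for q a b
    using oe that unfolding orth_on_def by blast
  note Ym = section_subset[OF Y[OF m] W(1,2)]
  define c where "c j q = g q (Y m q) (e j q) / g q (e j q) (e j q)" for j q
  define f where "f q = Y m q - (\<Sum>j<m. c j q *\<^sub>R e j q)" for q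
  have cs: "smooth_fun A W (c j)" if "j < m" for j
    unfolding c_def[abs_def] by (rule smooth_fun_divide[OF g_smooth[OF Ym es[OF that]] g_smooth[OF es[OF that] es[OF that]] nz[OF _ that]])
  have ce: "c j q *\<^sub>R e j q \<in> H q" if "q \<in> W" "j \<in> {..<m}" for q j
    by (rule subspace_scale[OF H_subspace section_onD(2)[OF es that(1)]]) (use that in simp)
  have fs: "section_on A H W f"
    unfolding f_def[abs_def]
  proof (rule section_onI[OF vf_diff[OF section_onD(1)[OF Ym] vf_sum[OF W(1) vf_scale]]])
    show "Y m q - (\<Sum>j<m. c j q *\<^sub>R e j q) \<in> H q" if "q \<in> W" for q
      by (rule subspace_diff[OF H_subspace section_onD(2)[OF Ym that] subspace_sum[OF H_subspace ce[OF that]]])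
  qed (use cs section_onD(1)[OF es] in simp_all)
  have fo: "g q (f q) (e b q) = 0" if q: "q \<in> W" and b: "b < m" for q b
  proof -
    note eb = section_onD(2)[OF es[OF b] q]
    note l = g_lin_left[OF eb]
    have "g q (f q) (e b q) = g q (Y m q) (e b q) - g q (\<Sum>j<m. c j q *\<^sub>R e j q) (e b q)"
      unfolding f_def
      by (rule linear_on_diff[OF l H_subspace section_onD(2)[OF Ym q] subspace_sum[OF H_subspace ce[OF q]]])
    also have "g q (\<Sum>j<m. c j q *\<^sub>R e j q) (e b q) = (\<Sum>j<m. g q (c j q *\<^sub>R e j q) (e b q))"
      by (rule linear_on_sum[OF l H_subspace ce[OF q]])
    also have "\<dots> = (\<Sum>j<m. if j = b then g q (Y m q) (e b q) else 0)"
    proof (rule sum.cong[OF refl])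
      fix j assume "j \<in> {..<m}"
      then have j: "j < m" by simp
      have "g q (c j q *\<^sub>R e j q) (e b q) = c j q * g q (e j q) (e b q)"
        using linear_onD(2)[OF l section_onD(2)[OF es[OF j] q]] by simp
      then show "g q (c j q *\<^sub>R e j q) (e b q) = (if j = b then g q (Y m q) (e b q) else 0)"
        using oo[OF q j b] nz[OF q b] by (simp add: c_def)
    qed
    also have "\<dots> = g q (Y m q) (e b q)" using b by simp
    finally show ?thesis by simp
  qed
  have fp: "f p = Y m p"
  proof -
    have "c j p = 0" if "j < m" for j
      using orth[of m j] m that by (simp add: c_def ep)
    then show ?thesis by (simp add: f_def)
  qed
  define W' where "W' = {q \<in> W. g q (f q) (f q) \<noteq> 0}"
  have W': "open W'" "W' \<subseteq> W" "p \<in> W'"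
    using smooth_fun_nonzero_open[OF g_smooth[OF fs fs]] W(3) orth[OF m m] by (auto simp: W'_def fp)
  define e' where "e' = e(m := f)"
  have e': "e' m = f" "\<And>a. a < m \<Longrightarrow> e' a = e a" by (simp_all add: e'_def)
  have "orth_on W' (Suc m) e'"
    unfolding orth_on_def
  proof (intro conjI allI impI ballI)
    fix a assume "a < Suc m"
    then have a: "a < m \<or> a = m" by auto
    show "section_on A H W' (e' a)" using a section_subset[OF es W'(1,2)] section_subset[OF fs W'(1,2)] e' by auto
    fix q assume "q \<in> W'"
    then have q: "q \<in> W" "g q (f q) (f q) \<noteq> 0" by (auto simp: W'_def)
    show "g q (e' a q) (e' a q) \<noteq> 0" using a nz[OF q(1)] q(2) e' by auto
    fix b assume "b < Suc m" and ab: "a \<noteq> b"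
    then have b: "b < m \<or> b = m" by auto
    have "g q (e c q) (f q) = 0" if "c < m" for c
      using g_sym[OF section_onD(2)[OF es[OF that] q(1)] section_onD(2)[OF fs q(1)]] fo[OF q(1) that] by simp
    then show "g q (e' a q) (e' b q) = 0" using a b ab oo[OF q(1)] fo[OF q(1)] e' by auto
  qed
  moreover have "e' a p = Y a p" if "a < Suc m" for a
    using that ep fp e' by (cases "a = m") auto
  ultimately show ?case using W'(1,3) subset_trans[OF W'(2) W(2)] by blast
qed

text \<open>Orthogonal non-isotropic vectors are independent, being dual to the functionals g(e_a,
  .) / g(e_a, e_a). There are as many of them as the rank of H, so they span.\<close>

lemma frame_exists:
  "\<exists>U e. open U \<and> p \<in> U \<and> orth_on U (4 * n) e \<and> (\<forall>q\<in>U. span ((\<lambda>a. e a q) ` {..<4 * n}) = H q)"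
proof -
  obtain U Y where U: "open U" "p \<in> U" and Y: "\<forall>a<4*n. section_on A H U (Y a)"
    and orth: "\<forall>a<4*n. \<forall>b<4*n. \<bar>g p (Y a p) (Y b p)\<bar> = (if a = b then 1 else 0)"
    and X: "\<forall>q\<in>U. \<exists>X. is_basis (4 * n) (H q) X"
    using orthonormal_extension[of p] by (elim exE conjE) (rule that)
  have "\<exists>W e. open W \<and> W \<subseteq> U \<and> p \<in> W \<and> orth_on W (4 * n) e \<and> (\<forall>a<4*n. e a p = Y a p)"
    by (rule gram_schmidt[OF U _ _ order_refl]) (use Y orth in simp_all)
  then obtain W e where W: "open W" "W \<subseteq> U" "p \<in> W" and e: "orth_on W (4 * n) e"
    by (elim exE conjE) (rule that)
  have "span ((\<lambda>a. e a q) ` {..<4 * n}) = H q" if q: "q \<in> W" for q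
  proof -
    obtain X where X: "is_basis (4 * n) (H q) X" using X q W by blast
    have es: "e a q \<in> H q" if "a < 4 * n" for a
      using e that section_onD(2)[OF _ q] unfolding orth_on_def by blast
    have nz: "g q (e a q) (e a q) \<noteq> 0" if "a < 4 * n" for a using e q that unfolding orth_on_def by blast
    have oo: "g q (e a q) (e b q) = 0" if "a < 4 * n" "b < 4 * n" "a \<noteq> b" for a b
      using e q that unfolding orth_on_def by blast
    let ?f = "\<lambda>a x. (1 / g q (e a q) (e a q)) *\<^sub>R g q (e a q) x"
    have f: "linear_on (H q) (?f a)" if "a \<in> {..<4*n}" for a
      by (rule linear_on_scaleR_fun[OF g_lin[OF es]]) (use that in simp)
    have fe: "?f a (e b q) = (if a = b then 1 else 0)" if "a \<in> {..<4*n}" "b \<in> {..<4*n}" for a b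
      by (cases "a = b") (use oo[of a b] nz[of a] that in simp_all)
    have m: "e a q \<in> H q" if "a \<in> {..<4*n}" for a using es that by simp
    note d = dual_independent[of "{..<4*n}" "H q" "\<lambda>a. e a q" ?f, OF finite_lessThan H_subspace m f fe]
    show ?thesis by (rule independent_card_span[OF X d]) (use es in auto)
  qed
  then show ?thesis using W(1,3) e by blast
qed

lemma local_frame:
  assumes D: "local_data A H g PQ U \<eta> I" and p: "p \<in> U"
  obtains W e where "p \<in> W" "W \<subseteq> U" "pqc_frame A H g PQ n W \<eta> I e"
proof -
  obtain T e where T: "open T" "p \<in> T" and e: "orth_on T (4 * n) e"
    and sp: "\<forall>q\<in>T. span ((\<lambda>a. e a q) ` {..<4 * n}) = H q" using frame_exists by blast
  have oU: "open U" using local_dataD(1)[OF D, of 1] by (simp add: one_form_def)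
  have W: "open (T \<inter> U)" "T \<inter> U \<subseteq> U" "T \<inter> U \<subseteq> T" using T oU by auto
  have es: "section_on A H (T \<inter> U) (e a)" if "a < 4 * n" for a
    using e that section_subset[OF _ W(1,3)] unfolding orth_on_def by blast
  have "pqc_frame A H g PQ n (T \<inter> U) \<eta> I e"
  proof
    show "2 \<le> n" "metric_on A H (2 * n) (2 * n) g" "local_data A H g PQ (T \<inter> U) \<eta> I"
      by (rule n, rule metric, rule local_data_subset[OF D W(1,2)])
    show "section_on A H (T \<inter> U) (e a)" if "a < 4 * n" for a by (rule es[OF that])
    fix q assume "q \<in> T \<inter> U"
    then have q: "q \<in> T" by simp
    show "g q (e a q) (e b q) = 0" if "a < 4 * n" "b < 4 * n" "a \<noteq> b" for a b
      using e q that unfolding orth_on_def by blast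
    show "g q (e a q) (e a q) \<noteq> 0" if "a < 4 * n" for a using e q that unfolding orth_on_def by blast
    show "span ((\<lambda>a. e a q) ` {..<4 * n}) = H q" using sp q by blast
  qed
  then show thesis using that T p by blast
qed

end

text \<open>On H the derivative of f \<eta>_s is f d\<eta>_s, since \<eta>_s vanishes there.
  Multiplying the forms by the conformal factor therefore passes from the representative in the
  definition to any metric of the class, with the same I_s.\<close>

lemma (in smooth_mfd) local_data_rescale:
  assumes D: "local_data A H g PQ U \<eta> I" and f: "smooth_fun A UNIV f" "\<And>p. f p > 0"
    and g': "\<And>p x y. x \<in> H p \<Longrightarrow> y \<in> H p \<Longrightarrow> g' p x y = f p * g p x y"
  shows "local_data A H g' PQ U (\<lambda>s q v. f q * \<eta> s q v) I"
proof (rule local_dataI)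
  note d = local_dataD[OF D]
  have Iin: "I s q x \<in> H q" if "q \<in> U" "s \<in> Idx" "x \<in> H q" for s q x
    using d(2)[OF that(2)] that unfolding endo_field_def endos_def by blast
  show "one_form A U (\<lambda>q v. f q * \<eta> s q v)" if s: "s \<in> Idx" for s
    unfolding one_form_def
  proof (intro conjI ballI allI impI)
    note o = d(1)[OF s, unfolded one_form_def]
    show "open U" using o by blast
    show "linear_on (tangent_space A q) (\<lambda>v. f q * \<eta> s q v)" if "q \<in> U" for q
      using linear_on_scaleR_fun[of _ "\<eta> s q" "f q"] o that by simp
    fix W X assume W: "W \<subseteq> U \<and> vector_field A W X"
    show "smooth_fun A W (\<lambda>p. f p * \<eta> s p (X p))"
      by (rule smooth_fun_mult[OF smooth_fun_subset[OF f(1)]]) (use o W vf_open in blast)+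
  qed
  show "endo_field A H U (I s)" if "s \<in> Idx" for s by (rule d(2)[OF that])
  fix q assume q: "q \<in> U"
  show "paraquaternionic (H q) (\<lambda>s. I s q)" "PQ q = span {I 1 q, I 2 q, I 3 q}" by (rule d(3,4)[OF q])+
  have "f q \<noteq> 0" using f(2)[of q] by simp
  then show "H q = {v \<in> tangent_space A q. \<forall>s\<in>Idx. f q * \<eta> s q v = 0}"
    unfolding mult_eq_0_iff d(5)[OF q] by simp
  fix s x y assume s: "s \<in> Idx" and x: "x \<in> H q" and y: "y \<in> H q"
  show "g' q (I s q x) (I s q y) = - \<epsilon> s * g' q x y"
    unfolding g'[OF Iin[OF q s x] Iin[OF q s y]] g'[OF x y] d(6)[OF q s x y] by simp
next
  note d = local_dataD[OF D]
  fix s W X Y q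
  assume s: "s \<in> Idx" and W: "W \<subseteq> U" and X: "section_on A H W X" and Y: "section_on A H W Y" and q: "q \<in> W"
  have qU: "q \<in> U" using q W by blast
  have Iin: "I s q (X q) \<in> H q"
    using d(2)[OF s] qU section_onD(2)[OF X q] unfolding endo_field_def endos_def by blast
  note o = vf_open[OF section_onD(1)[OF X]]
  have z: "\<eta> s r (Z r) = 0" if "section_on A H W Z" "r \<in> W" for Z r
    using section_onD(2)[OF that] d(5)[of r] W that(2) s by blast
  have z1: "Z q (\<lambda>r. \<eta> s r (Z' r)) = 0" "Z q (\<lambda>r. f r * \<eta> s r (Z' r)) = 0"
    if Z: "section_on A H W Z" and Z': "section_on A H W Z'" for Z Z'
  proof -
    note Zq = vf_tangent[OF section_onD(1)[OF Z] q]
    have "Z q (\<lambda>r. \<eta> s r (Z' r)) = Z q (\<lambda>r. 0)" by (rule tangent_cong[OF Zq o q]) (rule z[OF Z'])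
    then show "Z q (\<lambda>r. \<eta> s r (Z' r)) = 0" unfolding tangent_const[OF Zq] .
    have "Z q (\<lambda>r. f r * \<eta> s r (Z' r)) = Z q (\<lambda>r. 0)" by (rule tangent_cong[OF Zq o q]) (simp add: z[OF Z'])
    then show "Z q (\<lambda>r. f r * \<eta> s r (Z' r)) = 0" unfolding tangent_const[OF Zq] .
  qed
  have "ext_deriv A (\<lambda>q v. f q * \<eta> s q v) X Y q = f q * ext_deriv A (\<eta> s) X Y q"
    unfolding ext_deriv_def z1[OF X Y] z1[OF Y X] by simp
  then show "ext_deriv A (\<lambda>q v. f q * \<eta> s q v) X Y q = - 2 * \<epsilon> s * g' q (I s q (X q)) (Y q)"
    unfolding d(7)[OF s W X Y q] g'[OF Iin section_onD(2)[OF Y q]] by simp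
qed

section \<open>Glueing\<close>

lemma smooth_conn_on_subset: "smooth_conn_on A U D \<Longrightarrow> W \<subseteq> U \<Longrightarrow> smooth_conn_on A W D"
  unfolding smooth_conn_on_def by (meson subset_trans)

context smooth_mfd
begin

lemma section_near_cong:
  assumes U: "open U" "p \<in> U" "\<And>q. q \<in> U \<Longrightarrow> V q = V' q" and Y: "section_near A V p Y"
  shows "section_near A V' p Y"
proof -
  from section_common[OF U(1,2) Y Y] obtain W where W: "W \<subseteq> U" "p \<in> W" and Y: "section_on A V W Y" .
  have "section_on A V' W Y"
    by (rule section_onI[OF section_onD(1)[OF Y]]) (use section_onD(2)[OF Y] U(3) W(1) in blast)
  then show ?thesis by (rule section_nearI[OF _ W(2)])
qed

text \<open>The connection enters through its value at \<open>p\<close>, the complement through its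
  germ, as sections of V and the local frame of V live near \<open>p\<close>. This asymmetry is that
  of the two hypotheses.\<close>

lemma adapted_at_cong:
  assumes U: "open U" "p \<in> U" and D: "D p = D' p" and V: "\<And>q. q \<in> U \<Longrightarrow> V q = V' q"
    and a: "adapted_at A H g PQ D V p"
  shows "adapted_at A H g PQ D' V' p"
proof -
  have sn: "section_near A V p Y = section_near A V' p Y" for Y
    using section_near_cong[of U p V V' Y, OF U V] section_near_cong[of U p V' V Y, OF U V[symmetric]] by blast
  have Vp: "V p = V' p" by (rule V[OF U(2)])
  obtain T X where T: "p \<in> T" "\<forall>i<3. vector_field A T (X i)" "\<forall>q\<in>T. is_basis 3 (V q) (\<lambda>i. X i q)"
    using adapted_atD(5)[OF a] by (elim exE conjE) (rule that)
  have o: "open T" using vf_open[OF T(2)[rule_format, of 0]] by simp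
  have basis: "\<exists>U X. p \<in> U \<and> (\<forall>i<3. vector_field A U (X i)) \<and> (\<forall>q\<in>U. is_basis 3 (V' q) (\<lambda>i. X i q))"
  proof (intro exI conjI allI impI ballI)
    show "p \<in> T \<inter> U" using T(1) U(2) by simp
    show "vector_field A (T \<inter> U) (X i)" if "i < 3" for i
      by (rule vf_subset[OF T(2)[rule_format, OF that]]) (use o U(1) in auto)
    show "is_basis 3 (V' q) (\<lambda>i. X i q)" if "q \<in> T \<inter> U" for q
      using T(3) V[of q] that by auto
  qed
  note d = a[unfolded adapted_at_def torsion_def has_endo_deriv_def D Vp sn]
  show ?thesis
    unfolding adapted_at_def torsion_def has_endo_deriv_def using d
    by (elim conjE) (intro conjI basis; assumption)
qed

text \<open>The Leibniz rule for the characteristic function of \<open>W\<close>, whose derivative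
  at \<open>p\<close> is zero, as for tangent vectors.\<close>

lemma conn_germ:
  assumes L: "linear_connection A D" and W: "open W" "p \<in> W" and eq: "\<And>q. q \<in> W \<Longrightarrow> Y q = Y' q"
    and v: "v \<in> tangent_space A p"
  shows "D p v Y = D p v Y'"
proof (cases "vector_field_near A p Y")
  case True
  have near: "vector_field_near A p Z'" if "vector_field_near A p Z" "\<And>q. q \<in> W \<Longrightarrow> Z q = Z' q" for Z Z'
  proof -
    obtain T where T: "p \<in> T" "vector_field A T Z" using \<open>vector_field_near A p Z\<close> unfolding vector_field_near_def by blast
    have "vector_field A (T \<inter> W) Z'"
      by (rule vf_cong[OF vf_subset[OF T(2)]]) (use vf_open[OF T(2)] W(1) that(2) in auto)
    then show ?thesis by (rule vector_field_nearI) (use T(1) W(2) in simp)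
  qed
  have True': "vector_field_near A p Y'" by (rule near[OF True eq])
  define c where "c = (\<lambda>q. if q \<in> W then 1::real else 0)"
  have c: "smooth_fun_near A p c" unfolding c_def by (rule smooth_fun_nearI[OF smooth_fun_indicator[OF W(1)] W(2)])
  have "v c = v (\<lambda>r. 1)" by (rule tangent_cong[OF v W]) (simp add: c_def)
  then have vc: "v c = 0" using tangent_const[OF v] by simp
  have cp: "c p = 1" using W by (simp add: c_def)
  have "D p v (\<lambda>q. c q *\<^sub>R Z q) = D p v Z" if Z: "vector_field_near A p Z" for Z
  proof -
    have "D p v (\<lambda>q. c q *\<^sub>R Z q) = v c *\<^sub>R Z p + c p *\<^sub>R D p v Z"
      using L v c Z unfolding linear_connection_def by simp
    then show ?thesis unfolding vc cp by (simp only: scaleR_zero_left scaleR_one add_0_left)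
  qed
  from this[OF True] this[OF True'] have "D p v Y = D p v (\<lambda>q. c q *\<^sub>R Y q)" "D p v Y' = D p v (\<lambda>q. c q *\<^sub>R Y' q)"
    by simp_all
  moreover have "(\<lambda>q. c q *\<^sub>R Y q) = (\<lambda>q. c q *\<^sub>R Y' q)" using eq by (auto simp: c_def)
  ultimately show ?thesis by simp
next
  case False
  have "\<not> vector_field_near A p Y'"
  proof
    assume "vector_field_near A p Y'"
    then obtain T where T: "p \<in> T" "vector_field A T Y'" unfolding vector_field_near_def by blast
    have "vector_field A (T \<inter> W) Y"
      by (rule vf_cong[OF vf_subset[OF T(2)]]) (use vf_open[OF T(2)] W(1) eq in auto)
    then show False using vector_field_nearI[of A "T \<inter> W" Y p] T(1) W(2) False by simp
  qed
  then show ?thesis using L False unfolding linear_connection_def by simp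
qed

text \<open>A rearrangement of quantifiers. Every clause is a statement about each point separately
  except the smoothness clause of \<open>linear_connection\<close>, which becomes
  \<open>smooth_conn_on\<close> over the whole manifold.\<close>

lemma conditions_iff_adapted:
  "linear_connection A D \<and> subbundle A 3 V \<and> supplementary A H V \<and>
    (preserves_subbundle A D H \<and> preserves_subbundle A D V \<and> preserves_metric A D H g \<and> preserves_PQ A D H PQ) \<and>
    (\<forall>p X Y. section_near A H p X \<and> section_near A H p Y \<longrightarrow>
       torsion A D X Y p = - proj_along (V p) (H p) (lie_bracket A X Y p)) \<and>
    (\<forall>p \<xi>. section_near A V p \<xi> \<longrightarrow>
       (\<exists>B \<in> sp_n_sp_1_perp (g p) (PQ p) (H p).
          represents A H p (\<lambda>X. proj_along (H p) (V p) (torsion A D \<xi> X p)) B)) \<and>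
    parallel_identification A D H V (phi0 A H g PQ)
  \<longleftrightarrow> (\<forall>p. adapted_at A H g PQ D V p) \<and> smooth_conn_on A UNIV D" (is "?L = ?R")
proof
  assume L: ?L
  note l1 = conjunct1[OF L] and r1 = conjunct2[OF L]
  note l2 = conjunct1[OF r1] and r2 = conjunct2[OF r1]
  note l3 = conjunct1[OF r2] and r3 = conjunct2[OF r2]
  note l4 = conjunct1[OF r3] and r4 = conjunct2[OF r3]
  note t = conjunct1[OF r4] and r5 = conjunct2[OF r4]
  note perp = conjunct1[OF r5] and par = conjunct2[OF r5, unfolded parallel_identification_def]
  note c1 = conjunct1[OF l1[unfolded linear_connection_def]] and d1 = conjunct2[OF l1[unfolded linear_connection_def]]
  note c2 = conjunct1[OF d1] and d2 = conjunct2[OF d1]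
  note c3 = conjunct1[OF d2] and d3 = conjunct2[OF d2]
  note c4 = conjunct1[OF d3] and c5 = conjunct2[OF d3]
  note pH = conjunct1[OF l4, unfolded preserves_subbundle_def] and e1 = conjunct2[OF l4]
  note pV = conjunct1[OF e1, unfolded preserves_subbundle_def] and e2 = conjunct2[OF e1]
  note pm = conjunct1[OF e2, unfolded preserves_metric_def] and pQ = conjunct2[OF e2, unfolded preserves_PQ_def]
  note sb = l2[unfolded subbundle_def] and su = l3[unfolded supplementary_def]
  have "adapted_at A H g PQ D V p" for p
  proof -
    have pQ': "\<forall>U \<sigma>. p \<in> U \<and> endo_field A H U \<sigma> \<and> (\<forall>q\<in>U. \<sigma> q \<in> PQ q) \<longrightarrow>
      (\<forall>v\<in>tangent_space A p. \<exists>B\<in>PQ p. has_endo_deriv A D H p v \<sigma> B)"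
    proof (intro allI impI, elim conjE)
      fix U \<sigma> assume *: "p \<in> U" "endo_field A H U \<sigma>" "\<forall>q\<in>U. \<sigma> q \<in> PQ q"
      show "\<forall>v\<in>tangent_space A p. \<exists>B\<in>PQ p. has_endo_deriv A D H p v \<sigma> B"
        by (rule bspec[OF mp[OF spec[OF spec[OF pQ]]] *(1)]) (rule conjI[OF *(2,3)])
    qed
    show ?thesis
      unfolding adapted_at_def
      by (rule conjI[OF spec[OF c1] conjI[OF spec[OF c2] conjI[OF spec[OF c3] conjI[OF spec[OF c5]
        conjI[OF spec[OF sb] conjI[OF conjunct1[OF spec[OF su]] conjI[OF conjunct2[OF spec[OF su]]
        conjI[OF spec[OF pH] conjI[OF spec[OF pV] conjI[OF spec[OF pm] conjI[OF pQ'
        conjI[OF spec[OF t] conjI[OF spec[OF perp] spec[OF par]]]]]]]]]]]]]])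
  qed
  moreover have "smooth_conn_on A UNIV D" using c4 unfolding smooth_conn_on_def by (simp only: subset_UNIV simp_thms)
  ultimately show ?R by (intro conjI allI)
next
  assume R: ?R
  have a: "adapted_at A H g PQ D V p" for p by (rule spec[OF conjunct1[OF R]])
  note b = a[unfolded adapted_at_def]
  note b1 = conjunct1[OF b] and n1 = conjunct2[OF b]
  note b2 = conjunct1[OF n1] and n2 = conjunct2[OF n1]
  note b3 = conjunct1[OF n2] and n3 = conjunct2[OF n2]
  note b4 = conjunct1[OF n3] and n4 = conjunct2[OF n3]
  note b5 = conjunct1[OF n4] and n5 = conjunct2[OF n4]
  note b6 = conjunct1[OF n5] and n6 = conjunct2[OF n5]
  note b7 = conjunct1[OF n6] and n7 = conjunct2[OF n6]
  note b8 = conjunct1[OF n7] and n8 = conjunct2[OF n7]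
  note b9 = conjunct1[OF n8] and n9 = conjunct2[OF n8]
  note b10 = conjunct1[OF n9] and n10 = conjunct2[OF conjunct2[OF n9]]
  note b12 = conjunct1[OF n10] and n12 = conjunct2[OF n10]
  note b13 = conjunct1[OF n12] and b14 = conjunct2[OF n12]
  have sm: "\<forall>U X Y. vector_field A U X \<and> vector_field A U Y \<longrightarrow> vector_field A U (\<lambda>p. D p (X p) Y)"
    using conjunct2[OF R] unfolding smooth_conn_on_def by (simp only: subset_UNIV simp_thms)
  have 1: "linear_connection A D"
    unfolding linear_connection_def
    by (rule conjI, rule allI, rule b1, rule conjI, rule allI, rule b2, rule conjI, rule allI, rule b3,
        rule conjI, rule sm, rule allI, rule b4)
  have 2: "subbundle A 3 V" unfolding subbundle_def by (rule allI, rule b5)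
  have 3: "supplementary A H V" unfolding supplementary_def by (rule allI, rule conjI, rule b6, rule b7)
  have 4: "preserves_subbundle A D H" unfolding preserves_subbundle_def by (rule allI, rule b8)
  have 5: "preserves_subbundle A D V" unfolding preserves_subbundle_def by (rule allI, rule b9)
  have 6: "preserves_metric A D H g" unfolding preserves_metric_def by (rule allI, rule b10)
  have 7: "preserves_PQ A D H PQ"
    unfolding preserves_PQ_def
  proof (intro allI impI ballI, elim conjE)
    fix U \<sigma> p v assume "p \<in> U" "v \<in> tangent_space A p" "endo_field A H U \<sigma>" "\<forall>q\<in>U. \<sigma> q \<in> PQ q"
    then show "\<exists>B\<in>PQ p. has_endo_deriv A D H p v \<sigma> B" by (intro adapted_atD(11)[OF a])
  qed
  have 8: "\<forall>p X Y. section_near A H p X \<and> section_near A H p Y \<longrightarrow>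
       torsion A D X Y p = - proj_along (V p) (H p) (lie_bracket A X Y p)" by (rule allI, rule b12)
  have 9: "\<forall>p \<xi>. section_near A V p \<xi> \<longrightarrow>
       (\<exists>B \<in> sp_n_sp_1_perp (g p) (PQ p) (H p).
          represents A H p (\<lambda>X. proj_along (H p) (V p) (torsion A D \<xi> X p)) B)" by (rule allI, rule b13)
  have 10: "parallel_identification A D H V (phi0 A H g PQ)"
    unfolding parallel_identification_def by (rule allI, rule b14)
  show ?L by (rule conjI[OF 1 conjI[OF 2 conjI[OF 3 conjI[OF conjI[OF 4 conjI[OF 5 conjI[OF 6 7]]]
    conjI[OF 8 conjI[OF 9 10]]]]]])
qed

end

section \<open>From local to global solutions\<close>

context pqc_metric
begin

lemma local_adapted:
  "\<exists>U D V. open U \<and> p \<in> U \<and> (\<forall>q\<in>U. adapted_at A H g PQ D V q) \<and> smooth_conn_on A U D"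
proof -
  obtain U \<eta> I where U: "p \<in> U" "local_data A H g PQ U \<eta> I" using data[of p] by (elim exE conjE) (rule that)
  obtain W e where W: "p \<in> W" and F: "pqc_frame A H g PQ n W \<eta> I e" by (rule local_frame[OF U(2,1)])
  show ?thesis
    using pqc_frame.adapted_exists[OF F] pqc_frame.openU[OF F] W by (elim exE conjE) (intro exI conjI)
qed

lemma adapted_at_unique:
  assumes U: "open U" "q \<in> U"
    and 1: "\<And>r. r \<in> U \<Longrightarrow> adapted_at A H g PQ D V r" "smooth_conn_on A U D"
    and 2: "\<And>r. r \<in> U \<Longrightarrow> adapted_at A H g PQ D' V' r" "smooth_conn_on A U D'"
  shows "D q = D' q \<and> V q = V' q"
proof -
  obtain T \<eta> I where T: "q \<in> T" "local_data A H g PQ T \<eta> I" using data[of q] by (elim exE conjE) (rule that)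
  obtain W e where W: "q \<in> W" and F: "pqc_frame A H g PQ n W \<eta> I e" by (rule local_frame[OF T(2,1)])
  have o: "open (W \<inter> U)" "W \<inter> U \<subseteq> W" "W \<inter> U \<subseteq> U" "q \<in> W \<inter> U" using pqc_frame.openU[OF F] U W by auto
  show ?thesis
    by (rule pqc_frame.adapted_unique[OF pqc_frame.restrict[OF F o(1,2)] 1(1) smooth_conn_on_subset[OF 1(2) o(3)]
          2(1) smooth_conn_on_subset[OF 2(2) o(3)] o(4)]) simp_all
qed

text \<open>Near every point a local solution is chosen, and at \<open>q\<close> the global one
  takes the value of the solution chosen for \<open>q\<close>. By uniqueness it coincides on each
  chosen neighbourhood with a single local solution, which gives smoothness and the germ of
  V.\<close>

lemma adapted_global:
  "\<exists>D V. (\<forall>p. adapted_at A H g PQ D V p) \<and> smooth_conn_on A UNIV D"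
proof -
  define Q where "Q p x = (case x of (U, D, V) \<Rightarrow> open U \<and> p \<in> U \<and> (\<forall>q\<in>U. adapted_at A H g PQ D V q) \<and> smooth_conn_on A U D)" for p x
  have "\<forall>p. \<exists>x. Q p x"
  proof
    fix p
    from local_adapted[of p] obtain U D V where
      "open U \<and> p \<in> U \<and> (\<forall>q\<in>U. adapted_at A H g PQ D V q) \<and> smooth_conn_on A U D" by (elim exE) (rule that)
    then have "Q p (U, D, V)" unfolding Q_def prod.case .
    then show "\<exists>x. Q p x" by (rule exI)
  qed
  from choice[OF this] obtain x where x: "\<forall>p. Q p (x p)" ..
  define UU where "UU p = fst (x p)" for p
  define DD where "DD p = fst (snd (x p))" for p
  define VV where "VV p = snd (snd (x p))" for p
  have x': "open (UU p) \<and> p \<in> UU p \<and> (\<forall>q\<in>UU p. adapted_at A H g PQ (DD p) (VV p) q) \<and> smooth_conn_on A (UU p) (DD p)" for p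
    using x[THEN spec, of p] unfolding Q_def UU_def DD_def VV_def case_prod_beta .
  have o: "open (UU p)" and m: "p \<in> UU p" and s: "smooth_conn_on A (UU p) (DD p)" for p using x'[of p] by simp_all
  have a: "adapted_at A H g PQ (DD p) (VV p) q" if "q \<in> UU p" for p q using x'[of p] that by simp
  have eq: "DD p r = DD r r \<and> VV p r = VV r r" if r: "r \<in> UU p" for p r
  proof (rule adapted_at_unique[where U = "UU p \<inter> UU r" and q = r and D = "DD p" and D' = "DD r"
        and V = "VV p" and V' = "VV r"])
    show "smooth_conn_on A (UU p \<inter> UU r) (DD p)" "smooth_conn_on A (UU p \<inter> UU r) (DD r)"
      by (rule smooth_conn_on_subset[OF s], simp)+
  qed (use o m r a in auto)
  show ?thesis
  proof (rule exI[of _ "\<lambda>q. DD q q"], rule exI[of _ "\<lambda>q. VV q q"], intro conjI allI)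
    show "adapted_at A H g PQ (\<lambda>q. DD q q) (\<lambda>q. VV q q) p" for p
      by (rule adapted_at_cong[OF o m refl _ a[OF m]]) (rule conjunct2[OF eq])
    show "smooth_conn_on A UNIV (\<lambda>q. DD q q)"
      unfolding smooth_conn_on_def
    proof (intro allI impI, elim conjE)
      fix W X Y assume X: "vector_field A W X" and Y: "vector_field A W Y"
      show "vector_field A W (\<lambda>p. DD p p (X p) Y)"
      proof (rule vf_local[OF vf_open[OF X]])
        fix q assume q: "q \<in> W"
        have T: "open (W \<inter> UU q)" "W \<inter> UU q \<subseteq> W" "W \<inter> UU q \<subseteq> UU q" using o vf_open[OF X] by auto
        have "vector_field A (W \<inter> UU q) (\<lambda>p. DD q p (X p) Y)"
          using s[of q] T(3) vf_subset[OF X T(1,2)] vf_subset[OF Y T(1,2)] unfolding smooth_conn_on_def by simp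
        then have "vector_field A (W \<inter> UU q) (\<lambda>p. DD p p (X p) Y)"
          by (rule vf_cong) (use eq[of _ q] in simp)
        then show "\<exists>W'. q \<in> W' \<and> vector_field A W' (\<lambda>p. DD p p (X p) Y)" using q m by blast
      qed
    qed
  qed
qed

section \<open>The canonical map is the only natural identification on a given complement\<close>

context
  fixes V assumes sup: "supplementary A H V" and Vs: "\<And>p. subspace (V p)"
begin

lemmas supD = sup[unfolded supplementary_def, THEN spec, THEN conjunct1]
  sup[unfolded supplementary_def, THEN spec, THEN conjunct2]

lemma V_tangent: "x \<in> V p \<Longrightarrow> x \<in> tangent_space A p"
proof -
  assume x: "x \<in> V p"
  have "0 + x \<in> {x + \<xi> | x \<xi>. x \<in> H p \<and> \<xi> \<in> V p}" using x subspace_0[OF H_subspace[of p]] by blast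
  then show ?thesis unfolding supD(2) by simp
qed

lemma phi0_natural: "natural_identification A H g PQ V (phi0 A H g PQ)"
  unfolding natural_identification_def ball_Idx
proof (intro conjI allI impI ballI)
  fix p
  obtain T \<eta> I where T: "p \<in> T" "local_data A H g PQ T \<eta> I" using data[of p] by (elim exE conjE) (rule that)
  obtain W e where W: "p \<in> W" and F: "pqc_frame A H g PQ n W \<eta> I e" by (rule local_frame[OF T(2,1)])
  interpret F: pqc_frame A H g PQ n W \<eta> I e by (rule F)
  have "linear_on (tangent_space A p) (\<lambda>v. \<Sum>s\<in>Idx. \<eta> s p v *\<^sub>R I s p)"
    by (rule linear_on_sum_fun[OF linear_on_scaleR_vec[OF F.eta_linear[OF W]]])
  note l = linear_onD[OF this]
  show "linear_on (V p) (phi0 A H g PQ p)"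
    unfolding linear_on_def
    by (intro conjI ballI allI)
      (simp_all only: F.phi0_eq[OF W] V_tangent subspace_add[OF Vs] subspace_scale[OF Vs] l)
next
  fix U \<eta> I p \<xi> s
  assume D: "local_data A H g PQ U \<eta> I" and p: "p \<in> U" and s: "s \<in> Idx"
    and x: "(\<forall>s\<in>Idx. \<xi> s \<in> V p) \<and> (\<forall>s\<in>Idx. \<forall>t\<in>Idx. \<eta> s p (\<xi> t) = (if s = t then 1 else 0))"
  obtain W e where W: "p \<in> W" and F: "pqc_frame A H g PQ n W \<eta> I e" by (rule local_frame[OF D p])
  interpret F: pqc_frame A H g PQ n W \<eta> I e by (rule F)
  have "phi0 A H g PQ p (\<xi> s) = (\<Sum>t\<in>Idx. \<eta> t p (\<xi> s) *\<^sub>R I t p)"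
    by (rule F.phi0_eq[OF W V_tangent]) (use x s in blast)
  also have "\<dots> = (\<Sum>t\<in>Idx. if t = s then I s p else 0)"
    by (rule sum.cong[OF refl]) (use x s in simp)
  also have "\<dots> = I s p" using s by simp
  finally show "phi0 A H g PQ p (\<xi> s) = I s p" .
qed

text \<open>Naturality fixes \<phi> only on frames of V at \<open>p\<close> dual to some local data.
  Such a frame is the V-component of any dual frame, since \<eta>_t ignores the horizontal part;
  linearity on V does the rest. Outside V the map \<phi> is arbitrary, which is why only values on V
  are compared.\<close>

lemma natural_eq_phi0:
  assumes nat: "natural_identification A H g PQ V \<phi>" and v: "v \<in> V p"
  shows "\<phi> p v = phi0 A H g PQ p v"
proof -
  obtain T \<eta> I where T: "p \<in> T" "local_data A H g PQ T \<eta> I" using data[of p] by (elim exE conjE) (rule that)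
  obtain W e where W: "p \<in> W" and F: "pqc_frame A H g PQ n W \<eta> I e" by (rule local_frame[OF T(2,1)])
  obtain \<zeta> where Z: "pqc_dual A H g PQ n W \<eta> I e \<zeta>" using pqc_frame.dual_frame_exists[OF F] ..
  interpret Z: pqc_dual A H g PQ n W \<eta> I e \<zeta> by (rule Z)
  have "\<forall>s\<in>Idx. \<exists>x. x \<in> V p \<and> (\<forall>t\<in>Idx. \<eta> t p x = (if t = s then 1 else 0))"
  proof
    fix s assume s: "s \<in> Idx"
    have "\<zeta> s p \<in> {x + \<xi> | x \<xi>. x \<in> H p \<and> \<xi> \<in> V p}"
      unfolding supD(2) by (rule Z.xi_tangent[OF W s])
    then obtain h x where *: "\<zeta> s p = h + x" "h \<in> H p" "x \<in> V p" by blast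
    have "\<eta> t p x = (if t = s then 1 else 0)" if t: "t \<in> Idx" for t
      using Z.dual[OF W t s] linear_onD(1)[OF Z.eta_linear[OF W t] Z.H_tangent[OF W *(2)] V_tangent[OF *(3)]]
        Z.eta_H[OF W t *(2)] unfolding *(1) by simp
    then show "\<exists>x. x \<in> V p \<and> (\<forall>t\<in>Idx. \<eta> t p x = (if t = s then 1 else 0))" using *(3) by blast
  qed
  from bchoice[OF this] obtain x where x: "\<forall>s\<in>Idx. x s \<in> V p \<and> (\<forall>t\<in>Idx. \<eta> t p (x s) = (if t = s then 1 else 0))" ..
  have xV: "x s \<in> V p" and xd: "t \<in> Idx \<Longrightarrow> \<eta> t p (x s) = (if t = s then 1 else 0)" if "s \<in> Idx" for s t
    using x that by simp_all
  define w where "w = (\<Sum>s\<in>Idx. \<eta> s p v *\<^sub>R x s)"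
  note sc = subspace_scale[OF Vs xV] and tT = tangent_subspace[of p]
  have wV: "w \<in> V p" unfolding w_def by (rule subspace_sum[OF Vs sc])
  have "\<eta> t p (v - w) = 0" if t: "t \<in> Idx" for t
  proof -
    note l = Z.eta_linear[OF W t]
    have "\<eta> t p w = (\<Sum>s\<in>Idx. \<eta> t p (\<eta> s p v *\<^sub>R x s))"
      unfolding w_def by (rule linear_on_sum[OF l tT V_tangent[OF sc]])
    also have "\<dots> = (\<Sum>s\<in>Idx. if s = t then \<eta> t p v else 0)"
      by (rule sum.cong[OF refl]) (simp add: linear_onD(2)[OF l V_tangent[OF xV]] xd t)
    also have "\<dots> = \<eta> t p v" using t by simp
    finally show ?thesis using linear_on_diff[OF l tT V_tangent[OF v] V_tangent[OF wV]] by simp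
  qed
  then have "v - w \<in> H p"
    using Z.H_iff[OF W subspace_diff[OF tT V_tangent[OF v] V_tangent[OF wV]]] by blast
  moreover have "v - w \<in> V p" by (rule subspace_diff[OF Vs v wV])
  ultimately have "v - w \<in> H p \<inter> V p" by blast
  then have vw: "v = w" unfolding supD(1) by simp
  have lin: "linear_on (V p) (\<phi> p)" using nat unfolding natural_identification_def by simp
  have \<phi>x: "\<phi> p (x s) = I s p" if s: "s \<in> Idx" for s
    using nat[unfolded natural_identification_def ball_Idx, THEN conjunct2, THEN spec, THEN spec, THEN spec,
        THEN mp, OF Z.data, THEN bspec, OF W, THEN spec, of x] x s by simp
  have "\<phi> p w = (\<Sum>s\<in>Idx. \<phi> p (\<eta> s p v *\<^sub>R x s))"
    unfolding w_def by (rule linear_on_sum[OF lin Vs sc])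
  also have "\<dots> = (\<Sum>s\<in>Idx. \<eta> s p v *\<^sub>R I s p)"
    by (rule sum.cong[OF refl]) (simp only: linear_onD(2)[OF lin xV] \<phi>x)
  also have "\<dots> = phi0 A H g PQ p v" by (rule Z.phi0_eq[OF W V_tangent[OF v], symmetric])
  finally show ?thesis by (simp only: vw[symmetric])
qed

text \<open>\<phi> enters \<nabla>\<phi> = 0 only through its values on the section \<zeta> near
  \<open>p\<close> and on \<nabla>_v \<zeta>, which lies in V; there it equals \<open>phi0\<close>,
  and the derivative sees only germs.\<close>

lemma parallel_phi0:
  assumes L: "linear_connection A D" and pV: "preserves_subbundle A D V"
    and nat: "natural_identification A H g PQ V \<phi>" and par: "parallel_identification A D H V \<phi>"
  shows "parallel_identification A D H V (phi0 A H g PQ)"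
  unfolding parallel_identification_def
proof (intro allI ballI impI)
  fix p v \<zeta> assume v: "v \<in> tangent_space A p" and Z: "section_near A V p \<zeta>"
  note eq = natural_eq_phi0[OF nat]
  from section_common[OF open_UNIV UNIV_I Z Z] obtain W where W: "open W" "p \<in> W" and ZW: "section_on A V W \<zeta>" .
  have "D p v \<zeta> \<in> V p" using pV v Z unfolding preserves_subbundle_def by simp
  note eD = eq[OF this]
  have h: "has_endo_deriv A D H p v (\<lambda>q. \<phi> q (\<zeta> q)) (\<phi> p (D p v \<zeta>))"
    using par v Z unfolding parallel_identification_def by simp
  have "D p v (\<lambda>q. \<phi> q (\<zeta> q) (X q)) = D p v (\<lambda>q. phi0 A H g PQ q (\<zeta> q) (X q))" for X
    by (rule conn_germ[OF L W _ v]) (simp only: eq[OF section_onD(2)[OF ZW]])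
  then show "has_endo_deriv A D H p v (\<lambda>q. phi0 A H g PQ q (\<zeta> q)) (phi0 A H g PQ p (D p v \<zeta>))"
    using h unfolding has_endo_deriv_def eD eq[OF section_onD(2)[OF ZW W(2)]] by simp
qed

end

end

lemma pqc_metricI:
  fixes A :: "('m::{t2_space,second_countable_topology}, 'e::euclidean_space) atlas"
  assumes M: "pqc_manifold A n H C PQ" and n: "4 * n + 3 > 7" and g: "g \<in> C"
  shows "pqc_metric A H g PQ n"
proof -
  obtain g0 where at: "smooth_atlas A" and dim: "DIM('e) = 4 * n + 3" and sub: "subbundle A (DIM('e) - 3) H"
    and C: "C = conformal_class A H (2 * n) (2 * n) g0" and D: "\<forall>p. \<exists>U \<eta> I. p \<in> U \<and> local_data A H g0 PQ U \<eta> I"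
    using M unfolding pqc_manifold_def by (elim exE conjE) (rule that)
  obtain f where met: "metric_on A H (2 * n) (2 * n) g" and f: "smooth_fun A UNIV f"
    "\<forall>p. f p > 0 \<and> (\<forall>x\<in>H p. \<forall>y\<in>H p. g p x y = f p * g0 p x y)"
    using g unfolding C conformal_class_def mem_Collect_eq by (elim exE conjE) (rule that)
  interpret smooth_mfd A by standard (rule at)
  show ?thesis
  proof
    show "2 \<le> n" using n by simp
    show "metric_on A H (2 * n) (2 * n) g" by (rule met)
    show "subbundle A (4 * n) H" using sub by (simp add: dim)
    fix p
    obtain U \<eta> I where U: "p \<in> U" and D: "local_data A H g0 PQ U \<eta> I"
      using D[THEN spec, of p] by (elim exE conjE) (rule that)
    have "local_data A H g PQ U (\<lambda>s q v. f q * \<eta> s q v) I"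
      by (rule local_data_rescale[OF D f(1)]) (use f(2) in simp_all)
    then show "\<exists>U \<eta> I. p \<in> U \<and> local_data A H g PQ U \<eta> I" using U by (intro exI conjI)
  qed
qed

theorem theorem3p1:
  fixes A :: "('m::{t2_space,second_countable_topology}, 'e::euclidean_space) atlas"
    and n :: nat
    and H :: "'m \<Rightarrow> 'm tvec set"
    and C :: "('m \<Rightarrow> 'm tvec \<Rightarrow> 'm tvec \<Rightarrow> real) set"
    and PQ :: "'m \<Rightarrow> ('m tvec \<Rightarrow> 'm tvec) set"
    and g :: "'m \<Rightarrow> 'm tvec \<Rightarrow> 'm tvec \<Rightarrow> real"
  assumes "pqc_manifold A n H C PQ"
    and "4 * n + 3 > 7"
    and "g \<in> C"
  shows "\<exists>!(D, V). linear_connection A D \<and> subbundle A 3 V \<and> supplementary A H V \<and>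
    (preserves_subbundle A D H \<and> preserves_subbundle A D V \<and>
     preserves_metric A D H g \<and> preserves_PQ A D H PQ) \<and>
    (\<forall>p X Y. section_near A H p X \<and> section_near A H p Y \<longrightarrow>
       torsion A D X Y p = - proj_along (V p) (H p) (lie_bracket A X Y p)) \<and>
    (\<forall>p \<xi>. section_near A V p \<xi> \<longrightarrow>
       (\<exists>B \<in> sp_n_sp_1_perp (g p) (PQ p) (H p).
          represents A H p (\<lambda>X. proj_along (H p) (V p) (torsion A D \<xi> X p)) B)) \<and>
    (\<exists>\<phi>. natural_identification A H g PQ V \<phi> \<and> parallel_identification A D H V \<phi>)"
  (is "\<exists>!(D, V). ?P D V")
proof -
  interpret pqc_metric A H g PQ n by (rule pqc_metricI[OF assms])
  have subspace: "\<And>V p. subbundle A 3 V \<Longrightarrow> subspace (V p)"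
  proof -
    fix V p assume b: "subbundle A 3 V"
    obtain W X where "p \<in> W" "\<forall>q\<in>W. is_basis 3 (V q) (\<lambda>i. X i q)"
      using b[unfolded subbundle_def, THEN spec, of p] by (elim exE conjE) (rule that)
    then have "V p = span ((\<lambda>i. X i p) ` {..<3})" by (simp add: is_basis_def)
    then show "subspace (V p)" using subspace_span by simp
  qed
  \<comment> \<open>Eliminates the quantified \<phi>: any natural identification may be replaced by
    \<open>phi0\<close>, and conversely \<open>phi0\<close> is a witness. Uniqueness of the pair (D,
    V) is then uniqueness of adapted pairs at every point.\<close>
  have iff: "?P D V \<longleftrightarrow> (\<forall>p. adapted_at A H g PQ D V p) \<and> smooth_conn_on A UNIV D" (is "_ \<longleftrightarrow> ?Q D V") for D V
  proof
    assume P: "?P D V"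
    then obtain \<phi> where L: "linear_connection A D" and V: "subbundle A 3 V" "supplementary A H V"
      and pV: "preserves_subbundle A D V"
      and nat: "natural_identification A H g PQ V \<phi>" and par: "parallel_identification A D H V \<phi>"
      by (elim exE conjE) (rule that)
    note p0 = parallel_phi0[OF V(2) subspace[OF V(1)] L pV nat par]
    show "?Q D V"
      unfolding conditions_iff_adapted[symmetric] using P p0 by (elim conjE) (intro conjI; assumption)
  next
    assume "?Q D V"
    note L = this[unfolded conditions_iff_adapted[symmetric]]
    have V: "subbundle A 3 V" using L by (elim conjE)
    have V': "supplementary A H V" using L by (elim conjE)
    note nat = phi0_natural[OF V' subspace[OF V]]
    show "?P D V" using L by (elim conjE) (intro conjI exI[of _ "phi0 A H g PQ"] nat; assumption)
  qed
  obtain D V where DV: "?Q D V" using adapted_global by (elim exE) (rule that)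
  show ?thesis
  proof (rule ex1I[of _ "(D, V)"])
    show "case (D, V) of (D, V) \<Rightarrow> ?P D V" unfolding prod.case iff by (rule DV)
    fix x assume x: "case x of (D, V) \<Rightarrow> ?P D V"
    obtain D' V' where x': "x = (D', V')" by (cases x)
    have "?Q D' V'" using x unfolding x' prod.case iff .
    then have "D' p = D p \<and> V' p = V p" for p
      using adapted_at_unique[of UNIV p D' V' D V] DV by simp
    then show "x = (D, V)" unfolding x' by (simp add: fun_eq_iff)
  qed
qed

end
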